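(* Let $\Gamma\subset\operatorname{PSL}(2,\mathbb R)$ be a geometrically finite Fuchsian group of the first kind without elliptic elements, and let $B^\Gamma_p$ be the Bergman kernel function of cusp forms of weight $2p$ of $\Gamma$. If $\Gamma$ is cocompact, then uniformly on $\Gamma\backslash\mathbb H$, $$B^\Gamma_p(x)=\frac p\pi+\mathcal O(1)\qquad\text{as }p\to+\infty.$$ If $\Gamma$ is not cocompact, then $$\sup_{x\in\Gamma\backslash\mathbb H}B^\Gamma_p(x)=\Big(\frac p\pi\Big)^{3/2}+\mathcal O(p)\qquad\text{as }p\to+\infty.$$
   Context: $\mathbb H$ is the upper half-plane, $z=x+iy$. A $\Gamma$-modular form of weight $2p$ is a holomorphic function $f$ on $\mathbb H$ with $f(\gamma z)=(cz+d)^{2p}f(z)$ for all $\gamma=\begin{pmatrix}a&b\\c&d\end{pmatrix}\in\Gamma$ that extends holomorphically to the cusps of $\Gamma$ (fixed points of parabolic elements); it is a cusp form if it vanishes at the cusps. The space $\mathcal S^\Gamma_{2p}$ of cusp forms of weight $2p$ carries the Petersson inner product $\langle f,g\rangle=\int_U f(z)\overline{g(z)}(2y)^{2p}\,dv_{\mathbb H}(z)$, with $U$ a fundamental domain for $\Gamma$ and $dv_{\mathbb H}=\tfrac12y^{-2}dx\wedge dy$. For an orthonormal basis $(f_j)$ of $\mathcal S^\Gamma_{2p}$, the Bergman kernel function is the function on $\Gamma\backslash\mathbb H$ defined by $B^\Gamma_p(\pi(z))=\sum_j|f_j(z)|^2(2y)^{2p}$, $\pi:\mathbb H\to\Gamma\backslash\mathbb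 H$ the projection. *)

theory Defs
  imports
    "HOL-Analysis.Analysis"
    "HOL-Algebra.Coset"
    "HOL-Library.Landau_Symbols"
begin

section \<open>Quotient topologies\<close>

definition quotient_topology :: "'a topology \<Rightarrow> ('a \<Rightarrow> 'b) \<Rightarrow> 'b topology" where
  "quotient_topology X q =
     topology (\<lambda>V. V \<subseteq> q ` topspace X \<and> openin X {x \<in> topspace X. q x \<in> V})"

lemma openin_quotient_topology:
  "openin (quotient_topology X q) V \<longleftrightarrow>
     V \<subseteq> q ` topspace X \<and> openin X {x \<in> topspace X. q x \<in> V}"
proof -
  have "istopology (\<lambda>V. V \<subseteq> q ` topspace X \<and> openin X {x \<in> topspace X. q x \<in> V})"
    unfolding istopology_def
  proof (intro conjI allI impI)
    fix S T
    assume S: "S \<subseteq> q ` topspace X \<and> openin X {x \<in> topspace X. q x \<in> S}"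
      and T: "T \<subseteq> q ` topspace X \<and> openin X {x \<in> topspace X. q x \<in> T}"
    show "S \<inter> T \<subseteq> q ` topspace X" using S by blast
    have "{x \<in> topspace X. q x \<in> S \<inter> T} =
        {x \<in> topspace X. q x \<in> S} \<inter> {x \<in> topspace X. q x \<in> T}" by blast
    then show "openin X {x \<in> topspace X. q x \<in> S \<inter> T}" using S T by auto
  next
    fix \<K>
    assume K: "\<forall>K\<in>\<K>. K \<subseteq> q ` topspace X \<and> openin X {x \<in> topspace X. q x \<in> K}"
    show "\<Union>\<K> \<subseteq> q ` topspace X" using K by blast
    have "{x \<in> topspace X. q x \<in> \<Union>\<K>} = (\<Union>K\<in>\<K>. {x \<in> topspace X. q x \<in> K})" by blast
    then show "openin X {x \<in> topspace X. q x \<in> \<Union>\<K>}" using K by auto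
  qed
  then show ?thesis by (simp add: quotient_topology_def topology_inverse')
qed

lemma topspace_quotient_topology: "topspace (quotient_topology X q) = q ` topspace X"
proof (rule antisym)
  show "topspace (quotient_topology X q) \<subseteq> q ` topspace X"
    using openin_quotient_topology openin_topspace by metis
  have "{x \<in> topspace X. q x \<in> q ` topspace X} = topspace X" by blast
  then have "openin (quotient_topology X q) (q ` topspace X)"
    by (simp add: openin_quotient_topology)
  then show "q ` topspace X \<subseteq> topspace (quotient_topology X q)"
    by (rule openin_subset)
qed

lemma quotient_map_quotient_topology: "quotient_map X (quotient_topology X q) q"
  by (auto simp: quotient_map_def topspace_quotient_topology openin_quotient_topology)


section \<open>The group PSL(2,R) and its action\<close>

definition SL2R :: "(real^2^2) monoid" where
  "SL2R = \<lparr>carrier = {A. det A = 1}, mult = (**), one = mat 1\<rparr>"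

definition PSL2R :: "(real^2^2) set monoid" where
  "PSL2R = SL2R Mod {mat 1, - mat 1}"

definition PSL_proj :: "real^2^2 \<Rightarrow> (real^2^2) set" where
  "PSL_proj A = {mat 1, - mat 1} #>\<^bsub>SL2R\<^esub> A"

definition PSL2R_topology :: "(real^2^2) set topology" where
  "PSL2R_topology = quotient_topology (top_of_set (carrier SL2R)) PSL_proj"

definition fuchsian :: "(real^2^2) set set \<Rightarrow> bool" where
  "fuchsian \<Gamma> \<longleftrightarrow> subgroup \<Gamma> PSL2R \<and>
     subtopology PSL2R_topology \<Gamma> = discrete_topology \<Gamma>"

definition uhp :: "complex set" where
  "uhp = {z. Im z > 0}"

definition aut_factor :: "real^2^2 \<Rightarrow> complex \<Rightarrow> complex" where
  "aut_factor A z = of_real (A$2$1) * z + of_real (A$2$2)"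

definition moebius :: "real^2^2 \<Rightarrow> complex \<Rightarrow> complex" where
  "moebius A z = (of_real (A$1$1) * z + of_real (A$1$2)) / aut_factor A z"

text \<open>The Riemann sphere is the one-point compactification of the complex plane,
  with \<^term>\<open>None\<close> as the point at infinity.\<close>

definition moebius_sphere :: "real^2^2 \<Rightarrow> complex option \<Rightarrow> complex option" where
  "moebius_sphere A x = (case x of
       None \<Rightarrow> if A$2$1 = 0 then None else Some (of_real (A$1$1 / A$2$1))
     | Some z \<Rightarrow> if aut_factor A z = 0 then None else Some (moebius A z))"

definition boundary_uhp :: "complex option set" where
  "boundary_uhp = insert None (range (\<lambda>t::real. Some (of_real t)))"

text \<open>An element of PSL(2,R) is the set \<open>{A, -A}\<close> of its matrix representatives, so
  \<open>\<Union>\<Gamma>\<close> is the full preimage of \<open>\<Gamma>\<close> in SL(2,R).\<close>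

definition orbit_of :: "(real^2^2) set set \<Rightarrow> complex \<Rightarrow> complex set" where
  "orbit_of \<Gamma> z = {moebius A z | A. A \<in> \<Union>\<Gamma>}"

definition quotient_surface :: "(real^2^2) set set \<Rightarrow> complex set set" where
  "quotient_surface \<Gamma> = orbit_of \<Gamma> ` uhp"

definition cocompact :: "(real^2^2) set set \<Rightarrow> bool" where
  "cocompact \<Gamma> \<longleftrightarrow> compact_space (quotient_topology (top_of_set uhp) (orbit_of \<Gamma>))"

definition elliptic :: "(real^2^2) set \<Rightarrow> bool" where
  "elliptic \<gamma> \<longleftrightarrow> (\<exists>A\<in>\<gamma>. \<bar>trace A\<bar> < 2)"

definition parabolic :: "(real^2^2) set \<Rightarrow> bool" where
  "parabolic \<gamma> \<longleftrightarrow> \<gamma> \<noteq> \<one>\<^bsub>PSL2R\<^esub> \<and> (\<exists>A\<in>\<gamma>. \<bar>trace A\<bar> = 2)"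

definition limit_set :: "(real^2^2) set set \<Rightarrow> complex option set" where
  "limit_set \<Gamma> =
     (\<Union>z\<in>uhp. Alexandroff_compactification euclidean derived_set_of (Some ` orbit_of \<Gamma> z))"

definition first_kind :: "(real^2^2) set set \<Rightarrow> bool" where
  "first_kind \<Gamma> \<longleftrightarrow> limit_set \<Gamma> = boundary_uhp"


section \<open>Fundamental domains and geometric finiteness\<close>

definition hyp_area :: "complex measure" where
  "hyp_area = density (restrict_space lborel uhp) (\<lambda>z. ennreal (1 / (2 * (Im z)\<^sup>2)))"

definition fundamental_domain :: "(real^2^2) set set \<Rightarrow> complex set \<Rightarrow> bool" where
  "fundamental_domain \<Gamma> U \<longleftrightarrow>
     U \<subseteq> uhp \<and> open U \<and> connected U \<and>
     (\<forall>\<gamma>\<in>\<Gamma>. \<gamma> \<noteq> \<one>\<^bsub>PSL2R\<^esub> \<longrightarrow> (\<forall>A\<in>\<gamma>. moebius A ` U \<inter> U = {})) \<and>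
     (\<forall>z\<in>uhp. orbit_of \<Gamma> z \<inter> closure U \<noteq> {}) \<and>
     frontier U \<inter> uhp \<in> null_sets hyp_area"

text \<open>The condition on the discriminant says that \<open>a\<bar>z\<bar>\<^sup>2 + b Re z + c = 0\<close> is a geodesic: a
  semicircle or vertical half-line orthogonal to the real axis.\<close>

definition hyp_half_plane :: "complex set \<Rightarrow> bool" where
  "hyp_half_plane S \<longleftrightarrow>
     (\<exists>a b c :: real. b\<^sup>2 - 4 * a * c > 0 \<and>
        S = {z \<in> uhp. a * (cmod z)\<^sup>2 + b * Re z + c > 0})"

definition finite_sided_convex_polygon :: "complex set \<Rightarrow> bool" where
  "finite_sided_convex_polygon P \<longleftrightarrow>
     (\<exists>\<H>. finite \<H> \<and> (\<forall>S\<in>\<H>. hyp_half_plane S) \<and> P = uhp \<inter> \<Inter>\<H>)"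

definition geometrically_finite :: "(real^2^2) set set \<Rightarrow> bool" where
  "geometrically_finite \<Gamma> \<longleftrightarrow>
     (\<exists>P. fundamental_domain \<Gamma> P \<and> finite_sided_convex_polygon P)"


section \<open>Modular forms and cusp forms\<close>

definition cusps :: "(real^2^2) set set \<Rightarrow> complex option set" where
  "cusps \<Gamma> =
     {x \<in> boundary_uhp. \<exists>\<gamma>\<in>\<Gamma>. parabolic \<gamma> \<and> (\<forall>A\<in>\<gamma>. moebius_sphere A x = x)}"

definition translation_mat :: "real \<Rightarrow> real^2^2" where
  "translation_mat h = vector [vector [1, h], vector [0, 1]]"

text \<open>A chart at the cusp \<open>x\<close> is a matrix \<open>\<sigma>\<close> taking infinity to \<open>x\<close> together with a
  width \<open>h\<close> such that \<open>\<sigma>\<^sup>-\<^sup>1 \<Gamma> \<sigma>\<close> contains the translation by \<open>h\<close>. The width need not be minimal: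
  passing to a multiple replaces the coordinate \<open>q\<close> by a root of \<open>q\<close>, which affects neither
  the existence of a holomorphic extension to \<open>q = 0\<close> nor its value there.\<close>

definition cusp_chart ::
  "(real^2^2) set set \<Rightarrow> complex option \<Rightarrow> real^2^2 \<Rightarrow> real \<Rightarrow> bool" where
  "cusp_chart \<Gamma> x \<sigma> h \<longleftrightarrow>
     \<sigma> \<in> carrier SL2R \<and> moebius_sphere \<sigma> None = x \<and> h > 0 \<and>
     PSL_proj (\<sigma> ** translation_mat h ** matrix_inv \<sigma>) \<in> \<Gamma>"

definition cusp_extension ::
  "nat \<Rightarrow> (complex \<Rightarrow> complex) \<Rightarrow> real^2^2 \<Rightarrow> real \<Rightarrow> (complex \<Rightarrow> complex) \<Rightarrow> bool" where
  "cusp_extension p f \<sigma> h g \<longleftrightarrow>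
     g holomorphic_on ball 0 1 \<and>
     (\<forall>z\<in>uhp. f (moebius \<sigma> z) / aut_factor \<sigma> z ^ (2 * p)
        = g (exp (2 * of_real pi * \<i> * z / of_real h)))"

text \<open>The weight is \<open>2p\<close>. Only the values of \<open>f\<close> on the upper half-plane matter.\<close>

definition modular_form :: "(real^2^2) set set \<Rightarrow> nat \<Rightarrow> (complex \<Rightarrow> complex) \<Rightarrow> bool" where
  "modular_form \<Gamma> p f \<longleftrightarrow>
     f holomorphic_on uhp \<and>
     (\<forall>\<gamma>\<in>\<Gamma>. \<forall>A\<in>\<gamma>. \<forall>z\<in>uhp. f (moebius A z) = aut_factor A z ^ (2 * p) * f z) \<and>
     (\<forall>x\<in>cusps \<Gamma>. \<forall>\<sigma> h. cusp_chart \<Gamma> x \<sigma> h \<longrightarrow> (\<exists>g. cusp_extension p f \<sigma> h g))"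

definition cusp_form :: "(real^2^2) set set \<Rightarrow> nat \<Rightarrow> (complex \<Rightarrow> complex) \<Rightarrow> bool" where
  "cusp_form \<Gamma> p f \<longleftrightarrow>
     modular_form \<Gamma> p f \<and>
     (\<forall>x\<in>cusps \<Gamma>. \<forall>\<sigma> h. cusp_chart \<Gamma> x \<sigma> h \<longrightarrow>
        (\<exists>g. cusp_extension p f \<sigma> h g \<and> g 0 = 0))"


section \<open>The Petersson inner product and the Bergman kernel function\<close>

definition petersson ::
  "complex set \<Rightarrow> nat \<Rightarrow> (complex \<Rightarrow> complex) \<Rightarrow> (complex \<Rightarrow> complex) \<Rightarrow> complex" where
  "petersson U p f g = (LINT z:U|hyp_area. f z * cnj (g z) * of_real ((2 * Im z) ^ (2 * p)))"

definition cusp_form_onb ::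
  "(real^2^2) set set \<Rightarrow> complex set \<Rightarrow> nat \<Rightarrow> nat \<Rightarrow> (nat \<Rightarrow> complex \<Rightarrow> complex) \<Rightarrow> bool" where
  "cusp_form_onb \<Gamma> U p n f \<longleftrightarrow>
     (\<forall>j<n. cusp_form \<Gamma> p (f j)) \<and>
     (\<forall>i<n. \<forall>j<n. petersson U p (f i) (f j) = (if i = j then 1 else 0)) \<and>
     (\<forall>g. cusp_form \<Gamma> p g \<longrightarrow> (\<exists>c. \<forall>z\<in>uhp. g z = (\<Sum>j<n. c j * f j z)))"

text \<open>A function on \<open>\<Gamma>\H\<close>, whose points are the orbits. The definite description is proper
  because the sum depends neither on the orthonormal basis of the (finite-dimensional) space of
  cusp forms nor on the point \<open>z\<close> of the orbit.\<close>

definition bergman_kernel ::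
  "(real^2^2) set set \<Rightarrow> complex set \<Rightarrow> nat \<Rightarrow> complex set \<Rightarrow> real" where
  "bergman_kernel \<Gamma> U p x =
     (THE b. \<exists>n f z. cusp_form_onb \<Gamma> U p n f \<and> z \<in> uhp \<and> orbit_of \<Gamma> z = x \<and>
        b = (\<Sum>j<n. (cmod (f j z))\<^sup>2 * (2 * Im z) ^ (2 * p)))"

end

theory Submission
  imports Defs "HOL-Complex_Analysis.Complex_Analysis" "HOL-Real_Asymp.Real_Asymp"
begin

text \<open>Let \<open>M\<close> be the preimage of \<open>\<Gamma>\<close> in SL(2,R). Averaging \<open>(\<i> / (z - cnj w))\<^sup>2\<^sup>p\<close> over \<open>M\<close> gives a bounded
  automorphic form that reproduces cusp forms at \<open>w\<close>, so the Bergman kernel at \<open>w\<close> is \<open>(2p-1)/(2\<pi>)\<close> times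
  \<open>E = 1/2 \<Sum>A\<in>M. (tr A / 2 - \<i> s(A,w))\<^sup>-\<^sup>2\<^sup>p\<close>, whose terms have modulus \<open>(1 + sinh\<^sup>2 (d(w, A w) / 2))\<^sup>-\<^sup>p\<close>.
  Where all displacements are bounded below, only \<open>\<plusminus>1\<close> contributes and \<open>E = 1 + O(c\<^sup>-\<^sup>p)\<close>. By the Margulis
  lemma and finiteness of the area every other point lies in a cusp; there \<open>E\<close> is up to \<open>O(4\<^sup>-\<^sup>p)\<close> the sum
  over the translations, \<open>\<Sum>n. (1 - \<i> n / (2y))\<^sup>-\<^sup>2\<^sup>p\<close> at height \<open>y\<close>. Lipschitz' formula turns it into a sum
  over Fourier modes, the first of which peaks at \<open>y = p / (2\<pi>)\<close> with the value asked for by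
  Stirling's formula.\<close>

no_notation fps_nth (infixl "$" 75)


text \<open>The kernel function is a definite description over finite orthonormal bases of cusp
  forms, so its value is accessible only after two identifications. Cusp forms turn out to be the
  automorphic forms with |f| y^p bounded, a condition without charts; Bessel's inequality for the
  averaged kernel, integrated over a domain of finite area, then bounds the length of orthonormal
  systems, so a basis exists. All errors must be uniform in the point while p grows: of the exponent
  p in each term, 2 is spent on convergence, by comparing the orbit sum with an area integral, and p
  - 2 on decay. In a cusp the comparison constant grows linearly with the height; one spare factor
  pays for it, because an element not fixing the cusp displaces a point of height y by an amount
  that grows with y. Hyperbolic distance itself is avoided: \<open>hypu\<close> and
  \<open>disp\<close> are rational expressions, and for determinant 1 the trace and
  \<open>shear\<close> determine \<open>disp\<close>. The sums run over matrices rather than classes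
  \<open>{A, - A}\<close>, hence the factors 1/2 and 2.\<close>

definition mat2 :: "real \<Rightarrow> real \<Rightarrow> real \<Rightarrow> real \<Rightarrow> real^2^2" where
  "mat2 a b c d = vector [vector [a, b], vector [c, d]]"

lemma mat2_nth [simp]:
  "mat2 a b c d $ 1 $ 1 = a" "mat2 a b c d $ 1 $ 2 = b"
  "mat2 a b c d $ 2 $ 1 = c" "mat2 a b c d $ 2 $ 2 = d"
  by (simp_all add: mat2_def)

lemma mat2_eqI:
  fixes A B :: "real^2^2"
  assumes "A$1$1 = B$1$1" "A$1$2 = B$1$2" "A$2$1 = B$2$1" "A$2$2 = B$2$2"
  shows "A = B"
  using assms by (simp add: vec_eq_iff forall_2)

lemma mat2_mult_nth [simp]:
  fixes A B :: "real^2^2"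
  shows "(A ** B)$1$1 = A$1$1 * B$1$1 + A$1$2 * B$2$1" "(A ** B)$1$2 = A$1$1 * B$1$2 + A$1$2 * B$2$2"
    "(A ** B)$2$1 = A$2$1 * B$1$1 + A$2$2 * B$2$1" "(A ** B)$2$2 = A$2$1 * B$1$2 + A$2$2 * B$2$2"
  by (simp_all add: matrix_matrix_mult_def sum_2)

lemma mat1_nth [simp]:
  "(mat 1 :: real^2^2)$1$1 = 1" "(mat 1 :: real^2^2)$1$2 = 0"
  "(mat 1 :: real^2^2)$2$1 = 0" "(mat 1 :: real^2^2)$2$2 = 1"
  by (simp_all add: mat_def)

lemma trace2: "trace (A :: real^2^2) = A$1$1 + A$2$2"
  by (simp add: trace_def sum_2)

lemma norm2_mat2: "(norm (A :: real^2^2))\<^sup>2 = (A$1$1)\<^sup>2 + (A$1$2)\<^sup>2 + (A$2$1)\<^sup>2 + (A$2$2)\<^sup>2"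
  by (simp add: norm_vec_def L2_set_def sum_2 sum_nonneg)

text \<open>The adjugate, used as the inverse on SL(2,R). Being given by its entries, it obeys the
  laws for products and signs without any condition on the determinant.\<close>

definition adj2 :: "real^2^2 \<Rightarrow> real^2^2" where
  "adj2 A = mat2 (A$2$2) (- A$1$2) (- A$2$1) (A$1$1)"

lemma adj2_nth [simp]:
  "adj2 A $ 1 $ 1 = A$2$2" "adj2 A $ 1 $ 2 = - A$1$2" "adj2 A $ 2 $ 1 = - A$2$1" "adj2 A $ 2 $ 2 = A$1$1"
  by (simp_all add: adj2_def)

lemma adj2_adj2 [simp]: "adj2 (adj2 A) = A"
  by (rule mat2_eqI) auto

lemma det_adj2 [simp]: "det (adj2 A) = det A"
  by (simp add: det_2)

lemma adj2_mult [simp]: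
  assumes "det A = 1"
  shows "A ** adj2 A = mat 1" "adj2 A ** A = mat 1"
  using assms by (intro mat2_eqI; simp add: det_2 algebra_simps)+

lemma adj2_cancel [simp]:
  assumes "det A = 1"
  shows "A ** (adj2 A ** B) = B" "adj2 A ** (A ** B) = B"
  using assms by (simp_all add: matrix_mul_assoc)

lemma matrix_inv_eq_adj2:
  assumes "det A = 1" shows "matrix_inv A = adj2 A"
proof -
  have "invertible A" using assms by (simp add: invertible_det_nz)
  then have "A ** matrix_inv A = mat 1" 
    unfolding invertible_def matrix_inv_def by (metis (mono_tags, lifting) someI_ex)
  then have "adj2 A ** (A ** matrix_inv A) = adj2 A" by simp
  then show ?thesis using assms by simp
qed

lemma uminus_matrix_mult [simp]:
  fixes A B :: "real^2^2"
  shows "(- A) ** B = - (A ** B)" "A ** (- B) = - (A ** B)"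
  by (rule mat2_eqI; simp)+

lemma det_uminus2 [simp]: "det (- A :: real^2^2) = det A"
  by (simp add: det_2)

lemma adj2_neg [simp]: "adj2 (- A) = - adj2 A"
  by (rule mat2_eqI) auto

lemma adj2_prod: "adj2 (A ** B) = adj2 B ** adj2 A"
  by (rule mat2_eqI) (auto simp: algebra_simps)

lemma trace_conj2: "det S = 1 ==> trace (adj2 S ** A ** S) = trace (A :: real^2^2)"
  by (simp add: trace2 det_2) algebra

lemma det_conj2: "det S = 1 ==> det (adj2 S ** A ** S) = det (A :: real^2^2)"
  by (simp add: det_mul)


section \<open>The Moebius action and its point-pair invariant\<close>

lemma uhp_iff: "z \<in> uhp \<longleftrightarrow> Im z > 0"
  by (simp add: uhp_def)

lemma aut_factor_nz:
  assumes "det A = 1" "Im z > 0" shows "aut_factor A z \<noteq> 0"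
proof
  assume "aut_factor A z = 0"
  then have "A$2$1 * Im z = 0" "A$2$1 * Re z + A$2$2 = 0"
    by (simp_all add: aut_factor_def complex_eq_iff)
  then show False using assms by (simp add: det_2)
qed

text \<open>The cocycle identity. It makes the weighted action on functions compatible with
  products.\<close>

lemma aut_factor_mult:
  assumes "det B = 1" "Im z > 0"
  shows "aut_factor (A ** B) z = aut_factor A (moebius B z) * aut_factor B z"
proof -
  have nz: "aut_factor B z \<noteq> 0" using assms by (rule aut_factor_nz)
  have "aut_factor A (moebius B z) * aut_factor B z
      = of_real (A$2$1) * (of_real (B$1$1) * z + of_real (B$1$2)) + of_real (A$2$2) * aut_factor B z"
    using nz by (simp add: aut_factor_def[of A] moebius_def distrib_right)
  also have "... = aut_factor (A ** B) z" by (simp add: aut_factor_def algebra_simps)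
  finally show ?thesis ..
qed

lemma moebius_mult:
  assumes "det A = 1" "det B = 1" "Im z > 0"
  shows "moebius (A ** B) z = moebius A (moebius B z)"
proof -
  have nz: "aut_factor B z \<noteq> 0" using assms by (intro aut_factor_nz)
  have "moebius A (moebius B z) = (of_real (A$1$1) * moebius B z + of_real (A$1$2)) * aut_factor B z
       / (aut_factor A (moebius B z) * aut_factor B z)"
    using nz by (simp add: moebius_def[of A])
  also have "(of_real (A$1$1) * moebius B z + of_real (A$1$2)) * aut_factor B z =
       of_real ((A**B)$1$1) * z + of_real ((A**B)$1$2)"
    using nz by (simp add: moebius_def distrib_right) (simp add: aut_factor_def algebra_simps)
  finally show ?thesis using assms by (simp add: aut_factor_mult moebius_def[of "A ** B"])
qed

lemma moebius_mat1 [simp]: "moebius (mat 1) z = z"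
  by (simp add: moebius_def aut_factor_def)

lemma aut_factor_mat1 [simp]: "aut_factor (mat 1) z = 1"
  by (simp add: aut_factor_def)

lemma aut_factor_neg [simp]: "aut_factor (- A) z = - aut_factor A z"
  by (simp add: aut_factor_def)

lemma moebius_neg [simp]: "moebius (- A) z = moebius A z"
proof -
  have "moebius (- A) z = (- (of_real (A$1$1) * z + of_real (A$1$2))) / (- aut_factor A z)"
    by (simp add: moebius_def)
  then show ?thesis by (simp only: minus_divide_divide) (simp add: moebius_def)
qed

lemma Im_moebius:
  assumes "det A = 1" shows "Im (moebius A z) = Im z / (cmod (aut_factor A z))\<^sup>2"
proof -
  let ?N = "of_real (A$1$1) * z + of_real (A$1$2)"
  have "Im ?N * Re (aut_factor A z) - Re ?N * Im (aut_factor A z) = (A$1$1 * A$2$2 - A$1$2 * A$2$1) * Im z"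
    by (simp add: aut_factor_def algebra_simps)
  then show ?thesis
    using assms by (simp only: moebius_def Im_divide cmod_power2 det_2 mult_1)
qed

lemma Im_moebius_pos: "det A = 1 ==> Im z > 0 ==> Im (moebius A z) > 0"
  by (simp add: Im_moebius aut_factor_nz)

lemma moebius_adj2 [simp]:
  assumes "det A = 1" "Im z > 0"
  shows "moebius (adj2 A) (moebius A z) = z" "moebius A (moebius (adj2 A) z) = z"
  using assms by (simp_all flip: moebius_mult)

text \<open>The points need not lie in the upper half-plane: the formula is applied to conjugate
  points, where nonvanishing of the factor is checked separately.\<close>

lemma moebius_diff:
  assumes "det A = 1" "aut_factor A z \<noteq> 0" "aut_factor A w \<noteq> 0"
  shows "moebius A z - moebius A w = (z - w) / (aut_factor A z * aut_factor A w)"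
proof -
  have d: "of_real (A$1$1) * of_real (A$2$2) - of_real (A$1$2) * of_real (A$2$1) = (1::complex)"
    using arg_cong[OF assms(1), of complex_of_real] by (simp add: det_2)
  have "(of_real (A$1$1) * z + of_real (A$1$2)) * aut_factor A w
      - (of_real (A$1$1) * w + of_real (A$1$2)) * aut_factor A z
     = (of_real (A$1$1) * of_real (A$2$2) - of_real (A$1$2) * of_real (A$2$1)) * (z - w)"
    unfolding aut_factor_def by algebra
  then show ?thesis using assms(2,3) d by (simp add: moebius_def diff_frac_eq mult.commute)
qed

lemma cnj_aut_factor: "cnj (aut_factor A z) = aut_factor A (cnj z)"
  by (simp add: aut_factor_def)

lemma cnj_moebius: "cnj (moebius A z) = moebius A (cnj z)"
  by (simp add: moebius_def aut_factor_def)

definition hypu :: "complex \<Rightarrow> complex \<Rightarrow> real" where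
  "hypu z w = (cmod (z - w))\<^sup>2 / (4 * Im z * Im w)"

lemma hypu_sym: "hypu z w = hypu w z"
  by (simp add: hypu_def norm_minus_commute mult.commute)

lemma hypu_nonneg: "Im z > 0 ==> Im w > 0 ==> hypu z w \<ge> 0"
  by (simp add: hypu_def)

lemma hypu_self [simp]: "hypu z z = 0"
  by (simp add: hypu_def)

lemma hypu_moebius:
  assumes "det A = 1" "Im z > 0" "Im w > 0"
  shows "hypu (moebius A z) (moebius A w) = hypu z w"
proof -
  have nz: "aut_factor A z \<noteq> 0" "aut_factor A w \<noteq> 0" using assms aut_factor_nz by auto
  show ?thesis using nz assms
    by (simp add: hypu_def Im_moebius moebius_diff norm_divide norm_mult field_simps)
qed

text \<open>Keeping only the vertical part of z - w in \<open>hypu\<close> bounds (Im z - Im w)^2,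
  and hence (Im z)^2, by a multiple of Im z * Im w. This plays the part of |log (Im z / Im w)| being
  at most the distance.\<close>

lemma hypu_Im_ratio:
  assumes "Im z > 0" "Im w > 0"
  shows "Im z / Im w \<le> 2 + 4 * hypu z w"
proof -
  have "(Im z - Im w)\<^sup>2 \<le> (cmod (z - w))\<^sup>2"
    by (simp add: cmod_power2)
  also have "... = 4 * hypu z w * Im z * Im w" using assms by (simp add: hypu_def)
  finally have h: "(Im z)\<^sup>2 + (Im w)\<^sup>2 \<le> (2 + 4 * hypu z w) * Im z * Im w"
    by (simp add: power2_eq_square algebra_simps)
  have "Im z * Im z \<le> (Im z)\<^sup>2 + (Im w)\<^sup>2" by (simp add: power2_eq_square)
  also note h
  finally have "Im z * Im z \<le> ((2 + 4 * hypu z w) * Im w) * Im z" by (simp add: mult_ac)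
  then have "Im z \<le> (2 + 4 * hypu z w) * Im w" using assms by simp
  then show ?thesis using assms by (simp add: field_simps)
qed

text \<open>A substitute for the triangle inequality: \<open>hypu\<close> is \<open>sinh\<^sup>2 (d/2)\<close> for the hyperbolic distance \<open>d\<close>.\<close>

lemma hypu_triangle:
  assumes "Im z > 0" "Im v > 0" "Im w > 0"
  shows "1 + hypu z w \<le> (1 + 4 * hypu z v) * (1 + 4 * hypu v w)"
proof -
  have "cmod (z - w) \<le> cmod (z - v) + cmod (v - w)"
    using norm_triangle_ineq[of "z - v" "v - w"] by simp
  then have "(cmod (z - w))\<^sup>2 \<le> (cmod (z - v) + cmod (v - w))\<^sup>2" by simp
  also have "... \<le> 2 * (cmod (z - v))\<^sup>2 + 2 * (cmod (v - w))\<^sup>2"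
    using zero_le_power2[of "cmod (z - v) - cmod (v - w)"] by (simp add: power2_eq_square algebra_simps)
  finally have "hypu z w \<le> (2 * (cmod (z - v))\<^sup>2 + 2 * (cmod (v - w))\<^sup>2) / (4 * Im z * Im w)"
    using assms by (simp add: hypu_def divide_right_mono)
  also have "... = 2 * hypu z v * (Im v / Im w) + 2 * hypu v w * (Im v / Im z)"
    using assms by (simp add: hypu_def field_simps)
  also have "... \<le> 2 * hypu z v * (2 + 4 * hypu v w) + 2 * hypu v w * (2 + 4 * hypu v z)"
    using assms by (intro add_mono mult_left_mono hypu_Im_ratio) (auto simp: hypu_nonneg)
  finally show ?thesis by (simp add: hypu_sym algebra_simps)
qed

lemma cmod_diff_cnj:
  "(cmod (z - cnj w))\<^sup>2 = (cmod (z - w))\<^sup>2 + 4 * Im z * Im w"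
  unfolding cmod_power2 by (simp add: power2_eq_square algebra_simps)

text \<open>Both sides are cosh^2 (d/2) for the hyperbolic distance d. Through this identity the
  modulus of the kernel 1 / (z - cnj w) is controlled by \<open>hypu\<close>.\<close>

lemma hypu_cnj:
  assumes "Im z > 0" "Im w > 0"
  shows "1 + hypu z w = (cmod (z - cnj w))\<^sup>2 / (4 * Im z * Im w)"
  using assms by (simp add: hypu_def cmod_diff_cnj add_divide_distrib)


section \<open>Trace, shear and displacement of a matrix\<close>

definition herm :: "real^2^2 \<Rightarrow> complex \<Rightarrow> complex \<Rightarrow> complex" where
  "herm A w z = (of_real (A$1$1) * z + of_real (A$1$2)) - cnj w * aut_factor A z"

text \<open>\<open>herm\<close> is the denominator of the kernel at \<open>moebius A z\<close> after
  the automorphy factor has been absorbed. It is a polynomial in the entries of \<open>A\<close>, in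
  z and in cnj w, so it is visibly holomorphic in z.\<close>

lemma herm_eq: 
  assumes "det A = 1" "Im z > 0"
  shows "herm A w z = aut_factor A z * (moebius A z - cnj w)"
  using aut_factor_nz[OF assms] by (simp add: herm_def moebius_def right_diff_distrib)

text \<open>The numerator is the Hermitian version of the quadratic form whose real zeros are the
  fixed points of \<open>A\<close>. For a hyperbolic matrix it vanishes exactly on the axis, so
  \<open>shear\<close> is a signed measure of the distance from the axis; for the translation by b
  it is b / (2 Im w).\<close>

definition shear :: "real^2^2 \<Rightarrow> complex \<Rightarrow> real" where
  "shear A w = (A$1$2 + (A$1$1 - A$2$2) * Re w - A$2$1 * (cmod w)\<^sup>2) / (2 * Im w)"

definition disp :: "real^2^2 \<Rightarrow> complex \<Rightarrow> real" where
  "disp A w = hypu w (moebius A w)"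

text \<open>On the diagonal the conjugation invariant trace separates from the position of the
  point, which enters through \<open>shear\<close> alone.\<close>

lemma herm_diag:
  assumes "Im w > 0"
  shows "herm A w w = 2 * \<i> * of_real (Im w) * (of_real (trace A / 2) - \<i> * of_real (shear A w))"
  unfolding herm_def aut_factor_def shear_def cmod_power2
  using assms by (simp add: complex_eq_iff trace2 field_simps power2_eq_square) 

lemma cmod_herm:
  assumes "det A = 1" "Im z > 0" "Im w > 0"
  shows "(cmod (herm A w z))\<^sup>2 = 4 * Im z * Im w * (1 + hypu (moebius A z) w)"
  using assms aut_factor_nz[OF assms(1,2)]
  by (simp add: herm_eq hypu_cnj Im_moebius_pos norm_mult power_mult_distrib) (simp add: Im_moebius field_simps)

text \<open>The modulus of \<open>herm A w w\<close> is computed twice, by \<open>cmod_herm\<close>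
  in terms of the displacement and by \<open>herm_diag\<close> in terms of trace and shear.\<close>

lemma disp_eq:
  assumes "det A = 1" "Im w > 0"
  shows "disp A w = (trace A)\<^sup>2 / 4 - 1 + (shear A w)\<^sup>2"
proof -
  have "4 * Im w * Im w * (1 + disp A w) = (cmod (herm A w w))\<^sup>2"
    using assms by (simp add: cmod_herm disp_def hypu_sym)
  also have "... = 4 * Im w * Im w * ((trace A)\<^sup>2 / 4 + (shear A w)\<^sup>2)"
  proof -
    have "(cmod (of_real (trace A / 2) - \<i> * of_real (shear A w)))\<^sup>2 = (trace A)\<^sup>2 / 4 + (shear A w)\<^sup>2"
      by (simp add: cmod_power2 power_divide)
    then show ?thesis using assms
      by (simp add: herm_diag norm_mult power_mult_distrib) (simp add: power2_eq_square)
  qed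
  finally show ?thesis using assms by simp
qed

lemma herm_conj:
  assumes "det S = 1" "det A = 1" "Im w > 0"
  shows "herm (adj2 S ** A ** S) w w = of_real ((cmod (aut_factor S w))\<^sup>2) * herm A (moebius S w) (moebius S w)"
proof -
  let ?j = "aut_factor S w"
  let ?v = "moebius S w"
  have v: "Im ?v > 0" "Im (moebius A ?v) > 0" using assms by (auto intro: Im_moebius_pos)
  have j0: "?j \<noteq> 0" using assms aut_factor_nz by blast
  have one: "aut_factor (adj2 S) ?v * ?j = 1"
    using assms by (simp flip: aut_factor_mult)
  have k0: "aut_factor (adj2 S) (moebius A ?v) \<noteq> 0"
    using assms v aut_factor_nz by simp
  have k1: "aut_factor (adj2 S) (cnj ?v) \<noteq> 0" 
    using one by (metis cnj_aut_factor complex_cnj_zero_iff mult_zero_left zero_neq_one)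
  have "herm (adj2 S ** A ** S) w w = aut_factor (adj2 S ** A ** S) w * (moebius (adj2 S ** A ** S) w - cnj w)"
    using assms by (intro herm_eq) (auto simp: det_mul)
  also have "aut_factor (adj2 S ** A ** S) w = aut_factor (adj2 S) (moebius A ?v) * aut_factor A ?v * ?j"
    using assms v by (simp add: aut_factor_mult det_mul flip: matrix_mul_assoc moebius_mult)
  also have "moebius (adj2 S ** A ** S) w = moebius (adj2 S) (moebius A ?v)"
    using assms v by (simp add: moebius_mult det_mul)
  also have "cnj w = moebius (adj2 S) (cnj ?v)"
    using assms by (simp flip: cnj_moebius)
  also have "moebius (adj2 S) (moebius A ?v) - moebius (adj2 S) (cnj ?v) =
     (moebius A ?v - cnj ?v) / (aut_factor (adj2 S) (moebius A ?v) * aut_factor (adj2 S) (cnj ?v))"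
    using assms k0 k1 by (intro moebius_diff) auto
  also have "1 / aut_factor (adj2 S) (cnj ?v) = cnj ?j"
  proof -
    have "aut_factor (adj2 S) (cnj ?v) * cnj ?j = 1"
      using one by (metis cnj_aut_factor complex_cnj_mult complex_cnj_one)
    then show ?thesis using k1 by (simp add: field_simps)
  qed
  then have "aut_factor (adj2 S) (moebius A ?v) * aut_factor A ?v * ?j *
     ((moebius A ?v - cnj ?v) / (aut_factor (adj2 S) (moebius A ?v) * aut_factor (adj2 S) (cnj ?v)))
    = (?j * cnj ?j) * (aut_factor A ?v * (moebius A ?v - cnj ?v))"
    using k0 by (simp flip: \<open>1 / _ = cnj ?j\<close>)
  also have "... = of_real ((cmod ?j)\<^sup>2) * herm A ?v ?v"
    using assms v by (simp only: herm_eq complex_norm_square)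
  finally show ?thesis .
qed

text \<open>Conjugation multiplies the diagonal value of \<open>herm\<close> by |j|^2, and |j|^2 Im
  (S w) = Im w. The trace is unchanged, so \<open>herm_diag\<close> leaves only the two shears to be
  compared.\<close>

lemma shear_conj:
  assumes "det S = 1" "det A = 1" "Im w > 0"
  shows "shear (adj2 S ** A ** S) w = shear A (moebius S w)"
proof -
  have v: "Im (moebius S w) > 0" using assms by (auto intro: Im_moebius_pos)
  have "2 * \<i> * of_real (Im w) * (of_real (trace A / 2) - \<i> * of_real (shear (adj2 S ** A ** S) w))
     = herm (adj2 S ** A ** S) w w"
    using assms by (simp add: herm_diag trace_conj2 del: of_real_divide)
  also have "... = of_real ((cmod (aut_factor S w))\<^sup>2 * Im (moebius S w)) * 
      (2 * \<i> * (of_real (trace A / 2) - \<i> * of_real (shear A (moebius S w))))"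
    using v by (simp only: herm_conj[OF assms] herm_diag[OF v] of_real_mult mult_ac)
  also have "(cmod (aut_factor S w))\<^sup>2 * Im (moebius S w) = Im w"
    using assms aut_factor_nz[of S w] by (simp add: Im_moebius)
  finally have "of_real (trace A / 2) - \<i> * of_real (shear (adj2 S ** A ** S) w) =
      of_real (trace A / 2) - \<i> * of_real (shear A (moebius S w))"
    using assms(3) by (simp del: of_real_divide)
  then show ?thesis by simp
qed

lemma disp_conj:
  assumes "det S = 1" "det A = 1" "Im w > 0"
  shows "disp (adj2 S ** A ** S) w = disp A (moebius S w)"
  using assms by (simp add: disp_eq shear_conj trace_conj2 det_conj2 Im_moebius_pos)

section \<open>Conformal change of variables\<close>

text \<open>Transport between the plane and \<open>real^2\<close>, where the change of variables
  formula with a Jacobian determinant is stated.\<close>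

definition cvec :: "complex \<Rightarrow> real^2" where
  "cvec z = vector [Re z, Im z]"

definition veccomp :: "real^2 \<Rightarrow> complex" where
  "veccomp v = Complex (v$1) (v$2)"

lemma cvec_nth [simp]: "cvec z $ 1 = Re z" "cvec z $ 2 = Im z"
  by (simp_all add: cvec_def)

lemma cvec_veccomp [simp]: "cvec (veccomp v) = v" "veccomp (cvec z) = z"
  by (simp_all add: veccomp_def vec_eq_iff forall_2)

lemma bounded_linear_cvec: "bounded_linear cvec"
proof -
  have "linear cvec" by (rule linearI) (simp_all add: vec_eq_iff forall_2)
  then show ?thesis using linear_conv_bounded_linear by blast
qed

lemma bounded_linear_veccomp: "bounded_linear veccomp"
proof -
  have "linear veccomp" by (rule linearI) (simp_all add: veccomp_def complex_eq_iff)
  then show ?thesis using linear_conv_bounded_linear by blast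
qed

lemma borel_measurable_veccomp [measurable]: "veccomp \<in> borel_measurable borel"
  by (intro borel_measurable_continuous_onI linear_continuous_on bounded_linear_veccomp)

lemma borel_measurable_cvec [measurable]: "cvec \<in> borel_measurable borel"
  by (intro borel_measurable_continuous_onI linear_continuous_on bounded_linear_cvec)

lemma distr_veccomp: "distr lborel borel veccomp = lborel"
proof (rule lborel_eqI[symmetric])
  fix l u :: complex assume lu: "\<And>b. b \<in> Basis ==> l \<bullet> b \<le> u \<bullet> b"
  have bs: "(\<Prod>b\<in>(Basis::(real^2) set). f b) = f (axis 1 1) * f (axis 2 1)" for f :: "_ \<Rightarrow> real"
  proof -
    have B: "(Basis::(real^2) set) = {axis 1 1, axis 2 1}"
      by (auto simp: Basis_vec_def UNIV_2)
    have ne: "axis 1 1 \<noteq> (axis 2 1 :: real^2)" by (simp add: axis_eq_axis)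
    have x: "prod f {a,b} = f a * f b" if "a \<noteq> b" for a b using that by simp
    show ?thesis unfolding B by (rule x[OF ne])
  qed
  have lu': "Re l \<le> Re u" "Im l \<le> Im u" using lu[of 1] lu[of \<i>] by (auto simp: Basis_complex_def)
  have "veccomp -` box l u = box (cvec l) (cvec u)"
    by (rule Set.set_eqI) (simp add: in_box_complex_iff mem_box_cart forall_2 veccomp_def)
  then have "emeasure (distr lborel borel veccomp) (box l u) = emeasure lborel (box (cvec l) (cvec u))"
    by (simp add: emeasure_distr)
  also have "... = (\<Prod>b\<in>Basis. (cvec u - cvec l) \<bullet> b)"
  proof -
    have "cvec l \<bullet> b \<le> cvec u \<bullet> b" if "b \<in> Basis" for b
      using that lu' by (auto simp: Basis_vec_def UNIV_2 inner_axis)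
    then show ?thesis by (simp add: emeasure_lborel_box inner_diff_left)
  qed
  also have "(\<Prod>b\<in>Basis. (cvec u - cvec l) \<bullet> b) = (\<Prod>b\<in>Basis. (u - l) \<bullet> b)"
    by (simp add: bs inner_axis Basis_complex_def complex_i_not_one[symmetric] del: complex_i_not_one)
  finally show "emeasure (distr lborel borel veccomp) (box l u) = (\<Prod>b\<in>Basis. (u - l) \<bullet> b)" .
qed simp

lemma det_complex_mult:
  "det (matrix (\<lambda>h. cvec (d * veccomp h))) = (cmod d)\<^sup>2"
  by (simp add: det_2 matrix_def veccomp_def axis_def cmod_power2) (simp add: power2_eq_square)

text \<open>The change of variables theorem equates a finite measure with an existing integral.
  Infinite values are added by contraposition: a finite integral would make the image measurable of
  finite measure, so in the remaining case both sides are infinite.\<close>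

lemma emeasure_holomorphic_image:
  assumes S: "open S" and hol: "\<phi> holomorphic_on S" and inj: "inj_on \<phi> S"
    and B: "B \<in> sets borel" "B \<subseteq> S" and im: "\<phi> ` B \<in> sets borel"
  shows "emeasure lborel (\<phi> ` B) = (\<integral>\<^sup>+z. ennreal ((cmod (deriv \<phi> z))\<^sup>2) * indicator B z \<partial>lborel)"
proof -
  define f where "f = (\<lambda>v. cvec (\<phi> (veccomp v)))"
  define f' where "f' = (\<lambda>v h. cvec (deriv \<phi> (veccomp v) * veccomp h))"
  define B' where "B' = veccomp -` B"
  define g where "g = (\<lambda>v. (cmod (deriv \<phi> (veccomp v)))\<^sup>2)"
  have B'borel: "B' \<in> sets borel"
    using measurable_sets_borel[OF borel_measurable_veccomp B(1)] by (simp add: B'_def)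
  have der: "(f has_derivative f' v) (at v within B')" if "v \<in> B'" for v
  proof -
    have "veccomp v \<in> S" using that B by (auto simp: B'_def)
    then have "(\<phi> has_field_derivative deriv \<phi> (veccomp v)) (at (veccomp v))"
      using S hol holomorphic_derivI by blast
    then have 1: "(\<phi> has_derivative (*) (deriv \<phi> (veccomp v))) (at (veccomp v))"
      by (simp add: has_field_derivative_def)
    have "(f has_derivative f' v) (at v)"
      unfolding f_def f'_def
      by (intro bounded_linear.has_derivative[OF bounded_linear_cvec]
           has_derivative_compose[OF bounded_linear.has_derivative[OF bounded_linear_veccomp has_derivative_ident] 1])
    then show ?thesis by (rule has_derivative_at_withinI)
  qed
  have injf: "inj_on f B'"
  proof (rule inj_onI)
    fix v w assume vw: "v \<in> B'" "w \<in> B'" "f v = f w"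
    then have "\<phi> (veccomp v) = \<phi> (veccomp w)" unfolding f_def by (metis cvec_veccomp(2))
    then have "veccomp v = veccomp w" using vw B inj by (auto simp: B'_def inj_on_def)
    then show "v = w" by (metis cvec_veccomp(1))
  qed
  have imf: "f ` B' = veccomp -` (\<phi> ` B)"
  proof (intro Set.set_eqI iffI)
    fix v assume "v \<in> f ` B'"
    then show "v \<in> veccomp -` (\<phi> ` B)" by (auto simp: f_def B'_def)
  next
    fix v assume "v \<in> veccomp -` (\<phi> ` B)"
    then obtain z where "veccomp v = \<phi> z" "z \<in> B" by auto
    then have "f (cvec z) = cvec (veccomp v)" "cvec z \<in> B'" by (simp_all add: f_def B'_def)
    then have "v = f (cvec z)" "cvec z \<in> B'" by simp_all
    then show "v \<in> f ` B'" by blast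
  qed
  have imborel: "f ` B' \<in> sets borel"
    using measurable_sets_borel[OF borel_measurable_veccomp im] by (simp add: imf)
  have cont: "continuous_on S (deriv \<phi>)"
    using S hol holomorphic_deriv holomorphic_on_imp_continuous_on by blast
  have meas: "(\<lambda>z. (cmod (deriv \<phi> z))\<^sup>2 * indicator B z) \<in> borel_measurable borel"
  proof -
    have "continuous_on B (\<lambda>z. (cmod (deriv \<phi> z))\<^sup>2)"
      by (intro continuous_intros continuous_on_subset[OF cont B(2)])
    then have "(\<lambda>z. indicator B z *\<^sub>R (cmod (deriv \<phi> z))\<^sup>2) \<in> borel_measurable borel"
      using B(1) borel_measurable_continuous_on_indicator by blast
    then show ?thesis by (simp add: mult.commute)
  qed
  have meas': "(\<lambda>v. g v * indicator B' v) \<in> borel_measurable borel"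
    using measurable_compose[OF borel_measurable_veccomp meas] 
    by (simp add: g_def B'_def indicator_def)
  have key: "(f ` B' \<in> lmeasurable \<and> measure lebesgue (f ` B') = m) \<longleftrightarrow> (g has_integral m) B'" for m
    using has_measure_differentiable_image[of B' f f' m] der injf B'borel
    by (simp add: f'_def det_complex_mult g_def)
  let ?I = "\<integral>\<^sup>+v. ennreal (g v) * indicator B' v \<partial>lborel"
  have I: "(g has_integral m) B' \<longleftrightarrow> 0 \<le> m \<and> ?I = ennreal m" for m
  proof -
    have 1: "(g has_integral m) B' \<longleftrightarrow> ((\<lambda>v. g v * indicator B' v) has_integral m) UNIV"
    proof -
      have "(\<lambda>v. g v * indicator B' v) = (\<lambda>v. if v \<in> B' then g v else 0)" by (auto simp: indicator_def)
      then show ?thesis by (simp only: has_integral_restrict_UNIV)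
    qed
    have 2: "?I = (\<integral>\<^sup>+v. ennreal (g v * indicator B' v) \<partial>lborel)"
      by (intro nn_integral_cong) (auto simp: indicator_def)
    have nn: "0 \<le> g v * indicator B' v" for v by (simp add: g_def)
    show ?thesis unfolding 1 2
    proof
      assume h: "((\<lambda>v. g v * indicator B' v) has_integral m) UNIV"
      then have "(\<integral>\<^sup>+v. ennreal (g v * indicator B' v) \<partial>lborel) = ennreal m"
        using nn meas' by (intro nn_integral_has_integral_lborel) auto
      moreover have "0 \<le> m" using h nn has_integral_nonneg by blast
      ultimately show "0 \<le> m \<and> (\<integral>\<^sup>+v. ennreal (g v * indicator B' v) \<partial>lborel) = ennreal m" by simp
    next
      assume h: "0 \<le> m \<and> (\<integral>\<^sup>+v. ennreal (g v * indicator B' v) \<partial>lborel) = ennreal m"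
      then show "((\<lambda>v. g v * indicator B' v) has_integral m) UNIV"
        using nn meas' by (intro nn_integral_has_integral) auto
    qed
  qed
  have "emeasure lborel (f ` B') = ?I"
  proof (cases "f ` B' \<in> lmeasurable")
    case True
    then have "(g has_integral measure lebesgue (f ` B')) B'" using key by blast
    then have "?I = ennreal (measure lebesgue (f ` B'))" using I by blast
    also have "... = emeasure lebesgue (f ` B')" using True by (simp add: emeasure_eq_measure2)
    also have "... = emeasure lborel (f ` B')" using imborel by simp
    finally show ?thesis by simp
  next
    case False
    have "?I = \<infinity>"
    proof (rule ccontr)
      assume "?I \<noteq> \<infinity>"
      then obtain m where "0 \<le> m" "?I = ennreal m" by (cases ?I) auto
      then have "(g has_integral m) B'" using I by blast
      then show False using key False by blast
    qed
    moreover have "emeasure lborel (f ` B') = \<infinity>"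
      using False imborel by (auto simp: fmeasurable_def less_top[symmetric])
    ultimately show ?thesis by simp
  qed
  moreover have "emeasure lborel (f ` B') = emeasure lborel (\<phi> ` B)"
  proof -
    have "emeasure lborel (\<phi> ` B) = emeasure (distr lborel borel veccomp) (\<phi> ` B)" by (simp only: distr_veccomp)
    then show ?thesis using im by (simp add: emeasure_distr imf)
  qed
  moreover have "?I = (\<integral>\<^sup>+z. ennreal ((cmod (deriv \<phi> z))\<^sup>2) * indicator B z \<partial>lborel)"
  proof -
    have m1: "(\<lambda>z. ennreal ((cmod (deriv \<phi> z))\<^sup>2) * indicator B z) \<in> borel_measurable borel"
    proof -
      have "(\<lambda>z. ennreal ((cmod (deriv \<phi> z))\<^sup>2 * indicator B z)) \<in> borel_measurable borel"
        using meas by measurable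
      also have "(\<lambda>z. ennreal ((cmod (deriv \<phi> z))\<^sup>2 * indicator B z)) = (\<lambda>z. ennreal ((cmod (deriv \<phi> z))\<^sup>2) * indicator B z)"
        by (auto simp: indicator_def)
      finally show ?thesis .
    qed
    have "(\<integral>\<^sup>+z. ennreal ((cmod (deriv \<phi> z))\<^sup>2) * indicator B z \<partial>lborel) =
      (\<integral>\<^sup>+z. ennreal ((cmod (deriv \<phi> z))\<^sup>2) * indicator B z \<partial>distr lborel borel veccomp)" by (simp only: distr_veccomp)
    also have "... = ?I" using m1 by (subst nn_integral_distr) (auto simp: g_def B'_def indicator_def intro!: nn_integral_cong)
    finally show ?thesis by simp
  qed
  ultimately show ?thesis by simp
qed

text \<open>An equality of measures serves nonnegative and Bochner integrals at once. The value 0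
  outside \<open>S\<close> only makes the map a total Borel function; the density vanishes
  there.\<close>

lemma distr_conformal:
  assumes S: "open S" and hol: "\<phi> holomorphic_on S" and inj: "inj_on \<phi> S"
  shows "distr (density lborel (\<lambda>z. ennreal ((cmod (deriv \<phi> z))\<^sup>2) * indicator S z)) borel
      (\<lambda>z. if z \<in> S then \<phi> z else 0) = density lborel (indicator (\<phi> ` S))"
    and "(\<lambda>z. if z \<in> S then \<phi> z else 0) \<in> borel_measurable borel"
    and "(\<lambda>z. ennreal ((cmod (deriv \<phi> z))\<^sup>2) * indicator S z) \<in> borel_measurable borel"
    and "open (\<phi> ` S)"
proof -
  let ?\<phi> = "\<lambda>z. if z \<in> S then \<phi> z else 0"
  let ?d = "\<lambda>z. ennreal ((cmod (deriv \<phi> z))\<^sup>2) * indicator S z"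
  show op: "open (\<phi> ` S)"
    using open_mapping_thm3[OF hol S inj] .
  have "(\<lambda>z. indicator S z *\<^sub>R \<phi> z) \<in> borel_measurable borel"
    using S holomorphic_on_imp_continuous_on[OF hol] borel_measurable_continuous_on_indicator[of S \<phi>] by simp
  also have "(\<lambda>z. indicator S z *\<^sub>R \<phi> z) = ?\<phi>" by (auto simp: indicator_def)
  finally show m\<phi>: "?\<phi> \<in> borel_measurable borel" .
  have "continuous_on S (\<lambda>z. (cmod (deriv \<phi> z))\<^sup>2)"
    using S hol holomorphic_deriv holomorphic_on_imp_continuous_on by (intro continuous_intros) blast
  then have "(\<lambda>z. indicator S z *\<^sub>R (cmod (deriv \<phi> z))\<^sup>2) \<in> borel_measurable borel"
    using S borel_measurable_continuous_on_indicator[of S "\<lambda>z. (cmod (deriv \<phi> z))\<^sup>2"] by simp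
  then have "(\<lambda>z. ennreal (indicator S z *\<^sub>R (cmod (deriv \<phi> z))\<^sup>2)) \<in> borel_measurable borel" by measurable
  also have "(\<lambda>z. ennreal (indicator S z *\<^sub>R (cmod (deriv \<phi> z))\<^sup>2)) = ?d"
    by (auto simp: indicator_def)
  finally show md: "?d \<in> borel_measurable borel" .
  show "distr (density lborel ?d) borel ?\<phi> = density lborel (indicator (\<phi> ` S))"
  proof (rule measure_eqI)
    fix E assume "E \<in> sets (distr (density lborel ?d) borel ?\<phi>)"
    then have E: "E \<in> sets borel" by simp
    define B where "B = S \<inter> ?\<phi> -` E"
    have "?\<phi> -` E \<in> sets borel" using measurable_sets_borel[OF m\<phi> E] .
    then have B: "B \<in> sets borel" "B \<subseteq> S" using S by (auto simp: B_def)
    have im: "\<phi> ` B = E \<inter> \<phi> ` S" by (auto simp: B_def)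
    have "\<phi> ` B \<in> sets borel" using E op by (simp add: im)
    then have e: "emeasure lborel (\<phi> ` B) = (\<integral>\<^sup>+z. ennreal ((cmod (deriv \<phi> z))\<^sup>2) * indicator B z \<partial>lborel)"
      by (rule emeasure_holomorphic_image[OF S hol inj B])
    have "emeasure (distr (density lborel ?d) borel ?\<phi>) E = emeasure (density lborel ?d) (?\<phi> -` E)"
      using m\<phi> E by (simp add: emeasure_distr)
    also have "... = (\<integral>\<^sup>+z. ?d z * indicator (?\<phi> -` E) z \<partial>lborel)"
      using md \<open>?\<phi> -` E \<in> sets borel\<close> by (simp add: emeasure_density)
    also have "... = (\<integral>\<^sup>+z. ennreal ((cmod (deriv \<phi> z))\<^sup>2) * indicator B z \<partial>lborel)"
      by (intro nn_integral_cong) (auto simp: B_def indicator_def)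
    also have "... = emeasure lborel (E \<inter> \<phi> ` S)" using e by (simp add: im)
    also have "... = emeasure (density lborel (indicator (\<phi> ` S))) E"
      using E op by (simp add: emeasure_density nn_integral_indicator indicator_inter_arith[symmetric] Int_commute)
    finally show "emeasure (distr (density lborel ?d) borel ?\<phi>) E = emeasure (density lborel (indicator (\<phi> ` S))) E" .
  qed simp
qed

lemma nn_integral_conformal:
  assumes S: "open S" and hol: "\<phi> holomorphic_on S" and inj: "inj_on \<phi> S"
    and g: "g \<in> borel_measurable borel"
  shows "(\<integral>\<^sup>+w. g w * indicator (\<phi> ` S) w \<partial>lborel) =
     (\<integral>\<^sup>+z. g (\<phi> z) * ennreal ((cmod (deriv \<phi> z))\<^sup>2) * indicator S z \<partial>lborel)"
proof -
  note c = distr_conformal[OF S hol inj]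
  have "(\<integral>\<^sup>+w. g w * indicator (\<phi> ` S) w \<partial>lborel) = (\<integral>\<^sup>+w. g w \<partial>density lborel (indicator (\<phi> ` S)))"
    using c(4) g by (subst nn_integral_density) (auto simp: mult.commute)
  also have "... = (\<integral>\<^sup>+z. ennreal ((cmod (deriv \<phi> z))\<^sup>2) * indicator S z * g (if z \<in> S then \<phi> z else 0) \<partial>lborel)"
    using c g by (subst c(1)[symmetric], subst nn_integral_distr) (auto simp: nn_integral_density)
  also have "... = (\<integral>\<^sup>+z. g (\<phi> z) * ennreal ((cmod (deriv \<phi> z))\<^sup>2) * indicator S z \<partial>lborel)"
    by (intro nn_integral_cong) (auto simp: indicator_def mult.commute)
  finally show ?thesis .
qed

lemma integral_conformal:
  fixes g :: "complex \<Rightarrow> complex"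
  assumes S: "open S" and hol: "\<phi> holomorphic_on S" and inj: "inj_on \<phi> S"
    and g: "g \<in> borel_measurable borel"
  shows "(\<integral>w. indicator (\<phi> ` S) w *\<^sub>R g w \<partial>lborel) =
     (\<integral>z. indicator S z *\<^sub>R ((cmod (deriv \<phi> z))\<^sup>2 *\<^sub>R g (\<phi> z)) \<partial>lborel)"
proof -
  note c = distr_conformal[OF S hol inj]
  have e1: "(indicator A :: complex \<Rightarrow> ennreal) = (\<lambda>x. ennreal (indicator A x))" for A
    by (auto simp: indicator_def)
  have e2: "(\<lambda>z. ennreal ((cmod (deriv \<phi> z))\<^sup>2) * indicator S z) = (\<lambda>z. ennreal ((cmod (deriv \<phi> z))\<^sup>2 * indicator S z))"
    by (auto simp: indicator_def)
  have m: "(\<lambda>z. (cmod (deriv \<phi> z))\<^sup>2 * indicator S z) \<in> borel_measurable borel"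
  proof -
    have "(\<lambda>z. enn2real (ennreal ((cmod (deriv \<phi> z))\<^sup>2 * indicator S z))) \<in> borel_measurable borel"
      using c(3) unfolding e2 by measurable
    then show ?thesis by (simp add: enn2real_ennreal)
  qed
  have "(\<integral>w. indicator (\<phi> ` S) w *\<^sub>R g w \<partial>lborel) = (\<integral>w. g w \<partial>density lborel (indicator (\<phi> ` S)))"
    unfolding e1 using c(4) g by (subst integral_density) auto
  also have "... = (\<integral>z. g (if z \<in> S then \<phi> z else 0) \<partial>density lborel (\<lambda>z. ennreal ((cmod (deriv \<phi> z))\<^sup>2) * indicator S z))"
    using c g by (subst c(1)[symmetric], subst integral_distr) auto
  also have "... = (\<integral>z. ((cmod (deriv \<phi> z))\<^sup>2 * indicator S z) *\<^sub>R g (if z \<in> S then \<phi> z else 0) \<partial>lborel)"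
    unfolding e2 using m c(2) g by (subst integral_density) auto
  also have "... = (\<integral>z. indicator S z *\<^sub>R ((cmod (deriv \<phi> z))\<^sup>2 *\<^sub>R g (\<phi> z)) \<partial>lborel)"
    by (intro Bochner_Integration.integral_cong) (auto simp: indicator_def)
  finally show ?thesis .
qed

section \<open>Stirling\<close>

text \<open>The logarithm of n! divided by n^(n + 1/2) e^(-n); Stirling's formula says that it tends
  to ln (sqrt (2 pi)).\<close>

definition stirl :: "nat \<Rightarrow> real" where
  "stirl n = ln (fact n) - (real n + 1/2) * ln (real n) + real n"

lemma stirl_diff:
  assumes "n > 0"
  shows "stirl n - stirl (Suc n) = (real n + 1/2) * ln ((real n + 1) / real n) - 1"
proof -
  have "(fact (Suc n) :: real) = (real n + 1) * fact n" by simp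
  then have "ln (fact (Suc n) :: real) = ln (real n + 1) + ln (fact n)" by (simp only:) (simp add: ln_mult)
  moreover have "ln ((real n + 1) / real n) = ln (real n + 1) - ln (real n)" using assms by (simp add: ln_div)
  ultimately show ?thesis unfolding stirl_def by (simp only: of_nat_Suc) (simp add: algebra_simps del: fact_Suc)
qed

text \<open>With t = 1/x, the logarithm ln (1 + t) lies between 2t / (2 + t) and (2t + t^2) / (2 (1
  + t)); each comparison holds since the difference vanishes at 0 and has a nonnegative derivative.
  The upper bound is written as a difference so that it telescopes.\<close>

lemma ln_ratio_bounds:
  fixes x :: real assumes "x > 0"
  shows "(x + 1/2) * ln ((x + 1) / x) - 1 \<ge> 0"
    and "(x + 1/2) * ln ((x + 1) / x) - 1 \<le> 1 / (4 * x) - 1 / (4 * (x + 1))"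
proof -
  define f where "f = (\<lambda>t::real. ln (1 + t) - 2 * t / (2 + t))"
  have f: "f t \<ge> f 0" if "t \<ge> 0" for t
  proof (rule DERIV_nonneg_imp_nondecreasing[OF that])
    fix y :: real assume y: "0 \<le> y" "y \<le> t"
    have "(f has_real_derivative (1 / (1 + y) - (2 * (2 + y) - 2 * y) / (2 + y)\<^sup>2)) (at y)"
      unfolding f_def using y by (auto intro!: derivative_eq_intros simp: power2_eq_square field_simps)
    moreover have "1 / (1 + y) - (2 * (2 + y) - 2 * y) / (2 + y)\<^sup>2 = y\<^sup>2 / ((1 + y) * (2 + y)\<^sup>2)"
      using y by (simp add: divide_simps) (simp add: power2_eq_square algebra_simps)
    ultimately show "\<exists>D. (f has_real_derivative D) (at y) \<and> 0 \<le> D"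
      using y by (metis divide_nonneg_nonneg mult_nonneg_nonneg zero_le_power2 add_nonneg_nonneg zero_le_one)
  qed
  have 1: "ln (1 + 1 / x) \<ge> 2 * (1/x) / (2 + 1/x)" using f[of "1/x"] assms by (simp add: f_def)
  have "2 * (1/x) / (2 + 1/x) = 1 / (x + 1/2)" using assms by (simp add: field_simps)
  moreover have e: "(x + 1) / x = 1 + 1 / x" using assms by (simp add: field_simps)
  ultimately have "(x + 1/2) * (1 / (x + 1/2)) \<le> (x + 1/2) * ln ((x + 1) / x)"
    using 1 assms by (intro mult_left_mono) auto
  then show "(x + 1/2) * ln ((x + 1) / x) - 1 \<ge> 0" using assms by simp
  define g where "g = (\<lambda>t::real. (2 * t + t\<^sup>2) / (2 * (1 + t)) - ln (1 + t))"
  have g: "g t \<ge> g 0" if "t \<ge> 0" for t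
  proof (rule DERIV_nonneg_imp_nondecreasing[OF that])
    fix y :: real assume y: "0 \<le> y" "y \<le> t"
    have "(g has_real_derivative (((2 + 2 * y) * (2 * (1 + y)) - (2 * y + y\<^sup>2) * 2) / (2 * (1 + y))\<^sup>2 - 1 / (1 + y))) (at y)"
      unfolding g_def using y by (auto intro!: derivative_eq_intros simp: power2_eq_square)
    moreover have "((2 + 2 * y) * (2 * (1 + y)) - (2 * y + y\<^sup>2) * 2) / (2 * (1 + y))\<^sup>2 - 1 / (1 + y) = y\<^sup>2 / (2 * (1 + y)\<^sup>2)"
      using y by (simp add: divide_simps) (simp add: power2_eq_square algebra_simps)
    ultimately show "\<exists>D. (g has_real_derivative D) (at y) \<and> 0 \<le> D"
      using y by (metis divide_nonneg_nonneg mult_nonneg_nonneg zero_le_power2 zero_le_numeral)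
  qed
  have "ln (1 + 1 / x) \<le> (2 * (1/x) + (1/x)\<^sup>2) / (2 * (1 + 1/x))"
    using g[of "1/x"] assms by (simp add: g_def)
  then have "(x + 1/2) * ln ((x + 1) / x) \<le> (x + 1/2) * ((2 * (1/x) + (1/x)\<^sup>2) / (2 * (1 + 1/x)))"
    unfolding e using assms by (intro mult_left_mono) auto
  also have "... = 1 + (1 / (4 * x) - 1 / (4 * (x + 1)))"
    using assms by (simp add: divide_simps) (simp add: power2_eq_square algebra_simps)
  finally show "(x + 1/2) * ln ((x + 1) / x) - 1 \<le> 1 / (4 * x) - 1 / (4 * (x + 1))" by simp
qed

lemma stirl_antimono: "n \<le> m ==> n > 0 ==> stirl m \<le> stirl n"
proof (induction rule: dec_induct)
  case (step k)
  then show ?case using stirl_diff[of k] ln_ratio_bounds(1)[of "real k"] by (simp add: add.commute)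
qed simp

lemma stirl_mono: "n \<le> m ==> n > 0 ==> stirl n - 1 / (4 * real n) \<le> stirl m - 1 / (4 * real m)"
proof (induction rule: dec_induct)
  case (step k)
  then show ?case using stirl_diff[of k] ln_ratio_bounds(2)[of "real k"] by (simp add: add.commute)
qed simp

text \<open>Monotonicity and a lower bound give a limit L. In the logarithm of the Wallis product
  the powers and exponentials cancel, leaving 4 \<open>stirl n\<close> - 2
  \<open>stirl (2 * n)\<close> and elementary terms, so 2 L = ln (2 pi).\<close>

lemma stirl_limit: "stirl \<longlonglongrightarrow> ln (sqrt (2 * pi))"
proof -
  have "decseq (\<lambda>n. stirl (Suc n))" by (intro decseq_SucI stirl_antimono) auto
  moreover have "stirl 1 - 1/4 \<le> stirl (Suc n)" for n
  proof -
    have "stirl 1 - 1/4 \<le> stirl (Suc n) - 1 / (4 * real (Suc n))" using stirl_mono[of 1 "Suc n"] by simp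
    also have "... \<le> stirl (Suc n)" by simp
    finally show ?thesis .
  qed
  ultimately obtain L where L1: "(\<lambda>n. stirl (Suc n)) \<longlonglongrightarrow> L" using decseq_convergent by blast
  then have L: "stirl \<longlonglongrightarrow> L" by (simp add: filterlim_sequentially_Suc)
  have w: "(\<Prod>k=1..n. (4*real k^2) / (4*real k^2 - 1)) = (2 ^ (4 * n) * fact n ^ 4) / (fact (2 * n) ^ 2 * (2 * real n + 1))" for n
  proof (induction n)
    case (Suc n)
    have "(\<Prod>k=1..Suc n. (4*real k^2) / (4*real k^2 - 1)) = (2 ^ (4 * n) * fact n ^ 4) / (fact (2 * n) ^ 2 * (2 * real n + 1)) * ((4*real (Suc n)^2) / (4*real (Suc n)^2 - 1))"
      using Suc by simp
    also have "4*real (Suc n)^2 - 1 = (2 * real n + 1) * (2 * real n + 3)"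
      by (simp add: power2_eq_square algebra_simps)
    also have "(2 ^ (4 * n) * fact n ^ 4) / (fact (2 * n) ^ 2 * (2 * real n + 1)) * ((4*real (Suc n)^2) / ((2 * real n + 1) * (2 * real n + 3))) =
      (2 ^ (4 * Suc n) * fact (Suc n) ^ 4) / (fact (2 * Suc n) ^ 2 * (2 * real (Suc n) + 1))"
    proof -
      have f1: "fact (2 * Suc n) = (2 * real n + 2) * (2 * real n + 1) * fact (2 * n)"
        by (simp add: algebra_simps)
      have f2: "(fact (Suc n) :: real) = (real n + 1) * fact n" by (simp add: algebra_simps)
      have f3: "(2::real) ^ (4 * Suc n) = 16 * 2 ^ (4 * n)" by (simp add: power_add)
      have r: "2 * real (Suc n) + 1 = 2 * real n + 3" "real (Suc n) = real n + 1" "2 * real n + 2 = 2 * (real n + 1)" by simp_all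
      show ?thesis unfolding f1 f2 f3 r(1) r(2) r(3)
        by (simp add: divide_simps) (simp add: power2_eq_square eval_nat_numeral algebra_simps)
    qed
    finally show ?case .
  qed simp
  have ln: "ln (\<Prod>k=1..n. (4*real k^2) / (4*real k^2 - 1)) = 4 * stirl n - 2 * stirl (2 * n) - ln 2 + ln (real n / (2 * real n + 1))"
    if "n > 0" for n
  proof -
    have "ln (\<Prod>k=1..n. (4*real k^2) / (4*real k^2 - 1)) = real (4 * n) * ln 2 + 4 * ln (fact n) - (2 * ln (fact (2 * n)) + ln (2 * real n + 1))"
      unfolding w using that by (simp add: ln_mult ln_div ln_realpow del: of_nat_mult)
    moreover have "ln (real n / (2 * real n + 1)) = ln (real n) - ln (2 * real n + 1)"
      using that by (simp add: ln_div)
    moreover have "ln (real (2 * n)) = ln 2 + ln (real n)" using that by (simp add: ln_mult)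
    ultimately show ?thesis unfolding stirl_def by (simp add: algebra_simps)
  qed
  have sub: "(\<lambda>n. stirl (2 * n)) \<longlonglongrightarrow> L"
    using LIMSEQ_subseq_LIMSEQ[OF L, of "\<lambda>n. 2 * n"] by (simp add: strict_mono_def o_def)
    have "(\<lambda>n. inverse (2 + inverse (real n))) \<longlonglongrightarrow> inverse (2 + 0)"
    by (intro tendsto_intros LIMSEQ_inverse_real_of_nat[THEN LIMSEQ_imp_Suc] lim_inverse_n) simp_all
  moreover have "eventually (\<lambda>n. inverse (2 + inverse (real n)) = real n / (2 * real n + 1)) sequentially"
    using eventually_gt_at_top[of 0] by eventually_elim (simp add: field_simps)
  ultimately have "(\<lambda>n. real n / (2 * real n + 1)) \<longlonglongrightarrow> inverse (2 + 0)" by (rule Lim_transform_eventually)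
  then have A: "(\<lambda>n. real n / (2 * real n + 1)) \<longlonglongrightarrow> 1/2" by simp
  have lnA: "(\<lambda>n. ln (real n / (2 * real n + 1))) \<longlonglongrightarrow> ln (1/2)" by (rule tendsto_ln[OF A]) simp
  have "(\<lambda>n. 4 * stirl n - 2 * stirl (2 * n) - ln 2 + ln (real n / (2 * real n + 1))) \<longlonglongrightarrow> 4 * L - 2 * L - ln 2 + ln (1/2)"
    by (intro tendsto_add tendsto_diff tendsto_mult tendsto_const L sub lnA)
  then have "(\<lambda>n. ln (\<Prod>k=1..n. (4*real k^2) / (4*real k^2 - 1))) \<longlonglongrightarrow> 4 * L - 2 * L - ln 2 + ln (1/2)"
    by (rule Lim_transform_eventually) (rule eventually_mono[OF eventually_gt_at_top[of 0]], simp only: ln)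
  moreover have "(\<lambda>n. ln (\<Prod>k=1..n. (4*real k^2) / (4*real k^2 - 1))) \<longlonglongrightarrow> ln (pi / 2)"
    by (intro tendsto_ln wallis) simp_all
  ultimately have "4 * L - 2 * L - ln 2 + ln (1/2) = ln (pi / 2)" by (rule LIMSEQ_unique)
  then have "L = ln (2 * pi) / 2" by (simp add: ln_div ln_mult)
  then have "L = ln (sqrt (2 * pi))" by (simp add: ln_sqrt)
  then show ?thesis using L by simp
qed

lemma stirling_bounds:
  assumes "n > 0"
  shows "sqrt (2 * pi * real n) * real n ^ n * exp (- real n) \<le> fact n"
    and "fact n \<le> sqrt (2 * pi * real n) * real n ^ n * exp (- real n) * exp (1 / (4 * real n))"
proof -
  have e: "fact n = exp (stirl n) * (sqrt (real n) * real n ^ n * exp (- real n))"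
  proof -
    have "fact n = exp (ln (fact n :: real))" by simp
    also have "ln (fact n :: real) = stirl n + (ln (real n) / 2 + real n * ln (real n) - real n)"
      by (simp add: stirl_def algebra_simps)
    also have "exp ... = exp (stirl n) * (exp (ln (sqrt (real n))) * exp (real n * ln (real n)) * exp (- real n))"
    proof -
      have "ln (real n) / 2 = ln (sqrt (real n))" using assms by (simp add: ln_sqrt)
      then show ?thesis by (simp only: exp_add diff_conv_add_uminus mult.assoc)
    qed
    also have "exp (real n * ln (real n)) = real n ^ n" using assms by (simp add: exp_of_nat_mult)
    finally show ?thesis using assms by simp
  qed
  have 1: "ln (sqrt (2 * pi)) \<le> stirl n"
    by (rule LIMSEQ_le_const2[OF stirl_limit]) (use assms stirl_antimono in blast)
  have 2: "stirl n - 1 / (4 * real n) \<le> ln (sqrt (2 * pi))"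
  proof (rule LIMSEQ_le_const)
    have "(\<lambda>m. stirl m - (1/4) * inverse (real m)) \<longlonglongrightarrow> ln (sqrt (2 * pi)) - (1/4) * 0"
      by (intro tendsto_intros stirl_limit lim_inverse_n)
    then show "(\<lambda>m. stirl m - 1 / (4 * real m)) \<longlonglongrightarrow> ln (sqrt (2 * pi))" by (simp add: field_simps)
    show "\<exists>N. \<forall>m\<ge>N. stirl n - 1 / (4 * real n) \<le> stirl m - 1 / (4 * real m)"
      using stirl_mono assms by blast
  qed
  have s: "sqrt (2 * pi * real n) = exp (ln (sqrt (2 * pi))) * sqrt (real n)" by (simp add: real_sqrt_mult)
  show "sqrt (2 * pi * real n) * real n ^ n * exp (- real n) \<le> fact n"
    unfolding e s using 1 by (simp add: mult_right_mono mult.assoc del: exp_ln)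
  have "exp (stirl n) \<le> exp (ln (sqrt (2 * pi)) + 1 / (4 * real n))" using 2 by simp
  note mult_left_mono[OF this, of "sqrt (real n) * real n ^ n * exp (- real n)"]
  then show "fact n \<le> sqrt (2 * pi * real n) * real n ^ n * exp (- real n) * exp (1 / (4 * real n))"
    unfolding e s
    by (simp add: exp_add mult_ac del: exp_ln)
qed

text \<open>The value \<open>(2p)\<^sup>2\<^sup>p e\<^sup>-\<^sup>2\<^sup>p / (2 \<pi> (2p-2)!)\<close> is the peak of the first Fourier mode.\<close>

lemma peak_bounds:
  assumes "p \<ge> 1"
  shows "real (2*p) ^ (2*p) * exp (- real (2*p)) * (2 * real p * (2 * real p - 1)) / (2 * pi * fact (2*p)) \<le> (real p / pi) powr (3/2)"
    and "real (2*p) ^ (2*p) * exp (- real (2*p)) * (2 * real p * (2 * real p - 1)) / (2 * pi * fact (2*p)) \<ge> (real p / pi) powr (3/2) - real p"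
proof -
  define q where "q = (real p / pi) powr (3/2)"
  define W where "W = real (2*p) ^ (2*p) * exp (- real (2*p))"
  \<comment> \<open>The ratio of the Stirling approximation of (2p)! to (2p)! itself; it lies
    between exp (- 1 / (8p)) and 1.\<close>
  define R where "R = W / fact (2 * p) * sqrt (2 * pi * real (2 * p))"
  have W: "W > 0" using assms by (simp add: W_def)
  have sq: "sqrt (2 * pi * real (2 * p)) = 2 * sqrt (pi * real p)" by (simp add: real_sqrt_mult)
  have R1: "R \<le> 1" using stirling_bounds(1)[of "2*p"] assms
    by (simp add: R_def W_def field_simps)
  have R2: "R \<ge> exp (- 1 / (8 * real p))" using stirling_bounds(2)[of "2*p"] assms
    by (simp add: R_def W_def field_simps exp_minus)
  have q: "q = real p / pi * sqrt (real p / pi)"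
  proof -
    have "q = (real p / pi) powr (1 + 1/2)" by (simp add: q_def)
    also have "... = real p / pi * sqrt (real p / pi)"
      using assms by (subst powr_add) (simp add: powr_half_sqrt)
    finally show ?thesis .
  qed
  have main: "W * (2 * real p * (2 * real p - 1)) / (2 * pi * fact (2*p)) = R * (1 - 1 / (2 * real p)) * q"
  proof -
    have "sqrt (pi * real p) * sqrt (real p / pi) = real p"
      using assms by (simp add: real_sqrt_mult[symmetric])
    then have "R * (1 - 1 / (2 * real p)) * q = W / fact (2 * p) * 2 * real p * (1 - 1 / (2 * real p)) * (real p / pi)"
    proof -
      have "R * (1 - 1 / (2 * real p)) * q = W / fact (2 * p) * 2 * (sqrt (pi * real p) * sqrt (real p / pi)) * (1 - 1 / (2 * real p)) * (real p / pi)"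
        unfolding R_def q sq by (simp only: mult_ac)
      then show ?thesis using \<open>_ = real p\<close> by simp
    qed
    also have "... = W / fact (2 * p) * ((2 * real p - 1) * real p / pi)"
      using assms by (simp add: field_simps)
    also have "... = W * (2 * real p * (2 * real p - 1)) / (2 * pi * fact (2*p))" by (simp add: field_simps)
    finally show ?thesis by simp
  qed
  have q0: "q \<ge> 0" by (simp add: q_def)
  have "R \<ge> 0" using R2 by (smt (verit) exp_gt_zero)
  then have "R * (1 - 1 / (2 * real p)) \<le> 1" using R1 assms by (intro mult_le_one) auto
  then have "R * (1 - 1 / (2 * real p)) * q \<le> q" using mult_right_mono[OF _ q0, of _ 1] by simp
  then show "real (2*p) ^ (2*p) * exp (- real (2*p)) * (2 * real p * (2 * real p - 1)) / (2 * pi * fact (2*p)) \<le> (real p / pi) powr (3/2)"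
    using main by (simp add: W_def q_def)
  have "1 + (- 1 / (8 * real p)) \<le> exp (- 1 / (8 * real p))" by (rule exp_ge_add_one_self)
  then have R3: "1 - 1 / (8 * real p) \<le> R" using R2 by simp
  have "(1 - 1 / (8 * real p)) * (1 - 1 / (2 * real p)) \<le> R * (1 - 1 / (2 * real p))"
    using R3 assms by (intro mult_right_mono) auto
  moreover have "(1 - 1 / (8 * real p)) * (1 - 1 / (2 * real p)) \<ge> 1 - 1 / real p"
    using assms by (simp add: field_simps)
  ultimately have "(1 - 1 / real p) * q \<le> R * (1 - 1 / (2 * real p)) * q" using q0 by (intro mult_right_mono) auto
  \<comment> \<open>This crude bound turns the relative error 1/p into an absolute error of at most
    p.\<close>
  moreover have "q \<le> real p * real p"
  proof -
    have "real p / pi \<le> real p" using assms pi_gt3 by (simp add: field_simps)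
    moreover have "sqrt (real p / pi) \<le> sqrt (real p * real p)"
    proof (intro real_sqrt_le_mono)
      have "1 * real p \<le> real p * real p" using assms by (intro mult_right_mono) auto
      with \<open>real p / pi \<le> real p\<close> show "real p / pi \<le> real p * real p" by linarith
    qed
    ultimately show ?thesis unfolding q by (intro mult_mono) auto
  qed
  then have "q / real p \<le> real p" using assms by (simp add: field_simps)
  then have "(1 - 1 / real p) * q \<ge> q - real p" by (simp add: algebra_simps)
  ultimately show "real (2*p) ^ (2*p) * exp (- real (2*p)) * (2 * real p * (2 * real p - 1)) / (2 * pi * fact (2*p)) \<ge> (real p / pi) powr (3/2) - real p"
    using main by (simp add: W_def q_def)
qed

section \<open>A sum over the integers\<close>

text \<open>Induction through the operator x d/dx, which raises the exponent of m by one and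
  preserves the disc of convergence.\<close>

lemma summable_power_times_geometric:
  fixes x :: complex
  assumes "norm x < 1"
  shows "summable (\<lambda>m. of_nat m ^ k * x ^ m)"
  using assms
proof (induction k arbitrary: x)
  case (Suc k)
  have "summable (\<lambda>n. diffs (\<lambda>m. of_nat m ^ k) n * x ^ n)"
    by (rule termdiff_converges[where K = 1]) (use Suc in auto)
  then have "summable (\<lambda>n. x * (diffs (\<lambda>m. of_nat m ^ k) n * x ^ n))" by (rule summable_mult)
  also have "(\<lambda>n. x * (diffs (\<lambda>m. of_nat m ^ k) n * x ^ n)) = (\<lambda>n. of_nat (Suc n) ^ Suc k * x ^ Suc n)"
    by (simp add: diffs_def mult_ac)
  finally show ?case by (subst summable_Suc_iff[symmetric])
qed (simp add: summable_geometric)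

text \<open>The polylogarithm of order -k, except that for k = 0 the term m = 0 counts as 0^0 = 1,
  so that \<open>polq 0 x\<close> is 1 / (1 - x).\<close>

definition polq :: "nat \<Rightarrow> complex \<Rightarrow> complex" where
  "polq k x = (\<Sum>m. of_nat m ^ k * x ^ m)"

lemma polq_deriv:
  assumes "norm x < 1"
  shows "\<exists>d. (polq k has_field_derivative d) (at x) \<and> x * d = polq (Suc k) x"
proof -
  obtain r where r: "norm x < r" "r < 1" using assms dense by blast
  have "norm (complex_of_real r) = r" using r norm_ge_zero[of x] by (simp del: norm_ge_zero)
  then have "((\<lambda>x. \<Sum>n. of_nat n ^ k * x ^ n) has_field_derivative (\<Sum>n. diffs (\<lambda>m. of_nat m ^ k) n * x ^ n)) (at x)"
    using r by (intro termdiffs_strong[where K = "complex_of_real r"] summable_power_times_geometric) auto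
  moreover have "x * (\<Sum>n. diffs (\<lambda>m. of_nat m ^ k) n * x ^ n) = polq (Suc k) x"
  proof -
    have "summable (\<lambda>n. diffs (\<lambda>m. of_nat m ^ k) n * x ^ n)"
      by (rule termdiff_converges[where K = 1]) (use assms summable_power_times_geometric in auto)
    then have "x * (\<Sum>n. diffs (\<lambda>m. of_nat m ^ k) n * x ^ n) = (\<Sum>n. x * (diffs (\<lambda>m. of_nat m ^ k) n * x ^ n))"
      by (rule suminf_mult[symmetric])
    also have "... = (\<Sum>n. of_nat (Suc n) ^ Suc k * x ^ Suc n)"
      by (simp add: diffs_def mult_ac)
    also have "... = (\<Sum>n. of_nat n ^ Suc k * x ^ n)"
      using suminf_split_head[OF summable_power_times_geometric[OF assms, of "Suc k"]] by simp
    finally show ?thesis by (simp add: polq_def)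
  qed
  ultimately show ?thesis unfolding polq_def[abs_def] by blast
qed

text \<open>The k-th derivative of -pi cot (pi z). For k > 0 the two polygamma values are, up to a
  common factor, the two halves of the sum of (z + n)^(-k-1) over all integers n.\<close>

definition bipoly :: "nat \<Rightarrow> complex \<Rightarrow> complex" where
  "bipoly k z = Polygamma k z + (-1) ^ (k + 1) * Polygamma k (1 - z)"

lemma not_nonpos_Int: "Im z \<noteq> 0 ==> z \<notin> \<int>\<^sub>\<le>\<^sub>0"
  by (auto elim!: nonpos_Ints_cases)

lemma bipoly_deriv:
  assumes "Im z > 0"
  shows "(bipoly k has_field_derivative bipoly (Suc k) z) (at z)"
proof -
  have "z \<notin> \<int>\<^sub>\<le>\<^sub>0" "1 - z \<notin> \<int>\<^sub>\<le>\<^sub>0" using assms by (auto intro!: not_nonpos_Int)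
  then show ?thesis unfolding bipoly_def[abs_def]
    by (auto intro!: derivative_eq_intros)
qed

text \<open>The logarithmic derivative of the reflection formula for Gamma gives -pi cot (pi z),
  rewritten in q = exp (2 pi i z). The final -2 removes the term m = 0 that \<open>polq 0\<close>
  contains.\<close>

lemma bipoly_0:
  assumes "Im z > 0"
  shows "bipoly 0 z = of_real pi * \<i> * (1 + 2 * polq 0 (exp (2 * of_real pi * \<i> * z)) - 2)"
proof -
  let ?G = "\<lambda>z::complex. Gamma z * Gamma (1 - z)"
  have z: "z \<notin> \<int>\<^sub>\<le>\<^sub>0" "1 - z \<notin> \<int>\<^sub>\<le>\<^sub>0" using assms by (auto intro!: not_nonpos_Int)
  have d1: "(?G has_field_derivative (?G z * (Digamma z - Digamma (1 - z)))) (at z)"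
    using z by (auto intro!: derivative_eq_intros simp: algebra_simps)
  have s0: "sin (of_real pi * z) \<noteq> 0"
  proof
    assume "sin (of_real pi * z) = 0"
    then obtain n :: int where "of_real pi * z = of_int n * of_real pi" unfolding sin_eq_0 by auto
    then have "Im (of_real pi * z) = 0" by simp
    then show False using assms by simp
  qed
  have d2: "((\<lambda>z. of_real pi / sin (of_real pi * z)) has_field_derivative
     (- ((of_real pi) ^ 2) * cos (of_real pi * z) / sin (of_real pi * z) ^ 2)) (at z)"
    using s0 by (auto intro!: derivative_eq_intros simp: power2_eq_square)
  have "?G z * (Digamma z - Digamma (1 - z)) = - ((of_real pi) ^ 2) * cos (of_real pi * z) / sin (of_real pi * z) ^ 2"
    using DERIV_unique[OF d1] d2 by (simp add: Gamma_reflection_complex)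
  then have "of_real pi / sin (of_real pi * z) * (Digamma z - Digamma (1 - z)) =
      of_real pi / sin (of_real pi * z) * (- of_real pi * cos (of_real pi * z) / sin (of_real pi * z))"
    by (simp add: Gamma_reflection_complex power2_eq_square)
  moreover have "of_real pi / sin (of_real pi * z) \<noteq> 0" using s0 by simp
  ultimately have "Digamma z - Digamma (1 - z) = - of_real pi * cos (of_real pi * z) / sin (of_real pi * z)"
    by (metis mult_left_cancel)
  then have "bipoly 0 z = - of_real pi * cos (of_real pi * z) / sin (of_real pi * z)"
    by (simp add: bipoly_def)
  moreover
  define e where "e = exp (\<i> * (of_real pi * z))"
  have e0: "e \<noteq> 0" by (simp add: e_def)
  have q: "exp (2 * of_real pi * \<i> * z) = e * e" by (simp add: e_def exp_add[symmetric] algebra_simps)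
  have nq: "norm (e * e) < 1"
    using assms by (simp flip: q)
  have eq: "e * e \<noteq> 1" using nq by auto
  have c: "cos (of_real pi * z) = (e + inverse e) / 2" "sin (of_real pi * z) = (e - inverse e) / (2 * \<i>)"
    by (simp_all add: cos_exp_eq sin_exp_eq e_def exp_minus)
  have "polq 0 (e * e) = 1 / (1 - e * e)" using nq by (simp add: polq_def suminf_geometric)
  moreover have "- of_real pi * cos (of_real pi * z) / sin (of_real pi * z) = of_real pi * \<i> * (1 + 2 * (1 / (1 - e * e)) - 2)"
    unfolding c using e0 eq by (simp add: divide_simps) (simp add: algebra_simps)
  ultimately show ?thesis by (simp add: q)
qed

text \<open>On functions of q, differentiation by z is 2 pi i q d/dq, which takes
  \<open>polq k\<close> to \<open>polq (Suc k)\<close>. The constant in \<open>bipoly_0\<close>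
  disappears at the first derivative, which is why the formula starts at order one.\<close>

lemma bipoly_q:
  assumes "Im z > 0"
  shows "bipoly (Suc k) z = 2 * of_real pi * \<i> * (2 * of_real pi * \<i>) ^ Suc k * polq (Suc k) (exp (2 * of_real pi * \<i> * z))"
  using assms
proof (induction k arbitrary: z)
  case (0 z)
  have nq: "norm (exp (2 * of_real pi * \<i> * z)) < 1" using 0 by simp
  obtain d where d: "(polq 0 has_field_derivative d) (at (exp (2 * of_real pi * \<i> * z)))"
     "exp (2 * of_real pi * \<i> * z) * d = polq 1 (exp (2 * of_real pi * \<i> * z))" using polq_deriv[OF nq, of 0] by auto
  have e: "((\<lambda>z. exp (2 * of_real pi * \<i> * z)) has_field_derivative (exp (2 * of_real pi * \<i> * z) * (2 * of_real pi * \<i>))) (at z)"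
    by (auto intro!: derivative_eq_intros)
  have "((\<lambda>z. of_real pi * \<i> * (1 + 2 * polq 0 (exp (2 * of_real pi * \<i> * z)) - 2)) has_field_derivative
     of_real pi * \<i> * (2 * (d * (exp (2 * of_real pi * \<i> * z) * (2 * of_real pi * \<i>))))) (at z)"
    using DERIV_chain2[OF d(1) e] by (auto intro!: derivative_eq_intros)
  then have "(bipoly 0 has_field_derivative of_real pi * \<i> * (2 * (d * (exp (2 * of_real pi * \<i> * z) * (2 * of_real pi * \<i>))))) (at z)"
    by (rule has_field_derivative_transform_within_open[of _ _ _ "{z. Im z > 0}"])
       (use 0 bipoly_0 open_halfspace_Im_gt in auto)
  from DERIV_unique[OF this bipoly_deriv[OF 0]]
  have "bipoly 1 z = of_real pi * \<i> * (2 * (d * (exp (2 * of_real pi * \<i> * z) * (2 * of_real pi * \<i>))))" by simp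
  also have "... = 2 * of_real pi * \<i> * (2 * of_real pi * \<i>) * (exp (2 * of_real pi * \<i> * z) * d)" by (simp only: mult_ac)
  finally show ?case using d(2) by simp
next
  case (Suc k z)
  let ?c = "2 * of_real pi * \<i> :: complex"
  have nq: "norm (exp (?c * z)) < 1" using Suc by simp
  obtain d where d: "(polq (Suc k) has_field_derivative d) (at (exp (?c * z)))"
     "exp (?c * z) * d = polq (Suc (Suc k)) (exp (?c * z))" using polq_deriv[OF nq, of "Suc k"] by auto
  have e: "((\<lambda>z. exp (?c * z)) has_field_derivative (exp (?c * z) * ?c)) (at z)"
    by (auto intro!: derivative_eq_intros)
  have "((\<lambda>z. ?c * ?c ^ Suc k * polq (Suc k) (exp (?c * z))) has_field_derivative
     ?c * ?c ^ Suc k * (d * (exp (?c * z) * ?c))) (at z)"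
    using DERIV_chain2[OF d(1) e] by (auto intro!: derivative_eq_intros)
  then have "(bipoly (Suc k) has_field_derivative ?c * ?c ^ Suc k * (d * (exp (?c * z) * ?c))) (at z)"
    by (rule has_field_derivative_transform_within_open[of _ _ _ "{z. Im z > 0}"])
       (use Suc open_halfspace_Im_gt in auto)
  from DERIV_unique[OF this bipoly_deriv[OF Suc.prems]]
  have "bipoly (Suc (Suc k)) z = ?c * ?c ^ Suc k * (d * (exp (?c * z) * ?c))" by simp
  also have "... = ?c * (?c * ?c ^ Suc k) * (exp (?c * z) * d)" by (simp only: mult_ac)
  finally show ?case using d(2) by simp
qed

text \<open>The Fourier side of Lipschitz' formula for the sum of (1 - i n / u)^(-2p) over the
  integers; a point at height y of a cusp corresponds to u = 2y.\<close>

definition Qsum :: "nat \<Rightarrow> real \<Rightarrow> real" where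
  "Qsum p u = (2 * pi * u) ^ (2 * p) / fact (2 * p - 1) * (\<Sum>m. real m ^ (2 * p - 1) * exp (- (2 * pi * u) * real m))"

lemma summable_power_exp:
  assumes "a > 0"
  shows "summable (\<lambda>m. real m ^ k * exp (- a * real m))"
proof -
  have "summable (\<lambda>m. complex_of_real (real m ^ k * exp (- a * real m)))"
    using summable_power_times_geometric[of "of_real (exp (- a))" k] assms
    by (simp add: exp_of_nat_mult[symmetric] mult.commute flip: exp_of_real)
  then show ?thesis by (simp only: summable_of_real_iff)
qed

text \<open>Since 1 - i n / u = (z + n) / (i u) for z = i u, the sum is (i u)^(2p) times the
  two-sided series evaluated by \<open>bipoly_q\<close>. The even exponent removes the sign of (i u)
  (2 pi i) = - 2 pi u.\<close>

lemma sum_int_shear: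
  assumes u: "u > 0" and p: "p \<ge> 1"
  shows "((\<lambda>n::int. (1 / (1 - \<i> * of_real (of_int n / u))) ^ (2 * p)) has_sum of_real (Qsum p u)) UNIV"
proof -
  define z where "z = \<i> * complex_of_real u"
  have z: "Im z > 0" using u by (simp add: z_def)
  obtain k where k: "2 * p - 1 = Suc k" "2 * p = Suc (Suc k)" using p by (cases p) auto
  have np: "z \<notin> \<int>\<^sub>\<le>\<^sub>0" "1 - z \<notin> \<int>\<^sub>\<le>\<^sub>0" using z by (auto intro!: not_nonpos_Int)
  define f where "f = (\<lambda>n::int. inverse ((z + of_int n) ^ (2 * p)))"
  have s1: "(\<lambda>n. f (int n)) sums (Polygamma (Suc k) z / fact (Suc k))"
    using Polygamma_LIMSEQ[of z "Suc k"] np u by (auto simp: f_def k(2) z_def simp flip: k(2))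
  have s2: "(\<lambda>n. f (- int n - 1)) sums (Polygamma (Suc k) (1 - z) / fact (Suc k))"
  proof -
    have "inverse ((1 - z + of_nat n) ^ Suc (Suc k)) = f (- int n - 1)" for n
    proof -
      have "z + of_int (- int n - 1) = - (1 - z + of_nat n)" by simp
      then show ?thesis unfolding f_def k(2)[symmetric] by (simp only: power_minus_even even_mult_iff even_numeral simp_thms)
    qed
    moreover have "(-1 :: complex) ^ Suc (Suc k) = 1" using k(2) by (metis power_minus1_even)
    moreover have "1 - z \<noteq> 0" using np(2) by auto
    ultimately show ?thesis using Polygamma_LIMSEQ[of "1 - z" "Suc k"] by (simp only: nat.simps simp_thms mult_1)
  qed
  \<comment> \<open>Supplies absolute convergence, which is what permits passing from ordered sums
    to unordered ones and gluing the two halves of the integers.\<close>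
  have nb: "norm (f n) \<le> inverse (real_of_int (abs n) ^ 2)" if "abs n \<ge> 1" for n
  proof -
    have "real_of_int (abs n) \<le> norm (z + of_int n)"
      using abs_Re_le_cmod[of "z + of_int n"] by (simp add: z_def)
    then have "real_of_int (abs n) ^ (2 * p) \<le> norm (z + of_int n) ^ (2 * p)" by (intro power_mono) auto
    moreover have "real_of_int (abs n) ^ 2 \<le> real_of_int (abs n) ^ (2 * p)"
      using that p by (intro power_increasing) auto
    ultimately show ?thesis using that by (simp add: f_def norm_inverse norm_power)
       (smt (verit, best) abs_norm_cancel le_imp_inverse_le of_int_abs power2_abs zero_less_power2 of_int_eq_0_iff)
  qed
  have sm: "summable (\<lambda>n. inverse (real (n + 1) ^ 2))"
    using summable_ignore_initial_segment[OF inverse_power_summable[of 2, where ?'a = real], of 1] by simp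
  have n1: "summable (\<lambda>n. norm (f (int n)))"
  proof -
    have "summable (\<lambda>n. norm (f (int (n + 1))))"
      by (rule summable_comparison_test'[OF sm, of 0]) (use nb[of "int (_ + 1)"] in \<open>simp add: add_ac\<close>)
    then show ?thesis using summable_iff_shift[of "\<lambda>n. norm (f (int n))" 1] by simp
  qed
  have n2: "summable (\<lambda>n. norm (f (- int n - 1)))"
  proof (rule summable_comparison_test'[OF sm, of 0])
    fix n :: nat
    have "\<bar>- int n - 1\<bar> = int (n + 1)" by simp
    then show "norm (norm (f (- int n - 1))) \<le> inverse (real (n + 1) ^ 2)" using nb[of "- int n - 1"] by simp
  qed
  have h1: "((\<lambda>n. f (int n)) has_sum (Polygamma (Suc k) z / fact (Suc k))) UNIV"
    by (rule norm_summable_imp_has_sum[OF n1 s1])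
  have h2: "((\<lambda>n. f (- int n - 1)) has_sum (Polygamma (Suc k) (1 - z) / fact (Suc k))) UNIV"
    by (rule norm_summable_imp_has_sum[OF n2 s2])
  have "(f has_sum (Polygamma (Suc k) z / fact (Suc k))) (range int)"
    using h1 by (subst has_sum_reindex) (auto simp: o_def)
  moreover have "(f has_sum (Polygamma (Suc k) (1 - z) / fact (Suc k))) (range (\<lambda>n. - int n - 1))"
    using h2 by (subst has_sum_reindex) (auto simp: o_def inj_on_def)
  moreover have "range int \<inter> range (\<lambda>n. - int n - 1) = {}" by auto
  moreover have "range int \<union> range (\<lambda>n. - int n - 1) = UNIV"
  proof (rule UNIV_eq_I[symmetric])
    fix n :: int
    show "n \<in> range int \<union> range (\<lambda>n. - int n - 1)"
    proof (cases "n \<ge> 0")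
      case True then show ?thesis by (auto intro!: image_eqI[of _ _ "nat n"])
    next
      case False then have "n = - int (nat (- n - 1)) - 1" by simp
      then show ?thesis by blast
    qed
  qed
  ultimately have "(f has_sum (Polygamma (Suc k) z / fact (Suc k) + Polygamma (Suc k) (1 - z) / fact (Suc k))) UNIV"
    using has_sum_Un_disjoint by metis
  moreover have ev: "even (Suc k + 1)" using k by (metis Suc_eq_plus1 dvd_triv_left)
  then have "Polygamma (Suc k) z / fact (Suc k) + Polygamma (Suc k) (1 - z) / fact (Suc k) = bipoly (Suc k) z / fact (Suc k)"
    unfolding bipoly_def by (simp add: add_divide_distrib)
  moreover have "bipoly (Suc k) z = (2 * of_real pi * \<i>) ^ (2 * p) * polq (Suc k) (exp (2 * of_real pi * \<i> * z))"
    using bipoly_q[OF z] k by simp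
  moreover have "polq (Suc k) (exp (2 * of_real pi * \<i> * z)) = of_real (\<Sum>m. real m ^ (2 * p - 1) * exp (- (2 * pi * u) * real m))"
  proof -
    have "exp (2 * of_real pi * \<i> * z) = of_real (exp (- (2 * pi * u)))"
      by (simp add: z_def exp_of_real[symmetric] mult_ac)
    then have "polq (Suc k) (exp (2 * of_real pi * \<i> * z)) = (\<Sum>m. of_real (real m ^ (2 * p - 1) * exp (- (2 * pi * u) * real m)))"
      unfolding polq_def
    proof (simp only:, intro suminf_cong)
      fix m
      have "exp (- (2 * pi * u)) ^ m = exp (- (2 * pi * u) * real m)"
        by (simp only: exp_of_nat_mult[symmetric] mult.commute)
      then show "of_nat m ^ Suc k * complex_of_real (exp (- (2 * pi * u))) ^ m =
          of_real (real m ^ (2 * p - 1) * exp (- (2 * pi * u) * real m))"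
        by (simp only: k(1) of_real_mult of_real_power[symmetric]) (simp only: of_real_power of_real_of_nat_eq)
    qed
    also have "... = of_real (\<Sum>m. real m ^ (2 * p - 1) * exp (- (2 * pi * u) * real m))"
      using summable_power_exp[of "2 * pi * u" "2 * p - 1"] u by (intro suminf_of_real[symmetric]) auto
    finally show ?thesis .
  qed
  ultimately have F: "(f has_sum ((2 * of_real pi * \<i>) ^ (2 * p) * of_real (\<Sum>m. real m ^ (2 * p - 1) * exp (- (2 * pi * u) * real m)) / fact (Suc k))) UNIV"
    by simp
  have "((\<lambda>n. (\<i> * of_real u) ^ (2 * p) * f n) has_sum ((\<i> * of_real u) ^ (2 * p) * ((2 * of_real pi * \<i>) ^ (2 * p) * of_real (\<Sum>m. real m ^ (2 * p - 1) * exp (- (2 * pi * u) * real m)) / fact (Suc k)))) UNIV"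
    by (rule has_sum_cmult_right[OF F])
  moreover have "(\<i> * of_real u) ^ (2 * p) * f n = (1 / (1 - \<i> * of_real (of_int n / u))) ^ (2 * p)" for n
  proof -
    have nz: "z + of_int n \<noteq> 0" using z by (auto simp: complex_eq_iff)
    have "1 - \<i> * of_real (of_int n / u) = (z + of_int n) / (\<i> * of_real u)"
      using u by (simp add: z_def field_simps)
    then have e: "1 / (1 - \<i> * of_real (of_int n / u)) = (\<i> * complex_of_real u) / (z + of_int n)" by simp
    show ?thesis unfolding e power_divide f_def by (simp only: divide_inverse)
  qed
  moreover have "(\<i> * of_real u) ^ (2 * p) * ((2 * of_real pi * \<i>) ^ (2 * p) * of_real (\<Sum>m. real m ^ (2 * p - 1) * exp (- (2 * pi * u) * real m)) / fact (Suc k)) = complex_of_real (Qsum p u)"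
  proof -
    have "(\<i> * complex_of_real u) ^ (2 * p) * (2 * of_real pi * \<i>) ^ (2 * p) = of_real ((2 * pi * u) ^ (2 * p))"
    proof -
      have "(\<i> * complex_of_real u) * (2 * of_real pi * \<i>) = - of_real (2 * pi * u)" by (simp add: field_simps)
      then have "(\<i> * complex_of_real u) ^ (2 * p) * (2 * of_real pi * \<i>) ^ (2 * p) = (- of_real (2 * pi * u)) ^ (2 * p)"
        by (simp only: power_mult_distrib[symmetric])
      then show ?thesis by simp
    qed
    moreover have "a * (b * x / c) = (a * b) / c * x" for a b x c :: complex by simp
    ultimately show ?thesis unfolding Qsum_def k(1) by (simp only: of_real_mult of_real_divide of_real_fact)
  qed
  ultimately show ?thesis by simp
qed

section \<open>Bounds for the Fourier side\<close>

primrec pexp_int :: "real \<Rightarrow> nat \<Rightarrow> real \<Rightarrow> real" where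
  "pexp_int a 0 x = - exp (- a * x) / a"
| "pexp_int a (Suc k) x = - (x ^ Suc k) * exp (- a * x) / a + real (Suc k) / a * pexp_int a k x"

lemma pexp_int_deriv:
  assumes "a > 0"
  shows "(pexp_int a k has_real_derivative x ^ k * exp (- a * x)) (at x)"
proof (induction k)
  case 0
  show ?case using assms by (auto intro!: derivative_eq_intros simp: pexp_int.simps[abs_def])
next
  case (Suc k)
  have h1: "((\<lambda>x. - (x ^ Suc k) * exp (- a * x) / a) has_real_derivative
     (- (real (Suc k) * x ^ k) * exp (- a * x) + - (x ^ Suc k) * (exp (- a * x) * (- a))) / a) (at x)"
  proof (rule DERIV_cdivide)
    have "x ^ k + real k * x ^ (k - Suc 0) * x = (1 + real k) * x ^ k" by (cases k) (auto simp: algebra_simps)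
    then show "((\<lambda>x. - (x ^ Suc k) * exp (- a * x)) has_real_derivative
     (- (real (Suc k) * x ^ k) * exp (- a * x) + - (x ^ Suc k) * (exp (- a * x) * (- a)))) (at x)"
      by (auto intro!: derivative_eq_intros)
  qed
  have h2: "((\<lambda>x. real (Suc k) / a * pexp_int a k x) has_real_derivative real (Suc k) / a * (x ^ k * exp (- a * x))) (at x)"
    by (rule DERIV_cmult[OF Suc])
  have "(- (real (Suc k) * x ^ k) * exp (- a * x) + - (x ^ Suc k) * (exp (- a * x) * (- a))) / a + real (Suc k) / a * (x ^ k * exp (- a * x))
    = x ^ Suc k * exp (- a * x)" using assms by (simp add: field_simps)
  then show ?case using DERIV_add[OF h1 h2] by (simp only: pexp_int.simps(2)[abs_def])
qed

text \<open>The antiderivative is normalised to vanish at infinity, so its value at 0 is minus the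
  Gamma integral of x^k exp (- a x).\<close>

lemma pexp_int_0: "a > 0 ==> pexp_int a k 0 = - fact k / a ^ Suc k"
proof (induction k)
  case (Suc k)
  then have "pexp_int a (Suc k) 0 = real (Suc k) / a * (- fact k / a ^ Suc k)" by simp
  also have "... = - (real (Suc k) * fact k) / a ^ Suc (Suc k)" by simp
  finally show ?case by simp
qed simp

lemma pexp_int_nonpos: "a > 0 ==> x \<ge> 0 ==> pexp_int a k x \<le> 0"
proof (induction k)
  case (Suc k)
  have "real (Suc k) / a * pexp_int a k x \<le> 0" using Suc by (intro mult_nonneg_nonpos) auto
  moreover have "x ^ Suc k * exp (- a * x) / a \<ge> 0" using Suc by simp
  ultimately show ?case by simp
qed simp

lemma power_exp_mono:
  fixes a x y :: real
  assumes "a > 0" "k > 0"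
  shows "0 \<le> x ==> x \<le> y ==> y \<le> real k / a ==> x ^ k * exp (- a * x) \<le> y ^ k * exp (- a * y)"
    and "real k / a \<le> x ==> x \<le> y ==> y ^ k * exp (- a * y) \<le> x ^ k * exp (- a * x)"
proof -
  have d: "((\<lambda>x. x ^ k * exp (- a * x)) has_real_derivative (x ^ (k - 1) * exp (- a * x) * (real k - a * x))) (at x)" for x
  proof -
    have "((\<lambda>x. x ^ k * exp (- a * x)) has_real_derivative (real k * x ^ (k - 1) * exp (- a * x) + x ^ k * (exp (- a * x) * (- a)))) (at x)"
      by (auto intro!: derivative_eq_intros)
    moreover have "x ^ k = x ^ (k - 1) * x" using assms by (metis One_nat_def Suc_pred power_Suc2)
    ultimately show ?thesis by (simp add: algebra_simps)
  qed
  show "x ^ k * exp (- a * x) \<le> y ^ k * exp (- a * y)" if "0 \<le> x" "x \<le> y" "y \<le> real k / a"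
  proof (rule DERIV_nonneg_imp_nondecreasing[OF that(2)])
    fix t assume t: "x \<le> t" "t \<le> y"
    have "a * t \<le> real k" using t that assms by (smt (verit) mult.commute pos_le_divide_eq)
    then have "t ^ (k - 1) * exp (- a * t) * (real k - a * t) \<ge> 0" using t that by simp
    then show "\<exists>D. ((\<lambda>x. x ^ k * exp (- a * x)) has_real_derivative D) (at t) \<and> 0 \<le> D" using d by blast
  qed
  show "y ^ k * exp (- a * y) \<le> x ^ k * exp (- a * x)" if "real k / a \<le> x" "x \<le> y"
  proof (rule DERIV_nonpos_imp_nonincreasing[OF that(2)])
    fix t assume t: "x \<le> t" "t \<le> y"
    have "real k \<le> a * t" using t that assms by (smt (verit) mult.commute pos_divide_le_eq)
    moreover have "t \<ge> 0" using t that assms by (smt (verit) divide_nonneg_pos of_nat_0_le_iff)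
    ultimately have "t ^ (k - 1) * exp (- a * t) * (real k - a * t) \<le> 0" by (simp add: mult_nonneg_nonpos)
    then show "\<exists>D. ((\<lambda>x. x ^ k * exp (- a * x)) has_real_derivative D) (at t) \<and> D \<le> 0" using d by blast
  qed
qed

text \<open>For a unimodal function a sum over integers exceeds the integral by at most the maximum; the
  increments of the minimum with the peak absorb the increasing part.\<close>

lemma sum_power_exp_le:
  fixes a M :: real
  assumes a: "a > 0" and k: "k > 0" and M: "\<And>x. x \<ge> 1 ==> x ^ k * exp (- a * x) \<le> M"
  shows "(\<Sum>m. real m ^ k * exp (- a * real m)) \<le> M + fact k / a ^ Suc k"
proof -
  define g where "g = (\<lambda>x. x ^ k * exp (- a * x))"
  define v where "v = real k / a"
  define G where "G = pexp_int a k"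
  have v0: "v > 0" using a k by (simp add: v_def)
  have inc: "g x \<le> g y" if "0 \<le> x" "x \<le> y" "y \<le> v" for x y
    using power_exp_mono(1)[OF a k that(1,2)] that by (simp add: g_def v_def)
  have dec: "g y \<le> g x" if "v \<le> x" "x \<le> y" for x y
    using power_exp_mono(2)[OF a k _ that(2)] that by (simp add: g_def v_def)
  have g0: "g x \<ge> 0" if "x \<ge> 0" for x using that by (simp add: g_def)
  have step: "g (real (Suc m)) \<le> G (real (Suc m)) - G (real m) + g (min (real (Suc m)) v) - g (min (real m) v)" for m
  proof -
    have "\<exists>\<xi>. real m < \<xi> \<and> \<xi> < real (Suc m) \<and> G (real (Suc m)) - G (real m) = (real (Suc m) - real m) * g \<xi>"
      unfolding G_def g_def by (rule MVT2) (use pexp_int_deriv a in auto)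
    then obtain \<xi> where x: "real m < \<xi>" "\<xi> < real (Suc m)" "G (real (Suc m)) - G (real m) = g \<xi>" by auto
    have x0: "\<xi> \<ge> 0" using x by linarith
    consider "real (Suc m) \<le> v" | "v \<le> real m" | "real m < v" "v < real (Suc m)" by linarith
    then show ?thesis
    proof cases
      case 1
      then have "g (real m) \<le> g \<xi>" using x by (intro inc) auto
      then show ?thesis using 1 x by simp
    next
      case 2
      then have "g (real (Suc m)) \<le> g \<xi>" using x by (intro dec) auto
      then show ?thesis using 2 x by simp
    next
      case 3
      have m1: "min (real (Suc m)) v = v" "min (real m) v = real m" using 3 by auto
      have "g (real m) \<le> g v" using 3 by (intro inc) auto
      moreover have "g (real (Suc m)) \<le> g v" using 3 by (intro dec) auto
      \<comment> \<open>The mean value point lies left or right of the peak. Either way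
        \<open>g \<xi>\<close> dominates the endpoint on its own side, and the other endpoint is
        dominated by the peak value \<open>g v\<close>.\<close>
      moreover have "g \<xi> \<ge> g (real m) \<or> g \<xi> \<ge> g (real (Suc m))"
      proof (cases "\<xi> \<le> v")
        case True then show ?thesis using x by (intro disjI1 inc) auto
      next
        case False then show ?thesis using x by (intro disjI2 dec) auto
      qed
      ultimately show ?thesis unfolding m1 x(3) by linarith
    qed
  qed
  have G0: "G 0 = - fact k / a ^ Suc k" using pexp_int_0[OF a] by (simp add: G_def)
  have Gn: "G (real n) \<le> 0" for n using pexp_int_nonpos[OF a] by (simp add: G_def)
  have Gmono: "G 0 \<le> G 1"
  proof -
    have "\<exists>\<xi>. 0 < \<xi> \<and> \<xi> < 1 \<and> G 1 - G 0 = (1 - 0) * g \<xi>"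
      unfolding G_def g_def by (rule MVT2) (use pexp_int_deriv a in auto)
    then show ?thesis using g0 by (metis diff_ge_0_iff_ge diff_zero less_le mult_1)
  qed
  have part: "(\<Sum>m<n. g (real m)) \<le> M + fact k / a ^ Suc k" for n
  proof -
    have gz: "g 0 = 0" using k by (simp add: g_def)
    have "(\<Sum>m<Suc (Suc n). g (real m)) \<le> M + fact k / a ^ Suc k"
    \<comment> \<open>The bound \<open>M\<close> is assumed only from 1 on. If the peak lies before
      1 its value is not controlled; then the term m = 1 is bounded on its own and all later terms
      lie in the decreasing range.\<close>
    proof (cases "v \<ge> 1")
      case True
      have "(\<Sum>m<Suc (Suc n). g (real m)) = (\<Sum>m<Suc n. g (real (Suc m)))"
        by (subst sum.lessThan_Suc_shift) (simp add: gz)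
      also have "... \<le> (\<Sum>m<Suc n. (G (real (Suc m)) + g (min (real (Suc m)) v)) - (G (real m) + g (min (real m) v)))"
        by (intro sum_mono) (use step in \<open>simp add: algebra_simps\<close>)
      also have "... = G (real (Suc n)) + g (min (real (Suc n)) v) - (G (real 0) + g (min (real 0) v))"
        by (rule sum_lessThan_telescope)
      also have "... \<le> M + fact k / a ^ Suc k"
      proof -
        have "g (min (real (Suc n)) v) \<le> g v" using v0 by (intro inc) auto
        also have "g v \<le> M" using M True by (simp add: g_def)
        finally show ?thesis using Gn[of "Suc n"] G0 v0 gz by simp
      qed
      finally show ?thesis .
    next
      case False
      have "(\<Sum>m<Suc (Suc n). g (real m)) = g 1 + (\<Sum>m<n. g (real (Suc (Suc m))))"
        by (subst sum.lessThan_Suc_shift, subst sum.lessThan_Suc_shift) (simp add: gz)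
      also have "(\<Sum>m<n. g (real (Suc (Suc m)))) \<le> (\<Sum>m<n. G (real (Suc (Suc m))) - G (real (Suc m)))"
      proof (intro sum_mono)
        fix m
        have "min (real (Suc (Suc m))) v = v" "min (real (Suc m)) v = v" using False by auto
        then show "g (real (Suc (Suc m))) \<le> G (real (Suc (Suc m))) - G (real (Suc m))" using step[of "Suc m"] by simp
      qed
      also have "... = G (real (Suc n)) - G (real (Suc 0))"
        using sum_lessThan_telescope[of "\<lambda>m. G (real (Suc m))" n] by simp
      finally show ?thesis using M[of 1] Gn[of "Suc n"] G0 Gmono by (simp add: g_def)
    qed
    moreover have "(\<Sum>m<n. g (real m)) \<le> (\<Sum>m<Suc (Suc n). g (real m))"
      using g0[of "real n"] g0[of "real (Suc n)"] by simp
    ultimately show ?thesis by linarith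
  qed
  have "summable (\<lambda>m. g (real m))" using summable_power_exp[OF a, of k] by (simp add: g_def)
  then have "(\<Sum>m. g (real m)) \<le> M + fact k / a ^ Suc k" using part by (rule suminf_le_const)
  then show ?thesis by (simp add: g_def)
qed

text \<open>From t <= exp (t - 1) at t = y / n, raised to the n-th power.\<close>

lemma power_exp_max:
  fixes y :: real assumes "y \<ge> 0" "n > 0"
  shows "y ^ n * exp (- y) \<le> real n ^ n * exp (- real n)"
proof -
  have "y / real n \<le> exp (y / real n - 1)" using exp_ge_add_one_self[of "y / real n - 1"] by simp
  then have "(y / real n) ^ n \<le> exp (y / real n - 1) ^ n" using assms by (intro power_mono) auto
  also have "... = exp (y - real n)" using assms by (simp add: exp_of_nat_mult[symmetric] right_diff_distrib)
  finally have "(y / real n) ^ n * (real n ^ n * exp (- y)) \<le> exp (y - real n) * (real n ^ n * exp (- y))"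
    by (rule mult_right_mono) simp
  moreover have "(y / real n) ^ n * (real n ^ n * exp (- y)) = y ^ n * exp (- y)"
    using assms by (simp add: power_divide)
  moreover have "exp (y - real n) * (real n ^ n * exp (- y)) = real n ^ n * exp (- real n)"
  proof -
    have "exp (y - real n) * exp (- y) = exp (- real n)" by (simp add: exp_add[symmetric])
    then show ?thesis by (metis mult.left_commute)
  qed
  ultimately show ?thesis by simp
qed

text \<open>For x >= 1 the exponent 2p - 1 may be raised to 2p, after which the maximum depends on a
  x alone and the bound becomes free of u. The Gamma integral contributes exactly the summand
  1.\<close>

lemma Qsum_le:
  assumes u: "u > 0" and p: "p \<ge> 1"
  shows "Qsum p u \<le> real (2*p) ^ (2*p) * exp (- real (2*p)) / fact (2 * p - 1) + 1"
proof -
  define a where "a = 2 * pi * u"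
  define P where "P = real (2*p) ^ (2*p) * exp (- real (2*p))"
  have a: "a > 0" using u by (simp add: a_def)
  have Suc: "Suc (2 * p - 1) = 2 * p" using p by simp
  have "x ^ (2 * p - 1) * exp (- a * x) \<le> P / a ^ (2 * p)" if "x \<ge> 1" for x
  proof -
    have "x ^ (2 * p - 1) \<le> x ^ (2 * p)" using that by (intro power_increasing) auto
    then have "a ^ (2 * p) * (x ^ (2 * p - 1) * exp (- a * x)) \<le> a ^ (2 * p) * (x ^ (2 * p) * exp (- a * x))"
      using a by (intro mult_left_mono mult_right_mono) auto
    also have "... = (a * x) ^ (2 * p) * exp (- (a * x))" by (simp add: power_mult_distrib)
    also have "... \<le> P" unfolding P_def using a that p by (intro power_exp_max) auto
    finally have "(x ^ (2 * p - 1) * exp (- a * x)) * a ^ (2 * p) \<le> P" by (simp only: mult.commute)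
    then show ?thesis using a by (simp only: pos_le_divide_eq zero_less_power)
  qed
  then have "(\<Sum>m. real m ^ (2 * p - 1) * exp (- a * real m)) \<le> P / a ^ (2 * p) + fact (2 * p - 1) / a ^ Suc (2 * p - 1)"
    using a p by (intro sum_power_exp_le) auto
  then have "a ^ (2 * p) / fact (2 * p - 1) * (\<Sum>m. real m ^ (2 * p - 1) * exp (- a * real m)) \<le>
     a ^ (2 * p) / fact (2 * p - 1) * (P / a ^ (2 * p) + fact (2 * p - 1) / a ^ (2 * p))"
    unfolding Suc using a by (intro mult_left_mono) auto
  also have "... = P / fact (2 * p - 1) + 1"
  proof -
    have "c / d * (P / c + d / c) = P / d + 1" if "c \<noteq> 0" "d \<noteq> 0" for c d :: real
      using that by (simp add: distrib_left)
    then show ?thesis using a by simp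
  qed
  finally show ?thesis unfolding Qsum_def a_def P_def .
qed

text \<open>Only the mode m = 1 is kept. The choice u = p / pi makes 2 pi u = 2p, where that mode is
  largest.\<close>

lemma Qsum_ge:
  assumes p: "p \<ge> 1"
  shows "Qsum p (real p / pi) \<ge> real (2*p) ^ (2*p) * exp (- real (2*p)) / fact (2 * p - 1)"
proof -
  let ?f = "\<lambda>m. real m ^ (2 * p - 1) * exp (- (2 * pi * (real p / pi)) * real m)"
  have "summable ?f" using p by (intro summable_power_exp) auto
  then have "(\<Sum>m\<in>{1}. ?f m) \<le> suminf ?f" by (intro sum_le_suminf) auto
  then have "exp (- real (2 * p)) \<le> suminf ?f" by simp
  then have "real (2 * p) ^ (2 * p) / fact (2 * p - 1) * exp (- real (2 * p)) \<le> real (2 * p) ^ (2 * p) / fact (2 * p - 1) * suminf ?f"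
    by (intro mult_left_mono) auto
  then show ?thesis unfolding Qsum_def by simp
qed

section \<open>Discrete groups of matrices\<close>

abbreviation conj_group :: "real^2^2 \<Rightarrow> (real^2^2) set \<Rightarrow> (real^2^2) set" where
  "conj_group S M \<equiv> (\<lambda>A. adj2 S ** A ** S) ` M"

lemma norm_mult_mat2: "norm (A ** B) \<le> norm A * norm (B :: real^2^2)" for A :: "real^2^2"
proof -
  have cs: "(a * b + c * d)\<^sup>2 \<le> (a\<^sup>2 + c\<^sup>2) * (b\<^sup>2 + d\<^sup>2)" for a b c d :: real
  proof -
    have "(a\<^sup>2 + c\<^sup>2) * (b\<^sup>2 + d\<^sup>2) - (a * b + c * d)\<^sup>2 = (a * d - c * b)\<^sup>2" by (simp add: power2_eq_square algebra_simps)
    then show ?thesis using zero_le_power2[of "a * d - c * b"] by linarith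
  qed
  have "(norm (A ** B))\<^sup>2 \<le> (norm A * norm B)\<^sup>2"
    unfolding power_mult_distrib norm2_mat2
    using cs[of "A$1$1" "B$1$1" "A$1$2" "B$2$1"] cs[of "A$1$1" "B$1$2" "A$1$2" "B$2$2"]
      cs[of "A$2$1" "B$1$1" "A$2$2" "B$2$1"] cs[of "A$2$1" "B$1$2" "A$2$2" "B$2$2"]
    by (simp add: algebra_simps)
  then show ?thesis by (simp add: abs_le_square_iff[symmetric])
qed

lemma norm_adj2 [simp]: "norm (adj2 A) = norm A"
proof -
  have "(norm (adj2 A))\<^sup>2 = (norm A)\<^sup>2" by (simp add: norm2_mat2)
  then show ?thesis by simp
qed

text \<open>An upper triangular matrix carrying i to w; conjugating by it moves questions at w to
  the base point i.\<close>

definition to_pt :: "complex \<Rightarrow> real^2^2" where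
  "to_pt w = mat2 (sqrt (Im w)) (Re w / sqrt (Im w)) 0 (1 / sqrt (Im w))"

lemma to_pt:
  assumes "Im w > 0"
  shows "det (to_pt w) = 1" "moebius (to_pt w) \<i> = w"
proof -
  show "det (to_pt w) = 1" using assms by (simp add: det_2 to_pt_def)
  have s: "complex_of_real (sqrt (Im w)) * complex_of_real (sqrt (Im w)) = of_real (Im w)"
    using assms by (simp flip: of_real_mult)
  have s0: "complex_of_real (sqrt (Im w)) \<noteq> 0" using assms by simp
  have "moebius (to_pt w) \<i> = (complex_of_real (sqrt (Im w)) * \<i> + of_real (Re w) / complex_of_real (sqrt (Im w))) * complex_of_real (sqrt (Im w))"
    by (simp add: moebius_def aut_factor_def to_pt_def)
  also have "... = of_real (Im w) * \<i> + of_real (Re w)"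
  proof -
    have "(complex_of_real (sqrt (Im w)) * \<i> + of_real (Re w) / complex_of_real (sqrt (Im w))) * complex_of_real (sqrt (Im w))
      = (complex_of_real (sqrt (Im w)) * complex_of_real (sqrt (Im w))) * \<i> + of_real (Re w) / complex_of_real (sqrt (Im w)) * complex_of_real (sqrt (Im w))"
      by (simp only: distrib_right) (simp only: mult_ac)
    then show ?thesis using s0 by (simp only: s) simp
  qed
  also have "... = w" by (simp add: complex_eq_iff)
  finally show "moebius (to_pt w) \<i> = w" .
qed

text \<open>At i the displacement is a function of the Frobenius norm. This links geometric
  smallness to the norm balls in which discreteness is expressed.\<close>

lemma norm_disp_i:
  assumes "det A = 1" shows "(norm A)\<^sup>2 = 2 + 4 * disp A \<i>"
proof -
  have "disp A \<i> = (trace A)\<^sup>2 / 4 - 1 + (shear A \<i>)\<^sup>2" using assms by (simp add: disp_eq)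
  then show ?thesis using assms unfolding norm2_mat2 shear_def trace2 det_2 by (simp add: power2_eq_square field_simps)
qed

lemma conj2_inverse:
  assumes "det S = 1" shows "S ** (adj2 S ** A ** S) ** adj2 S = A"
  using assms by (simp add: matrix_mul_assoc[symmetric])

lemma norm_le_disp:
  assumes "det A = 1" "Im w > 0"
  shows "norm A \<le> (norm (to_pt w))\<^sup>2 * sqrt (2 + 4 * disp A w)"
proof -
  let ?T = "to_pt w" and ?A = "adj2 (to_pt w) ** A ** to_pt w"
  note T = to_pt[OF assms(2)]
  have d: "det ?A = 1" using T assms by (simp add: det_conj2)
  have "disp ?A \<i> = disp A w" using T assms by (simp add: disp_conj)
  then have n: "norm ?A = sqrt (2 + 4 * disp A w)" using norm_disp_i[OF d] by (metis norm_ge_zero real_sqrt_unique)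
  have "norm A = norm (?T ** ?A ** adj2 ?T)" using conj2_inverse[OF T(1)] by simp
  also have "... \<le> norm ?T * norm ?A * norm (adj2 ?T)"
    by (meson mult_right_mono norm_ge_zero norm_mult_mat2 order_trans)
  finally show ?thesis by (simp add: n power2_eq_square mult_ac)
qed

text \<open>The traceless part of \<open>B\<close> is \<open>l\<close> times that of
  \<open>A\<close>. Among matrices of determinant 1 this describes the centraliser of a noncentral
  \<open>A\<close>; \<open>l\<close> multiplies the shear and l^2 multiplies trace^2 / 4 - 1, hence
  displacements at all points scale by the same l^2.\<close>

definition prop_dev :: "real \<Rightarrow> real^2^2 \<Rightarrow> real^2^2 \<Rightarrow> bool" where
  "prop_dev l A B \<longleftrightarrow> B$1$1 - B$2$2 = l * (A$1$1 - A$2$2) \<and> B$1$2 = l * A$1$2 \<and> B$2$1 = l * A$2$1"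

lemma prop_dev_shear: "prop_dev l A B ==> shear B w = l * shear A w"
proof -
  assume h: "prop_dev l A B"
  then have "B$1$2 + (B$1$1 - B$2$2) * Re w - B$2$1 * (cmod w)\<^sup>2 = l * (A$1$2 + (A$1$1 - A$2$2) * Re w - A$2$1 * (cmod w)\<^sup>2)"
    unfolding prop_dev_def by (simp only:) (simp add: algebra_simps)
  then show ?thesis unfolding shear_def by simp
qed

lemma trace_dev: "det (A :: real^2^2) = 1 ==> (trace A)\<^sup>2 / 4 - 1 = ((A$1$1 - A$2$2) / 2)\<^sup>2 + A$1$2 * A$2$1"
  unfolding det_2 trace2 by (simp add: power2_eq_square field_simps)

lemma prop_dev_trace:
  assumes "prop_dev l A B" "det A = 1" "det B = 1"
  shows "(trace B)\<^sup>2 / 4 - 1 = l\<^sup>2 * ((trace A)\<^sup>2 / 4 - 1)"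
  using assms(1) unfolding trace_dev[OF assms(2)] trace_dev[OF assms(3)] prop_dev_def
  by (simp only:) (simp add: power2_eq_square algebra_simps)

lemma prop_dev_disp:
  assumes "prop_dev l A B" "det A = 1" "det B = 1" "Im w > 0"
  shows "disp B w = l\<^sup>2 * disp A w"
  using prop_dev_trace[OF assms(1-3)] prop_dev_shear[OF assms(1), of w] assms
  by (simp add: disp_eq power_mult_distrib algebra_simps)

lemma prop_dev_commute:
  assumes "prop_dev l A B" "prop_dev m A C"
  shows "B ** C = C ** B"
proof -
  have B: "B$1$1 = B$2$2 + l * (A$1$1 - A$2$2)" "B$1$2 = l * A$1$2" "B$2$1 = l * A$2$1"
    and C: "C$1$1 = C$2$2 + m * (A$1$1 - A$2$2)" "C$1$2 = m * A$1$2" "C$2$1 = m * A$2$1"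
    using assms by (auto simp: prop_dev_def)
  show ?thesis by (rule mat2_eqI) (simp_all add: B C algebra_simps)
qed

text \<open>Commuting says that the two traceless parts are parallel. A noncentral \<open>A\<close>
  has a nonzero entry in its traceless part, and the factor is a quotient by such an entry.\<close>

lemma commute_prop_dev:
  assumes AB: "A ** B = B ** A" and d: "det A = 1" and A: "A \<noteq> mat 1" "A \<noteq> - mat 1"
  shows "\<exists>l. prop_dev l A B"
proof -
  have "(A ** B)$1$1 = (B ** A)$1$1" "(A ** B)$1$2 = (B ** A)$1$2" "(A ** B)$2$1 = (B ** A)$2$1"
    using AB by auto
  then have e: "A$1$2 * B$2$1 = B$1$2 * A$2$1"
     "A$1$2 * (B$1$1 - B$2$2) = B$1$2 * (A$1$1 - A$2$2)"
     "A$2$1 * (B$1$1 - B$2$2) = B$2$1 * (A$1$1 - A$2$2)"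
    by (auto simp: algebra_simps)
  show ?thesis
  proof (cases "A$1$2 = 0 \<and> A$2$1 = 0")
    case True
    have "A$1$1 \<noteq> A$2$2"
    proof
      assume eq: "A$1$1 = A$2$2"
      then have "(A$2$2)\<^sup>2 = 1" using d True by (simp add: det_2 power2_eq_square)
      then have "A$2$2 = 1 \<or> A$2$2 = - 1" by (simp add: power2_eq_1_iff)
      then have "A = mat 1 \<or> A = - mat 1" using True eq by (auto intro!: mat2_eqI)
      then show False using A by blast
    qed
    then show ?thesis using e True
      by (intro exI[of _ "(B$1$1 - B$2$2) / (A$1$1 - A$2$2)"]) (auto simp: prop_dev_def)
  next
    case False
    then consider "A$1$2 \<noteq> 0" | "A$2$1 \<noteq> 0" by blast
    then show ?thesis
    proof cases
      case 1
      then show ?thesis using e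
        by (intro exI[of _ "B$1$2 / A$1$2"]) (auto simp: prop_dev_def field_simps)
    next
      case 2
      then show ?thesis using e
        by (intro exI[of _ "B$2$1 / A$2$1"]) (auto simp: prop_dev_def field_simps)
    qed
  qed
qed

lemma sum_squares_split:
  fixes a b c d k :: real
  shows "a * d - b * c = 1 ==> a\<^sup>2 + b\<^sup>2 + c\<^sup>2 + d\<^sup>2 = 2 + 4 * k ==> (a - d)\<^sup>2 + (b + c)\<^sup>2 = 4 * k"
    and "(a - d)\<^sup>2 / 2 + b\<^sup>2 + c\<^sup>2 = ((a - d)\<^sup>2 + (b + c)\<^sup>2) / 2 + (b - c)\<^sup>2 / 2"
  by (simp_all add: power2_eq_square algebra_simps add_divide_distrib diff_divide_distrib)

lemma disp_zero_i:
  assumes d: "det A = 1" and z: "disp A \<i> = 0" and t: "\<bar>trace A\<bar> \<ge> 2"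
  shows "A = mat 1 \<or> A = - mat 1"
proof -
  have t: "(trace A)\<^sup>2 \<ge> 4" using t abs_le_square_iff[of 2 "trace A"] by simp
  have e: "(trace A)\<^sup>2 / 4 - 1 + (shear A \<i>)\<^sup>2 = 0" using z d by (simp add: disp_eq)
  then have "(shear A \<i>)\<^sup>2 = 0" using t zero_le_power2[of "shear A \<i>"] by linarith
  then have bc: "A$1$2 = A$2$1" by (simp add: shear_def)
  have n: "(A$1$1)\<^sup>2 + (A$1$2)\<^sup>2 + (A$2$1)\<^sup>2 + (A$2$2)\<^sup>2 = 2 + 4 * 0"
    using norm_disp_i[OF d] z by (simp add: norm2_mat2)
  have "A$1$1 * A$2$2 - A$1$2 * A$2$1 = 1" using d by (simp only: det_2)
  from sum_squares_split(1)[OF this n]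
  have "(A$1$1 - A$2$2)\<^sup>2 + (A$1$2 + A$2$1)\<^sup>2 = 0" by (simp only: mult_zero_right)
  then have "A$1$1 - A$2$2 = 0 \<and> A$1$2 + A$2$1 = 0" by (simp only: sum_power2_eq_zero_iff)
  then have s1: "A$1$1 = A$2$2" "A$1$2 = 0" "A$2$1 = 0" using bc by auto
  have "(A$2$2)\<^sup>2 = 1" using d s1 by (simp add: det_2 power2_eq_square)
  then have "A$2$2 = 1 \<or> A$2$2 = - 1" by (simp only: power2_eq_1_iff)
  then show ?thesis using s1 by (auto intro!: mat2_eqI)
qed

text \<open>Without elliptic elements only the central matrices fix a point; the bound on the trace
  excludes rotations about w.\<close>

lemma disp_zero:
  assumes "det A = 1" "Im w > 0" "disp A w = 0" "\<bar>trace A\<bar> \<ge> 2"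
  shows "A = mat 1 \<or> A = - mat 1"
proof -
  define B where "B = adj2 (to_pt w) ** A ** to_pt w"
  note T = to_pt[OF assms(2)]
  have "det B = 1" "disp B \<i> = 0" "\<bar>trace B\<bar> \<ge> 2"
    using T assms by (simp_all add: B_def det_conj2 disp_conj trace_conj2)
  then have "B = mat 1 \<or> B = - mat 1" by (rule disp_zero_i)
  moreover have "A = to_pt w ** B ** adj2 (to_pt w)" using conj2_inverse[OF T(1)] by (simp add: B_def)
  ultimately show ?thesis using T by auto
qed

text \<open>The preimage in SL(2,R) of a Fuchsian group without elliptic elements: discreteness is
  finiteness of norm balls, and the trace condition expresses the absence of elliptic
  elements.\<close>

locale fuchsian_matrices =
  fixes M :: "(real^2^2) set"
  assumes det1: "A \<in> M ==> det A = 1"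
    and one_mem: "mat 1 \<in> M"
    and neg_mem: "A \<in> M ==> - A \<in> M"
    and mult_mem: "A \<in> M ==> B \<in> M ==> A ** B \<in> M"
    and adj2_mem: "A \<in> M ==> adj2 A \<in> M"
    and finite_norm: "finite {A \<in> M. norm A \<le> R}"
    and trace_ge: "A \<in> M ==> \<bar>trace A\<bar> \<ge> 2"
begin

lemma moebius_mem: "A \<in> M ==> Im z > 0 ==> Im (moebius A z) > 0"
  by (simp add: det1 Im_moebius_pos)

lemma countable_M: "countable M"
proof -
  have "M = (\<Union>n. {A \<in> M. norm A \<le> real n})" using real_arch_simple by auto
  moreover have "countable (\<Union>n. {A \<in> M. norm A \<le> real n})" by (intro countable_UN[OF countableI_type] countable_finite finite_norm)
  ultimately show ?thesis by metis
qed

lemma finite_disp: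
  assumes "Im w > 0" shows "finite {A \<in> M. disp A w \<le> R}"
proof (rule finite_subset[OF _ finite_norm[of "(norm (to_pt w))\<^sup>2 * sqrt (2 + 4 * R)"]])
  show "{A \<in> M. disp A w \<le> R} \<subseteq> {A \<in> M. norm A \<le> (norm (to_pt w))\<^sup>2 * sqrt (2 + 4 * R)}"
  proof safe
    fix A assume A: "A \<in> M" "disp A w \<le> R"
    have "norm A \<le> (norm (to_pt w))\<^sup>2 * sqrt (2 + 4 * disp A w)" using A det1 assms by (intro norm_le_disp) auto
    also have "... \<le> (norm (to_pt w))\<^sup>2 * sqrt (2 + 4 * R)" using A by (intro mult_left_mono) auto
    finally show "norm A \<le> (norm (to_pt w))\<^sup>2 * sqrt (2 + 4 * R)" .
  qed
qed

lemma trace_sq_ge: "A \<in> M ==> (trace A)\<^sup>2 / 4 \<ge> 1"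
  using trace_ge[of A] abs_le_square_iff[of 2 "trace A"] by simp

lemma disp_nonneg: "A \<in> M ==> Im w > 0 ==> disp A w \<ge> 0"
  by (simp add: disp_def hypu_nonneg moebius_mem)

lemma disp_pos: "A \<in> M ==> Im w > 0 ==> A \<noteq> mat 1 ==> A \<noteq> - mat 1 ==> disp A w > 0"
  by (metis disp_zero disp_nonneg trace_ge det1 order_le_less)

lemma conj_fuchsian:
  assumes S: "det S = 1"
  shows "fuchsian_matrices (conj_group S M)"
proof
  fix A R
  let ?c = "\<lambda>A. adj2 S ** A ** S"
  show "det A = 1" if "A \<in> ?c ` M" using that S det1 by (auto simp: det_conj2)
  have "?c (mat 1) = mat 1" using S by simp
  then show "mat 1 \<in> ?c ` M" using one_mem by (metis image_eqI)
  show "- A \<in> ?c ` M" if a: "A \<in> ?c ` M"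
  proof -
    obtain A' where "A = ?c A'" "A' \<in> M" using a by auto
    then have "- A = ?c (- A')" "- A' \<in> M" using neg_mem by auto
    then show ?thesis by (rule image_eqI)
  qed
  show "adj2 A \<in> ?c ` M" if a: "A \<in> ?c ` M"
  proof -
    obtain A' where "A = ?c A'" "A' \<in> M" using a by auto
    then have "adj2 A = ?c (adj2 A')" "adj2 A' \<in> M" using adj2_mem by (auto simp: adj2_prod matrix_mul_assoc)
    then show ?thesis by (rule image_eqI)
  qed
  show "A ** B \<in> ?c ` M" if "A \<in> ?c ` M" "B \<in> ?c ` M" for B
  proof -
    obtain A' B' where "A = ?c A'" "B = ?c B'" "A' \<in> M" "B' \<in> M" using \<open>A \<in> _\<close> \<open>B \<in> _\<close> by auto
    then have "A ** B = ?c (A' ** B')" using S by (simp add: matrix_mul_assoc[symmetric])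
    then show ?thesis using mult_mem \<open>A' \<in> M\<close> \<open>B' \<in> M\<close> by blast
  qed
  show "\<bar>trace A\<bar> \<ge> 2" if "A \<in> ?c ` M" using that S trace_ge by (auto simp: trace_conj2)
  have "{A \<in> ?c ` M. norm A \<le> R} \<subseteq> ?c ` {A \<in> M. norm A \<le> norm S * R * norm S}"
  proof safe
    fix A assume A: "A \<in> M" "norm (?c A) \<le> R"
    have "norm A = norm (S ** ?c A ** adj2 S)" using conj2_inverse[OF S] by simp
    also have "... \<le> norm S * norm (?c A) * norm (adj2 S)"
      by (meson mult_right_mono norm_ge_zero norm_mult_mat2 order_trans)
    also have "... \<le> norm S * R * norm S" using A by (simp add: mult_left_mono mult_right_mono)
    finally show "?c A \<in> ?c ` {A \<in> M. norm A \<le> norm S * R * norm S}" using A by blast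
  qed
  then show "finite {A \<in> ?c ` M. norm A \<le> R}" using finite_norm finite_surj by blast
qed

end

section \<open>The Margulis lemma with an explicit constant\<close>

definition margulis_const :: real where "margulis_const = 1 / 1000"

text \<open>The difference of the commutator from 1 is A B - B A times a bounded factor, and A B - B
  A involves only the traceless parts of \<open>A\<close> and \<open>B\<close>. It is therefore
  quadratically small, while the displacement is comparable to the squared norm of a single
  traceless part.\<close>

lemma commutator_small:
  assumes d: "det A = 1" "det B = 1" and t: "\<bar>trace A\<bar> \<ge> 2" "\<bar>trace B\<bar> \<ge> 2"
    and e: "disp A \<i> \<le> disp B \<i>" "disp B \<i> < margulis_const" "disp A \<i> > 0"
  defines "C \<equiv> A ** B ** adj2 A ** adj2 B"
  shows "disp C \<i> < disp A \<i>" "C \<noteq> - mat 1"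
proof -
  define dv where "dv = (\<lambda>A :: real^2^2. mat2 ((A$1$1 - A$2$2) / 2) (A$1$2) (A$2$1) (- (A$1$1 - A$2$2) / 2))"
  have ndv: "(norm (dv A))\<^sup>2 = (A$1$1 - A$2$2)\<^sup>2 / 2 + (A$1$2)\<^sup>2 + (A$2$1)\<^sup>2" for A
    unfolding norm2_mat2 dv_def by (simp add: power2_eq_square field_simps)
  have d4: "(A$1$1 - A$2$2)\<^sup>2 + (A$1$2 + A$2$1)\<^sup>2 = 4 * disp A \<i>" if "det A = 1" for A :: "real^2^2"
    using norm_disp_i[OF that] that unfolding norm2_mat2 det_2 by (intro sum_squares_split(1)) auto
  \<comment> \<open>Here |trace| >= 2 enters: it gives shear^2 <= displacement, which controls the
    antisymmetric part. A small rotation can have small displacement at i and large traceless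
    part.\<close>
  have up: "(norm (dv A))\<^sup>2 \<le> 4 * disp A \<i>" if "det A = 1" "\<bar>trace A\<bar> \<ge> 2" for A
  proof -
    have "(trace A)\<^sup>2 \<ge> 4" using that(2) abs_le_square_iff[of 2 "trace A"] by simp
    then have "(shear A \<i>)\<^sup>2 \<le> disp A \<i>" using that by (simp add: disp_eq)
    then have "(A$1$2 - A$2$1)\<^sup>2 \<le> 4 * disp A \<i>" by (simp add: shear_def power2_eq_square)
    moreover have "s = k ==> t \<le> k ==> s / 2 + t / 2 \<le> k" for s t k :: real by simp
    ultimately show ?thesis using d4[OF that(1)] unfolding ndv sum_squares_split(2) by blast
  qed
  have low: "2 * disp A \<i> \<le> (norm (dv A))\<^sup>2" if "det A = 1" for A
  proof -
    have "s = 4 * k ==> 0 \<le> t ==> 2 * k \<le> s / 2 + t / 2" for s t k :: real by simp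
    then show ?thesis using d4[OF that] zero_le_power2 unfolding ndv sum_squares_split(2) by blast
  qed
  have dC: "det C = 1" using d by (simp add: C_def det_mul)
  have c: "A ** B - B ** A = dv A ** dv B - dv B ** dv A"
    by (rule mat2_eqI) (simp_all add: dv_def field_simps)
  have C1: "C - mat 1 = (A ** B - B ** A) ** (adj2 A ** adj2 B)"
  proof -
    have "(A ** B - B ** A) ** (adj2 A ** adj2 B) = A ** B ** (adj2 A ** adj2 B) - B ** A ** (adj2 A ** adj2 B)"
      by (rule mat2_eqI) (simp_all add: algebra_simps)
    also have "B ** A ** (adj2 A ** adj2 B) = mat 1" using d by (simp add: matrix_mul_assoc[symmetric])
    finally show ?thesis by (simp add: C_def matrix_mul_assoc)
  qed
  have nAB: "norm A \<le> 3/2" "norm B \<le> 3/2"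
  proof -
    have "(norm A)\<^sup>2 \<le> (3/2)\<^sup>2" "(norm B)\<^sup>2 \<le> (3/2)\<^sup>2"
      using e unfolding norm_disp_i[OF d(1)] norm_disp_i[OF d(2)] by (auto simp: margulis_const_def power2_eq_square)
    then show "norm A \<le> 3/2" "norm B \<le> 3/2" by (auto intro: power2_le_imp_le)
  qed
  have "norm (C - mat 1) \<le> norm (A ** B - B ** A) * (norm A * norm B)"
    unfolding C1 using order_trans[OF norm_mult_mat2 mult_left_mono[OF norm_mult_mat2[of "adj2 A" "adj2 B"] norm_ge_zero]]
    by simp
  also have "norm (A ** B - B ** A) \<le> norm (dv A ** dv B) + norm (dv B ** dv A)" unfolding c by (rule norm_triangle_ineq4)
  also have "... \<le> 2 * (norm (dv A) * norm (dv B))"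
    using norm_mult_mat2[of "dv A" "dv B"] norm_mult_mat2[of "dv B" "dv A"] by (simp add: mult.commute)
  finally have n1: "norm (C - mat 1) \<le> 2 * (norm (dv A) * norm (dv B)) * (norm A * norm B)"
    by (simp add: mult_right_mono)
  also have "... \<le> 2 * (norm (dv A) * norm (dv B)) * (3/2 * (3/2))"
    using nAB by (intro mult_left_mono mult_mono) auto
  finally have n2: "norm (C - mat 1) \<le> 9/2 * (norm (dv A) * norm (dv B))" by simp
  have "(norm (C - mat 1))\<^sup>2 \<le> (9/2 * (norm (dv A) * norm (dv B)))\<^sup>2" using n2 by (intro power_mono) auto
  also have "... = 81/4 * ((norm (dv A))\<^sup>2 * (norm (dv B))\<^sup>2)" by (simp add: power_mult_distrib power_divide)
  also have "... \<le> 81/4 * ((4 * disp A \<i>) * (4 * margulis_const))"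
    using up[OF d(1) t(1)] up[OF d(2) t(2)] e by (intro mult_left_mono mult_mono) auto
  \<comment> \<open>The origin of the size of the Margulis constant: 81/4 * 16 / 1000 is less than
    1.\<close>
  also have "... < disp A \<i>" using e(3) by (simp add: margulis_const_def)
  finally have n3: "(norm (C - mat 1))\<^sup>2 < disp A \<i>" .
  have "(norm (dv C))\<^sup>2 \<le> (norm (C - mat 1))\<^sup>2"
  proof -
    have "(C$1$1 - C$2$2)\<^sup>2 / 2 \<le> (C$1$1 - 1)\<^sup>2 + (C$2$2 - 1)\<^sup>2"
      using zero_le_power2[of "C$1$1 + C$2$2 - 2"] by (simp add: power2_eq_square field_simps)
    then show ?thesis unfolding ndv unfolding norm2_mat2 by simp
  qed
  then show "disp C \<i> < disp A \<i>" using low[OF dC] n3 e(3) by linarith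
  show "C \<noteq> - mat 1"
  proof
    assume "C = - mat 1"
    then have "(norm (C - mat 1))\<^sup>2 = 8" unfolding norm2_mat2 by simp
    then show False using n3 e by (simp add: margulis_const_def)
  qed
qed

context fuchsian_matrices
begin

text \<open>A noncentral element of least displacement commutes with every other small element,
  since the commutator would be smaller still. So \<open>X\<close> and \<open>Y\<close> lie in the
  centraliser of that one element, which is commutative.\<close>

lemma margulis_i:
  assumes X: "X \<in> M" "disp X \<i> < margulis_const" and Y: "Y \<in> M" "disp Y \<i> < margulis_const"
  shows "X ** Y = Y ** X"
proof (cases "X \<in> {mat 1, - mat 1} \<or> Y \<in> {mat 1, - mat 1}")
  case True then show ?thesis by auto
next
  case False
  define S where "S = {A \<in> M. disp A \<i> \<le> margulis_const \<and> disp A \<i> < margulis_const \<and> A \<noteq> mat 1 \<and> A \<noteq> - mat 1}"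
  have fS: "finite S" by (rule finite_subset[OF _ finite_disp[of \<i> margulis_const]]) (auto simp: S_def)
  have XY: "X \<in> S" "Y \<in> S" using X Y False by (auto simp: S_def)
  then have "S \<noteq> {}" by auto
  define A where "A = arg_min_on (\<lambda>A. disp A \<i>) S"
  have A: "A \<in> S" "\<And>B. B \<in> S ==> disp A \<i> \<le> disp B \<i>"
    using arg_min_if_finite(1)[OF fS \<open>S \<noteq> {}\<close>] arg_min_least[OF fS \<open>S \<noteq> {}\<close>] by (auto simp: A_def)
  have comm: "A ** B = B ** A" if "B \<in> S" for B
  proof -
    define C where "C = A ** B ** adj2 A ** adj2 B"
    have AB: "A \<in> M" "B \<in> M" "det A = 1" "det B = 1" using A(1) that det1 by (auto simp: S_def)
    have C: "C \<in> M" using AB by (auto simp: C_def intro!: mult_mem adj2_mem)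
    have Ap: "disp A \<i> > 0" using A(1) by (intro disp_pos) (auto simp: S_def)
    have c: "disp C \<i> < disp A \<i>" "C \<noteq> - mat 1"
      using commutator_small[OF AB(3,4) trace_ge[OF AB(1)] trace_ge[OF AB(2)] A(2)[OF that] _ Ap] that
      by (auto simp: C_def S_def)
    have "C = mat 1"
    proof (rule ccontr)
      assume "C \<noteq> mat 1"
      then have "C \<in> S" using C c A(1) by (auto simp: S_def)
      then show False using A(2) c by force
    qed
    then have "C ** B ** A = B ** A" by simp
    moreover have "C ** B ** A = A ** B" using AB by (simp add: C_def matrix_mul_assoc[symmetric])
    ultimately show ?thesis by simp
  qed
  have A': "det A = 1" "A \<noteq> mat 1" "A \<noteq> - mat 1" using A(1) det1 by (auto simp: S_def)
  obtain l m where "prop_dev l A X" "prop_dev m A Y"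
    using commute_prop_dev[OF comm[OF XY(1)] A'] commute_prop_dev[OF comm[OF XY(2)] A'] by blast
  then show ?thesis by (rule prop_dev_commute)
qed

end

context fuchsian_matrices
begin

lemma margulis:
  assumes w: "Im w > 0" and X: "X \<in> M" "disp X w < margulis_const" and Y: "Y \<in> M" "disp Y w < margulis_const"
  shows "X ** Y = Y ** X"
proof -
  let ?T = "to_pt w"
  note T = to_pt[OF w]
  let ?c = "\<lambda>A. adj2 ?T ** A ** ?T"
  interpret c: fuchsian_matrices "?c ` M" by (rule conj_fuchsian[OF T(1)])
  have c: "?c X ** ?c Y = ?c Y ** ?c X"
  proof (rule c.margulis_i)
    show "?c X \<in> ?c ` M" "?c Y \<in> ?c ` M" by (rule imageI[OF X(1)], rule imageI[OF Y(1)])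
    have "disp (?c A) \<i> = disp A w" if "A \<in> M" for A
      using disp_conj[OF T(1) det1[OF that], of \<i>] unfolding T(2) by simp
    then show "disp (?c X) \<i> < margulis_const" "disp (?c Y) \<i> < margulis_const" using X Y by simp_all
  qed
  have h: "?c A ** ?c B = ?c (A ** B)" for A B
  proof -
    have "?c A ** ?c B = adj2 ?T ** A ** (?T ** adj2 ?T) ** B ** ?T" by (simp only: matrix_mul_assoc)
    then show ?thesis using T by (simp only: adj2_mult matrix_mul_rid matrix_mul_assoc)
  qed
  have "?c (X ** Y) = ?c (Y ** X)" using c unfolding h .
  then have "?T ** ?c (X ** Y) ** adj2 ?T = ?T ** ?c (Y ** X) ** adj2 ?T" by (simp only:)
  then show ?thesis unfolding conj2_inverse[OF T(1)] .
qed

end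

section \<open>The invariant measure\<close>

lemma open_uhp: "open uhp"
  by (simp add: uhp_def open_halfspace_Im_gt)

lemma uhp_borel [measurable, simp]: "uhp \<in> sets borel"
  using open_uhp by simp

lemma space_hyp_area [simp]: "space hyp_area = uhp"
  by (simp add: hyp_area_def space_restrict_space)

lemma sets_hyp_area: "sets hyp_area = sets (restrict_space borel uhp)"
  by (simp add: hyp_area_def sets_restrict_space cong: sets_restrict_space_cong)

lemma sets_hyp_area_iff: "E \<in> sets hyp_area \<longleftrightarrow> E \<in> sets borel \<and> E \<subseteq> uhp"
  by (auto simp: sets_hyp_area sets_restrict_space_iff)

lemma measurable_hyp_area: "measurable hyp_area N = measurable (restrict_space borel uhp) N"
  by (rule measurable_cong_sets) (simp_all add: sets_hyp_area)

lemma nn_integral_hyp_area: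
  assumes "h \<in> borel_measurable hyp_area"
  shows "(\<integral>\<^sup>+z. h z \<partial>hyp_area) = (\<integral>\<^sup>+z. h z * ennreal (1 / (2 * (Im z)\<^sup>2)) * indicator uhp z \<partial>lborel)"
proof -
  have m: "(\<lambda>z. ennreal (1 / (2 * (Im z)\<^sup>2))) \<in> borel_measurable (restrict_space lborel uhp)"
    by (rule measurable_restrict_space1) simp
  have "h \<in> borel_measurable (restrict_space borel uhp)" using assms by (simp add: measurable_hyp_area)
  also have "borel_measurable (restrict_space borel uhp) = borel_measurable (restrict_space lborel uhp)"
    by (rule measurable_cong_sets) (simp_all add: sets_restrict_space)
  finally have "(\<integral>\<^sup>+z. h z \<partial>hyp_area) = (\<integral>\<^sup>+z. ennreal (1 / (2 * (Im z)\<^sup>2)) * h z \<partial>restrict_space lborel uhp)"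
    unfolding hyp_area_def using m by (simp add: nn_integral_density)
  also have "... = (\<integral>\<^sup>+z. ennreal (1 / (2 * (Im z)\<^sup>2)) * h z * indicator uhp z \<partial>lborel)"
    by (subst nn_integral_restrict_space) auto
  finally show ?thesis by (simp add: mult_ac)
qed

lemma integral_hyp_area:
  fixes h :: "complex \<Rightarrow> complex"
  assumes "h \<in> borel_measurable hyp_area"
  shows "(\<integral>z. h z \<partial>hyp_area) = (\<integral>z. indicator uhp z *\<^sub>R ((1 / (2 * (Im z)\<^sup>2)) *\<^sub>R h z) \<partial>lborel)"
proof -
  have "h \<in> borel_measurable (restrict_space borel uhp)" using assms by (simp add: measurable_hyp_area)
  also have "borel_measurable (restrict_space borel uhp) = borel_measurable (restrict_space lborel uhp)"
    by (rule measurable_cong_sets) (simp_all add: sets_restrict_space)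
  finally have m1: "h \<in> borel_measurable (restrict_space lborel uhp)" .
  have m: "(\<lambda>z. 1 / (2 * (Im z)\<^sup>2)) \<in> borel_measurable (restrict_space lborel uhp)"
    by (rule measurable_restrict_space1) simp
  have "(\<integral>z. h z \<partial>hyp_area) = (\<integral>z. (1 / (2 * (Im z)\<^sup>2)) *\<^sub>R h z \<partial>restrict_space lborel uhp)"
    unfolding hyp_area_def using m m1 by (intro integral_density) auto
  also have "... = (\<integral>z. indicator uhp z *\<^sub>R ((1 / (2 * (Im z)\<^sup>2)) *\<^sub>R h z) \<partial>lborel)"
    by (intro integral_restrict_space) auto
  finally show ?thesis .
qed

lemma sigma_finite_hyp_area: "sigma_finite_measure hyp_area"
proof -
  interpret r: sigma_finite_measure "restrict_space lborel uhp"
    by (rule sigma_finite_measure_restrict_space) (simp_all add: sigma_finite_lborel)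
  have "(\<lambda>z. ennreal (1 / (2 * (Im z)\<^sup>2))) \<in> borel_measurable (restrict_space lborel uhp)"
    by (rule measurable_restrict_space1) simp
  then show ?thesis unfolding hyp_area_def
    by (subst r.sigma_finite_iff_density_finite) auto
qed

interpretation hyp_area: sigma_finite_measure hyp_area by (rule sigma_finite_hyp_area)

lemma moebius_holomorphic:
  assumes "det A = 1" shows "moebius A holomorphic_on uhp"
    and "aut_factor A holomorphic_on S"
  unfolding moebius_def[abs_def] aut_factor_def[abs_def]
  using aut_factor_nz[OF assms, unfolded aut_factor_def]
  by (auto intro!: holomorphic_intros simp: uhp_iff)

lemma moebius_has_derivative:
  assumes "det A = 1" "Im z > 0"
  shows "(moebius A has_field_derivative 1 / (aut_factor A z)\<^sup>2) (at z)"
proof -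
  have nz: "aut_factor A z \<noteq> 0" using assms aut_factor_nz by blast
  have d: "of_real (A$1$1) * of_real (A$2$2) - of_real (A$1$2) * of_real (A$2$1) = (1::complex)"
    using arg_cong[OF assms(1), of complex_of_real] by (simp add: det_2)
  have "((\<lambda>z. (of_real (A$1$1) * z + of_real (A$1$2)) / (of_real (A$2$1) * z + of_real (A$2$2))) has_field_derivative
     (of_real (A$1$1) * (of_real (A$2$1) * z + of_real (A$2$2)) - (of_real (A$1$1) * z + of_real (A$1$2)) * of_real (A$2$1)) / ((of_real (A$2$1) * z + of_real (A$2$2)) * (of_real (A$2$1) * z + of_real (A$2$2)))) (at z)"
    using nz unfolding aut_factor_def by (intro DERIV_divide) (auto intro!: derivative_eq_intros)
  moreover have "of_real (A$1$1) * (of_real (A$2$1) * z + of_real (A$2$2)) - (of_real (A$1$1) * z + of_real (A$1$2)) * of_real (A$2$1)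
      = of_real (A$1$1) * of_real (A$2$2) - of_real (A$1$2) * (of_real (A$2$1) :: complex)" by (simp add: algebra_simps)
  ultimately show ?thesis unfolding moebius_def[abs_def] aut_factor_def[abs_def] d power2_eq_square by simp
qed

lemma moebius_inj: "det A = 1 ==> inj_on (moebius A) uhp"
  by (metis inj_onI moebius_adj2(1) uhp_iff)

lemma moebius_image_uhp:
  assumes "det A = 1" shows "moebius A ` uhp = uhp"
proof (intro equalityI subsetI)
  fix w assume "w \<in> uhp"
  then have "w = moebius A (moebius (adj2 A) w)" "moebius (adj2 A) w \<in> uhp"
    using assms by (simp_all add: uhp_iff Im_moebius_pos)
  then show "w \<in> moebius A ` uhp" by blast
qed (use assms Im_moebius_pos in \<open>auto simp: uhp_iff\<close>)

lemma measurable_moebius: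
  assumes "det A = 1" shows "moebius A \<in> measurable hyp_area hyp_area"
proof -
  have "continuous_on uhp (moebius A)"
    using moebius_holomorphic(1)[OF assms] holomorphic_on_imp_continuous_on by blast
  then have "moebius A \<in> borel_measurable (restrict_space borel uhp)"
    by (rule borel_measurable_continuous_on_restrict)
  then have "moebius A \<in> measurable (restrict_space borel uhp) (restrict_space borel uhp)"
    using assms Im_moebius_pos by (intro measurable_restrict_space2) (auto simp: space_restrict_space uhp_iff)
  also have "measurable (restrict_space borel uhp) (restrict_space borel uhp) = measurable hyp_area hyp_area"
    by (intro measurable_cong_sets) (simp_all add: sets_hyp_area)
  finally show ?thesis .
qed

text \<open>The Jacobian of the action is |j|^(-4) and the imaginary part scales by |j|^(-2), so the
  density y^(-2) absorbs the Jacobian.\<close>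

lemma distr_moebius:
  assumes A: "det A = 1" shows "distr hyp_area hyp_area (moebius A) = hyp_area"
proof (rule measure_eqI)
  fix E assume "E \<in> sets (distr hyp_area hyp_area (moebius A))"
  then have E: "E \<in> sets hyp_area" by simp
  then have Eb: "E \<in> sets borel" "E \<subseteq> uhp" by (auto simp: sets_hyp_area_iff)
  note m = measurable_moebius[OF A]
  let ?g = "\<lambda>w. indicator E w * ennreal (1 / (2 * (Im w)\<^sup>2))"
  have g: "?g \<in> borel_measurable borel" using Eb by measurable
  have "emeasure (distr hyp_area hyp_area (moebius A)) E = (\<integral>\<^sup>+z. indicator E z \<partial>distr hyp_area hyp_area (moebius A))"
    using E by (simp add: nn_integral_indicator)
  also have "... = (\<integral>\<^sup>+z. indicator E (moebius A z) \<partial>hyp_area)"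
    using E m by (intro nn_integral_distr) auto
  also have "... = (\<integral>\<^sup>+z. indicator E (moebius A z) * ennreal (1 / (2 * (Im z)\<^sup>2)) * indicator uhp z \<partial>lborel)"
    using E m by (intro nn_integral_hyp_area measurable_compose[OF m]) auto
  also have "... = (\<integral>\<^sup>+z. ?g (moebius A z) * ennreal ((cmod (deriv (moebius A) z))\<^sup>2) * indicator uhp z \<partial>lborel)"
  proof (intro nn_integral_cong)
    fix z
    show "indicator E (moebius A z) * ennreal (1 / (2 * (Im z)\<^sup>2)) * indicator uhp z =
       ?g (moebius A z) * ennreal ((cmod (deriv (moebius A) z))\<^sup>2) * indicator uhp z"
    proof (cases "z \<in> uhp")
      case True
      then have z: "Im z > 0" by (simp add: uhp_iff)
      have nz: "aut_factor A z \<noteq> 0" using z A aut_factor_nz by blast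
      have dv: "deriv (moebius A) z = 1 / (aut_factor A z)\<^sup>2"
        using moebius_has_derivative[OF A z] by (rule DERIV_imp_deriv)
      have "1 / (2 * (Im (moebius A z))\<^sup>2) * (cmod (deriv (moebius A) z))\<^sup>2 = 1 / (2 * (Im z)\<^sup>2)"
        using nz z by (simp add: dv Im_moebius[OF A] norm_divide norm_power power_divide)
      then have "ennreal (1 / (2 * (Im (moebius A z))\<^sup>2)) * ennreal ((cmod (deriv (moebius A) z))\<^sup>2) = ennreal (1 / (2 * (Im z)\<^sup>2))"
        by (subst ennreal_mult[symmetric]) auto
      then show ?thesis by (simp add: mult.assoc)
    qed simp
  qed
  also have "... = (\<integral>\<^sup>+w. ?g w * indicator (moebius A ` uhp) w \<partial>lborel)"
    by (rule nn_integral_conformal[symmetric, OF open_uhp moebius_holomorphic(1)[OF A] moebius_inj[OF A] g])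
  also have "... = (\<integral>\<^sup>+w. indicator E w \<partial>hyp_area)"
    using E by (subst nn_integral_hyp_area) (auto simp: moebius_image_uhp[OF A])
  also have "... = emeasure hyp_area E" using E by simp
  finally show "emeasure (distr hyp_area hyp_area (moebius A)) E = emeasure hyp_area E" .
qed simp

lemma nn_integral_moebius:
  assumes "det A = 1" "h \<in> borel_measurable hyp_area"
  shows "(\<integral>\<^sup>+z. h (moebius A z) \<partial>hyp_area) = (\<integral>\<^sup>+z. h z \<partial>hyp_area)"
  using nn_integral_distr[OF measurable_moebius[OF assms(1)], of h] assms(2)
  by (simp add: distr_moebius[OF assms(1)])

lemma integral_moebius:
  fixes h :: "complex \<Rightarrow> complex"
  assumes "det A = 1" "h \<in> borel_measurable hyp_area"
  shows "(\<integral>z. h (moebius A z) \<partial>hyp_area) = (\<integral>z. h z \<partial>hyp_area)"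
  using integral_distr[OF measurable_moebius[OF assms(1)] assms(2)]
  by (simp add: distr_moebius[OF assms(1)])

section \<open>Unfolding integrals over a fundamental domain\<close>

locale fundamental_tiling = fuchsian_matrices +
  fixes U :: "complex set"
  assumes U_sets: "U \<in> sets hyp_area"
    and U_disjoint: "A \<in> M ==> A \<noteq> mat 1 ==> A \<noteq> - mat 1 ==> moebius A ` U \<inter> U = {}"
    and U_covers: "uhp - (\<Union>A\<in>M. moebius A ` U) \<in> null_sets hyp_area"
begin

lemma U_uhp: "U \<subseteq> uhp" and U_borel: "U \<in> sets borel"
  using U_sets by (auto simp: sets_hyp_area_iff)

sublocale cs: sigma_finite_measure "count_space M"
  by (rule sigma_finite_measure_count_space_countable[OF countable_M])

sublocale pair_sigma_finite "count_space M" hyp_area ..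

text \<open>The two matrices over a single element of PSL(2,R) account for the factor 2 in all
  unfolding formulas.\<close>

lemma card_translates:
  assumes V: "V \<subseteq> uhp" "\<And>A. A \<in> M ==> A \<noteq> mat 1 ==> A \<noteq> - mat 1 ==> moebius A ` V \<inter> V = {}"
    and z: "z \<in> uhp" and A: "A \<in> M" "moebius A z \<in> V"
  shows "{B \<in> M. moebius B z \<in> V} = {A, - A}" "A \<noteq> - A"
proof -
  show "A \<noteq> - A"
  proof
    assume "A = - A"
    then have "A$1$1 = - A$1$1" "A$1$2 = - A$1$2" by (metis vector_uminus_component)+
    then have "A$1$1 = 0" "A$1$2 = 0" by simp_all
    then show False using det1[OF A(1)] by (simp add: det_2)
  qed
  show "{B \<in> M. moebius B z \<in> V} = {A, - A}"
  proof (intro equalityI subsetI)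
    fix B assume "B \<in> {B \<in> M. moebius B z \<in> V}"
    then have B: "B \<in> M" "moebius B z \<in> V" by auto
    have "moebius (B ** adj2 A) (moebius A z) = moebius B z"
      using A B z det1 by (simp add: moebius_mult uhp_iff Im_moebius_pos)
    then have "moebius (B ** adj2 A) ` V \<inter> V \<noteq> {}" using A B by (metis disjoint_iff imageI)
    then have "B ** adj2 A = mat 1 \<or> B ** adj2 A = - mat 1"
      using V(2) A B mult_mem adj2_mem by metis
    then have "B ** adj2 A ** A = A \<or> B ** adj2 A ** A = - A" by auto
    moreover have "B ** adj2 A ** A = B" using det1[OF A(1)] by (simp add: matrix_mul_assoc[symmetric])
    ultimately show "B \<in> {A, - A}" by auto
  qed (use A neg_mem in auto)
qed

lemma measurable_pair_moebius:
  fixes h :: "complex \<Rightarrow> 'b :: topological_space"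
  assumes "h \<in> borel_measurable hyp_area"
  shows "(\<lambda>(A, z). h (moebius A z)) \<in> borel_measurable (count_space M \<Otimes>\<^sub>M hyp_area)"
  using assms det1 by (intro measurable_pair_measure_countable1 countable_M) (auto intro: measurable_compose[OF measurable_moebius])

lemma tile_count:
  "AE z in hyp_area. z \<in> uhp \<and> (\<exists>A\<in>M. A \<noteq> - A \<and> {B \<in> M. moebius (adj2 B) z \<in> U} = {A, - A})"
  using AE_not_in[OF U_covers] AE_space
proof (eventually_elim, goal_cases)
  case (1 z)
  then have z: "z \<in> uhp" by simp
  then obtain A w where A: "A \<in> M" "w \<in> U" "z = moebius A w" using 1 by auto
  have w: "w \<in> uhp" using A U_uhp by auto
  have B: "adj2 A \<in> M" "moebius (adj2 A) z \<in> U" using A w det1[OF A(1)] adj2_mem by (auto simp: uhp_iff)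
  note c = card_translates[OF U_uhp U_disjoint z B]
  have "{B \<in> M. moebius (adj2 B) z \<in> U} = adj2 ` {B \<in> M. moebius B z \<in> U}"
  proof (intro equalityI subsetI)
    fix B assume "B \<in> {B \<in> M. moebius (adj2 B) z \<in> U}"
    then show "B \<in> adj2 ` {B \<in> M. moebius B z \<in> U}"
      using adj2_mem by (intro image_eqI[of _ _ "adj2 B"]) auto
  qed (use adj2_mem in auto)
  then have e: "{B \<in> M. moebius (adj2 B) z \<in> U} = {A, - A}" using c(1) by auto
  have ne: "A \<noteq> - A" using c(2) by (metis adj2_adj2 adj2_neg)
  show ?case using z A e ne by blast
qed

text \<open>Tonelli's theorem for the counting measure on the countable set \<open>M\<close>,
  followed by invariance of the area, shifts the translate from \<open>h\<close> to
  \<open>U\<close>. Almost every point then lies in the translate of \<open>U\<close> by precisely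
  two matrices.\<close>

lemma unfolding_nn:
  assumes h: "h \<in> borel_measurable hyp_area"
  shows "(\<integral>\<^sup>+z. (\<integral>\<^sup>+A. h (moebius A z) \<partial>count_space M) * indicator U z \<partial>hyp_area) = 2 * (\<integral>\<^sup>+z. h z \<partial>hyp_area)"
proof -
  have mU: "(indicator U :: complex \<Rightarrow> ennreal) \<in> borel_measurable hyp_area" using U_sets by simp
  have "(\<integral>\<^sup>+z. (\<integral>\<^sup>+A. h (moebius A z) \<partial>count_space M) * indicator U z \<partial>hyp_area)
      = (\<integral>\<^sup>+z. (\<integral>\<^sup>+A. h (moebius A z) * indicator U z \<partial>count_space M) \<partial>hyp_area)"
    by (intro nn_integral_cong) (simp add: nn_integral_multc)
  also have "... = (\<integral>\<^sup>+A. (\<integral>\<^sup>+z. h (moebius A z) * indicator U z \<partial>hyp_area) \<partial>count_space M)"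
  proof (rule Fubini')
    have "(\<lambda>x. (case x of (A, z) \<Rightarrow> h (moebius A z)) * indicator U (snd x)) \<in> borel_measurable (count_space M \<Otimes>\<^sub>M hyp_area)"
      using measurable_pair_moebius[OF h] mU by measurable
    then show "(\<lambda>(A, z). h (moebius A z) * indicator U z) \<in> borel_measurable (count_space M \<Otimes>\<^sub>M hyp_area)"
      by (simp add: case_prod_beta')
  qed
  also have "... = (\<integral>\<^sup>+A. (\<integral>\<^sup>+z. h z * indicator U (moebius (adj2 A) z) \<partial>hyp_area) \<partial>count_space M)"
  proof (rule nn_integral_cong)
    fix A assume "A \<in> space (count_space M)"
    then have A: "A \<in> M" "det A = 1" "det (adj2 A) = 1" using det1 by auto
    have "(\<integral>\<^sup>+z. h (moebius A z) * indicator U z \<partial>hyp_area) = (\<integral>\<^sup>+z. h (moebius A z) * indicator U (moebius (adj2 A) (moebius A z)) \<partial>hyp_area)"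
      using A by (intro nn_integral_cong) (simp add: uhp_iff)
    also have "... = (\<integral>\<^sup>+z. h z * indicator U (moebius (adj2 A) z) \<partial>hyp_area)"
      using h mU measurable_moebius[OF A(3)]
      by (intro nn_integral_moebius[OF A(2), of "\<lambda>z. h z * indicator U (moebius (adj2 A) z)"]) (auto intro: measurable_compose[OF measurable_moebius[OF A(3)]])
    finally show "(\<integral>\<^sup>+z. h (moebius A z) * indicator U z \<partial>hyp_area) = (\<integral>\<^sup>+z. h z * indicator U (moebius (adj2 A) z) \<partial>hyp_area)" .
  qed
  also have "... = (\<integral>\<^sup>+z. (\<integral>\<^sup>+A. h z * indicator U (moebius (adj2 A) z) \<partial>count_space M) \<partial>hyp_area)"
  proof (rule Fubini'[symmetric])
    show "(\<lambda>(A, z). h z * indicator U (moebius (adj2 A) z)) \<in> borel_measurable (count_space M \<Otimes>\<^sub>M hyp_area)"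
      using det1 h mU by (intro measurable_pair_measure_countable1 countable_M)
         (auto intro!: borel_measurable_times_ennreal measurable_compose[OF measurable_moebius])
  qed
  also have "... = (\<integral>\<^sup>+z. 2 * h z \<partial>hyp_area)"
  proof (rule nn_integral_cong_AE)
    show "AE z in hyp_area. (\<integral>\<^sup>+A. h z * indicator U (moebius (adj2 A) z) \<partial>count_space M) = 2 * h z"
      using tile_count
    proof (eventually_elim, goal_cases)
      case (1 z)
      then obtain A where A: "A \<in> M" "A \<noteq> - A" and e: "{B \<in> M. moebius (adj2 B) z \<in> U} = {A, - A}" by blast
      have "(\<integral>\<^sup>+B. h z * indicator U (moebius (adj2 B) z) \<partial>count_space M) = h z * (\<integral>\<^sup>+B. indicator U (moebius (adj2 B) z) \<partial>count_space M)"
        by (simp add: nn_integral_cmult)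
      also have "(\<integral>\<^sup>+B. indicator U (moebius (adj2 B) z) \<partial>count_space M) = (\<integral>\<^sup>+B. indicator {A, - A} B \<partial>count_space M)"
        by (rule nn_integral_cong) (use e in \<open>auto simp: indicator_def\<close>)
      also have "... = emeasure (count_space M) {A, - A}"
        using A neg_mem by (intro nn_integral_indicator) auto
      also have "... = 2" using A neg_mem by (subst emeasure_count_space) auto
      finally show ?case by (simp add: mult.commute)
    qed
  qed
  also have "... = 2 * (\<integral>\<^sup>+z. h z \<partial>hyp_area)" using h by (rule nn_integral_cmult)
  finally show ?thesis .
qed

text \<open>Unfolding applied to the indicator of \<open>V\<close>: an orbit meets \<open>V\<close>
  for at most two matrices. This compares any two fundamental domains and also bounds the number of
  disjoint balls embedded in the quotient.\<close>

lemma injected_area_le: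
  assumes V: "V \<in> sets hyp_area" "\<And>A. A \<in> M ==> A \<noteq> mat 1 ==> A \<noteq> - mat 1 ==> moebius A ` V \<inter> V = {}"
  shows "emeasure hyp_area V \<le> emeasure hyp_area U"
proof -
  have Vu: "V \<subseteq> uhp" using V(1) by (simp add: sets_hyp_area_iff)
  have "2 * emeasure hyp_area V = 2 * (\<integral>\<^sup>+z. indicator V z \<partial>hyp_area)" using V(1) by simp
  also have "... = (\<integral>\<^sup>+z. (\<integral>\<^sup>+A. indicator V (moebius A z) \<partial>count_space M) * indicator U z \<partial>hyp_area)"
    using V(1) by (intro unfolding_nn[symmetric]) auto
  also have "... \<le> (\<integral>\<^sup>+z. 2 * indicator U z \<partial>hyp_area)"
  proof (intro nn_integral_mono mult_right_mono)
    fix z assume "z \<in> space hyp_area"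
    then have z: "z \<in> uhp" by simp
    show "(\<integral>\<^sup>+A. indicator V (moebius A z) \<partial>count_space M) \<le> 2"
    proof (cases "\<exists>A\<in>M. moebius A z \<in> V")
      case True
      then obtain A where A: "A \<in> M" "moebius A z \<in> V" by blast
      note c = card_translates[OF Vu V(2) z A]
      have "(\<integral>\<^sup>+B. indicator V (moebius B z) \<partial>count_space M) = (\<integral>\<^sup>+B. indicator {A, - A} B \<partial>count_space M)"
        by (intro nn_integral_cong) (use c(1) in \<open>auto simp: indicator_def\<close>)
      also have "... = emeasure (count_space M) {A, - A}"
        using A neg_mem by (intro nn_integral_indicator) auto
      also have "... = 2" using A neg_mem c(2) by (subst emeasure_count_space) auto
      finally show ?thesis by simp
    next
      case False
      then have "(\<integral>\<^sup>+B. indicator V (moebius B z) \<partial>count_space M) = (\<integral>\<^sup>+B. 0 \<partial>count_space M)"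
        by (intro nn_integral_cong) (auto simp: indicator_def)
      then show ?thesis by simp
    qed
  qed simp
  also have "... = 2 * emeasure hyp_area U" using U_sets by (subst nn_integral_cmult) auto
  finally show ?thesis by (simp add: ennreal_mult_le_mult_iff)
qed

text \<open>The same exchange for Bochner integrals. Absolute integrability on the product comes
  from unfolding the norm.\<close>

lemma unfolding_integral:
  fixes \<phi> :: "complex \<Rightarrow> complex"
  assumes \<phi>: "integrable hyp_area \<phi>"
  shows "(\<integral>z. indicator U z *\<^sub>R (\<integral>A. \<phi> (moebius A z) \<partial>count_space M) \<partial>hyp_area) = 2 * (\<integral>z. \<phi> z \<partial>hyp_area)"
    and "integrable hyp_area (\<lambda>z. indicator U z *\<^sub>R (\<integral>A. \<phi> (moebius A z) \<partial>count_space M))"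
proof -
  have m\<phi>: "\<phi> \<in> borel_measurable hyp_area" using \<phi> by auto
  have mU: "(indicator U :: complex \<Rightarrow> real) \<in> borel_measurable hyp_area" using U_sets by simp
  let ?F = "\<lambda>A z. indicator U z *\<^sub>R \<phi> (moebius A z)"
  let ?F' = "\<lambda>A z. indicator U (moebius (adj2 A) z) *\<^sub>R \<phi> z"
  have meas: "case_prod ?F \<in> borel_measurable (count_space M \<Otimes>\<^sub>M hyp_area)"
  proof -
    have "(\<lambda>x. indicator U (snd x) *\<^sub>R (case x of (A, z) \<Rightarrow> \<phi> (moebius A z))) \<in> borel_measurable (count_space M \<Otimes>\<^sub>M hyp_area)"
      using measurable_pair_moebius[OF m\<phi>] mU by measurable
    then show ?thesis by (simp add: case_prod_beta')
  qed
  have meas': "case_prod ?F' \<in> borel_measurable (count_space M \<Otimes>\<^sub>M hyp_area)"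
      using det1 m\<phi> mU by (intro measurable_pair_measure_countable1 countable_M)
         (auto intro!: borel_measurable_scaleR measurable_compose[OF measurable_moebius])
  have fin: "(\<integral>\<^sup>+z. (\<integral>\<^sup>+A. ennreal (norm (\<phi> (moebius A z))) \<partial>count_space M) * indicator U z \<partial>hyp_area) < \<infinity>"
    using unfolding_nn[of "\<lambda>z. ennreal (norm (\<phi> z))"] \<phi> m\<phi>
    by (simp add: integrable_iff_bounded ennreal_mult_less_top)
  have int: "integrable (count_space M \<Otimes>\<^sub>M hyp_area) (case_prod ?F)"
  proof (subst integrable_iff_bounded, intro conjI meas)
    have "(\<integral>\<^sup>+x. ennreal (norm (case_prod ?F x)) \<partial>(count_space M \<Otimes>\<^sub>M hyp_area)) =
       (\<integral>\<^sup>+z. (\<integral>\<^sup>+A. ennreal (norm (?F A z)) \<partial>count_space M) \<partial>hyp_area)"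
      using measurable_compose[OF meas, of "\<lambda>x. ennreal (norm x)" borel] by (subst nn_integral_snd[symmetric]) (simp_all add: case_prod_beta')
    also have "... = (\<integral>\<^sup>+z. (\<integral>\<^sup>+A. ennreal (norm (\<phi> (moebius A z))) \<partial>count_space M) * indicator U z \<partial>hyp_area)"
      by (intro nn_integral_cong) (auto simp: indicator_def)
    finally show "(\<integral>\<^sup>+x. ennreal (norm (case_prod ?F x)) \<partial>(count_space M \<Otimes>\<^sub>M hyp_area)) < \<infinity>" using fin by simp
  qed
  have e1: "(\<integral>A. ?F A z \<partial>count_space M) = indicator U z *\<^sub>R (\<integral>A. \<phi> (moebius A z) \<partial>count_space M)" for z
    by (cases "z \<in> U") auto
  show "integrable hyp_area (\<lambda>z. indicator U z *\<^sub>R (\<integral>A. \<phi> (moebius A z) \<partial>count_space M))"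
    using integrable_snd[OF int] by (simp add: e1)
  have "(\<integral>z. indicator U z *\<^sub>R (\<integral>A. \<phi> (moebius A z) \<partial>count_space M) \<partial>hyp_area) = (\<integral>z. (\<integral>A. ?F A z \<partial>count_space M) \<partial>hyp_area)"
    by (simp add: e1)
  also have "... = (\<integral>A. (\<integral>z. ?F A z \<partial>hyp_area) \<partial>count_space M)" by (rule Fubini_integral[OF int])
  also have "... = (\<integral>A. (\<integral>z. ?F' A z \<partial>hyp_area) \<partial>count_space M)"
  proof (rule Bochner_Integration.integral_cong[OF refl])
    fix A assume "A \<in> space (count_space M)"
    then have A: "A \<in> M" "det A = 1" "det (adj2 A) = 1" using det1 by auto
    have "(\<integral>z. ?F A z \<partial>hyp_area) = (\<integral>z. ?F' A (moebius A z) \<partial>hyp_area)"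
      using A by (intro Bochner_Integration.integral_cong) (auto simp: uhp_iff)
    also have "... = (\<integral>z. ?F' A z \<partial>hyp_area)"
      using m\<phi> mU by (intro integral_moebius[OF A(2), of "?F' A"] borel_measurable_scaleR measurable_compose[OF measurable_moebius[OF A(3)]])
    finally show "(\<integral>z. ?F A z \<partial>hyp_area) = (\<integral>z. ?F' A z \<partial>hyp_area)" .
  qed
  also have "... = (\<integral>z. (\<integral>A. ?F' A z \<partial>count_space M) \<partial>hyp_area)"
  proof (rule Fubini_integral[symmetric])
    show "integrable (count_space M \<Otimes>\<^sub>M hyp_area) (case_prod ?F')"
    proof (subst integrable_iff_bounded, intro conjI meas')
      have "(\<integral>\<^sup>+x. ennreal (norm (case_prod ?F' x)) \<partial>(count_space M \<Otimes>\<^sub>M hyp_area)) =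
         (\<integral>\<^sup>+z. (\<integral>\<^sup>+A. ennreal (norm (?F' A z)) \<partial>count_space M) \<partial>hyp_area)"
        using measurable_compose[OF meas', of "\<lambda>x. ennreal (norm x)" borel] by (subst nn_integral_snd[symmetric]) (simp_all add: case_prod_beta')
      also have "... = (\<integral>\<^sup>+z. 2 * ennreal (norm (\<phi> z)) \<partial>hyp_area)"
      proof (rule nn_integral_cong_AE)
        show "AE z in hyp_area. (\<integral>\<^sup>+A. ennreal (norm (?F' A z)) \<partial>count_space M) = 2 * ennreal (norm (\<phi> z))"
          using tile_count
        proof (eventually_elim, goal_cases)
          case (1 z)
          then obtain A where A: "A \<in> M" "A \<noteq> - A" and e: "{B \<in> M. moebius (adj2 B) z \<in> U} = {A, - A}" by blast
          have "(\<integral>\<^sup>+B. ennreal (norm (?F' B z)) \<partial>count_space M) = (\<integral>\<^sup>+B. ennreal (norm (\<phi> z)) * indicator {A, - A} B \<partial>count_space M)"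
            by (rule nn_integral_cong) (use e in \<open>auto simp: indicator_def\<close>)
          also have "... = ennreal (norm (\<phi> z)) * emeasure (count_space M) {A, - A}"
            using A neg_mem by (subst nn_integral_cmult_indicator) auto
          also have "emeasure (count_space M) {A, - A} = 2" using A neg_mem by (subst emeasure_count_space) auto
          finally show ?case by (simp add: mult.commute)
        qed
      qed
      also have "... = 2 * (\<integral>\<^sup>+z. ennreal (norm (\<phi> z)) \<partial>hyp_area)" using m\<phi> by (intro nn_integral_cmult) auto
      also have "... < \<infinity>" using \<phi> by (simp add: integrable_iff_bounded ennreal_mult_less_top)
      finally show "(\<integral>\<^sup>+x. ennreal (norm (case_prod ?F' x)) \<partial>(count_space M \<Otimes>\<^sub>M hyp_area)) < \<infinity>" .
    qed
  qed
  also have "... = (\<integral>z. 2 * \<phi> z \<partial>hyp_area)"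
  proof (rule integral_cong_AE)
    show "(\<lambda>z. \<integral>A. ?F' A z \<partial>count_space M) \<in> borel_measurable hyp_area"
      using measurable_compose[OF measurable_pair_swap' meas'] cs.borel_measurable_lebesgue_integral[of "\<lambda>z A. ?F' A z" hyp_area]
      by (simp add: case_prod_beta')
    show "(\<lambda>z. 2 * \<phi> z) \<in> borel_measurable hyp_area" using m\<phi> by auto
    show "AE z in hyp_area. (\<integral>A. ?F' A z \<partial>count_space M) = 2 * \<phi> z"
      using tile_count
    proof (eventually_elim, goal_cases)
      case (1 z)
      then obtain A where A: "A \<in> M" "A \<noteq> - A" and e: "{B \<in> M. moebius (adj2 B) z \<in> U} = {A, - A}" by blast
      have "(\<integral>B. ?F' B z \<partial>count_space M) = (\<integral>B. indicator {A, - A} B *\<^sub>R \<phi> z \<partial>count_space M)"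
        by (rule Bochner_Integration.integral_cong[OF refl]) (use e in \<open>auto simp: indicator_def\<close>)
      also have "... = measure (count_space M) {A, - A} *\<^sub>R \<phi> z"
        using A neg_mem by (subst integral_scaleR_left) (auto simp: Int_absorb2 integrable_indicator_iff)
      also have "measure (count_space M) {A, - A} = 2" using A neg_mem by (subst measure_count_space) auto
      finally show ?case by (simp add: scaleR_conv_of_real)
    qed
  qed
  also have "... = 2 * (\<integral>z. \<phi> z \<partial>hyp_area)" by simp
  finally show "(\<integral>z. indicator U z *\<^sub>R (\<integral>A. \<phi> (moebius A z) \<partial>count_space M) \<partial>hyp_area) = 2 * (\<integral>z. \<phi> z \<partial>hyp_area)" .
qed

end

section \<open>From Fuchsian groups to matrices\<close>

lemma PSL_proj_eq: "PSL_proj A = {A, - A}"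
  by (auto simp: PSL_proj_def r_coset_def SL2R_def)

lemma PSL2R_carrier: "carrier PSL2R = PSL_proj ` {A. det A = 1}"
  by (auto simp: PSL2R_def FactGroup_def RCOSETS_def PSL_proj_def SL2R_def)

lemma PSL2R_one: "\<one>\<^bsub>PSL2R\<^esub> = {mat 1, - mat 1}"
  by (simp add: PSL2R_def FactGroup_def)

lemma PSL2R_mult: "PSL_proj A \<otimes>\<^bsub>PSL2R\<^esub> PSL_proj B = PSL_proj (A ** B)"
  by (auto simp: PSL2R_def FactGroup_def set_mult_def PSL_proj_eq SL2R_def)

lemma PSL_proj_eq_iff: "PSL_proj A = PSL_proj B \<longleftrightarrow> A = B \<or> A = - B"
  by (auto simp: PSL_proj_eq doubleton_eq_iff)

lemma PSL_proj_one: "PSL_proj A = \<one>\<^bsub>PSL2R\<^esub> \<longleftrightarrow> A = mat 1 \<or> A = - mat 1"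
  by (auto simp: PSL_proj_eq PSL2R_one doubleton_eq_iff)

lemma PSL2R_inv:
  assumes A: "det A = 1" shows "inv\<^bsub>PSL2R\<^esub> (PSL_proj A) = PSL_proj (adj2 A)"
  unfolding m_inv_def
proof (rule the_equality)
  have "PSL_proj (adj2 A) \<in> carrier PSL2R" using A by (auto simp: PSL2R_carrier)
  then show "PSL_proj (adj2 A) \<in> carrier PSL2R \<and> PSL_proj A \<otimes>\<^bsub>PSL2R\<^esub> PSL_proj (adj2 A) = \<one>\<^bsub>PSL2R\<^esub> \<and>
      PSL_proj (adj2 A) \<otimes>\<^bsub>PSL2R\<^esub> PSL_proj A = \<one>\<^bsub>PSL2R\<^esub>"
    using A by (simp add: PSL2R_mult PSL_proj_one)
next
  fix y assume y: "y \<in> carrier PSL2R \<and> PSL_proj A \<otimes>\<^bsub>PSL2R\<^esub> y = \<one>\<^bsub>PSL2R\<^esub> \<and> y \<otimes>\<^bsub>PSL2R\<^esub> PSL_proj A = \<one>\<^bsub>PSL2R\<^esub>"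
  then obtain B where B: "det B = 1" "y = PSL_proj B" by (auto simp: PSL2R_carrier)
  then have "A ** B = mat 1 \<or> A ** B = - mat 1" using y by (simp add: PSL2R_mult PSL_proj_one)
  then have "adj2 A ** (A ** B) = adj2 A \<or> adj2 A ** (A ** B) = - adj2 A" by auto
  then show "y = PSL_proj (adj2 A)" using A B by (simp add: PSL_proj_eq_iff)
qed

lemma norm_ge_det: "det A = 1 ==> norm A \<ge> 1" for A :: "real^2^2"
proof -
  assume "det A = 1"
  then have "A$1$1 * A$2$2 - A$1$2 * A$2$1 = 1" by (simp only: det_2)
  moreover have "a * d - b * c = 1 ==> 1 \<le> a\<^sup>2 + b\<^sup>2 + c\<^sup>2 + d\<^sup>2" for a b c d :: real
    using zero_le_power2[of "a - d"] zero_le_power2[of "b + c"] by (simp add: power2_eq_square algebra_simps)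
  ultimately have "1 \<le> (norm A)\<^sup>2" unfolding norm2_mat2 by blast
  then show "norm A \<ge> 1" by (metis one_power2 norm_ge_zero power2_le_imp_le)
qed

lemma subgroup_matrices:
  assumes G: "subgroup \<Gamma> PSL2R"
  shows "A \<in> \<Union>\<Gamma> \<longleftrightarrow> det A = 1 \<and> PSL_proj A \<in> \<Gamma>"
    and "\<gamma> \<in> \<Gamma> ==> A \<in> \<gamma> ==> \<gamma> = PSL_proj A"
proof -
  have sub: "\<Gamma> \<subseteq> PSL_proj ` {A. det A = 1}" using subgroup.subset[OF G] by (simp add: PSL2R_carrier)
  have e: "\<gamma> = PSL_proj A \<and> det A = 1" if h: "\<gamma> \<in> \<Gamma>" "A \<in> \<gamma>" for \<gamma> A
  proof -
    obtain B where B: "det B = 1" "\<gamma> = PSL_proj B" using sub h by auto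
    then have "A = B \<or> A = - B" using h by (auto simp: PSL_proj_eq)
    then show ?thesis using B by (auto simp: PSL_proj_eq)
  qed
  show "\<gamma> \<in> \<Gamma> ==> A \<in> \<gamma> ==> \<gamma> = PSL_proj A" using e by blast
  show "A \<in> \<Union>\<Gamma> \<longleftrightarrow> det A = 1 \<and> PSL_proj A \<in> \<Gamma>"
    using e by (auto simp: PSL_proj_eq)
qed

text \<open>Discreteness of the quotient topology at the identity yields a norm ball around 1
  containing only central elements of the preimage. Translating it by inverses makes every bounded
  part uniformly discrete, hence finite.\<close>

lemma fuchsian_matrices_Union:
  assumes F: "fuchsian \<Gamma>" and ell: "\<forall>\<gamma>\<in>\<Gamma>. \<not> elliptic \<gamma>"
  shows "fuchsian_matrices (\<Union>\<Gamma>)"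
proof -
  have G: "subgroup \<Gamma> PSL2R" and disc: "subtopology PSL2R_topology \<Gamma> = discrete_topology \<Gamma>"
    using F by (auto simp: fuchsian_def)
  note m = subgroup_matrices(1)[OF G]
  have one: "\<one>\<^bsub>PSL2R\<^esub> \<in> \<Gamma>" using G by (rule subgroup.one_closed)
  have "openin (subtopology PSL2R_topology \<Gamma>) {\<one>\<^bsub>PSL2R\<^esub>}" unfolding disc using one by simp
  then obtain V where V: "openin PSL2R_topology V" "{\<one>\<^bsub>PSL2R\<^esub>} = V \<inter> \<Gamma>" by (auto simp: openin_subtopology)
  have "openin (top_of_set (carrier SL2R)) {x \<in> carrier SL2R. PSL_proj x \<in> V}"
    using V(1) by (simp add: PSL2R_topology_def openin_quotient_topology)
  moreover have "mat 1 \<in> {x \<in> carrier SL2R. PSL_proj x \<in> V}" using V(2) PSL_proj_one by (auto simp: SL2R_def)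
  ultimately obtain e where e: "e > 0" "\<And>x. det x = 1 ==> dist x (mat 1) < e ==> PSL_proj x \<in> V"
    using det_I[where ?'a = real and ?'n = 2] by (simp only: openin_euclidean_subtopology_iff SL2R_def partial_object.simps mem_Collect_eq) blast
  have near: "A = mat 1 \<or> A = - mat 1" if "A \<in> \<Union>\<Gamma>" "norm (A - mat 1) < e" for A
  proof -
    have "PSL_proj A \<in> V \<inter> \<Gamma>" using that e m by (auto simp: dist_norm)
    then show ?thesis using V(2) PSL_proj_one by blast
  qed
  have adj: "adj2 A \<in> \<Union>\<Gamma>" if "A \<in> \<Union>\<Gamma>" for A
    using that subgroup.m_inv_closed[OF G, of "PSL_proj A"] unfolding m by (auto simp: PSL2R_inv)
  have mlt: "A ** B \<in> \<Union>\<Gamma>" if "A \<in> \<Union>\<Gamma>" "B \<in> \<Union>\<Gamma>" for A B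
    using that subgroup.m_closed[OF G, of "PSL_proj A" "PSL_proj B"] unfolding m by (auto simp: PSL2R_mult det_mul)
  show ?thesis
  proof
    show "det A = 1" if "A \<in> \<Union>\<Gamma>" for A using that unfolding m by blast
    show "mat 1 \<in> \<Union>\<Gamma>" using one unfolding m by (simp add: PSL_proj_eq PSL2R_one)
    have "PSL_proj (- A) = PSL_proj A" for A by (simp add: PSL_proj_eq_iff)
    then show "- A \<in> \<Union>\<Gamma>" if "A \<in> \<Union>\<Gamma>" for A using that unfolding m by simp
    show "A ** B \<in> \<Union>\<Gamma>" if "A \<in> \<Union>\<Gamma>" "B \<in> \<Union>\<Gamma>" for A B using mlt that by blast
    show "adj2 A \<in> \<Union>\<Gamma>" if "A \<in> \<Union>\<Gamma>" for A using adj that by blast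
    show "\<bar>trace A\<bar> \<ge> 2" if "A \<in> \<Union>\<Gamma>" for A using that ell by (force simp: elliptic_def)
    show "finite {A \<in> \<Union>\<Gamma>. norm A \<le> R}" for R
    proof -
      let ?S = "{A \<in> \<Union>\<Gamma>. norm A \<le> R}"
      \<comment> \<open>The second bound brings \<open>adj2 A ** B\<close> within e of 1, so that B
        is A or - A. The first excludes B = - A, which is at distance 2 \<open>norm A\<close>, at
        least 2.\<close>
      define d where "d = min 1 (e / (\<bar>R\<bar> + 1))"
      have d0: "d > 0" using e by (simp add: d_def)
      have "A = B" if AB: "A \<in> ?S" "B \<in> ?S" and dd: "dist A B < d" for A B
      proof -
        have dA: "det A = 1" using AB m by blast
        have "adj2 A ** B - mat 1 = adj2 A ** (B - A)"
        proof -
          have "adj2 A ** (B - A) = adj2 A ** B - adj2 A ** A" by (rule mat2_eqI) (simp_all add: algebra_simps)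
          then show ?thesis using dA by simp
        qed
        then have "norm (adj2 A ** B - mat 1) \<le> norm A * norm (B - A)"
          using norm_mult_mat2[of "adj2 A" "B - A"] by simp
        also have "... \<le> (\<bar>R\<bar> + 1) * dist A B" using AB by (intro mult_mono) (auto simp: dist_norm norm_minus_commute)
        also have "... < (\<bar>R\<bar> + 1) * (e / (\<bar>R\<bar> + 1))" using dd by (intro mult_strict_left_mono) (auto simp: d_def)
        also have "... = e" by simp
        finally have lt: "norm (adj2 A ** B - mat 1) < e" .
        have mem: "adj2 A ** B \<in> \<Union>\<Gamma>" using AB by (intro mlt adj) auto
        have "adj2 A ** B = mat 1 \<or> adj2 A ** B = - mat 1" by (rule near[OF mem lt])
        then have "A ** (adj2 A ** B) = A \<or> A ** (adj2 A ** B) = - A" by auto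
        then have BA: "B = A \<or> B = - A" using dA by simp
        show "A = B"
        proof (rule ccontr)
          assume "A \<noteq> B"
          then have "dist A B = 2 * norm A" using BA by (auto simp: dist_norm simp flip: scaleR_2)
          then show False using dd norm_ge_det[OF dA] by (simp add: d_def)
        qed
      qed
      then have "uniform_discrete ?S" unfolding uniform_discrete_def using d0 by blast
      moreover have "bounded ?S" by (rule boundedI[of _ R]) auto
      ultimately show ?thesis using uniform_discrete_finite_iff by blast
    qed
  qed
qed

text \<open>Only the measure-theoretic content of a domain is retained: a point missed by all
  translates of \<open>U\<close> lies in a translate of its frontier, and countably many null sets
  form a null set.\<close>

lemma fundamental_tiling_domain:
  assumes F: "fuchsian \<Gamma>" and ell: "\<forall>\<gamma>\<in>\<Gamma>. \<not> elliptic \<gamma>" and U: "fundamental_domain \<Gamma> U"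
  shows "fundamental_tiling (\<Union>\<Gamma>) U"
proof -
  interpret fuchsian_matrices "\<Union>\<Gamma>" by (rule fuchsian_matrices_Union[OF F ell])
  have G: "subgroup \<Gamma> PSL2R" using F by (simp add: fuchsian_def)
  have Uo: "open U" "U \<subseteq> uhp" and N: "frontier U \<inter> uhp \<in> null_sets hyp_area"
    and cov: "\<And>z. z \<in> uhp ==> orbit_of \<Gamma> z \<inter> closure U \<noteq> {}"
    and dis: "\<And>\<gamma> A. \<gamma> \<in> \<Gamma> ==> \<gamma> \<noteq> \<one>\<^bsub>PSL2R\<^esub> ==> A \<in> \<gamma> ==> moebius A ` U \<inter> U = {}"
    using U by (auto simp: fundamental_domain_def)
  let ?N = "frontier U \<inter> uhp"
  have US: "U \<in> sets hyp_area" using Uo by (simp add: sets_hyp_area_iff)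
  have im: "moebius A ` B = moebius (adj2 A) -` B \<inter> space hyp_area" if "det A = 1" "B \<subseteq> uhp" for A B
  proof (intro equalityI subsetI)
    fix w assume "w \<in> moebius (adj2 A) -` B \<inter> space hyp_area"
    then have "w = moebius A (moebius (adj2 A) w)" "moebius (adj2 A) w \<in> B" using that by (auto simp: uhp_iff)
    then show "w \<in> moebius A ` B" by blast
  qed (use that in \<open>auto simp: uhp_iff subset_iff Im_moebius_pos\<close>)
  have ims: "moebius A ` B \<in> sets hyp_area" "emeasure hyp_area (moebius A ` B) = emeasure hyp_area B"
    if A: "det A = 1" and B: "B \<in> sets hyp_area" for A B
  proof -
    have Bu: "B \<subseteq> uhp" using B by (simp add: sets_hyp_area_iff)
    have d: "det (adj2 A) = 1" using A by simp
    show "moebius A ` B \<in> sets hyp_area" unfolding im[OF A Bu] using measurable_moebius[OF d] B by (rule measurable_sets)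
    have "emeasure hyp_area B = emeasure (distr hyp_area hyp_area (moebius (adj2 A))) B" by (simp add: distr_moebius[OF d])
    also have "... = emeasure hyp_area (moebius A ` B)"
      unfolding im[OF A Bu] using measurable_moebius[OF d] B by (rule emeasure_distr)
    finally show "emeasure hyp_area (moebius A ` B) = emeasure hyp_area B" by simp
  qed
  show ?thesis
  proof
    show "U \<in> sets hyp_area" by (rule US)
    show "moebius A ` U \<inter> U = {}" if "A \<in> \<Union>\<Gamma>" "A \<noteq> mat 1" "A \<noteq> - mat 1" for A
      using that dis subgroup_matrices[OF G] by (metis PSL_proj_one UnionE)
    have null: "(\<Union>A\<in>\<Union>\<Gamma>. moebius A ` ?N) \<in> null_sets hyp_area"
    proof (rule null_sets_UN'[OF countable_M])
      fix A assume "A \<in> \<Union>\<Gamma>"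
      then show "moebius A ` ?N \<in> null_sets hyp_area"
        using N det1 ims[of A ?N] by (auto simp: null_sets_def)
    qed
    have sub: "uhp - (\<Union>A\<in>\<Union>\<Gamma>. moebius A ` U) \<subseteq> (\<Union>A\<in>\<Union>\<Gamma>. moebius A ` ?N)"
    proof
      fix z assume z: "z \<in> uhp - (\<Union>A\<in>\<Union>\<Gamma>. moebius A ` U)"
      then have "orbit_of \<Gamma> z \<inter> closure U \<noteq> {}" using cov by blast
      then obtain A where A: "A \<in> \<Union>\<Gamma>" "moebius A z \<in> closure U" unfolding orbit_of_def by blast
      have e: "z = moebius (adj2 A) (moebius A z)" using z A det1 by (simp add: uhp_iff)
      have "moebius A z \<notin> U" using z adj2_mem[OF A(1)] e by (metis DiffD2 UN_I imageI)
      moreover have "moebius A z \<in> uhp" using z A moebius_mem by (simp add: uhp_iff)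
      ultimately have "moebius A z \<in> ?N" using A Uo by (simp add: frontier_def interior_open)
      then show "z \<in> (\<Union>A\<in>\<Union>\<Gamma>. moebius A ` ?N)" using e adj2_mem[OF A(1)] by blast
    qed
    have "uhp - (\<Union>A\<in>\<Union>\<Gamma>. moebius A ` U) \<in> sets hyp_area"
    proof -
      have "(\<Union>A\<in>\<Union>\<Gamma>. moebius A ` U) \<in> sets hyp_area"
        using det1 ims US by (intro sets.countable_UN' countable_M) auto
      then show ?thesis using sets.top[of hyp_area] by (metis sets.Diff space_hyp_area)
    qed
    then show "uhp - (\<Union>A\<in>\<Union>\<Gamma>. moebius A ` U) \<in> null_sets hyp_area"
      by (rule null_sets_subset[OF null _ sub])
  qed
qed

section \<open>The area of the fundamental polygon\<close>

lemma distr_Complex: "distr (lborel \<Otimes>\<^sub>M lborel) borel (\<lambda>(x, y). Complex x y) = lborel"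
proof (rule lborel_eqI[symmetric])
  have c: "(\<lambda>(x, y). Complex x y) \<in> borel_measurable borel"
    by (intro borel_measurable_continuous_onI) (auto simp: case_prod_beta' Complex_eq intro!: continuous_intros)
  fix l u :: complex assume lu: "\<And>b. b \<in> Basis ==> l \<bullet> b \<le> u \<bullet> b"
  have lu': "Re l \<le> Re u" "Im l \<le> Im u" using lu[of 1] lu[of \<i>] by (auto simp: Basis_complex_def)
  have v: "(\<lambda>(x, y). Complex x y) -` box l u = {Re l<..<Re u} \<times> {Im l<..<Im u}"
    by (auto simp: in_box_complex_iff)
  have "emeasure (distr (lborel \<Otimes>\<^sub>M lborel) borel (\<lambda>(x, y). Complex x y)) (box l u) = emeasure (lborel \<Otimes>\<^sub>M lborel) ({Re l<..<Re u} \<times> {Im l<..<Im u})"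
    using c by (subst emeasure_distr) (simp_all add: lborel_prod v)
  also have "... = ennreal (Re u - Re l) * ennreal (Im u - Im l)"
    using lu' by (subst lborel.emeasure_pair_measure_Times) auto
  also have "... = ennreal (\<Prod>b\<in>Basis. (u - l) \<bullet> b)"
    using lu' by (subst ennreal_mult[symmetric]) (auto simp: Basis_complex_def complex_i_not_one[symmetric] simp del: complex_i_not_one)
  finally show "emeasure (distr (lborel \<Otimes>\<^sub>M lborel) borel (\<lambda>(x, y). Complex x y)) (box l u) = ennreal (\<Prod>b\<in>Basis. (u - l) \<bullet> b)" .
qed simp

lemma measurable_Complex: "(\<lambda>(x, y). Complex x y) \<in> measurable (lborel \<Otimes>\<^sub>M lborel) borel"
proof -
  have "(\<lambda>(x, y). Complex x y) \<in> borel_measurable borel"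
    by (intro borel_measurable_continuous_onI) (auto simp: case_prod_beta' Complex_eq intro!: continuous_intros)
  then show ?thesis by (simp add: lborel_prod)
qed

lemma nn_integral_complex:
  assumes f: "f \<in> borel_measurable borel"
  shows "(\<integral>\<^sup>+z. f z \<partial>lborel) = (\<integral>\<^sup>+y. (\<integral>\<^sup>+x. f (Complex x y) \<partial>lborel) \<partial>lborel)"
proof -
  have m: "(\<lambda>p. f (case p of (x, y) \<Rightarrow> Complex x y)) \<in> borel_measurable (lborel \<Otimes>\<^sub>M lborel)"
    using measurable_compose[OF measurable_Complex f] .
  have "(\<integral>\<^sup>+z. f z \<partial>lborel) = (\<integral>\<^sup>+z. f z \<partial>distr (lborel \<Otimes>\<^sub>M lborel) borel (\<lambda>(x, y). Complex x y))"
    by (simp only: distr_Complex)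
  also have "... = (\<integral>\<^sup>+p. f (case p of (x, y) \<Rightarrow> Complex x y) \<partial>(lborel \<Otimes>\<^sub>M lborel))"
    using f measurable_Complex by (intro nn_integral_distr) auto
  also have "... = (\<integral>\<^sup>+y. (\<integral>\<^sup>+x. f (Complex x y) \<partial>lborel) \<partial>lborel)"
    using m by (subst lborel_pair.nn_integral_snd[symmetric]) auto
  finally show ?thesis .
qed

lemma hyp_area_strip_finite:
  assumes "R \<ge> 0"
  shows "emeasure hyp_area {z. \<bar>Re z\<bar> \<le> R \<and> 1 \<le> Im z} < \<infinity>"
proof -
  let ?E = "{z. \<bar>Re z\<bar> \<le> R \<and> 1 \<le> Im z}"
  have E: "?E \<in> sets hyp_area"
  proof -
    have "?E = {z. \<bar>Re z\<bar> \<le> R} \<inter> {z. 1 \<le> Im z}" by auto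
    moreover have "closed {z. \<bar>Re z\<bar> \<le> R}" "closed {z::complex. 1 \<le> Im z}"
      by (intro closed_Collect_le continuous_intros)+
    ultimately show ?thesis by (auto simp: sets_hyp_area_iff uhp_iff)
  qed
  have Eb: "?E \<in> sets borel" using E by (simp add: sets_hyp_area_iff)
  have "emeasure hyp_area ?E = (\<integral>\<^sup>+z. indicator ?E z * ennreal (1 / (2 * (Im z)\<^sup>2)) * indicator uhp z \<partial>lborel)"
    using E by (subst nn_integral_hyp_area[symmetric]) auto
  also have "... = (\<integral>\<^sup>+y. (\<integral>\<^sup>+x. indicator ?E (Complex x y) * ennreal (1 / (2 * (Im (Complex x y))\<^sup>2)) * indicator uhp (Complex x y) \<partial>lborel) \<partial>lborel)"
    using Eb by (intro nn_integral_complex) auto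
  also have "... \<le> (\<integral>\<^sup>+y. (\<integral>\<^sup>+x. ennreal (1 / (2 * y\<^sup>2)) * indicator {1..} y * indicator {-R..R} x \<partial>lborel) \<partial>lborel)"
    by (intro nn_integral_mono) (auto simp: indicator_def)
  also have "... = (\<integral>\<^sup>+y. ennreal (1 / (2 * y\<^sup>2)) * indicator {1..} y * ennreal (2 * R) \<partial>lborel)"
    using assms by (subst nn_integral_cmult_indicator) auto
  also have "... = (\<integral>\<^sup>+y. ennreal (1 / (2 * y\<^sup>2)) * indicator {1..} y \<partial>lborel) * ennreal (2 * R)"
    by (intro nn_integral_multc) auto
  also have "(\<integral>\<^sup>+y. ennreal (1 / (2 * y\<^sup>2)) * indicator {1..} y \<partial>lborel) = ennreal (0 - (- 1 / (2 * 1)))"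
  proof (rule nn_integral_FTC_atLeast[where F = "\<lambda>y. - 1 / (2 * y)"])
    fix y :: real assume "1 \<le> y"
    then show "((\<lambda>y. - 1 / (2 * y)) has_real_derivative 1 / (2 * y\<^sup>2)) (at y)"
      by (auto intro!: derivative_eq_intros simp: power2_eq_square field_simps)
  next
    have "((\<lambda>y::real. - (1/2) * inverse y) \<longlongrightarrow> - (1/2) * 0) at_top"
      by (intro tendsto_intros tendsto_inverse_0_at_top filterlim_ident)
    then show "((\<lambda>y::real. - 1 / (2 * y)) \<longlongrightarrow> 0) at_top" by (simp add: field_simps)
  qed auto
  also have "ennreal (0 - (- 1 / (2 * 1))) * ennreal (2 * R) < \<infinity>"
    by (simp only: ennreal_mult_less_top infinity_ennreal_def ennreal_less_top simp_thms)
  finally show ?thesis .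
qed

text \<open>The horizontal sections have length 2 K y^2, which cancels the density y^(-2). A polygon
  has this shape near an ideal vertex, between two sides tangent to each other.\<close>

lemma hyp_area_parabola_finite:
  assumes "K \<ge> 0"
  shows "emeasure hyp_area {z. \<bar>Re z - t\<bar> \<le> K * (Im z)\<^sup>2 \<and> 0 < Im z \<and> Im z \<le> 1} < \<infinity>"
proof -
  let ?E = "{z. \<bar>Re z - t\<bar> \<le> K * (Im z)\<^sup>2 \<and> 0 < Im z \<and> Im z \<le> 1}"
  have E: "?E \<in> sets hyp_area"
  proof -
    have "?E = {z. \<bar>Re z - t\<bar> \<le> K * (Im z)\<^sup>2} \<inter> {z. Im z \<le> 1} \<inter> {z. 0 < Im z}" by auto
    moreover have "closed {z. \<bar>Re z - t\<bar> \<le> K * (Im z)\<^sup>2}" "closed {z::complex. Im z \<le> 1}" "open {z::complex. 0 < Im z}"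
      by (intro closed_Collect_le open_Collect_less continuous_intros)+
    ultimately show ?thesis by (auto simp: sets_hyp_area_iff uhp_iff)
  qed
  have Eb: "?E \<in> sets borel" using E by (simp add: sets_hyp_area_iff)
  have "emeasure hyp_area ?E = (\<integral>\<^sup>+z. indicator ?E z * ennreal (1 / (2 * (Im z)\<^sup>2)) * indicator uhp z \<partial>lborel)"
    using E by (subst nn_integral_hyp_area[symmetric]) auto
  also have "... = (\<integral>\<^sup>+y. (\<integral>\<^sup>+x. indicator ?E (Complex x y) * ennreal (1 / (2 * (Im (Complex x y))\<^sup>2)) * indicator uhp (Complex x y) \<partial>lborel) \<partial>lborel)"
    using Eb by (intro nn_integral_complex) auto
  also have "... \<le> (\<integral>\<^sup>+y. (\<integral>\<^sup>+x. ennreal (1 / (2 * y\<^sup>2)) * indicator {0<..1} y * indicator {t - K * y\<^sup>2..t + K * y\<^sup>2} x \<partial>lborel) \<partial>lborel)"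
    by (intro nn_integral_mono) (auto simp: indicator_def)
  also have "... = (\<integral>\<^sup>+y. ennreal (1 / (2 * y\<^sup>2)) * indicator {0<..1} y * ennreal (2 * (K * y\<^sup>2)) \<partial>lborel)"
    using assms by (subst nn_integral_cmult_indicator) auto
  also have "... \<le> (\<integral>\<^sup>+y. ennreal K * indicator {0<..1} (y::real) \<partial>lborel)"
  proof (rule nn_integral_mono)
    fix y :: real
    show "ennreal (1 / (2 * y\<^sup>2)) * indicator {0<..1} y * ennreal (2 * (K * y\<^sup>2)) \<le> ennreal K * indicator {0<..1} y"
      using assms by (auto simp: indicator_def ennreal_mult[symmetric])
  qed
  also have "... = ennreal K" by (subst nn_integral_cmult_indicator) auto
  finally show ?thesis by (simp add: le_less_trans)
qed

lemma hyp_area_ball_finite: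
  assumes "Im w > 0"
  shows "emeasure hyp_area (ball w (Im w / 2)) < \<infinity>"
proof -
  let ?B = "ball w (Im w / 2)"
  have im: "Im z \<ge> Im w / 2" if "z \<in> ?B" for z
    using that abs_Im_le_cmod[of "w - z"] by (auto simp: dist_norm)
  then have B: "?B \<in> sets hyp_area" using assms by (force simp: sets_hyp_area_iff uhp_iff)
  have "emeasure hyp_area ?B = (\<integral>\<^sup>+z. indicator ?B z * ennreal (1 / (2 * (Im z)\<^sup>2)) * indicator uhp z \<partial>lborel)"
    using B by (subst nn_integral_hyp_area[symmetric]) auto
  also have "... \<le> (\<integral>\<^sup>+z. ennreal (1 / (2 * (Im w / 2)\<^sup>2)) * indicator ?B z \<partial>lborel)"
  proof (intro nn_integral_mono)
    fix z
    show "indicator ?B z * ennreal (1 / (2 * (Im z)\<^sup>2)) * indicator uhp z \<le> ennreal (1 / (2 * (Im w / 2)\<^sup>2)) * indicator ?B z"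
    proof (cases "z \<in> ?B")
      case True
      then have "(Im w / 2)\<^sup>2 \<le> (Im z)\<^sup>2" using im assms by (intro power_mono) auto
      moreover have "Im z > 0" using im[OF True] assms by linarith
      ultimately have "1 / (2 * (Im z)\<^sup>2) \<le> 1 / (2 * (Im w / 2)\<^sup>2)" using assms by (intro divide_left_mono) auto
      then show ?thesis using True by (auto simp: indicator_def ennreal_leI)
    qed simp
  qed
  also have "... = ennreal (1 / (2 * (Im w / 2)\<^sup>2)) * emeasure lborel ?B" by (subst nn_integral_cmult_indicator) auto
  also have "... < \<infinity>" using emeasure_lborel_ball_finite[of w "Im w / 2"] by (simp add: ennreal_mult_less_top)
  finally show ?thesis .
qed

text \<open>For a group of the first kind some orbit accumulates at t. Two of its points, the second
  nearer to t than the first and hence different from it, would both lie in \<open>P\<close>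
  although a group element joins them.\<close>

lemma limit_set_no_free_point:
  assumes F: "fuchsian \<Gamma>" and fk: "first_kind \<Gamma>"
    and dis: "\<And>\<gamma> A. \<gamma> \<in> \<Gamma> ==> \<gamma> \<noteq> \<one>\<^bsub>PSL2R\<^esub> ==> A \<in> \<gamma> ==> moebius A ` P \<inter> P = {}"
    and r: "r > 0" and free: "ball (of_real t) r \<inter> uhp \<subseteq> P"
  shows False
proof -
  have G: "subgroup \<Gamma> PSL2R" using F by (simp add: fuchsian_def)
  have "Some (complex_of_real t) \<in> limit_set \<Gamma>" using fk by (auto simp: first_kind_def boundary_uhp_def)
  then obtain z where z: "z \<in> uhp" "Some (complex_of_real t) \<in> Alexandroff_compactification euclidean derived_set_of (Some ` orbit_of \<Gamma> z)"
    by (auto simp: limit_set_def)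
  have ex: "\<exists>w\<in>orbit_of \<Gamma> z. w \<in> ball (of_real t) s" if "s > 0" for s
  proof -
    have "openin (Alexandroff_compactification euclidean) (Some ` ball (complex_of_real t) s)"
      by (auto simp: openin_Alexandroff_compactification)
    moreover have "Some (complex_of_real t) \<in> Some ` ball (complex_of_real t) s" using that by auto
    ultimately show ?thesis using z(2) unfolding in_derived_set_of by blast
  qed
  have orb: "w \<in> uhp" if "w \<in> orbit_of \<Gamma> z" for w
    using that z subgroup_matrices(1)[OF G] by (auto simp: orbit_of_def uhp_iff intro!: Im_moebius_pos)
  obtain w1 where w1: "w1 \<in> orbit_of \<Gamma> z" "w1 \<in> ball (of_real t) r" using ex r by blast
  have ne: "w1 \<noteq> of_real t" using orb[OF w1(1)] by (auto simp: uhp_iff)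
  obtain w2 where w2: "w2 \<in> orbit_of \<Gamma> z" "w2 \<in> ball (of_real t) (dist (of_real t) w1)"
    using ex[of "dist (of_real t) w1"] ne by auto
  have "w2 \<noteq> w1" "w2 \<in> ball (of_real t) r" using w1 w2 by auto
  then have P: "w1 \<in> P" "w2 \<in> P" using free orb w1 w2 by auto
  obtain A B where AB: "A \<in> \<Union>\<Gamma>" "B \<in> \<Union>\<Gamma>" "w1 = moebius A z" "w2 = moebius B z"
    using w1 w2 by (auto simp: orbit_of_def)
  have d: "det A = 1" "det B = 1" "PSL_proj A \<in> \<Gamma>" "PSL_proj B \<in> \<Gamma>" using AB subgroup_matrices(1)[OF G] by blast+
  let ?C = "B ** adj2 A"
  have C: "PSL_proj ?C \<in> \<Gamma>"
    using subgroup.m_closed[OF G d(4) subgroup.m_inv_closed[OF G d(3)]] d by (simp add: PSL2R_inv PSL2R_mult)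
  have "moebius ?C w1 = w2" using AB d z by (simp add: moebius_mult uhp_iff Im_moebius_pos)
  then have ne1: "?C \<noteq> mat 1" "?C \<noteq> - mat 1" using \<open>w2 \<noteq> w1\<close> by (metis moebius_mat1 moebius_neg)+
  then have "PSL_proj ?C \<noteq> \<one>\<^bsub>PSL2R\<^esub>" by (simp add: PSL_proj_one)
  moreover have "?C \<in> PSL_proj ?C" by (simp add: PSL_proj_eq)
  ultimately have "moebius ?C ` P \<inter> P = {}" using dis[OF C] by blast
  then show False using P \<open>moebius ?C w1 = w2\<close> by blast
qed

text \<open>Being of the first kind forbids a real point at which all side conditions are strictly
  satisfied. So near a real point either one side excludes \<open>P\<close> altogether, or sides end
  there from both directions and squeeze \<open>P\<close> into a parabola; compactness of a
  rectangle and a vertical strip do the rest.\<close>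

lemma finite_area_polygon:
  assumes F: "fuchsian \<Gamma>" and fk: "first_kind \<Gamma>"
    and P: "fundamental_domain \<Gamma> P" "finite_sided_convex_polygon P"
  shows "emeasure hyp_area P < \<infinity>"
proof -
  obtain \<H> where H: "finite \<H>" "\<forall>S\<in>\<H>. hyp_half_plane S" "P = uhp \<inter> \<Inter>\<H>"
    using P(2) by (auto simp: finite_sided_convex_polygon_def)
  have "\<forall>S\<in>\<H>. \<exists>q. case q of (a, b, c) \<Rightarrow> b\<^sup>2 - 4 * a * c > 0 \<and> S = {z \<in> uhp. a * (cmod z)\<^sup>2 + b * Re z + c > 0}"
    using H(2) by (auto simp: hyp_half_plane_def)
  from bchoice[OF this] obtain q where q: "\<forall>S\<in>\<H>. case q S of (a, b, c) \<Rightarrow> b\<^sup>2 - 4 * a * c > 0 \<and> S = {z \<in> uhp. a * (cmod z)\<^sup>2 + b * Re z + c > 0}"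
    by blast
  define a b c where "a = (\<lambda>S. fst (q S))" and "b = (\<lambda>S. fst (snd (q S)))" and "c = (\<lambda>S. snd (snd (q S)))"
  have abc: "(b S)\<^sup>2 - 4 * a S * c S > 0" "S = {z \<in> uhp. a S * (cmod z)\<^sup>2 + b S * Re z + c S > 0}" if "S \<in> \<H>" for S
    using q that by (auto simp: a_def b_def c_def split: prod.splits)
  define Q where "Q = (\<lambda>S z. a S * (cmod z)\<^sup>2 + b S * Re z + c S)"
  \<comment> \<open>The side conditions restricted to the real axis, which decide whether
    \<open>P\<close> reaches a boundary point.\<close>
  define R where "R = (\<lambda>S x. a S * x\<^sup>2 + b S * x + c S)"
  have QR: "Q S (of_real x) = R S x" for S x by (simp add: Q_def R_def)
  have Pm: "z \<in> P \<longleftrightarrow> z \<in> uhp \<and> (\<forall>S\<in>\<H>. Q S z > 0)" for z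
    unfolding H(3) using abc(2) by (auto simp: Q_def)
  have contQ: "continuous_on UNIV (Q S)" for S unfolding Q_def by (intro continuous_intros)
  have contR: "isCont (R S) x" for S x unfolding R_def by (intro continuous_intros)
  have dis: "\<And>\<gamma> A. \<gamma> \<in> \<Gamma> ==> \<gamma> \<noteq> \<one>\<^bsub>PSL2R\<^esub> ==> A \<in> \<gamma> ==> moebius A ` P \<inter> P = {}"
    using P(1) by (auto simp: fundamental_domain_def)
  have nofree: "\<exists>S\<in>\<H>. R S t \<le> 0" for t
  proof (rule ccontr)
    assume "\<not> (\<exists>S\<in>\<H>. R S t \<le> 0)"
    then have pos: "\<forall>S\<in>\<H>. Q S (of_real t) > 0" by (auto simp: QR not_le)
    have "open (\<Inter>S\<in>\<H>. {z. Q S z > 0})"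
      using H(1) contQ by (intro open_INT ballI open_Collect_less) auto
    then obtain r where r: "r > 0" "ball (of_real t) r \<subseteq> (\<Inter>S\<in>\<H>. {z. Q S z > 0})"
      using pos open_contains_ball by (metis (no_types, lifting) INT_I mem_Collect_eq)
    have free: "ball (of_real t) r \<inter> uhp \<subseteq> P" using r(2) by (auto simp: Pm)
    show False by (rule limit_set_no_free_point[of \<Gamma> P r t, OF F fk _ r(1) free]) (rule dis)
  qed
  have Pb: "P \<in> sets hyp_area" using P(1) by (auto simp: fundamental_domain_def sets_hyp_area_iff)
  have fin_sub: "emeasure hyp_area E < \<infinity>" if "E \<subseteq> E'" "emeasure hyp_area E' < \<infinity>" "E' \<in> sets hyp_area" for E E'
    using emeasure_mono[OF that(1,3)] that(2) by (rule le_less_trans)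
  \<comment> \<open>\<open>P\<close> is bounded horizontally. Either a side with a < 0 places it
    under a semicircle, or no real point far out may satisfy all conditions, which forces a vertical
    side towards each end.\<close>
  obtain X where X: "X \<ge> 0" "\<And>z. z \<in> P ==> \<bar>Re z\<bar> \<le> X"
  proof (cases "\<exists>S\<in>\<H>. a S < 0")
    case True
    then obtain S where S: "S \<in> \<H>" "a S < 0" by blast
    define X where "X = \<bar>b S\<bar> / \<bar>a S\<bar> + \<bar>c S\<bar> / \<bar>a S\<bar> + 1"
    have "\<bar>Re z\<bar> \<le> X" if "z \<in> P" for z
    proof (rule ccontr)
      assume "\<not> \<bar>Re z\<bar> \<le> X"
      then have big: "\<bar>Re z\<bar> > X" by simp
      have X1: "X \<ge> 1" by (simp add: X_def)
      have "Q S z > 0" using that S by (simp add: Pm)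
      then have "\<bar>a S\<bar> * (cmod z)\<^sup>2 < b S * Re z + c S" using S by (simp add: Q_def)
      also have "... \<le> \<bar>b S\<bar> * \<bar>Re z\<bar> + \<bar>c S\<bar>" by (metis abs_ge_self abs_mult add_mono)
      also have "\<bar>c S\<bar> \<le> \<bar>c S\<bar> * \<bar>Re z\<bar>" using big X1 mult_left_mono[of 1 "\<bar>Re z\<bar>" "\<bar>c S\<bar>"] by simp
      finally have "\<bar>a S\<bar> * (cmod z)\<^sup>2 < (\<bar>b S\<bar> + \<bar>c S\<bar>) * \<bar>Re z\<bar>" by (simp add: algebra_simps)
      moreover have "\<bar>Re z\<bar> * \<bar>Re z\<bar> \<le> (cmod z)\<^sup>2" unfolding cmod_power2 by (simp add: power2_eq_square)
      then have "\<bar>a S\<bar> * (\<bar>Re z\<bar> * \<bar>Re z\<bar>) \<le> \<bar>a S\<bar> * (cmod z)\<^sup>2" by (intro mult_left_mono) auto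
      ultimately have "(\<bar>a S\<bar> * \<bar>Re z\<bar>) * \<bar>Re z\<bar> < (\<bar>b S\<bar> + \<bar>c S\<bar>) * \<bar>Re z\<bar>" by (simp add: mult.assoc)
      then have "\<bar>a S\<bar> * \<bar>Re z\<bar> < \<bar>b S\<bar> + \<bar>c S\<bar>" using big X1 by (simp add: mult_less_cancel_right)
      moreover have "\<bar>a S\<bar> * X \<le> \<bar>a S\<bar> * \<bar>Re z\<bar>" using big by (intro mult_left_mono) auto
      moreover have "\<bar>a S\<bar> * X = \<bar>b S\<bar> + \<bar>c S\<bar> + \<bar>a S\<bar>" using S by (simp add: X_def field_simps)
      ultimately show False by simp
    qed
    moreover have "X \<ge> 0" by (simp add: X_def)
    ultimately show thesis using that by blast
  next
    case False
    then have a0: "a S \<ge> 0" if "S \<in> \<H>" for S using that by force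
    have b0: "b S \<noteq> 0" if "S \<in> \<H>" "a S = 0" for S using abc(1)[OF that(1)] that(2) by auto
    have lim: "eventually (\<lambda>x. a' * x\<^sup>2 + b' * x + c' > 0) at_top" if "a' > 0 \<or> (a' = 0 \<and> b' > 0)" for a' b' c' :: real
    proof -
      have "filterlim (\<lambda>x. a' * x\<^sup>2 + b' * x + c') at_top at_top"
        using that
      proof
        assume "a' > 0" then show ?thesis by real_asymp
      next
        assume "a' = 0 \<and> b' > 0" then show ?thesis by simp real_asymp
      qed
      then show ?thesis by (rule filterlim_at_top_dense[THEN iffD1, rule_format])
    qed
    have "\<exists>S\<in>\<H>. a S = 0 \<and> b S < 0"
    proof (rule ccontr)
      assume no: "\<not> (\<exists>S\<in>\<H>. a S = 0 \<and> b S < 0)"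
      have "\<forall>S\<in>\<H>. eventually (\<lambda>x. R S x > 0) at_top"
        unfolding R_def using no a0 b0 by (intro ballI lim) (metis linorder_neqE_linordered_idom order_le_less)
      then have "eventually (\<lambda>x. \<forall>S\<in>\<H>. R S x > 0) at_top" using H(1) by (simp add: eventually_ball_finite)
      then obtain x where "\<forall>S\<in>\<H>. R S x > 0" using eventually_happens by force
      then show False using nofree[of x] by force
    qed
    then obtain S1 where S1: "S1 \<in> \<H>" "a S1 = 0" "b S1 < 0" by blast
    have "\<exists>S\<in>\<H>. a S = 0 \<and> b S > 0"
    proof (rule ccontr)
      assume no: "\<not> (\<exists>S\<in>\<H>. a S = 0 \<and> b S > 0)"
      have "\<forall>S\<in>\<H>. eventually (\<lambda>x. a S * x\<^sup>2 + (- b S) * x + c S > 0) at_top"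
        using no a0 b0 by (intro ballI lim) (metis linorder_neqE_linordered_idom neg_0_less_iff_less order_le_less)
      then have "\<forall>S\<in>\<H>. eventually (\<lambda>x. R S (- x) > 0) at_top" by (simp add: R_def)
      then have "eventually (\<lambda>x. \<forall>S\<in>\<H>. R S (- x) > 0) at_top" using H(1) by (simp add: eventually_ball_finite)
      then obtain x where "\<forall>S\<in>\<H>. R S (- x) > 0" using eventually_happens by force
      then show False using nofree[of "- x"] by force
    qed
    then obtain S2 where S2: "S2 \<in> \<H>" "a S2 = 0" "b S2 > 0" by blast
    define X where "X = \<bar>c S1 / b S1\<bar> + \<bar>c S2 / b S2\<bar>"
    have "\<bar>Re z\<bar> \<le> X" if "z \<in> P" for z
    proof -
      have "b S1 * Re z + c S1 > 0" "b S2 * Re z + c S2 > 0" using that S1 S2 Pm[of z] by (auto simp: Q_def)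
      moreover define u1 u2 where "u1 = c S1 / b S1" and "u2 = c S2 / b S2"
      ultimately have e: "c S1 = u1 * b S1" "c S2 = u2 * b S2" "b S1 * Re z + c S1 > 0" "b S2 * Re z + c S2 > 0" using S1 S2 by auto
      then have "(- b S1) * (Re z + u1) < 0" "b S2 * (Re z + u2) > 0" by (simp_all add: algebra_simps)
      then have "Re z < - u1" "Re z > - u2" using S1 S2 by (auto simp: mult_less_0_iff zero_less_mult_iff)
      then have "\<bar>Re z\<bar> \<le> \<bar>u1\<bar> + \<bar>u2\<bar>" by linarith
      then show ?thesis by (simp only: X_def u1_def u2_def)
    qed
    moreover have "X \<ge> 0" by (simp add: X_def)
    ultimately show thesis using that by blast
  qed
  have loc: "\<exists>V. open V \<and> w \<in> V \<and> emeasure hyp_area (P \<inter> V) < \<infinity>" if w: "Im w \<ge> 0" for w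
  proof (cases "Im w > 0")
    case True
    have "ball w (Im w / 2) \<in> sets hyp_area"
    proof -
      have "Im z > 0" if "z \<in> ball w (Im w / 2)" for z
        using that abs_Im_le_cmod[of "w - z"] True by (auto simp: dist_norm)
      then show ?thesis by (auto simp: sets_hyp_area_iff uhp_iff)
    qed
    then have "emeasure hyp_area (P \<inter> ball w (Im w / 2)) < \<infinity>"
      by (rule fin_sub[OF _ hyp_area_ball_finite[OF True], rotated]) simp
    then show ?thesis using True by (intro exI[of _ "ball w (Im w / 2)"]) auto
  next
    case False
    define t where "t = Re w"
    have wt: "w = of_real t" using False w by (simp add: t_def complex_eq_iff)
    show ?thesis
    proof (cases "\<exists>S\<in>\<H>. R S t < 0")
      case True
      then obtain S where S: "S \<in> \<H>" "R S t < 0" by blast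
      have "open {z. Q S z < 0}" using contQ by (intro open_Collect_less) auto
      moreover have "P \<inter> {z. Q S z < 0} = {}" using S by (force simp: Pm)
      ultimately show ?thesis using S by (intro exI[of _ "{z. Q S z < 0}"]) (auto simp: wt QR)
    next
      case False
      then have nn: "R S t \<ge> 0" if "S \<in> \<H>" for S using that by force
      define d where "d = (\<lambda>S. 2 * a S * t + b S)"
      \<comment> \<open>The discriminant equals (d S)^2 - 4 a R at t, so a zero of
        \<open>R S\<close> is simple and the side really crosses the axis at t.\<close>
      have d0: "d S \<noteq> 0" if "S \<in> \<H>" "R S t = 0" for S
      proof
        assume "d S = 0"
        have "(b S)\<^sup>2 - 4 * a S * c S = (d S)\<^sup>2 - 4 * a S * R S t"
          by (simp add: d_def R_def power2_eq_square algebra_simps)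
        then show False using abc(1)[OF that(1)] that \<open>d S = 0\<close> by simp
      qed
      have RT: "R S (t + h) = R S t + h * (d S + a S * h)" for S h
        by (simp add: R_def d_def power2_eq_square algebra_simps)
      have QT: "Q S z = R S t + a S * (cmod (z - of_real t))\<^sup>2 + d S * (Re z - t)" for S z
        unfolding cmod_power2 Q_def R_def d_def by (simp add: power2_eq_square algebra_simps)
      \<comment> \<open>If no side ending at t faced away from the direction s, all conditions would
        hold strictly at t + s h for small h > 0, contrary to \<open>nofree\<close>. Taking s = 1
        and s = -1 gives one side for each direction.\<close>
      have sgn: "\<exists>S\<in>\<H>. R S t = 0 \<and> s * d S < 0" if s: "s = 1 \<or> s = -1" for s :: real
      proof (rule ccontr)
        assume no: "\<not> (\<exists>S\<in>\<H>. R S t = 0 \<and> s * d S < 0)"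
        have "\<forall>S\<in>\<H>. eventually (\<lambda>h. R S (t + s * h) > 0) (at_right 0)"
        proof
          fix S assume S: "S \<in> \<H>"
          show "eventually (\<lambda>h. R S (t + s * h) > 0) (at_right 0)"
          proof (cases "R S t = 0")
            case True
            then have sd: "s * d S > 0" using no S d0[OF S True] s by (metis linorder_neqE_linordered_idom mult_eq_0_iff one_neq_zero zero_neq_neg_one)
            have "((\<lambda>h. s * d S + a S * h) \<longlongrightarrow> s * d S + a S * 0) (at_right 0)" by (intro tendsto_intros)
            then have "eventually (\<lambda>h. s * d S + a S * h > 0) (at_right 0)" using sd by (intro order_tendstoD(1)) auto
            moreover have "eventually (\<lambda>h::real. h > 0) (at_right 0)" by (rule eventually_at_right_less)
            ultimately show ?thesis
            proof eventually_elim
              case (elim h)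
              have "R S (t + s * h) = h * (s * d S + a S * h)" using s True by (auto simp: RT algebra_simps)
              then show ?case using elim by simp
            qed
          next
            case False
            then have "R S t > 0" using nn[OF S] by simp
            moreover have "((\<lambda>h. R S (t + s * h)) \<longlongrightarrow> R S (t + s * 0)) (at_right 0)"
              by (intro isCont_tendsto_compose[OF contR] tendsto_intros)
            ultimately show ?thesis by (intro order_tendstoD(1)) auto
          qed
        qed
        then have "eventually (\<lambda>h. \<forall>S\<in>\<H>. R S (t + s * h) > 0) (at_right 0)" using H(1) by (simp add: eventually_ball_finite)
        then obtain h where "\<forall>S\<in>\<H>. R S (t + s * h) > 0"
          using eventually_happens[of _ "at_right (0::real)"] by force
        then show False using nofree[of "t + s * h"] by force
      qed
      obtain S1 where S1: "S1 \<in> \<H>" "R S1 t = 0" "d S1 < 0" using sgn[of 1] by auto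
      obtain S2 where S2: "S2 \<in> \<H>" "R S2 t = 0" "d S2 > 0" using sgn[of "-1"] by auto
      define K where "K = \<bar>a S1 / d S1\<bar> + \<bar>a S2 / d S2\<bar> + 1"
      have K: "K \<ge> 1" by (simp add: K_def)
      \<comment> \<open>With this radius K |Re z - t| is at most 1/2, so the quadratic term in Re z
        - t is absorbed on the left and only a multiple of (Im z)^2 remains.\<close>
      define \<rho> where "\<rho> = 1 / (2 * K)"
      have \<rho>: "\<rho> > 0" "K * \<rho> = 1/2" "\<rho> \<le> 1" using K by (auto simp: \<rho>_def field_simps)
      let ?E = "{z. \<bar>Re z - t\<bar> \<le> (2 * K) * (Im z)\<^sup>2 \<and> 0 < Im z \<and> Im z \<le> 1}"
      have "P \<inter> ball (of_real t) \<rho> \<subseteq> ?E"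
      proof
        fix z assume z: "z \<in> P \<inter> ball (of_real t) \<rho>"
        let ?n = "(cmod (z - of_real t))\<^sup>2"
        have lt: "cmod (z - of_real t) < \<rho>" using z by (simp add: dist_norm norm_minus_commute)
        have "a S1 * ?n + d S1 * (Re z - t) > 0" "a S2 * ?n + d S2 * (Re z - t) > 0"
          using z S1 S2 QT[of S1 z] QT[of S2 z] by (auto simp: Pm)
        then have "Re z - t < - (a S1 / d S1) * ?n" "Re z - t > - (a S2 / d S2) * ?n"
          using S1 S2 by (auto simp: field_simps)
        moreover have "- (a S1 / d S1) * ?n \<le> K * ?n" "- K * ?n \<le> - (a S2 / d S2) * ?n"
        proof -
          have h: "- (a S1 / d S1) \<le> K" "- K \<le> - (a S2 / d S2)" unfolding K_def by linarith+
          show "- (a S1 / d S1) * ?n \<le> K * ?n" by (rule mult_right_mono[OF h(1)]) simp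
          show "- K * ?n \<le> - (a S2 / d S2) * ?n" by (rule mult_right_mono[OF h(2)]) simp
        qed
        ultimately have "\<bar>Re z - t\<bar> \<le> K * ?n" by simp
        also have "?n = \<bar>Re z - t\<bar> * \<bar>Re z - t\<bar> + (Im z)\<^sup>2"
          unfolding cmod_power2 by (simp add: power2_eq_square)
        also have "K * (\<bar>Re z - t\<bar> * \<bar>Re z - t\<bar> + (Im z)\<^sup>2) \<le> 1/2 * \<bar>Re z - t\<bar> + K * (Im z)\<^sup>2"
        proof -
          have "\<bar>Re z - t\<bar> \<le> \<rho>" using abs_Re_le_cmod[of "z - of_real t"] lt by simp
          then have "K * \<bar>Re z - t\<bar> \<le> 1/2" using K \<rho>(2) by (metis mult_left_mono order_trans zero_le_one)
          then have "(K * \<bar>Re z - t\<bar>) * \<bar>Re z - t\<bar> \<le> 1/2 * \<bar>Re z - t\<bar>" by (intro mult_right_mono) auto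
          then show ?thesis by (simp add: algebra_simps)
        qed
        finally have "\<bar>Re z - t\<bar> \<le> (2 * K) * (Im z)\<^sup>2" by simp
        moreover have "Im z \<le> 1" using abs_Im_le_cmod[of "z - of_real t"] lt \<rho>(3) by simp
        ultimately show "z \<in> ?E" using z by (auto simp: Pm uhp_iff)
      qed
      moreover have E: "emeasure hyp_area ?E < \<infinity>" using K by (intro hyp_area_parabola_finite) auto
      moreover have "?E \<in> sets hyp_area"
      proof -
        have "?E = {z. \<bar>Re z - t\<bar> \<le> (2 * K) * (Im z)\<^sup>2} \<inter> {z. Im z \<le> 1} \<inter> {z. 0 < Im z}" by auto
        moreover have "closed {z. \<bar>Re z - t\<bar> \<le> (2 * K) * (Im z)\<^sup>2}" "closed {z::complex. Im z \<le> 1}" "open {z::complex. 0 < Im z}"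
          by (intro closed_Collect_le open_Collect_less continuous_intros)+
        ultimately show ?thesis by (auto simp: sets_hyp_area_iff uhp_iff)
      qed
      ultimately have "emeasure hyp_area (P \<inter> ball (of_real t) \<rho>) < \<infinity>" by (rule fin_sub)
      then show ?thesis using \<rho> wt by (intro exI[of _ "ball (of_real t) \<rho>"]) auto
    qed
  qed
  define K where "K = cbox (Complex (- X) 0) (Complex X 1)"
  have cK: "compact K" by (simp add: K_def)
  have "\<forall>w\<in>K. \<exists>V. open V \<and> w \<in> V \<and> emeasure hyp_area (P \<inter> V) < \<infinity>"
  proof
    fix w assume "w \<in> K"
    then have "Im w \<ge> 0" by (simp add: K_def in_cbox_complex_iff)
    then show "\<exists>V. open V \<and> w \<in> V \<and> emeasure hyp_area (P \<inter> V) < \<infinity>" by (rule loc)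
  qed
  from bchoice[OF this] obtain V where V: "\<forall>w\<in>K. open (V w) \<and> w \<in> V w \<and> emeasure hyp_area (P \<inter> V w) < \<infinity>" by blast
  obtain W where W: "W \<subseteq> K" "finite W" "K \<subseteq> (\<Union>w\<in>W. V w)"
  proof (rule compactE_image[OF cK, of K V])
    show "open (V w)" if "w \<in> K" for w using V that by blast
    show "K \<subseteq> (\<Union>w\<in>K. V w)" using V by blast
  qed (rule that)
  let ?S = "{z. \<bar>Re z\<bar> \<le> X \<and> 1 \<le> Im z}"
  have S: "?S \<in> sets hyp_area"
  proof -
    have "?S = {z. \<bar>Re z\<bar> \<le> X} \<inter> {z. 1 \<le> Im z}" by auto
    moreover have "closed {z. \<bar>Re z\<bar> \<le> X}" "closed {z::complex. 1 \<le> Im z}"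
      by (intro closed_Collect_le continuous_intros)+
    ultimately show ?thesis by (auto simp: sets_hyp_area_iff uhp_iff)
  qed
  have PV: "P \<inter> V w \<in> sets hyp_area" if "w \<in> W" for w
    using Pb V W that by (auto simp: sets_hyp_area_iff)
  have PVU: "(\<Union>w\<in>W. P \<inter> V w) \<in> sets hyp_area" using PV W(2) by (intro sets.finite_UN) auto
  have "P \<subseteq> ?S \<union> (\<Union>w\<in>W. P \<inter> V w)"
  proof
    fix z assume z: "z \<in> P"
    show "z \<in> ?S \<union> (\<Union>w\<in>W. P \<inter> V w)"
    proof (cases "Im z \<ge> 1")
      case False
      moreover have "- X \<le> Re z" "Re z \<le> X" using X(2)[OF z] by linarith+
      moreover have "Im z > 0" using z by (simp add: Pm uhp_iff)
      ultimately have "z \<in> K" by (simp add: K_def in_cbox_complex_iff)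
      then show ?thesis using W z by auto
    qed (use z X in auto)
  qed
  moreover have "emeasure hyp_area (?S \<union> (\<Union>w\<in>W. P \<inter> V w)) < \<infinity>"
  proof -
    have "emeasure hyp_area (?S \<union> (\<Union>w\<in>W. P \<inter> V w)) \<le> emeasure hyp_area ?S + emeasure hyp_area (\<Union>w\<in>W. P \<inter> V w)"
      by (rule emeasure_subadditive[OF S PVU])
    also have "... \<le> emeasure hyp_area ?S + (\<Sum>w\<in>W. emeasure hyp_area (P \<inter> V w))"
      using PV W by (intro add_left_mono emeasure_subadditive_finite) auto
    also have "... < \<infinity>" using hyp_area_strip_finite[OF X(1)] V W by (auto simp: ennreal_add_less_top less_top[symmetric])
    finally show ?thesis .
  qed
  ultimately show ?thesis by (rule fin_sub) (rule sets.Un[OF S PVU])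
qed

section \<open>The thick part\<close>

definition hball :: "complex \<Rightarrow> real \<Rightarrow> complex set" where
  "hball w d = {z. Im z > 0 \<and> hypu w z < d}"

lemma hball_sets: "hball w d \<in> sets hyp_area"
proof -
  have "continuous_on uhp (\<lambda>z. hypu w z)" if "Im w \<noteq> 0"
    unfolding hypu_def using that by (intro continuous_intros) (auto simp: uhp_iff)
  moreover have "continuous_on uhp (\<lambda>z. hypu w z)" if "Im w = 0"
    unfolding hypu_def using that by simp
  ultimately have c: "continuous_on uhp (\<lambda>z. hypu w z)" by blast
  have "open (uhp \<inter> (\<lambda>z. hypu w z) -` {..<d})" by (rule continuous_open_preimage[OF c open_uhp]) simp
  moreover have "uhp \<inter> (\<lambda>z. hypu w z) -` {..<d} = hball w d" by (auto simp: hball_def uhp_iff)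
  ultimately show ?thesis by (auto simp: sets_hyp_area_iff hball_def uhp_iff)
qed

lemma hball_image:
  assumes A: "det A = 1" and w: "Im w > 0"
  shows "z \<in> uhp ==> moebius A z \<in> hball (moebius A w) d \<longleftrightarrow> z \<in> hball w d"
  using assms by (simp add: hball_def uhp_iff Im_moebius_pos hypu_moebius)

lemma emeasure_hball:
  assumes w: "Im w > 0"
  shows "emeasure hyp_area (hball w d) = emeasure hyp_area (hball \<i> d)"
proof -
  note T = to_pt[OF w]
  have "emeasure hyp_area (hball w d) = (\<integral>\<^sup>+z. indicator (hball w d) z \<partial>hyp_area)" using hball_sets by simp
  also have "... = (\<integral>\<^sup>+z. indicator (hball w d) (moebius (to_pt w) z) \<partial>hyp_area)"
    using hball_sets by (intro nn_integral_moebius[symmetric] T) auto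
  also have "... = (\<integral>\<^sup>+z. indicator (hball \<i> d) z \<partial>hyp_area)"
    using hball_image[OF T(1), of \<i> _ d] by (intro nn_integral_cong) (simp add: T(2) indicator_def)
  also have "... = emeasure hyp_area (hball \<i> d)" using hball_sets by simp
  finally show ?thesis .
qed

lemma emeasure_hball_pos:
  assumes d: "d > 0" shows "emeasure hyp_area (hball \<i> d) > 0"
proof -
  define r where "r = min (1/2) (sqrt d / 2)"
  have r: "r > 0" "r \<le> 1/2" "r\<^sup>2 < d"
  proof -
    show "r > 0" "r \<le> 1/2" using d by (auto simp: r_def)
    have "r\<^sup>2 \<le> (sqrt d / 2)\<^sup>2" using \<open>r > 0\<close> by (intro power_mono) (auto simp: r_def)
    then show "r\<^sup>2 < d" using d by (simp add: power_divide)
  qed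
  have im: "1/2 < Im z" "Im z < 3/2" if "z \<in> ball \<i> r" for z
    using that abs_Im_le_cmod[of "\<i> - z"] r by (auto simp: dist_norm abs_le_iff)
  have sub: "ball \<i> r \<subseteq> hball \<i> d"
  proof
    fix z assume z: "z \<in> ball \<i> r"
    have "(cmod (\<i> - z))\<^sup>2 \<le> r\<^sup>2" using z by (intro power_mono) (auto simp: dist_norm)
    moreover have "hypu \<i> z \<le> (cmod (\<i> - z))\<^sup>2 / 1"
      unfolding hypu_def using im[OF z] by (intro divide_left_mono) auto
    ultimately have "hypu \<i> z < d" using r(3) by linarith
    then show "z \<in> hball \<i> d" using im[OF z] by (auto simp: hball_def)
  qed
  have B: "ball \<i> r \<in> sets hyp_area" using im by (force simp: sets_hyp_area_iff uhp_iff)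
  have "0 < ennreal (2/9) * emeasure lborel (ball \<i> r)"
    using content_ball_pos[OF r(1), of \<i>] by (auto simp: ennreal_zero_less_mult_iff measure_def enn2real_positive_iff)
  also have "... = (\<integral>\<^sup>+z. ennreal (2/9) * indicator (ball \<i> r) z \<partial>lborel)" by (subst nn_integral_cmult_indicator) auto
  also have "... \<le> (\<integral>\<^sup>+z. indicator (ball \<i> r) z * ennreal (1 / (2 * (Im z)\<^sup>2)) * indicator uhp z \<partial>lborel)"
  proof (rule nn_integral_mono)
    fix z
    show "ennreal (2/9) * indicator (ball \<i> r) z \<le> indicator (ball \<i> r) z * ennreal (1 / (2 * (Im z)\<^sup>2)) * indicator uhp z"
    proof (cases "z \<in> ball \<i> r")
      case True
      then have "0 < Im z" "(Im z)\<^sup>2 \<le> (3/2)\<^sup>2" using im[OF True] by (auto intro!: power_mono)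
      then have "2/9 \<le> 1 / (2 * (Im z)\<^sup>2)" by (simp add: field_simps power2_eq_square)
      then show ?thesis using True \<open>0 < Im z\<close> by (auto simp: indicator_def uhp_iff intro!: ennreal_leI)
    qed simp
  qed
  also have "... = emeasure hyp_area (ball \<i> r)" using B by (subst nn_integral_hyp_area[symmetric]) auto
  also have "... \<le> emeasure hyp_area (hball \<i> d)" using sub hball_sets by (intro emeasure_mono) auto
  finally show ?thesis .
qed

definition thick :: "(real^2^2) set \<Rightarrow> real \<Rightarrow> complex \<Rightarrow> bool" where
  "thick M t w \<longleftrightarrow> (\<forall>A\<in>M. A \<noteq> mat 1 --> A \<noteq> - mat 1 --> t \<le> disp A w)"

lemma hypu_triangle_less:
  assumes "Im z > 0" "Im v > 0" "Im w > 0" "hypu z v < d" "hypu v w < d"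
  shows "hypu z w < 8 * d + 16 * d\<^sup>2"
proof -
  have nn: "hypu z v \<ge> 0" "hypu v w \<ge> 0" using assms by (simp_all add: hypu_nonneg)
  have "1 + hypu z w \<le> (1 + 4 * hypu z v) * (1 + 4 * hypu v w)" using assms by (intro hypu_triangle)
  also have "... < (1 + 4 * d) * (1 + 4 * d)" using assms nn by (intro mult_strict_mono) auto
  finally show ?thesis by (simp add: power2_eq_square algebra_simps)
qed

context fuchsian_matrices
begin

lemma moebius_adj2_mem:
  assumes "A \<in> M" "Im z > 0"
  shows "moebius (adj2 A) (moebius A z) = z" "moebius A (moebius (adj2 A) z) = z"
  using assms det1 by simp_all

lemma disp_transport:
  assumes X: "X \<in> M" and zw: "Im z > 0" "Im w > 0" and R: "hypu z w \<le> R"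
  shows "disp X z \<le> (1 + 4 * R) * (1 + 4 * ((1 + 4 * disp X w) * (1 + 4 * R)))"
proof -
  have Xz: "Im (moebius X z) > 0" "Im (moebius X w) > 0" using X zw moebius_mem by auto
  have R0: "R \<ge> 0" using R hypu_nonneg[OF zw] by linarith
  have d0: "disp X w \<ge> 0" using X zw disp_nonneg by blast
  have "1 + hypu w (moebius X z) \<le> (1 + 4 * hypu w (moebius X w)) * (1 + 4 * hypu (moebius X w) (moebius X z))"
    using zw Xz by (intro hypu_triangle)
  also have "hypu (moebius X w) (moebius X z) = hypu z w" using X zw det1 by (simp add: hypu_moebius hypu_sym)
  also have "(1 + 4 * hypu w (moebius X w)) * (1 + 4 * hypu z w) \<le> (1 + 4 * disp X w) * (1 + 4 * R)"
    using R d0 by (auto simp: disp_def intro!: mult_left_mono)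
  finally have 1: "hypu w (moebius X z) \<le> (1 + 4 * disp X w) * (1 + 4 * R)" by simp
  have "1 + hypu z (moebius X z) \<le> (1 + 4 * hypu z w) * (1 + 4 * hypu w (moebius X z))"
    using zw Xz by (intro hypu_triangle)
  also have "... \<le> (1 + 4 * R) * (1 + 4 * ((1 + 4 * disp X w) * (1 + 4 * R)))"
    using R 1 R0 hypu_nonneg[OF zw(2) Xz(1)] by (intro mult_mono) auto
  finally show ?thesis by (simp add: disp_def)
qed

text \<open>Displacement at i is minimised over the noncentral part of the centraliser of
  \<open>X\<close>. Since displacements of centraliser elements keep their ratio at every point, the
  choice of i is immaterial; \<open>Y\<close> acts as a generator of the centraliser up to
  sign.\<close>

lemma prop_dev_disp_i_minimal:
  assumes X: "X \<in> M" "X \<noteq> mat 1" "X \<noteq> - mat 1"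
  obtains Y l where "Y \<in> M" "Y \<noteq> mat 1" "Y \<noteq> - mat 1" "prop_dev l X Y" "l \<noteq> 0" "l\<^sup>2 \<le> 1"
    "\<forall>m W. W \<in> M --> W \<noteq> mat 1 --> W \<noteq> - mat 1 --> prop_dev m Y W --> m\<^sup>2 \<ge> 1"
proof -
  define C where "C = {Y \<in> M. Y \<noteq> mat 1 \<and> Y \<noteq> - mat 1 \<and> (\<exists>l. prop_dev l X Y) \<and> disp Y \<i> \<le> disp X \<i>}"
  have fC: "finite C" by (rule finite_subset[OF _ finite_disp[of \<i> "disp X \<i>"]]) (auto simp: C_def)
  have XX: "prop_dev 1 X X" by (simp add: prop_dev_def)
  then have XC: "X \<in> C" using X by (auto simp: C_def)
  then have Cne: "C \<noteq> {}" by blast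
  define Y where "Y = arg_min_on (\<lambda>A. disp A \<i>) C"
  have Y: "Y \<in> C" "\<And>B. B \<in> C ==> disp Y \<i> \<le> disp B \<i>"
    using arg_min_if_finite(1)[OF fC Cne] arg_min_least[OF fC Cne] by (auto simp: Y_def)
  obtain l where l: "prop_dev l X Y" using Y(1) by (auto simp: C_def)
  have Ym: "Y \<in> M" "Y \<noteq> mat 1" "Y \<noteq> - mat 1" "disp Y \<i> \<le> disp X \<i>" using Y(1) by (auto simp: C_def)
  have pX: "disp X \<i> > 0" "disp Y \<i> > 0" using X Ym by (auto intro: disp_pos)
  have dl: "disp Y \<i> = l\<^sup>2 * disp X \<i>" using prop_dev_disp[OF l] det1 X Ym by simp
  have "l\<^sup>2 * disp X \<i> \<le> 1 * disp X \<i>" using dl Ym(4) by simp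
  then have l2: "l\<^sup>2 \<le> 1" by (rule mult_right_le_imp_le[OF _ pX(1)])
  have l1: "l \<noteq> 0" using dl pX(2) by auto
  have "m\<^sup>2 \<ge> 1" if W: "W \<in> M" "W \<noteq> mat 1" "W \<noteq> - mat 1" "prop_dev m Y W" for m W
  proof (rule ccontr)
    assume "\<not> m\<^sup>2 \<ge> 1"
    have dm: "disp W \<i> = m\<^sup>2 * disp Y \<i>" using prop_dev_disp[OF W(4)] det1 W Ym by simp
    then have lt: "disp W \<i> < disp Y \<i>" using \<open>\<not> m\<^sup>2 \<ge> 1\<close> pX by (simp add: mult_less_cancel_right1)
    have "prop_dev (m * l) X W" using l W(4) by (simp add: prop_dev_def)
    then have "W \<in> C" using W lt Ym(4) by (auto simp: C_def)
    then show False using Y(2) lt by force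
  qed
  then show thesis using that Ym l l1 l2 by blast
qed

end

text \<open>When the lower left entry is 0, the shear is affine in Re w at a fixed height. Otherwise
  Re w is the centre of the axis, and the height solves a quadratic equation, written as (c y + s)^2
  = s^2 + D with D = trace^2 / 4 - 1.\<close>

lemma shear_surj:
  assumes d: "det A = 1" and D: "(trace A)\<^sup>2 / 4 - 1 > 0"
  obtains w where "Im w > 0" "shear A w = s"
proof (cases "A$2$1 = 0")
  case True
  have "((A$1$1 - A$2$2) / 2)\<^sup>2 > 0" using D True by (simp add: trace_dev[OF d])
  then have ne: "A$1$1 - A$2$2 \<noteq> 0" by auto
  let ?w = "Complex ((s - A$1$2) / (A$1$1 - A$2$2)) (1/2)"
  have "shear A ?w = s" using ne by (simp add: shear_def True)
  then show thesis using that[of ?w] by simp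
next
  case False
  define D where "D = (trace A)\<^sup>2 / 4 - 1"
  define c where "c = A$2$1"
  define x where "x = (A$1$1 - A$2$2) / (2 * c)"
  define y where "y = (sqrt (s\<^sup>2 + D) - s * sgn c) / \<bar>c\<bar>"
  have D0: "D > 0" using assms by (simp add: D_def)
  have c0: "c \<noteq> 0" using False by (simp add: c_def)
  have "s * sgn c \<le> \<bar>s\<bar>" using c0 by (cases "c > 0") (auto simp: sgn_if)
  also have "\<bar>s\<bar> < sqrt (s\<^sup>2 + D)" using D0 by (simp add: real_less_rsqrt)
  finally have y0: "y > 0" using c0 by (simp add: y_def)
  have "c * y + s = sgn c * sqrt (s\<^sup>2 + D)" using c0 by (cases "c > 0") (auto simp: y_def sgn_if)
  then have "(c * y + s)\<^sup>2 = s\<^sup>2 + D" using c0 D0 by (simp add: power_mult_distrib sgn_if)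
  then have q: "D - c * c * y * y = 2 * s * y * c" by (simp add: power2_eq_square algebra_simps)
  have De: "D = ((A$1$1 - A$2$2) / 2)\<^sup>2 + A$1$2 * c" using trace_dev[OF d] by (simp add: D_def c_def)
  have a: "A$1$1 - A$2$2 = 2 * c * x" using c0 by (simp add: x_def)
  have "A$1$2 * c = D - c * c * x * x" using De unfolding a by (simp add: power2_eq_square)
  then have "(A$1$2 + (A$1$1 - A$2$2) * x - c * (x\<^sup>2 + y\<^sup>2)) * c = 2 * s * y * c"
    unfolding a using q by (simp add: power2_eq_square algebra_simps)
  then have "A$1$2 + (A$1$1 - A$2$2) * x - c * (x\<^sup>2 + y\<^sup>2) = 2 * s * y" using c0 by simp
  then have "shear A (Complex x y) = s" using y0 by (simp add: shear_def c_def cmod_power2)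
  then show thesis using that[of "Complex x y"] y0 by simp
qed

locale lattice = fundamental_tiling +
  assumes finite_area: "emeasure hyp_area U < \<infinity>"
begin

text \<open>A substitute for compactness of the thick part. Balls around points that are t-separated
  modulo the group embed disjointly in the quotient and have equal positive area, so finite area
  bounds their number; a separated set of maximal size covers.\<close>

lemma thick_cover:
  assumes t: "t > 0"
  obtains Z where "finite Z" "\<And>z. z \<in> Z ==> Im z > 0"
    "\<And>w. Im w > 0 ==> thick M t w ==> \<exists>A\<in>M. \<exists>z\<in>Z. hypu z (moebius A w) \<le> t"
proof -
  \<comment> \<open>By \<open>hypu_triangle_less\<close>, two points that share a ball of size d
    with a common point are less than 8 d + 16 d^2 <= t apart.\<close>
  define d where "d = min (1/2) (t / 32)"
  have d: "d > 0" "8 * d + 16 * d\<^sup>2 \<le> t"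
  proof -
    show "d > 0" using t by (simp add: d_def)
    have "16 * d * d \<le> 16 * d * (1/2)" using \<open>d > 0\<close> by (intro mult_left_mono) (auto simp: d_def)
    moreover have "d \<le> t / 32" by (simp add: d_def)
    ultimately show "8 * d + 16 * d\<^sup>2 \<le> t" using t unfolding power2_eq_square by linarith
  qed
  define sep where "sep = (\<lambda>F. finite F \<and> (\<forall>w\<in>F. Im w > 0 \<and> thick M t w) \<and>
     (\<forall>w\<in>F. \<forall>v\<in>F. w \<noteq> v --> (\<forall>A\<in>M. t < hypu w (moebius A v))))"
  define \<kappa> where "\<kappa> = emeasure hyp_area (hball \<i> d)"
  have \<kappa>0: "\<kappa> > 0" unfolding \<kappa>_def by (rule emeasure_hball_pos[OF d(1)])
  have inj: "w = v \<and> (A = mat 1 \<or> A = - mat 1)"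
    if F: "sep F" "w \<in> F" "v \<in> F" "A \<in> M" "z \<in> hball v d" "moebius A z \<in> hball w d" for F w v A z
  proof -
    have im: "Im w > 0" "Im v > 0" "Im z > 0" "Im (moebius A z) > 0" "Im (moebius A v) > 0"
      using F moebius_mem by (auto simp: sep_def hball_def)
    have "hypu w (moebius A z) < d" "hypu (moebius A z) (moebius A v) < d"
      using F im det1 by (auto simp: hball_def hypu_moebius hypu_sym)
    then have lt: "hypu w (moebius A v) < t" using hypu_triangle_less[of w "moebius A z" "moebius A v" d] im d(2) by auto
    have wv: "w = v"
    proof (rule ccontr)
      assume "w \<noteq> v"
      then have "t < hypu w (moebius A v)" using F(1-4) unfolding sep_def by blast
      then show False using lt by simp
    qed
    have "thick M t v" using F(1,3) unfolding sep_def by blast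
    then have "A \<noteq> mat 1 ==> A \<noteq> - mat 1 ==> t \<le> hypu v (moebius A v)" using F(4) unfolding thick_def disp_def by blast
    then show ?thesis using lt wv by force
  qed
  have area: "of_nat (card F) * \<kappa> \<le> emeasure hyp_area U" if F: "sep F" for F
  proof -
    let ?V = "\<Union>w\<in>F. hball w d"
    have fF: "finite F" using F by (simp add: sep_def)
    have dj: "disjoint_family_on (\<lambda>w. hball w d) F"
      unfolding disjoint_family_on_def
    proof (intro ballI impI)
      fix w v assume wv: "w \<in> F" "v \<in> F" "w \<noteq> v"
      show "hball w d \<inter> hball v d = {}"
      proof (rule ccontr)
        assume "hball w d \<inter> hball v d \<noteq> {}"
        then obtain z where "z \<in> hball w d" "z \<in> hball v d" by blast
        then show False using inj[OF F wv(1,2) one_mem, of z] wv(3) by simp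
      qed
    qed
    have hb: "emeasure hyp_area (hball w d) = \<kappa>" if "w \<in> F" for w
    proof -
      have "Im w > 0" using F that unfolding sep_def by blast
      then show ?thesis unfolding \<kappa>_def by (rule emeasure_hball)
    qed
    have "of_nat (card F) * \<kappa> = (\<Sum>w\<in>F. emeasure hyp_area (hball w d))"
      by (subst sum.cong[OF refl hb]) simp_all
    also have "... = emeasure hyp_area ?V" using fF dj hball_sets by (intro sum_emeasure) auto
    also have "... \<le> emeasure hyp_area U"
    proof (rule injected_area_le)
      show "?V \<in> sets hyp_area" using fF hball_sets by auto
      fix A assume A: "A \<in> M" "A \<noteq> mat 1" "A \<noteq> - mat 1"
      show "moebius A ` ?V \<inter> ?V = {}" using inj[OF F _ _ A(1)] A(2,3) by blast
    qed
    finally show ?thesis .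
  qed
  obtain N :: nat where N: "\<And>F. sep F ==> card F \<le> N"
  proof -
    obtain a where a: "a \<ge> 0" "emeasure hyp_area U = ennreal a"
      using finite_area by (cases "emeasure hyp_area U") auto
    obtain k where k: "k > 0" "ennreal k \<le> \<kappa>"
    proof (cases \<kappa>)
      case (real r) then show ?thesis using \<kappa>0 that[of r] by auto
    next
      case top then show ?thesis using that[of 1] by simp
    qed
    have "card F \<le> nat \<lceil>a / k\<rceil>" if F: "sep F" for F
    proof -
      have "ennreal (real (card F) * k) = of_nat (card F) * ennreal k"
        using k by (simp add: ennreal_mult ennreal_of_nat_eq_real_of_nat)
      also have "... \<le> of_nat (card F) * \<kappa>" using k by (intro mult_left_mono) auto
      also have "... \<le> ennreal a" using area[OF F] a by simp
      finally have "real (card F) * k \<le> a" using a by simp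
      then have "real (card F) \<le> a / k" using k by (simp add: field_simps)
      then show ?thesis by linarith
    qed
    then show thesis using that by blast
  qed
  have "sep {}" by (simp add: sep_def)
  then obtain Z where Z: "sep Z" "\<And>F. sep F ==> card F \<le> card Z"
    using ex_has_greatest_nat[of sep "{}" card "Suc N"] N by (auto simp: less_Suc_eq_le)
  have "\<exists>A\<in>M. \<exists>z\<in>Z. hypu z (moebius A w) \<le> t" if w: "Im w > 0" "thick M t w" for w
  proof (rule ccontr)
    assume no: "\<not> (\<exists>A\<in>M. \<exists>z\<in>Z. hypu z (moebius A w) \<le> t)"
    have wZ: "w \<notin> Z"
    proof
      assume "w \<in> Z"
      moreover have "hypu w (moebius (mat 1) w) \<le> t" using t by simp
      ultimately show False using no one_mem by blast
    qed
    have "t < hypu w (moebius A z)" if "z \<in> Z" "A \<in> M" for z A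
    proof -
      have "Im z > 0" using that Z by (auto simp: sep_def)
      have "hypu w (moebius A z) = hypu (moebius (adj2 A) w) (moebius (adj2 A) (moebius A z))"
        using that w \<open>Im z > 0\<close> det1 moebius_mem by (intro hypu_moebius[symmetric]) auto
      also have "... = hypu z (moebius (adj2 A) w)" using that \<open>Im z > 0\<close> moebius_adj2_mem by (simp add: hypu_sym)
      finally show ?thesis using no adj2_mem that by force
    qed
    moreover have "t < hypu z (moebius A w)" if "z \<in> Z" "A \<in> M" for z A using no that by force
    ultimately have "sep (insert w Z)" using Z(1) w unfolding sep_def by auto
    then have "card (insert w Z) \<le> card Z" by (rule Z(2))
    then show False using wZ Z(1) by (simp add: sep_def)
  qed
  then show thesis using that[of Z] Z(1) by (auto simp: sep_def)
qed

text \<open>Short hyperbolic elements are excluded because the distance tube around the axis of a minimal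
  one contains points of the thick part at which its displacement is a fixed constant.\<close>

lemma hyperbolic_gap:
  obtains \<eta> where "\<eta> > 0" "\<And>X. X \<in> M ==> (trace X)\<^sup>2 / 4 - 1 > 0 ==> (trace X)\<^sup>2 / 4 - 1 \<ge> \<eta>"
proof -
  define e where "e = margulis_const / 2"
  have e0: "e > 0" "e < margulis_const" by (simp_all add: e_def margulis_const_def)
  obtain Z where Z: "finite Z" "\<And>z. z \<in> Z ==> Im z > 0"
    "\<And>w. Im w > 0 ==> thick M e w ==> \<exists>A\<in>M. \<exists>z\<in>Z. hypu z (moebius A w) \<le> e"
    using thick_cover[OF e0(1)] by blast
  \<comment> \<open>The bound of \<open>disp_transport\<close> for an element of displacement e
    moved by a \<open>hypu\<close> of at most e.\<close>
  define r where "r = (1 + 4 * e) * (1 + 4 * ((1 + 4 * e) * (1 + 4 * e)))"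
  define S where "S = (\<Union>z\<in>Z. {Y \<in> M. disp Y z \<le> r})"
  have fS: "finite S" using Z finite_disp by (auto simp: S_def)
  define D where "D = (\<lambda>X :: real^2^2. (trace X)\<^sup>2 / 4 - 1)"
  \<comment> \<open>Only finitely many elements have displacement at most r at a centre, so their
    positive values of \<open>D\<close> have a minimum. Inserting e makes the set nonempty and
    covers the case that \<open>D X\<close> is not small.\<close>
  define E where "E = insert e (D ` S \<inter> {0<..})"
  have fE: "finite E" "E \<noteq> {}" using fS by (auto simp: E_def)
  define \<eta> where "\<eta> = Min E"
  have \<eta>0: "\<eta> > 0" using fE e0 by (auto simp: \<eta>_def E_def)
  have gap: "D X \<ge> \<eta>" if X: "X \<in> M" "D X > 0" for X
  proof (cases "D X \<ge> e")
    case True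
    moreover have "\<eta> \<le> e" unfolding \<eta>_def by (rule Min_le[OF fE(1)]) (simp add: E_def)
    ultimately show ?thesis by linarith
  next
    case False
    have X1: "X \<noteq> mat 1" "X \<noteq> - mat 1" using X(2) by (auto simp: D_def trace2)
    obtain Y l where Y: "Y \<in> M" "Y \<noteq> mat 1" "Y \<noteq> - mat 1" "prop_dev l X Y" "l \<noteq> 0" "l\<^sup>2 \<le> 1"
      and mn: "\<forall>m W. W \<in> M --> W \<noteq> mat 1 --> W \<noteq> - mat 1 --> prop_dev m Y W --> m\<^sup>2 \<ge> 1"
      by (rule prop_dev_disp_i_minimal[OF X(1) X1])
    have DY: "D Y = l\<^sup>2 * D X" using prop_dev_trace[OF Y(4)] X Y det1 by (simp add: D_def)
    have DY0: "D Y > 0" "D Y \<le> D X" using DY X(2) Y(5) mult_right_mono[OF Y(6), of "D X"] by simp_all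
    \<comment> \<open>By \<open>disp_eq\<close> this value of the shear makes the displacement of
      \<open>Y\<close> at w exactly e.\<close>
    obtain w where w: "Im w > 0" "shear Y w = sqrt (e - D Y)"
      using shear_surj[of Y "sqrt (e - D Y)"] DY0 det1[OF Y(1)] by (auto simp: D_def)
    have dYw: "disp Y w = e" using w det1[OF Y(1)] False DY0 by (simp add: disp_eq D_def)
    \<comment> \<open>An element of displacement below the Margulis constant at w commutes with
      \<open>Y\<close>, so its displacement is m^2 e; minimality of \<open>Y\<close> gives m^2 >=
      1.\<close>
    have "thick M e w" unfolding thick_def
    proof (intro ballI impI)
      fix W assume W: "W \<in> M" "W \<noteq> mat 1" "W \<noteq> - mat 1"
      show "e \<le> disp W w"
      proof (cases "disp W w < margulis_const")
        case True
        have "Y ** W = W ** Y" using w(1) Y(1) W(1) True dYw e0 by (intro margulis) auto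
        then obtain m where m: "prop_dev m Y W" using commute_prop_dev det1[OF Y(1)] Y(2,3) by blast
        have "disp W w = m\<^sup>2 * e" using prop_dev_disp[OF m] det1 Y(1) W(1) w dYw by simp
        moreover have "m\<^sup>2 * e \<ge> 1 * e" using mn W m e0 by (intro mult_right_mono) auto
        ultimately show ?thesis by simp
      qed (use e0 in auto)
    qed
    then obtain A z where A: "A \<in> M" "z \<in> Z" "hypu z (moebius A w) \<le> e" using Z(3) w by blast
    define Y' where "Y' = adj2 (adj2 A) ** Y ** adj2 A"
    have Y'M: "Y' \<in> M" unfolding Y'_def using A Y adj2_mem mult_mem by simp
    have dA: "det (adj2 A) = 1" using A det1 by simp
    have Aw: "Im (moebius A w) > 0" using A w moebius_mem by blast
    have "disp Y' (moebius A w) = disp Y w"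
      unfolding Y'_def using disp_conj[OF dA det1[OF Y(1)] Aw] moebius_adj2_mem[OF A(1) w(1)] by simp
    then have "disp Y' z \<le> r"
      using disp_transport[OF Y'M Z(2)[OF A(2)] Aw A(3)] by (simp add: dYw r_def)
    then have "Y' \<in> S" using A Y'M by (auto simp: S_def)
    then have "D Y' \<in> D ` S" by (rule imageI)
    moreover have "D Y' = D Y" unfolding D_def Y'_def using dA by (simp only: trace_conj2)
    ultimately have "D Y \<in> E" using DY0(1) by (simp add: E_def)
    then have "\<eta> \<le> D Y" unfolding \<eta>_def by (rule Min_le[OF fE(1)])
    then show ?thesis using DY0(2) by linarith
  qed
  then show thesis using that[OF \<eta>0] by (simp add: D_def)
qed

end

section \<open>Sums over the group\<close>

lemma nn_integral_arctan_finite: "(\<integral>\<^sup>+x. ennreal (1 / (1 + x\<^sup>2)) \<partial>lborel) < \<infinity>"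
proof -
  let ?f = "\<lambda>x::real. ennreal (1 / (1 + x\<^sup>2))"
  have pos: "(\<integral>\<^sup>+x. ?f x * indicator {0..} x \<partial>lborel) = ennreal (pi / 2 - arctan 0)"
  proof (rule nn_integral_FTC_atLeast)
    fix x :: real
    show "(arctan has_real_derivative 1 / (1 + x\<^sup>2)) (at x)"
      by (auto intro!: derivative_eq_intros simp: inverse_eq_divide)
    show "(arctan \<longlongrightarrow> pi / 2) at_top" by (rule tendsto_arctan_at_top)
  qed auto
  have "(\<integral>\<^sup>+x. ?f x \<partial>lborel) \<le> (\<integral>\<^sup>+x. ?f x * indicator {0..} x + ?f x * indicator {..0} x \<partial>lborel)"
    by (intro nn_integral_mono) (auto simp: indicator_def)
  also have "... = (\<integral>\<^sup>+x. ?f x * indicator {0..} x \<partial>lborel) + (\<integral>\<^sup>+x. ?f x * indicator {..0} x \<partial>lborel)"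
    by (intro nn_integral_add) auto
  also have "(\<integral>\<^sup>+x. ?f x * indicator {..0} x \<partial>lborel) = ennreal \<bar>-1\<bar> * (\<integral>\<^sup>+x. ?f (0 + (-1) * x) * indicator {..0} (0 + (-1) * x) \<partial>lborel)"
    by (rule nn_integral_real_affine) auto
  also have "... = (\<integral>\<^sup>+x. ?f x * indicator {0..} x \<partial>lborel)"
    by (auto simp: indicator_def intro!: nn_integral_cong)
  finally show ?thesis unfolding pos by (simp add: le_less_trans)
qed

lemma hypu_measurable: "(\<lambda>\<zeta>. ennreal (1 / (1 + hypu z \<zeta>)\<^sup>2)) \<in> borel_measurable hyp_area"
proof -
  have "(\<lambda>\<zeta>. ennreal (1 / (1 + hypu z \<zeta>)\<^sup>2)) \<in> borel_measurable borel"
    unfolding hypu_def by measurable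
  then show ?thesis unfolding measurable_hyp_area by (rule measurable_restrict_space1)
qed

lemma kernel_integral_invariant:
  assumes z: "Im z > 0"
  shows "(\<integral>\<^sup>+\<zeta>. ennreal (1 / (1 + hypu z \<zeta>)\<^sup>2) \<partial>hyp_area) = (\<integral>\<^sup>+\<zeta>. ennreal (1 / (1 + hypu \<i> \<zeta>)\<^sup>2) \<partial>hyp_area)"
proof -
  note T = to_pt[OF z]
  have "(\<integral>\<^sup>+\<zeta>. ennreal (1 / (1 + hypu z \<zeta>)\<^sup>2) \<partial>hyp_area) = (\<integral>\<^sup>+\<zeta>. ennreal (1 / (1 + hypu z (moebius (to_pt z) \<zeta>))\<^sup>2) \<partial>hyp_area)"
    by (rule nn_integral_moebius[symmetric, OF T(1) hypu_measurable])
  also have "... = (\<integral>\<^sup>+\<zeta>. ennreal (1 / (1 + hypu \<i> \<zeta>)\<^sup>2) \<partial>hyp_area)"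
  proof (rule nn_integral_cong)
    fix \<zeta> assume "\<zeta> \<in> space hyp_area"
    then have "hypu (moebius (to_pt z) \<i>) (moebius (to_pt z) \<zeta>) = hypu \<i> \<zeta>"
      using T(1) by (intro hypu_moebius) (auto simp: uhp_iff)
    then show "ennreal (1 / (1 + hypu z (moebius (to_pt z) \<zeta>))\<^sup>2) = ennreal (1 / (1 + hypu \<i> \<zeta>)\<^sup>2)" by (simp add: T(2))
  qed
  finally show ?thesis .
qed

text \<open>Already the exponent 2 makes the point-pair kernel integrable: x^2 + (1 + y)^2 is at
  least (1 + y)^2 and at least 1 + x^2, so the integrand is bounded by a product of one-dimensional
  integrable functions.\<close>

lemma kernel_integral_finite: "(\<integral>\<^sup>+\<zeta>. ennreal (1 / (1 + hypu \<i> \<zeta>)\<^sup>2) \<partial>hyp_area) < \<infinity>"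
proof -
  have mb: "(\<lambda>\<zeta>. ennreal (1 / (1 + hypu \<i> \<zeta>)\<^sup>2)) \<in> borel_measurable borel"
    unfolding hypu_def by measurable
  have "(\<integral>\<^sup>+\<zeta>. ennreal (1 / (1 + hypu \<i> \<zeta>)\<^sup>2) \<partial>hyp_area) =
     (\<integral>\<^sup>+\<zeta>. ennreal (1 / (1 + hypu \<i> \<zeta>)\<^sup>2) * ennreal (1 / (2 * (Im \<zeta>)\<^sup>2)) * indicator uhp \<zeta> \<partial>lborel)"
    by (rule nn_integral_hyp_area[OF hypu_measurable])
  also have "... = (\<integral>\<^sup>+y. (\<integral>\<^sup>+x. ennreal (1 / (1 + hypu \<i> (Complex x y))\<^sup>2) * ennreal (1 / (2 * (Im (Complex x y))\<^sup>2)) * indicator uhp (Complex x y) \<partial>lborel) \<partial>lborel)"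
    using mb by (intro nn_integral_complex) auto
  also have "... \<le> (\<integral>\<^sup>+y. (\<integral>\<^sup>+x. ennreal (8 / (1 + y)\<^sup>2) * indicator {0..} y * ennreal (1 / (1 + x\<^sup>2)) \<partial>lborel) \<partial>lborel)"
  proof (intro nn_integral_mono)
    fix x y :: real
    show "ennreal (1 / (1 + hypu \<i> (Complex x y))\<^sup>2) * ennreal (1 / (2 * (Im (Complex x y))\<^sup>2)) * indicator uhp (Complex x y)
      \<le> ennreal (8 / (1 + y)\<^sup>2) * indicator {0..} y * ennreal (1 / (1 + x\<^sup>2))"
    proof (cases "y > 0")
      case True
      have u: "1 + hypu \<i> (Complex x y) = (x\<^sup>2 + (1 + y)\<^sup>2) / (4 * y)"
        using True by (subst hypu_cnj) (simp_all add: cmod_power2)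
      have "1 / (s / (4 * y))\<^sup>2 * (1 / (2 * y\<^sup>2)) = 8 / (s * s)" for s :: real
        using True by (simp add: power_divide power2_eq_square)
      then have "1 / (1 + hypu \<i> (Complex x y))\<^sup>2 * (1 / (2 * y\<^sup>2)) = 8 / ((x\<^sup>2 + (1 + y)\<^sup>2) * (x\<^sup>2 + (1 + y)\<^sup>2))"
        unfolding u .
      also have "... \<le> 8 / ((1 + y)\<^sup>2 * (1 + x\<^sup>2))"
      proof (intro divide_left_mono mult_mono mult_pos_pos)
        have "1 \<le> (1 + y)\<^sup>2" using True by simp
        then show "1 + x\<^sup>2 \<le> x\<^sup>2 + (1 + y)\<^sup>2" by linarith
        have "x\<^sup>2 + (1 + y)\<^sup>2 > 0" using True by (simp add: add_nonneg_pos)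
        then show "0 < x\<^sup>2 + (1 + y)\<^sup>2" "0 < x\<^sup>2 + (1 + y)\<^sup>2" by simp_all
      qed (use True in \<open>auto simp: add_pos_nonneg\<close>)
      finally have "1 / (1 + hypu \<i> (Complex x y))\<^sup>2 * (1 / (2 * y\<^sup>2)) \<le> 8 / (1 + y)\<^sup>2 * (1 / (1 + x\<^sup>2))" by simp
      then have "ennreal (1 / (1 + hypu \<i> (Complex x y))\<^sup>2 * (1 / (2 * y\<^sup>2))) \<le> ennreal (8 / (1 + y)\<^sup>2 * (1 / (1 + x\<^sup>2)))"
        by (rule ennreal_leI)
      then have "ennreal (1 / (1 + hypu \<i> (Complex x y))\<^sup>2) * ennreal (1 / (2 * y\<^sup>2)) \<le> ennreal (8 / (1 + y)\<^sup>2) * ennreal (1 / (1 + x\<^sup>2))"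
        by (simp only: ennreal_mult[symmetric] zero_le_divide_iff zero_le_power2 zero_le_one add_nonneg_nonneg simp_thms zero_le_numeral mult_nonneg_nonneg)
      then show ?thesis using True by (simp add: uhp_iff)
    qed (simp add: uhp_iff)
  qed
  also have "... = (\<integral>\<^sup>+y. ennreal (8 / (1 + y)\<^sup>2) * indicator {0..} y * (\<integral>\<^sup>+x. ennreal (1 / (1 + x\<^sup>2)) \<partial>lborel) \<partial>lborel)"
    by (intro nn_integral_cong nn_integral_cmult) auto
  also have "... = (\<integral>\<^sup>+y. ennreal (8 / (1 + y)\<^sup>2) * indicator {0..} y \<partial>lborel) * (\<integral>\<^sup>+x. ennreal (1 / (1 + x\<^sup>2)) \<partial>lborel)"
    by (intro nn_integral_multc) auto
  also have "(\<integral>\<^sup>+y. ennreal (8 / (1 + y)\<^sup>2) * indicator {0..} y \<partial>lborel) = ennreal (0 - (- 8 / (1 + 0)))"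
  proof (rule nn_integral_FTC_atLeast[where F = "\<lambda>y. - 8 / (1 + y)"])
    fix y :: real assume "0 \<le> y"
    then show "((\<lambda>y. - 8 / (1 + y)) has_real_derivative 8 / (1 + y)\<^sup>2) (at y)"
      by (auto intro!: derivative_eq_intros simp: power2_eq_square field_simps)
  next
    show "((\<lambda>y::real. - 8 / (1 + y)) \<longlongrightarrow> 0) at_top" by real_asymp
  qed auto
  also have "ennreal (0 - (- 8 / (1 + 0))) * (\<integral>\<^sup>+x. ennreal (1 / (1 + x\<^sup>2)) \<partial>lborel) < \<infinity>"
    using nn_integral_arctan_finite by (simp only: ennreal_mult_less_top infinity_ennreal_def ennreal_less_top simp_thms)
  finally show ?thesis .
qed

text \<open>Each term is comparable with the kernel on a ball around the orbit point, and the number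
  of balls covering a point is at most the number of elements of small displacement at w. The
  constant is fixed before the group and the points, which gives uniformity later.\<close>

lemma kernel_sum_bound:
  assumes d: "d > 0"
  obtains C where "C > 0" "\<And>M z w F. fuchsian_matrices M ==> Im z > 0 ==> Im w > 0 ==> finite F ==> F \<subseteq> M ==>
    (\<Sum>A\<in>F. 1 / (1 + hypu z (moebius A w))\<^sup>2) \<le> C * real (card {A \<in> M. disp A w \<le> 8 * d + 16 * d\<^sup>2})"
proof -
  define \<kappa> where "\<kappa> = emeasure hyp_area (hball \<i> d)"
  have \<kappa>0: "\<kappa> > 0" unfolding \<kappa>_def by (rule emeasure_hball_pos[OF d])
  obtain k where k: "k > 0" "ennreal k \<le> \<kappa>"
  proof (cases \<kappa>)
    case (real r) then show ?thesis using \<kappa>0 that[of r] by auto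
  next
    case top then show ?thesis using that[of 1] by simp
  qed
  obtain I where I: "I \<ge> 0" "(\<integral>\<^sup>+\<zeta>. ennreal (1 / (1 + hypu \<i> \<zeta>)\<^sup>2) \<partial>hyp_area) = ennreal I"
    using kernel_integral_finite by (cases "(\<integral>\<^sup>+\<zeta>. ennreal (1 / (1 + hypu \<i> \<zeta>)\<^sup>2) \<partial>hyp_area)") auto
  define K where "K = 16 * (1 + 4 * d)\<^sup>2"
  have K0: "K > 0" using d by (simp add: K_def)
  define C where "C = (K * I + 1) / k"
  have C0: "C > 0" using k K0 I by (simp add: C_def add_nonneg_pos)
  have main: "(\<Sum>A\<in>F. 1 / (1 + hypu z (moebius A w))\<^sup>2) \<le> C * real (card {A \<in> M. disp A w \<le> 8 * d + 16 * d\<^sup>2})"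
    if M: "fuchsian_matrices M" and z: "Im z > 0" and w: "Im w > 0" and F: "finite F" "F \<subseteq> M" for M z w F
  proof -
    interpret fuchsian_matrices M by (rule M)
    define N where "N = card {A \<in> M. disp A w \<le> 8 * d + 16 * d\<^sup>2}"
    have Aw: "Im (moebius A w) > 0" if "A \<in> F" for A using that F w moebius_mem by blast
    have pt: "1 / (1 + hypu z (moebius A w))\<^sup>2 \<le> K * (1 / (1 + hypu z \<zeta>)\<^sup>2)"
      if A: "A \<in> F" and \<zeta>: "\<zeta> \<in> hball (moebius A w) d" for A \<zeta>
    proof -
      have \<zeta>0: "Im \<zeta> > 0" "hypu (moebius A w) \<zeta> < d" using \<zeta> by (auto simp: hball_def)
      have u0: "hypu z (moebius A w) \<ge> 0" "hypu z \<zeta> \<ge> 0" "hypu (moebius A w) \<zeta> \<ge> 0"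
        using z Aw[OF A] \<zeta>0 by (simp_all add: hypu_nonneg)
      have "1 + hypu z \<zeta> \<le> (1 + 4 * hypu z (moebius A w)) * (1 + 4 * hypu (moebius A w) \<zeta>)"
        using z Aw[OF A] \<zeta>0 by (intro hypu_triangle)
      also have "... \<le> (4 * (1 + hypu z (moebius A w))) * (1 + 4 * d)"
        using u0 \<zeta>0 by (intro mult_mono) auto
      finally have "(1 + hypu z \<zeta>)\<^sup>2 \<le> (4 * (1 + hypu z (moebius A w)) * (1 + 4 * d))\<^sup>2"
        using u0 by (intro power_mono) auto
      also have "... = K * (1 + hypu z (moebius A w))\<^sup>2" unfolding K_def power_mult_distrib by simp
      finally show ?thesis using u0 by (simp add: field_simps)
    qed
    have cnt: "(\<Sum>A\<in>F. indicator (hball (moebius A w) d) \<zeta>) \<le> (of_nat N :: ennreal)" if \<zeta>: "Im \<zeta> > 0" for \<zeta>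
    proof -
      let ?B = "{A \<in> F. \<zeta> \<in> hball (moebius A w) d}"
      have "(\<Sum>A\<in>F. indicator (hball (moebius A w) d) \<zeta>) = (of_nat (card ?B) :: ennreal)"
        using F by (simp add: indicator_def sum.If_cases Int_def flip: of_nat_sum)
      moreover have "card ?B \<le> N"
      proof (cases "?B = {}")
        case False
        then obtain A where A: "A \<in> F" "\<zeta> \<in> hball (moebius A w) d" by blast
        have AM: "A \<in> M" using A F by blast
        \<comment> \<open>If the balls around A w and B w share a point, then
          \<open>adj2 A ** B\<close> moves w only a little, so the multiplicity is counted by
          displacements at w.\<close>
        have im: "(\<lambda>B. adj2 A ** B) ` ?B \<subseteq> {A \<in> M. disp A w \<le> 8 * d + 16 * d\<^sup>2}"
        proof safe
          fix B assume B: "B \<in> F" "\<zeta> \<in> hball (moebius B w) d"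
          have BM: "B \<in> M" using B F by blast
          show "adj2 A ** B \<in> M" using AM BM mult_mem adj2_mem by blast
          have "hypu (moebius A w) (moebius B w) < 8 * d + 16 * d\<^sup>2"
            using A B Aw \<zeta> by (intro hypu_triangle_less[of _ \<zeta>]) (auto simp: hball_def hypu_sym)
          moreover have "hypu (moebius A w) (moebius B w) = hypu (moebius (adj2 A) (moebius A w)) (moebius (adj2 A) (moebius B w))"
            using AM Aw A B det1 by (intro hypu_moebius[symmetric]) auto
          moreover have "moebius (adj2 A) (moebius A w) = w" using AM w by (rule moebius_adj2_mem)
          moreover have "moebius (adj2 A) (moebius B w) = moebius (adj2 A ** B) w"
            using AM BM w det1 by (simp add: moebius_mult)
          ultimately show "disp (adj2 A ** B) w \<le> 8 * d + 16 * d\<^sup>2" by (simp add: disp_def)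
        qed
        have inj: "inj_on (\<lambda>B. adj2 A ** B) ?B"
          by (rule inj_on_inverseI[where g = "\<lambda>B. A ** B"]) (use det1[OF AM] in simp)
        show ?thesis unfolding N_def by (rule card_inj_on_le[OF inj im finite_disp[OF w]])
      next
        case True
        show ?thesis unfolding True by simp
      qed
      ultimately show ?thesis by simp
    qed
    have "ennreal (\<Sum>A\<in>F. 1 / (1 + hypu z (moebius A w))\<^sup>2) * ennreal k \<le> (\<Sum>A\<in>F. ennreal (1 / (1 + hypu z (moebius A w))\<^sup>2)) * \<kappa>"
    proof -
      have "(\<Sum>A\<in>F. ennreal (1 / (1 + hypu z (moebius A w))\<^sup>2)) = ennreal (\<Sum>A\<in>F. 1 / (1 + hypu z (moebius A w))\<^sup>2)"
        by (rule sum_ennreal) simp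
      then show ?thesis using mult_left_mono[OF k(2)] by simp
    qed
    also have "... = (\<Sum>A\<in>F. ennreal (1 / (1 + hypu z (moebius A w))\<^sup>2) * emeasure hyp_area (hball (moebius A w) d))"
      unfolding sum_distrib_right
    proof (rule sum.cong[OF refl])
      fix A assume "A \<in> F"
      then have "emeasure hyp_area (hball (moebius A w) d) = \<kappa>" unfolding \<kappa>_def by (intro emeasure_hball Aw)
      then show "ennreal (1 / (1 + hypu z (moebius A w))\<^sup>2) * \<kappa> =
          ennreal (1 / (1 + hypu z (moebius A w))\<^sup>2) * emeasure hyp_area (hball (moebius A w) d)" by (simp only:)
    qed
    also have "... = (\<Sum>A\<in>F. (\<integral>\<^sup>+\<zeta>. ennreal (1 / (1 + hypu z (moebius A w))\<^sup>2) * indicator (hball (moebius A w) d) \<zeta> \<partial>hyp_area))"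
      by (intro sum.cong refl) (subst nn_integral_cmult_indicator, auto simp: hball_sets)
    also have "... = (\<integral>\<^sup>+\<zeta>. (\<Sum>A\<in>F. ennreal (1 / (1 + hypu z (moebius A w))\<^sup>2) * indicator (hball (moebius A w) d) \<zeta>) \<partial>hyp_area)"
      using hball_sets by (intro nn_integral_sum[symmetric]) auto
    also have "... \<le> (\<integral>\<^sup>+\<zeta>. ennreal (K * real N) * ennreal (1 / (1 + hypu z \<zeta>)\<^sup>2) \<partial>hyp_area)"
    proof (rule nn_integral_mono)
      fix \<zeta> assume "\<zeta> \<in> space hyp_area"
      then have \<zeta>: "Im \<zeta> > 0" by (simp add: uhp_iff)
      have "(\<Sum>A\<in>F. ennreal (1 / (1 + hypu z (moebius A w))\<^sup>2) * indicator (hball (moebius A w) d) \<zeta>)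
         \<le> (\<Sum>A\<in>F. ennreal (K * (1 / (1 + hypu z \<zeta>)\<^sup>2)) * indicator (hball (moebius A w) d) \<zeta>)"
      proof (rule sum_mono)
        fix A assume A: "A \<in> F"
        show "ennreal (1 / (1 + hypu z (moebius A w))\<^sup>2) * indicator (hball (moebius A w) d) \<zeta>
            \<le> ennreal (K * (1 / (1 + hypu z \<zeta>)\<^sup>2)) * indicator (hball (moebius A w) d) \<zeta>"
        proof (cases "\<zeta> \<in> hball (moebius A w) d")
          case True
          then show ?thesis using ennreal_leI[OF pt[OF A True]] by simp
        qed simp
      qed
      also have "... = ennreal (K * (1 / (1 + hypu z \<zeta>)\<^sup>2)) * (\<Sum>A\<in>F. indicator (hball (moebius A w) d) \<zeta>)"
        by (rule sum_distrib_left[symmetric])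
      also have "... \<le> ennreal (K * (1 / (1 + hypu z \<zeta>)\<^sup>2)) * of_nat N" using cnt[OF \<zeta>] by (intro mult_left_mono) auto
      also have "... = ennreal (K * real N) * ennreal (1 / (1 + hypu z \<zeta>)\<^sup>2)"
        using K0 by (simp add: ennreal_of_nat_eq_real_of_nat ennreal_mult[symmetric] mult_ac)
      finally show "(\<Sum>A\<in>F. ennreal (1 / (1 + hypu z (moebius A w))\<^sup>2) * indicator (hball (moebius A w) d) \<zeta>)
          \<le> ennreal (K * real N) * ennreal (1 / (1 + hypu z \<zeta>)\<^sup>2)" .
    qed
    also have "... = ennreal (K * real N) * ennreal I"
      using hypu_measurable by (subst nn_integral_cmult) (auto simp: kernel_integral_invariant[OF z] I(2))
    also have "... = ennreal (K * real N * I)" using K0 I by (simp add: ennreal_mult)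
    finally have "ennreal ((\<Sum>A\<in>F. 1 / (1 + hypu z (moebius A w))\<^sup>2) * k) \<le> ennreal (K * real N * I)"
      using k by (subst ennreal_mult) (auto intro!: sum_nonneg)
    then have "(\<Sum>A\<in>F. 1 / (1 + hypu z (moebius A w))\<^sup>2) * k \<le> K * real N * I"
      using K0 I by (subst (asm) ennreal_le_iff) auto
    also have "... \<le> (K * I + 1) * real N" by (simp add: algebra_simps)
    finally have "(\<Sum>A\<in>F. 1 / (1 + hypu z (moebius A w))\<^sup>2) \<le> (K * I + 1) * real N / k"
      using k by (simp add: pos_le_divide_eq)
    then show ?thesis by (simp add: C_def N_def)
  qed
  show thesis by (rule that[OF C0 main])
qed

text \<open>Two factors are kept for summation by \<open>kernel_sum_bound\<close>; the other p - 2
  are estimated by the smallest displacement.\<close>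

lemma power_split_bound:
  fixes u m :: real
  assumes "u \<ge> m" "m \<ge> 0" "p \<ge> 2"
  shows "1 / (1 + u) ^ p \<le> 1 / (1 + m) ^ (p - 2) * (1 / (1 + u)\<^sup>2)"
proof -
  have "(1 + u) ^ p = (1 + u) ^ (p - 2) * (1 + u)\<^sup>2" using assms(3) by (metis le_add_diff_inverse2 power_add)
  moreover have "(1 + m) ^ (p - 2) \<le> (1 + u) ^ (p - 2)" using assms by (intro power_mono) auto
  ultimately have "(1 + m) ^ (p - 2) * (1 + u)\<^sup>2 \<le> (1 + u) ^ p" by (simp add: mult_right_mono)
  then have "1 / (1 + u) ^ p \<le> 1 / ((1 + m) ^ (p - 2) * (1 + u)\<^sup>2)"
    using assms by (intro divide_left_mono) auto
  then show ?thesis by simp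
qed

section \<open>The diagonal sum and its value in the thick part\<close>

definition tfac :: "complex \<Rightarrow> real^2^2 \<Rightarrow> complex" where
  "tfac w A = 1 / (of_real (trace A / 2) - \<i> * of_real (shear A w))"

text \<open>The function \<open>E\<close> of the overview. It takes an arbitrary set of matrices, so
  that a group may be replaced by a conjugate in which the cusp lies at infinity.\<close>

definition efun :: "(real^2^2) set \<Rightarrow> nat \<Rightarrow> complex \<Rightarrow> complex" where
  "efun M p w = (\<Sum>\<^sub>\<infinity>A\<in>M. tfac w A ^ (2 * p)) / 2"

lemma norm_tfac:
  assumes "det A = 1" "Im w > 0"
  shows "norm (tfac w A ^ (2 * p)) = 1 / (1 + disp A w) ^ p"
proof -
  have "(norm (tfac w A))\<^sup>2 = 1 / (1 + disp A w)"
    using disp_eq[OF assms] by (simp add: tfac_def norm_divide power_divide cmod_power2)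
  then show ?thesis by (simp add: norm_power power_mult power_divide)
qed

lemma summable_bounded_partial:
  fixes f :: "'a \<Rightarrow> complex"
  assumes "\<And>F. finite F ==> F \<subseteq> S ==> (\<Sum>A\<in>F. norm (f A)) \<le> B"
  shows "(\<lambda>A. norm (f A)) summable_on S" "f summable_on S" "norm (infsum f S) \<le> B"
proof -
  show 1: "(\<lambda>A. norm (f A)) summable_on S"
    by (rule nonneg_bdd_above_summable_on) (auto intro!: bdd_aboveI2[of _ _ B] assms)
  from Infinite_Sum.abs_summable_summable[OF this] show "f summable_on S" .
  have "norm (infsum f S) \<le> (\<Sum>\<^sub>\<infinity>A\<in>S. norm (f A))" by (rule norm_infsum_bound[OF 1])
  also have "... \<le> B" by (rule infsum_le_finite_sums[OF 1 assms])
  finally show "norm (infsum f S) \<le> B" .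
qed

lemma efun_conj:
  assumes S: "det S = 1" and M: "\<And>A. A \<in> M ==> det A = 1" and w: "Im w > 0"
  shows "efun (conj_group S M) p w = efun M p (moebius S w)"
proof -
  have "inj_on (\<lambda>A. adj2 S ** A ** S) M"
    by (rule inj_on_inverseI[where g = "\<lambda>B. S ** B ** adj2 S"]) (rule conj2_inverse[OF S])
  then have "(\<Sum>\<^sub>\<infinity>A\<in>conj_group S M. tfac w A ^ (2 * p)) = (\<Sum>\<^sub>\<infinity>A\<in>M. tfac w (adj2 S ** A ** S) ^ (2 * p))"
    by (subst infsum_reindex) (auto simp: o_def)
  also have "... = (\<Sum>\<^sub>\<infinity>A\<in>M. tfac (moebius S w) A ^ (2 * p))"
    using S M w by (intro infsum_cong) (simp add: tfac_def trace_conj2 shear_conj)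
  finally show ?thesis by (simp add: efun_def)
qed

text \<open>The radius d is taken so small that the displacements counted by
  \<open>kernel_sum_bound\<close> fall below t; only the two central matrices are counted, and the
  constant does not depend on the point.\<close>

lemma efun_thick:
  assumes t: "t > 0"
  obtains C where "C > 0" "\<And>M w p. fuchsian_matrices M ==> Im w > 0 ==> thick M t w ==> p \<ge> 2 ==>
     norm (efun M p w - 1) \<le> C / (1 + t) ^ (p - 2)"
proof -
  define d where "d = min (1/2) (t / 32)"
  have d: "d > 0" "8 * d + 16 * d\<^sup>2 < t"
  proof -
    show "d > 0" using t by (simp add: d_def)
    have "16 * d * d \<le> 16 * d * (1/2)" using \<open>d > 0\<close> by (intro mult_left_mono) (auto simp: d_def)
    moreover have "d \<le> t / 32" by (simp add: d_def)
    ultimately show "8 * d + 16 * d\<^sup>2 < t" using t unfolding power2_eq_square by linarith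
  qed
  obtain C where C: "C > 0" "\<And>M z w F. fuchsian_matrices M ==> Im z > 0 ==> Im w > 0 ==> finite F ==> F \<subseteq> M ==>
    (\<Sum>A\<in>F. 1 / (1 + hypu z (moebius A w))\<^sup>2) \<le> C * real (card {A \<in> M. disp A w \<le> 8 * d + 16 * d\<^sup>2})"
    using kernel_sum_bound[OF d(1)] by blast
  have main: "norm (efun M p w - 1) \<le> C / (1 + t) ^ (p - 2)"
    if M: "fuchsian_matrices M" and w: "Im w > 0" and th: "thick M t w" and p: "p \<ge> 2" for M w p
  proof -
    interpret fuchsian_matrices M by (rule M)
    let ?f = "\<lambda>A. tfac w A ^ (2 * p)"
    let ?I = "{mat 1, - mat 1} :: (real^2^2) set"
    have sub: "{A \<in> M. disp A w \<le> 8 * d + 16 * d\<^sup>2} \<subseteq> ?I" using th d(2) unfolding thick_def by force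
    have "card {A \<in> M. disp A w \<le> 8 * d + 16 * d\<^sup>2} \<le> card ?I" by (rule card_mono[OF _ sub]) simp
    also have "... \<le> 2" by (simp add: card_insert_if)
    finally have c2: "card {A \<in> M. disp A w \<le> 8 * d + 16 * d\<^sup>2} \<le> 2" .
    have bd: "(\<Sum>A\<in>F. norm (?f A)) \<le> 2 * C / (1 + t) ^ (p - 2)" if F: "finite F" "F \<subseteq> M - ?I" for F
    proof -
      have "(\<Sum>A\<in>F. norm (?f A)) \<le> (\<Sum>A\<in>F. 1 / (1 + t) ^ (p - 2) * (1 / (1 + disp A w)\<^sup>2))"
      proof (rule sum_mono)
        fix A assume "A \<in> F"
        then have A: "A \<in> M" "t \<le> disp A w" using F th by (auto simp: thick_def)
        then show "norm (?f A) \<le> 1 / (1 + t) ^ (p - 2) * (1 / (1 + disp A w)\<^sup>2)"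
          using power_split_bound[OF A(2) _ p] t w det1 by (simp add: norm_tfac)
      qed
      also have "... = 1 / (1 + t) ^ (p - 2) * (\<Sum>A\<in>F. 1 / (1 + hypu w (moebius A w))\<^sup>2)"
        by (simp add: sum_distrib_left disp_def)
      also have "... \<le> 1 / (1 + t) ^ (p - 2) * (C * 2)"
      proof (rule mult_left_mono)
        have "(\<Sum>A\<in>F. 1 / (1 + hypu w (moebius A w))\<^sup>2) \<le> C * real (card {A \<in> M. disp A w \<le> 8 * d + 16 * d\<^sup>2})"
          using F by (intro C(2) M w) auto
        also have "... \<le> C * 2" using C(1) c2 by (intro mult_left_mono) auto
        finally show "(\<Sum>A\<in>F. 1 / (1 + hypu w (moebius A w))\<^sup>2) \<le> C * 2" .
      qed (use t in auto)
      finally show ?thesis by (simp add: mult.commute)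
    qed
    note s = summable_bounded_partial[of "M - ?I" ?f, OF bd]
    have IM: "?I \<subseteq> M" using one_mem neg_mem by auto
    have ne: "(mat 1 :: real^2^2) \<noteq> - mat 1"
    proof -
      have "(mat 1 :: real^2^2)$1$1 \<noteq> (- mat 1 :: real^2^2)$1$1" by simp
      then show ?thesis by metis
    qed
    have f1: "?f (mat 1) = 1" "?f (- mat 1) = 1"
      by (simp_all add: tfac_def trace2 shear_def power_mult)
    have "infsum ?f M = infsum ?f (?I \<union> (M - ?I))" using IM by (simp only: Un_Diff_cancel Un_absorb1)
    also have "... = infsum ?f ?I + infsum ?f (M - ?I)"
      by (rule infsum_Un_disjoint) (use s in auto)
    also have "infsum ?f ?I = 2" using ne f1 by simp
    finally have "efun M p w - 1 = infsum ?f (M - ?I) / 2" by (simp add: efun_def field_simps)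
    then have "norm (efun M p w - 1) = norm (infsum ?f (M - ?I)) / 2" by (simp only: norm_divide norm_numeral)
    then show ?thesis using s(3) by simp
  qed
  show thesis by (rule that[OF C(1) main])
qed

section \<open>Cusps\<close>

text \<open>The height at which the unit translation has displacement 1 / (4 y^2) equal to the
  Margulis constant.\<close>

definition cusp_height :: real where "cusp_height = 1 / (2 * sqrt margulis_const)"

lemma cusp_height_pos: "cusp_height > 0"
  by (simp add: cusp_height_def margulis_const_def)

lemma shear_translation: "shear (mat2 1 b 0 1) w = b / (2 * Im w)"
  by (simp add: shear_def)

lemma disp_translation: "Im w > 0 ==> disp (mat2 1 b 0 1) w = b\<^sup>2 / (4 * (Im w)\<^sup>2)"
  by (simp add: disp_eq det_2 trace2 shear_translation power_divide power_mult_distrib)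

text \<open>A group normalised to have a cusp of width 1 at infinity.\<close>

locale cusp_group = fuchsian_matrices +
  assumes unit_translation: "mat2 1 1 0 1 \<in> M"
    and primitive: "mat2 1 b 0 1 \<in> M ==> b \<noteq> 0 ==> \<bar>b\<bar> \<ge> 1"
begin

lemma translation_mult: "mat2 1 a 0 1 ** mat2 1 b 0 1 = mat2 1 (a + b) 0 1"
  by (rule mat2_eqI) auto

lemma nat_translation: "mat2 1 (real n) 0 1 \<in> M"
proof (induction n)
  case 0
  have "mat2 1 0 0 1 = mat 1" by (rule mat2_eqI) auto
  then show ?case using one_mem by simp
next
  case (Suc n)
  then show ?case using mult_mem[OF Suc unit_translation] by (simp add: translation_mult add.commute)
qed

lemma int_translation: "mat2 1 (of_int n) 0 1 \<in> M"
proof (cases "n \<ge> 0")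
  case True then show ?thesis using nat_translation[of "nat n"] by simp
next
  case False
  have "adj2 (mat2 1 (real (nat (- n))) 0 1) = mat2 1 (of_int n) 0 1" using False by (intro mat2_eqI) auto
  then show ?thesis using adj2_mem[OF nat_translation[of "nat (- n)"]] by simp
qed

lemma translation_int:
  assumes "mat2 1 b 0 1 \<in> M" shows "\<exists>n::int. b = of_int n"
proof -
  have "mat2 1 (b + of_int (- \<lfloor>b\<rfloor>)) 0 1 \<in> M"
    using mult_mem[OF assms int_translation[of "- \<lfloor>b\<rfloor>"]] by (simp only: translation_mult)
  moreover have "\<bar>b + of_int (- \<lfloor>b\<rfloor>)\<bar> < 1" by (simp add: abs_if) linarith
  ultimately have "b + of_int (- \<lfloor>b\<rfloor>) = 0" using primitive by force
  then have "b = of_int \<lfloor>b\<rfloor>" by simp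
  then show ?thesis by blast
qed

text \<open>Conjugating the unit translation by \<open>A\<close> and by its inverse gives
  translations by a^2 and d^2 with a d = 1. Primitivity forces both to be at least 1, so a and d are
  1 or -1 and no hyperbolic element fixes the cusp.\<close>

lemma fixes_infinity:
  assumes A: "A \<in> M" "A$2$1 = 0"
  obtains n :: int where "A = mat2 1 (of_int n) 0 1 \<or> A = - mat2 1 (of_int n) 0 1"
proof -
  have ad: "A$1$1 * A$2$2 = 1" using det1[OF A(1)] A(2) by (simp add: det_2)
  have "A ** mat2 1 1 0 1 ** adj2 A = mat2 1 ((A$1$1)\<^sup>2) 0 1"
    by (rule mat2_eqI) (use A(2) ad in \<open>simp_all add: power2_eq_square algebra_simps\<close>)
  then have "mat2 1 ((A$1$1)\<^sup>2) 0 1 \<in> M" using mult_mem[OF mult_mem[OF A(1) unit_translation] adj2_mem[OF A(1)]] by simp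
  then have 1: "(A$1$1)\<^sup>2 \<ge> 1" using primitive[of "(A$1$1)\<^sup>2"] ad by (cases "A$1$1 = 0") auto
  have "adj2 A ** mat2 1 1 0 1 ** A = mat2 1 ((A$2$2)\<^sup>2) 0 1"
    by (rule mat2_eqI) (use A(2) ad in \<open>simp_all add: power2_eq_square algebra_simps\<close>)
  then have "mat2 1 ((A$2$2)\<^sup>2) 0 1 \<in> M" using mult_mem[OF mult_mem[OF adj2_mem[OF A(1)] unit_translation] A(1)] by simp
  then have 2: "(A$2$2)\<^sup>2 \<ge> 1" using primitive[of "(A$2$2)\<^sup>2"] ad by (cases "A$2$2 = 0") auto
  have "(A$1$1)\<^sup>2 * (A$2$2)\<^sup>2 = 1" using ad by (simp flip: power_mult_distrib)
  then have "(A$1$1)\<^sup>2 = 1" using 1 2 by (metis dual_order.antisym mult.commute mult_left_mono mult_1_right order_trans zero_le_power2)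
  then have "A$1$1 = 1 \<or> A$1$1 = - 1" by (simp only: power2_eq_1_iff)
  then consider "A$1$1 = 1" "A$2$2 = 1" | "A$1$1 = -1" "A$2$2 = -1" using ad by auto
  then show thesis
  proof cases
    case 1
    then have e: "A = mat2 1 (A$1$2) 0 1" using A(2) by (intro mat2_eqI) auto
    then obtain n :: int where "A$1$2 = of_int n" using translation_int A(1) by metis
    then show ?thesis using that[of n] e by metis
  next
    case 2
    then have e: "- A = mat2 1 (- A$1$2) 0 1" using A(2) by (intro mat2_eqI) auto
    then obtain n :: int where "- A$1$2 = of_int n" using translation_int neg_mem[OF A(1)] by metis
    then have "- A = mat2 1 (of_int n) 0 1" using e by metis
    then have "A = - mat2 1 (of_int n) 0 1" by (metis minus_minus)
    then show ?thesis using that[of n] by blast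
  qed
qed

text \<open>If w and A w were both high, the unit translation and its conjugate by \<open>A\<close>
  would both move w by less than the Margulis constant and commute. The conjugate would fix
  infinity, yet its lower left entry is minus the square of that of \<open>A\<close>.\<close>

lemma cusp_separation:
  assumes A: "A \<in> M" "A$2$1 \<noteq> 0" and w: "Im w > cusp_height"
  shows "Im (moebius A w) \<le> cusp_height"
proof (rule ccontr)
  let ?T = "mat2 1 1 0 1"
  assume "\<not> Im (moebius A w) \<le> cusp_height"
  then have v: "Im (moebius A w) > cusp_height" by simp
  have small: "disp ?T v < margulis_const" if "Im v > cusp_height" for v
  proof -
    have v0: "Im v > 0" using that cusp_height_pos by linarith
    have "cusp_height\<^sup>2 < (Im v)\<^sup>2" using that cusp_height_pos by (intro power_strict_mono) auto
    then have "1 / (4 * margulis_const) < (Im v)\<^sup>2" by (simp add: cusp_height_def power_divide power_mult_distrib margulis_const_def)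
    then have "1 / (Im v)\<^sup>2 < 1 / (1 / (4 * margulis_const))"
      using v0 by (intro divide_strict_left_mono) (auto simp: margulis_const_def)
    then show ?thesis using v0 by (simp add: disp_translation margulis_const_def)
  qed
  have w0: "Im w > 0" using w cusp_height_pos by linarith
  let ?B = "adj2 A ** ?T ** A"
  have BM: "?B \<in> M" by (intro mult_mem adj2_mem unit_translation A(1))
  have "disp ?B w = disp ?T (moebius A w)"
    using A det1 unit_translation w0 by (intro disp_conj) auto
  then have "?T ** ?B = ?B ** ?T" using small[OF w] small[OF v] unit_translation BM w0 by (intro margulis) auto
  moreover have "?T \<noteq> mat 1" "?T \<noteq> - mat 1"
  proof -
    have "?T$1$2 \<noteq> (mat 1 :: real^2^2)$1$2" "?T$1$2 \<noteq> (- mat 1 :: real^2^2)$1$2" by simp_all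
    then show "?T \<noteq> mat 1" "?T \<noteq> - mat 1" by metis+
  qed
  ultimately obtain l where "prop_dev l ?T ?B" using commute_prop_dev det1[OF unit_translation] by blast
  then have "?B$2$1 = 0" by (simp add: prop_dev_def)
  moreover have "?B$2$1 = - (A$2$1)\<^sup>2" by (simp add: power2_eq_square algebra_simps)
  ultimately show False using A(2) by simp
qed

text \<open>The image of a high point lies below \<open>cusp_height\<close>, so the vertical gap is
  at least half the height. The factor 64 makes the displacement at least 4.\<close>

lemma cusp_disp_ge:
  assumes A: "A \<in> M" "A$2$1 \<noteq> 0" and w: "Im w \<ge> 64 * cusp_height"
  shows "disp A w \<ge> Im w / (16 * cusp_height)"
proof -
  let ?h = cusp_height
  have h: "?h > 0" by (rule cusp_height_pos)
  have w0: "Im w > 0" "Im w > ?h" using w h by linarith+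
  let ?v = "Im (moebius A w)"
  have v: "?v \<le> ?h" "?v > 0" using cusp_separation[OF A w0(2)] moebius_mem[OF A(1) w0(1)] by auto
  have "Im w / 2 \<le> Im w - ?v" using v w h by linarith
  then have "(Im w / 2)\<^sup>2 \<le> (Im w - ?v)\<^sup>2" using w0 by (intro power_mono) auto
  also have "... \<le> (cmod (w - moebius A w))\<^sup>2" by (simp add: cmod_power2)
  finally have "(Im w / 2)\<^sup>2 / (4 * Im w * ?v) \<le> disp A w"
    unfolding disp_def hypu_def using w0 v by (intro divide_right_mono) auto
  moreover have "Im w / (16 * ?h) \<le> (Im w / 2)\<^sup>2 / (4 * Im w * ?v)"
  proof -
    have "(Im w / 2)\<^sup>2 / (4 * Im w * ?v) = Im w / (16 * ?v)" using w0 by (simp add: power2_eq_square)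
    then show ?thesis using v w0 h by (simp add: divide_left_mono)
  qed
  ultimately show ?thesis by linarith
qed

text \<open>The shear of the translation by n is n / (2 Im w), whence u = 2 Im w in
  \<open>Qsum\<close>; the matrices with opposite sign contribute the same sum again.\<close>

lemma translation_sums:
  assumes w: "Im w > 0" and p: "p \<ge> 1"
  shows "((\<lambda>A. tfac w A ^ (2 * p)) has_sum (2 * of_real (Qsum p (2 * Im w)))) {A \<in> M. A$2$1 = 0}"
proof -
  let ?f = "\<lambda>A. tfac w A ^ (2 * p)"
  let ?T = "\<lambda>n::int. mat2 1 (of_int n) 0 1"
  have fT: "?f (?T n) = (1 / (1 - \<i> * of_real (of_int n / (2 * Im w)))) ^ (2 * p)" for n
    by (simp add: tfac_def trace2 shear_translation)
  have "tfac w (- A) = - tfac w A" for A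
  proof -
    have "shear (- A) w = - shear A w" unfolding shear_def minus_divide_left by (simp add: algebra_simps)
    moreover have "trace (- A) = - trace A" by (simp add: trace2)
    ultimately have "tfac w (- A) = 1 / (- (of_real (trace A / 2) - \<i> * of_real (shear A w)))"
      by (simp add: tfac_def)
    then show ?thesis unfolding tfac_def by (simp only: divide_minus_right)
  qed
  then have fm: "?f (- A) = ?f A" for A by simp
  have Q: "((\<lambda>n. ?f (?T n)) has_sum of_real (Qsum p (2 * Im w))) UNIV"
    unfolding fT by (rule sum_int_shear) (use w p in auto)
  have i1: "inj ?T" by (rule injI) (metis mat2_nth(2) of_int_eq_iff)
  have i2: "inj (\<lambda>n. - ?T n)" using i1 by (auto simp: inj_def)
  have "(?f has_sum of_real (Qsum p (2 * Im w))) (range ?T)"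
    using Q by (subst has_sum_reindex[OF i1]) (simp add: o_def)
  moreover have "(?f has_sum of_real (Qsum p (2 * Im w))) (range (\<lambda>n. - ?T n))"
    using Q fm by (subst has_sum_reindex[OF i2]) (simp add: o_def)
  moreover have "range ?T \<inter> range (\<lambda>n. - ?T n) = {}"
  proof -
    have "?T n \<noteq> - ?T m" for n m
    proof
      assume "?T n = - ?T m"
      then have "?T n$1$1 = (- ?T m)$1$1" by simp
      then show False by simp
    qed
    then show ?thesis by auto
  qed
  ultimately have "(?f has_sum (of_real (Qsum p (2 * Im w)) + of_real (Qsum p (2 * Im w)))) (range ?T \<union> range (\<lambda>n. - ?T n))"
    by (rule has_sum_Un_disjoint)
  moreover have "range ?T \<union> range (\<lambda>n. - ?T n) = {A \<in> M. A$2$1 = 0}"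
  proof (intro equalityI subsetI)
    fix A assume "A \<in> {A \<in> M. A$2$1 = 0}"
    then show "A \<in> range ?T \<union> range (\<lambda>n. - ?T n)" by (elim CollectE conjE fixes_infinity) auto
  qed (use int_translation neg_mem in auto)
  ultimately show ?thesis by simp
qed

text \<open>Elements not fixing infinity are displaced by at least 4, so only translations count,
  and those of displacement at most 1 have |n| <= 2 Im w.\<close>

lemma card_cusp_le:
  assumes w: "Im w \<ge> 64 * cusp_height" "Im w \<ge> 1" and D: "D \<le> 1"
  shows "real (card {A \<in> M. disp A w \<le> D}) \<le> 10 * Im w"
proof -
  let ?T = "\<lambda>n::int. mat2 1 (of_int n) 0 1"
  define k where "k = \<lfloor>2 * Im w\<rfloor>"
  have w0: "Im w > 0" using w by linarith
  have sub: "{A \<in> M. disp A w \<le> D} \<subseteq> ?T ` {-k..k} \<union> (\<lambda>n. - ?T n) ` {-k..k}"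
  proof
    fix A assume "A \<in> {A \<in> M. disp A w \<le> D}"
    then have A: "A \<in> M" "disp A w \<le> 1" using D by auto
    have "A$2$1 = 0"
    proof (rule ccontr)
      assume "A$2$1 \<noteq> 0"
      then have "disp A w \<ge> Im w / (16 * cusp_height)" using A w by (intro cusp_disp_ge)
      moreover have "Im w / (16 * cusp_height) \<ge> 4" using w cusp_height_pos by (simp add: field_simps)
      ultimately show False using A by linarith
    qed
    then obtain n :: int where n: "A = ?T n \<or> A = - ?T n" using fixes_infinity A(1) by metis
    have dn: "disp (- ?T n) w = disp (?T n) w" by (simp add: disp_def)
    have "disp (?T n) w \<le> 1" using n A(2) dn by metis
    then have "(of_int n)\<^sup>2 \<le> (2 * Im w)\<^sup>2" using w0 by (simp add: disp_translation field_simps power_mult_distrib)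
    then have "\<bar>of_int n\<bar> \<le> \<bar>2 * Im w\<bar>" by (simp only: abs_le_square_iff)
    then have "\<bar>of_int n\<bar> \<le> 2 * Im w" using w0 by simp
    then have "n \<in> {-k..k}" by (simp add: k_def le_floor_iff abs_le_iff) linarith
    then show "A \<in> ?T ` {-k..k} \<union> (\<lambda>n. - ?T n) ` {-k..k}" using n by blast
  qed
  have "card {A \<in> M. disp A w \<le> D} \<le> card (?T ` {-k..k} \<union> (\<lambda>n. - ?T n) ` {-k..k})"
    by (rule card_mono[OF _ sub]) simp
  also have "... \<le> card (?T ` {-k..k}) + card ((\<lambda>n. - ?T n) ` {-k..k})" by (rule card_Un_le)
  also have "... \<le> card {-k..k} + card {-k..k}" by (intro add_mono card_image_le) auto
  finally have "card {A \<in> M. disp A w \<le> D} \<le> 2 * nat (2 * k + 1)" by simp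
  then have "real (card {A \<in> M. disp A w \<le> D}) \<le> real (2 * nat (2 * k + 1))" by (simp only: of_nat_le_iff)
  also have "... = 2 * (2 * of_int k + 1)" using w0 by (simp add: k_def)
  also have "... \<le> 2 * (2 * (2 * Im w) + Im w)" using w unfolding k_def by (intro mult_left_mono add_mono) auto
  finally show ?thesis by simp
qed

end

text \<open>The number of short elements grows like Im w, but elements not fixing infinity have
  displacement at least m = Im w / (16 \<open>cusp_height\<close>). One of the p - 2 spare factors 1
  / (1 + m) cancels the growth; the remaining p - 3 give the power of 4, since m >= 4.\<close>

lemma efun_cusp:
  obtains C L where "C > 0" "L \<ge> 64 * cusp_height" "L \<ge> 1" "\<And>M w p. cusp_group M ==> Im w \<ge> L ==> p \<ge> 3 ==>
     norm (efun M p w - of_real (Qsum p (2 * Im w))) \<le> C / 4 ^ (p - 3)"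
proof -
  define d :: real where "d = 1/32"
  have d: "d > 0" "8 * d + 16 * d\<^sup>2 \<le> 1" by (simp_all add: d_def power2_eq_square)
  obtain C where C: "C > 0" "\<And>M z w F. fuchsian_matrices M ==> Im z > 0 ==> Im w > 0 ==> finite F ==> F \<subseteq> M ==>
    (\<Sum>A\<in>F. 1 / (1 + hypu z (moebius A w))\<^sup>2) \<le> C * real (card {A \<in> M. disp A w \<le> 8 * d + 16 * d\<^sup>2})"
    using kernel_sum_bound[OF d(1)] by blast
  define L where "L = max 1 (64 * cusp_height)"
  have L: "L \<ge> 64 * cusp_height" "L \<ge> 1" by (simp_all add: L_def)
  define C' where "C' = 80 * C * cusp_height"
  have C'0: "C' > 0" using C cusp_height_pos by (simp add: C'_def)
  have main: "norm (efun M p w - of_real (Qsum p (2 * Im w))) \<le> C' / 4 ^ (p - 3)"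
    if M: "cusp_group M" and w: "Im w \<ge> L" and p: "p \<ge> 3" for M w p
  proof -
    interpret cusp_group M by (rule M)
    have w0: "Im w > 0" "Im w \<ge> 64 * cusp_height" "Im w \<ge> 1" using w L by linarith+
    let ?f = "\<lambda>A. tfac w A ^ (2 * p)"
    let ?P = "{A \<in> M. A$2$1 = 0}"
    define m where "m = Im w / (16 * cusp_height)"
    have m4: "m \<ge> 4" using w0 cusp_height_pos by (simp add: m_def field_simps)
    have bd: "(\<Sum>A\<in>F. norm (?f A)) \<le> 2 * C' / 4 ^ (p - 3)" if F: "finite F" "F \<subseteq> M - ?P" for F
    proof -
      have "(\<Sum>A\<in>F. norm (?f A)) \<le> (\<Sum>A\<in>F. 1 / (1 + m) ^ (p - 2) * (1 / (1 + disp A w)\<^sup>2))"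
      proof (rule sum_mono)
        fix A assume "A \<in> F"
        then have A: "A \<in> M" "A$2$1 \<noteq> 0" using F by auto
        have "m \<le> disp A w" unfolding m_def using A w0 by (intro cusp_disp_ge) auto
        then show "norm (?f A) \<le> 1 / (1 + m) ^ (p - 2) * (1 / (1 + disp A w)\<^sup>2)"
          using power_split_bound[of m "disp A w" p] m4 p w0 det1[OF A(1)] by (simp add: norm_tfac)
      qed
      also have "... = 1 / (1 + m) ^ (p - 2) * (\<Sum>A\<in>F. 1 / (1 + hypu w (moebius A w))\<^sup>2)"
        by (simp add: sum_distrib_left disp_def)
      also have "... \<le> 1 / (1 + m) ^ (p - 2) * (C * (10 * Im w))"
      proof (rule mult_left_mono)
        have "(\<Sum>A\<in>F. 1 / (1 + hypu w (moebius A w))\<^sup>2) \<le> C * real (card {A \<in> M. disp A w \<le> 8 * d + 16 * d\<^sup>2})"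
          using F w0 by (intro C(2) fuchsian_matrices_axioms) auto
        also have "... \<le> C * (10 * Im w)" using C(1) card_cusp_le[OF w0(2,3) d(2)] by (intro mult_left_mono) auto
        finally show "(\<Sum>A\<in>F. 1 / (1 + hypu w (moebius A w))\<^sup>2) \<le> C * (10 * Im w)" .
      qed (use m4 in auto)
      also have "... \<le> 1 / (m * 4 ^ (p - 3)) * (C * (10 * Im w))"
      proof (rule mult_right_mono)
        have "(1 + m) ^ (p - 2) = (1 + m) * (1 + m) ^ (p - 3)" using p by (metis Suc_diff_Suc Suc_le_lessD numeral_3_eq_3 numeral_2_eq_2 diff_Suc_Suc power_Suc)
        moreover have "m * 4 ^ (p - 3) \<le> (1 + m) * (1 + m) ^ (p - 3)" using m4 by (intro mult_mono power_mono) auto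
        ultimately show "1 / (1 + m) ^ (p - 2) \<le> 1 / (m * 4 ^ (p - 3))" using m4 by (intro divide_left_mono) auto
      qed (use C w0 in auto)
      also have "... = 2 * C' / 4 ^ (p - 3)" using w0 cusp_height_pos by (simp add: m_def C'_def)
      finally show ?thesis .
    qed
    note s = summable_bounded_partial[of "M - ?P" ?f, OF bd]
    have P: "(?f has_sum (2 * of_real (Qsum p (2 * Im w)))) ?P" using w0 p by (intro translation_sums) auto
    have "M = ?P \<union> (M - ?P)" by blast
    then have "infsum ?f M = infsum ?f (?P \<union> (M - ?P))" by metis
    also have "... = infsum ?f ?P + infsum ?f (M - ?P)"
      by (rule infsum_Un_disjoint) (use s P in \<open>auto simp: summable_on_def\<close>)
    also have "infsum ?f ?P = 2 * of_real (Qsum p (2 * Im w))" by (rule infsumI[OF P])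
    finally have "efun M p w - of_real (Qsum p (2 * Im w)) = infsum ?f (M - ?P) / 2" by (simp add: efun_def add_divide_distrib)
    then have "norm (efun M p w - of_real (Qsum p (2 * Im w))) = norm (infsum ?f (M - ?P)) / 2"
      by (simp only: norm_divide norm_numeral)
    then show ?thesis using s(3) by simp
  qed
  show thesis by (rule that[OF C'0 L main])
qed

lemma parabolic_normal_form:
  assumes d: "det A = 1" and t: "(trace A)\<^sup>2 / 4 = 1" and A: "A \<noteq> mat 1" "A \<noteq> - mat 1"
  obtains S where "det S = 1" "\<exists>e s. e \<in> {1, -1} \<and> s \<in> {1, -1} \<and> adj2 S ** A ** S = mat2 e s 0 e"
proof -
  have "(trace A / 2)\<^sup>2 = 1" using t by (simp add: power_divide)
  then obtain e where e: "e \<in> {1, -1}" "trace A = 2 * e" by (metis insert_iff mult.commute nonzero_divide_eq_eq power2_eq_1_iff zero_neq_numeral)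
  have tr: "A$1$1 + A$2$2 = 2 * e" using e by (simp add: trace2)
  have dev: "((A$1$1 - A$2$2) / 2)\<^sup>2 + A$1$2 * A$2$1 = 0" using trace_dev[OF d] t by simp
  show thesis
  proof (cases "A$2$1 = 0")
    case True
    then have eq: "A$1$1 = e" "A$2$2 = e" using dev tr by auto
    have b0: "A$1$2 \<noteq> 0"
    proof
      assume "A$1$2 = 0"
      then have "A = mat2 e 0 0 e" using eq True by (intro mat2_eqI) auto
      moreover have "mat2 1 0 0 1 = mat 1" "mat2 (-1) 0 0 (-1) = - mat 1" by (rule mat2_eqI; simp)+
      ultimately show False using e A by auto
    qed
    define r where "r = sqrt \<bar>A$1$2\<bar>"
    have r: "r > 0" "r * r = \<bar>A$1$2\<bar>" using b0 by (simp_all add: r_def)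
    have "adj2 (mat2 r 0 0 (1 / r)) ** A ** mat2 r 0 0 (1 / r) = mat2 e (sgn (A$1$2)) 0 e"
    proof (rule mat2_eqI)
      have "A$1$2 / (r * r) = sgn (A$1$2)" unfolding r(2) using b0 by (simp add: sgn_if)
      then show "(adj2 (mat2 r 0 0 (1 / r)) ** A ** mat2 r 0 0 (1 / r))$1$2 = mat2 e (sgn (A$1$2)) 0 e$1$2"
        using True by simp
    qed (use True eq r in auto)
    moreover have "det (mat2 r 0 0 (1 / r)) = 1" using r by (simp add: det_2)
    moreover have "sgn (A$1$2) \<in> {1, -1}" using b0 by (simp add: sgn_if)
    ultimately show thesis using that e by blast
  next
    case False
    define c where "c = A$2$1"
    define r where "r = sqrt \<bar>c\<bar>"
    define q where "q = (A$1$1 - A$2$2) / 2"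
    have c0: "c \<noteq> 0" using False by (simp add: c_def)
    have r: "r > 0" "r * r = \<bar>c\<bar>" using c0 by (simp_all add: r_def)
    have ent: "A$1$1 = e + q" "A$2$2 = e - q" "A$2$1 = c" using tr by (simp_all add: q_def c_def field_simps)
    have bq: "A$1$2 = - q * q / c" using dev c0 by (simp add: q_def[symmetric] c_def[symmetric] power2_eq_square field_simps)
    let ?S = "mat2 (q / c * r) (- 1 / r) r 0"
    have "adj2 ?S ** A ** ?S = mat2 e (- sgn c) 0 e"
    proof (rule mat2_eqI)
      have "c / (r * r) = sgn c" unfolding r(2) using c0 by (simp add: sgn_if)
      then show "(adj2 ?S ** A ** ?S)$1$2 = mat2 e (- sgn c) 0 e$1$2"
        using r(1) by (simp add: ent bq)
    qed (use c0 r(1) in \<open>simp_all add: ent bq field_simps\<close>)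
    moreover have "det ?S = 1" using r by (simp add: det_2)
    moreover have "- sgn c \<in> {1, -1}" using c0 by (simp add: sgn_if)
    ultimately show thesis using that e by blast
  qed
qed

context fuchsian_matrices
begin

text \<open>The normal form is taken for a minimal element \<open>Y\<close> of the centraliser of
  \<open>X\<close>, not for \<open>X\<close> itself. Translations in the conjugate group commute
  with \<open>Y\<close>, so minimality becomes primitivity, and l^2 <= 1 gives the inequality for
  the displacement of \<open>X\<close>.\<close>

lemma parabolic_cusp_group:
  assumes X: "X \<in> M" "X \<noteq> mat 1" "X \<noteq> - mat 1" "(trace X)\<^sup>2 / 4 = 1"
  obtains S where "det S = 1" "cusp_group (conj_group S M)"
    "\<And>v. Im v > 0 ==> 1 / (4 * (Im v)\<^sup>2) \<le> disp X (moebius S v)"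
proof -
  obtain Y l where Y: "Y \<in> M" "Y \<noteq> mat 1" "Y \<noteq> - mat 1" "prop_dev l X Y" "l \<noteq> 0" "l\<^sup>2 \<le> 1"
    and mn: "\<forall>m W. W \<in> M --> W \<noteq> mat 1 --> W \<noteq> - mat 1 --> prop_dev m Y W --> m\<^sup>2 \<ge> 1"
    by (rule prop_dev_disp_i_minimal[OF X(1-3)])
  have tY: "(trace Y)\<^sup>2 / 4 = 1" using prop_dev_trace[OF Y(4)] det1 X(1,4) Y(1) by simp
  obtain S where S: "det S = 1" "\<exists>e s. e \<in> {1, -1} \<and> s \<in> {1, -1} \<and> adj2 S ** Y ** S = mat2 e s 0 e"
    by (rule parabolic_normal_form[OF det1[OF Y(1)] tY Y(2,3)])
  let ?c = "\<lambda>A. adj2 S ** A ** S"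
  obtain e s where es: "e \<in> {1, -1}" "s \<in> {1, -1}" "?c Y = mat2 e s 0 e" using S(2) by blast
  interpret c: fuchsian_matrices "?c ` M" by (rule conj_fuchsian[OF S(1)])
  have cY: "mat2 e s 0 e \<in> ?c ` M" using Y(1) es(3) by (metis imageI)
  have m: "- mat2 a b c d = mat2 (- a) (- b) (- c) (- d)" for a b c d by (rule mat2_eqI) auto
  have a: "adj2 (mat2 a b c d) = mat2 d (- b) (- c) a" for a b c d by (rule mat2_eqI) auto
  \<comment> \<open>The normal form, its negative, its inverse and the negative of its inverse
    include the unit translation for each choice of the two signs.\<close>
  have T: "mat2 1 1 0 1 \<in> ?c ` M"
    using cY c.neg_mem[OF cY] c.adj2_mem[OF cY] c.neg_mem[OF c.adj2_mem[OF cY]] es(1,2) by (auto simp: m a)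
  have prim: "\<bar>b\<bar> \<ge> 1" if b: "mat2 1 b 0 1 \<in> ?c ` M" "b \<noteq> 0" for b
  proof -
    obtain W where W: "W \<in> M" "mat2 1 b 0 1 = ?c W" using b(1) by auto
    have W1: "W \<noteq> mat 1" "W \<noteq> - mat 1"
    proof -
      have "mat2 1 b 0 1$1$2 \<noteq> (mat 1 :: real^2^2)$1$2" "mat2 1 b 0 1$1$2 \<noteq> (- mat 1 :: real^2^2)$1$2" using b(2) by simp_all
      moreover have "?c (mat 1) = mat 1" "?c (- mat 1) = - mat 1" using S(1) by simp_all
      ultimately show "W \<noteq> mat 1" "W \<noteq> - mat 1" using W(2) by metis+
    qed
    have "?c Y ** ?c W = ?c W ** ?c Y" unfolding es(3) W(2)[symmetric] by (rule mat2_eqI) (simp_all add: algebra_simps)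
    moreover have h: "?c A ** ?c B = ?c (A ** B)" for A B
    proof -
      have "?c A ** ?c B = adj2 S ** A ** (S ** adj2 S) ** B ** S" by (simp only: matrix_mul_assoc)
      then show ?thesis using S(1) by (simp only: adj2_mult matrix_mul_rid matrix_mul_assoc)
    qed
    ultimately have "?c (Y ** W) = ?c (W ** Y)" by (simp only: h)
    then have "S ** ?c (Y ** W) ** adj2 S = S ** ?c (W ** Y) ** adj2 S" by (simp only:)
    then have "Y ** W = W ** Y" unfolding conj2_inverse[OF S(1)] .
    then obtain m where m: "prop_dev m Y W" using commute_prop_dev det1[OF Y(1)] Y(2,3) by blast
    then have "m\<^sup>2 \<ge> 1" using mn W(1) W1 by blast
    have "disp W (moebius S \<i>) = m\<^sup>2 * disp Y (moebius S \<i>)"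
      using prop_dev_disp[OF m] det1 Y(1) W(1) S(1) by (simp add: Im_moebius_pos)
    then have "disp (?c W) \<i> = m\<^sup>2 * disp (?c Y) \<i>" using disp_conj[OF S(1)] det1 Y(1) W(1) by simp
    moreover have "disp (?c W) \<i> = b\<^sup>2 / 4" unfolding W(2)[symmetric] by (simp add: disp_translation)
    moreover have "disp (?c Y) \<i> = 1 / 4" unfolding es(3) using es(1,2)
      by (auto simp: disp_eq det_2 trace2 shear_def power2_eq_square)
    ultimately have "b\<^sup>2 \<ge> 1\<^sup>2" using \<open>m\<^sup>2 \<ge> 1\<close> by simp
    then show ?thesis using abs_le_square_iff[of 1 b] by simp
  qed
  have cg: "cusp_group (?c ` M)" by unfold_locales (use T prim in auto)
  have "1 / (4 * (Im v)\<^sup>2) \<le> disp X (moebius S v)" if v: "Im v > 0" for v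
  proof -
    have Sv: "Im (moebius S v) > 0" using S(1) v by (rule Im_moebius_pos)
    have "1 / (4 * (Im v)\<^sup>2) = disp (?c Y) v" unfolding es(3) using es(1,2) v
      by (auto simp: disp_eq det_2 trace2 shear_def power2_eq_square)
    also have "... = disp Y (moebius S v)" using disp_conj[OF S(1) det1[OF Y(1)] v] .
    also have "... = l\<^sup>2 * disp X (moebius S v)" using prop_dev_disp[OF Y(4)] det1 X(1) Y(1) Sv by simp
    also have "... \<le> 1 * disp X (moebius S v)" using Y(6) disp_nonneg[OF X(1) Sv] by (rule mult_right_mono)
    finally show ?thesis by simp
  qed
  then show thesis using that S(1) cg by blast
qed

end

context lattice
begin

text \<open>The gap for hyperbolic elements makes any element of displacement below t parabolic. The
  bound t <= 1 / (4 L^2) then forces the point to lie above height L in the cusp of that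
  element.\<close>

lemma thick_or_cusp:
  assumes L: "L > 0"
  shows "\<exists>t>0. t \<le> margulis_const \<and> t \<le> 1 / (4 * L\<^sup>2) \<and>
    (\<forall>w. Im w > 0 --> \<not> thick M t w --> (\<exists>S v. det S = 1 \<and> cusp_group (conj_group S M) \<and> Im v > 0 \<and> moebius S v = w \<and> 1 / (4 * (Im v)\<^sup>2) < t))"
proof -
  obtain \<eta> where \<eta>: "\<eta> > 0" "\<And>X. X \<in> M ==> (trace X)\<^sup>2 / 4 - 1 > 0 ==> (trace X)\<^sup>2 / 4 - 1 \<ge> \<eta>"
    using hyperbolic_gap by blast
  define t where "t = min \<eta> (min margulis_const (1 / (4 * L\<^sup>2)))"
  have t: "t > 0" "t \<le> margulis_const" "t \<le> 1 / (4 * L\<^sup>2)" "t \<le> \<eta>"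
    using \<eta>(1) L by (auto simp: t_def margulis_const_def)
  have gap: "(trace X)\<^sup>2 / 4 - 1 \<ge> t" if "X \<in> M" "(trace X)\<^sup>2 / 4 - 1 > 0" for X
    using \<eta>(2)[OF that] t(4) by linarith
  have c: "\<exists>S v. det S = 1 \<and> cusp_group (conj_group S M) \<and> Im v > 0 \<and> moebius S v = w \<and> 1 / (4 * (Im v)\<^sup>2) < t"
    if w: "Im w > 0" "\<not> thick M t w" for w
  proof -
    obtain X where X: "X \<in> M" "X \<noteq> mat 1" "X \<noteq> - mat 1" "disp X w < t" using w(2) by (auto simp: thick_def not_le)
    have "(trace X)\<^sup>2 / 4 - 1 \<le> disp X w" using X(1) w det1 by (simp add: disp_eq)
    then have "\<not> (trace X)\<^sup>2 / 4 - 1 > 0" using gap[OF X(1)] X(4) by linarith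
    then have "(trace X)\<^sup>2 / 4 = 1" using trace_sq_ge[OF X(1)] by linarith
    then obtain S where S: "det S = 1" "cusp_group (conj_group S M)"
      "\<And>v. Im v > 0 ==> 1 / (4 * (Im v)\<^sup>2) \<le> disp X (moebius S v)"
      using parabolic_cusp_group[OF X(1-3)] by blast
    let ?v = "moebius (adj2 S) w"
    have v: "Im ?v > 0" "moebius S ?v = w" using S(1) w(1) by (auto intro: Im_moebius_pos)
    then have "1 / (4 * (Im ?v)\<^sup>2) < t" using S(3)[of ?v] X(4) by simp
    then show ?thesis using S v by blast
  qed
  show ?thesis by (intro exI[of _ t] conjI allI impI t(1-3) c)
qed

end

section \<open>Bounded automorphic forms\<close>

text \<open>Boundedness of the invariant norm replaces the conditions at the cusps. It mentions no
  charts and is what integrability and the reproducing formula use.\<close>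

definition bounded_form :: "(real^2^2) set \<Rightarrow> nat \<Rightarrow> (complex \<Rightarrow> complex) \<Rightarrow> bool" where
  "bounded_form M p f \<longleftrightarrow> f holomorphic_on uhp \<and>
     (\<forall>A\<in>M. \<forall>z\<in>uhp. f (moebius A z) = aut_factor A z ^ (2 * p) * f z) \<and>
     (\<exists>K. \<forall>z\<in>uhp. cmod (f z) * (2 * Im z) ^ p \<le> K)"

definition pseries :: "(real^2^2) set \<Rightarrow> nat \<Rightarrow> complex \<Rightarrow> complex \<Rightarrow> complex" where
  "pseries M p w z = (\<Sum>\<^sub>\<infinity>A\<in>M. (\<i> / herm A w z) ^ (2 * p)) / 2"

lemma herm_nz:
  assumes "det A = 1" "Im z > 0" "Im w > 0" shows "herm A w z \<noteq> 0"
proof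
  assume "herm A w z = 0"
  then have "4 * Im z * Im w * (1 + hypu (moebius A z) w) = 0" using cmod_herm[OF assms] by simp
  moreover have "hypu (moebius A z) w \<ge> 0" using assms by (intro hypu_nonneg Im_moebius_pos)
  ultimately show False using assms by simp
qed

lemma norm_herm_power:
  assumes "det A = 1" "Im z > 0" "Im w > 0"
  shows "norm ((\<i> / herm A w z) ^ (2 * p)) = 1 / (4 * Im z * Im w) ^ p * (1 / (1 + hypu (moebius A z) w) ^ p)"
proof -
  have "norm ((\<i> / herm A w z) ^ (2 * p)) = 1 / ((cmod (herm A w z))\<^sup>2) ^ p"
    by (simp add: norm_power norm_divide power_divide power_mult)
  then show ?thesis unfolding cmod_herm[OF assms] by (simp add: power_mult_distrib)
qed

lemma norm_herm_power_le:
  assumes "det A = 1" "Im z > 0" "Im w > 0" "p \<ge> 2"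
  shows "norm ((\<i> / herm A w z) ^ (2 * p)) \<le> 1 / (4 * Im z * Im w) ^ p * (1 / (1 + hypu (moebius A z) w)\<^sup>2)"
proof -
  have "hypu (moebius A z) w \<ge> 0" using assms by (intro hypu_nonneg Im_moebius_pos)
  then have "(1 + hypu (moebius A z) w)\<^sup>2 \<le> (1 + hypu (moebius A z) w) ^ p" "1 + hypu (moebius A z) w > 0"
    using assms(4) by (auto intro: power_increasing)
  then have "1 / (1 + hypu (moebius A z) w) ^ p \<le> 1 / (1 + hypu (moebius A z) w)\<^sup>2"
    by (intro divide_left_mono) auto
  then show ?thesis unfolding norm_herm_power[OF assms(1-3)] using assms by (intro mult_left_mono) auto
qed

lemma herm_moebius:
  assumes "det A = 1" "det B = 1" "Im z > 0"
  shows "herm A w (moebius B z) = herm (A ** B) w z / aut_factor B z"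
proof -
  have "Im (moebius B z) > 0" using assms by (intro Im_moebius_pos)
  moreover have "det (A ** B) = 1" using assms by (simp add: det_mul)
  ultimately show ?thesis
    using assms aut_factor_nz[OF assms(2,3)] by (simp add: herm_eq aut_factor_mult moebius_mult)
qed

context fuchsian_matrices
begin

text \<open>Replacing A by its inverse moves the group to the fixed point w. The bound of
  \<open>kernel_sum_bound\<close> then counts displacements at w only and is uniform in z.\<close>

lemma orbit_sum_bound:
  assumes w: "Im w > 0"
  obtains K where "K > 0" "\<forall>z F. Im z > 0 --> finite F --> F \<subseteq> M --> (\<Sum>A\<in>F. 1 / (1 + hypu (moebius A z) w)\<^sup>2) \<le> K"
proof -
  define N where "N = real (card {A \<in> M. disp A w \<le> 8 * 1 + 16 * 1\<^sup>2})"
  obtain C where C: "C > 0" "\<And>M z w F. fuchsian_matrices M ==> Im z > 0 ==> Im w > 0 ==> finite F ==> F \<subseteq> M ==>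
    (\<Sum>A\<in>F. 1 / (1 + hypu z (moebius A w))\<^sup>2) \<le> C * real (card {A \<in> M. disp A w \<le> 8 * 1 + 16 * 1\<^sup>2})"
    using kernel_sum_bound[of 1] by auto
  have "(\<Sum>A\<in>F. 1 / (1 + hypu (moebius A z) w)\<^sup>2) \<le> C * N + 1" if z: "Im z > 0" and F: "finite F" "F \<subseteq> M" for z F
  proof -
    have "(\<Sum>A\<in>F. 1 / (1 + hypu (moebius A z) w)\<^sup>2) = (\<Sum>A\<in>F. 1 / (1 + hypu z (moebius (adj2 A) w))\<^sup>2)"
    proof (rule sum.cong[OF refl])
      fix A assume "A \<in> F"
      then have A: "A \<in> M" "det A = 1" using F det1 by auto
      have "hypu (moebius (adj2 A) (moebius A z)) (moebius (adj2 A) w) = hypu (moebius A z) w"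
        using A z w by (intro hypu_moebius) (auto intro: Im_moebius_pos)
      then show "1 / (1 + hypu (moebius A z) w)\<^sup>2 = 1 / (1 + hypu z (moebius (adj2 A) w))\<^sup>2"
        using A z by simp
    qed
    also have "... = (\<Sum>B\<in>adj2 ` F. 1 / (1 + hypu z (moebius B w))\<^sup>2)"
    proof -
      have "inj_on adj2 F" by (rule inj_on_inverseI[where g = adj2]) simp
      then show ?thesis by (simp add: sum.reindex)
    qed
    also have "... \<le> C * N" unfolding N_def
      by (rule C(2)[OF fuchsian_matrices_axioms z w]) (use F adj2_mem in auto)
    finally show ?thesis by simp
  qed
  moreover have "C * N + 1 > 0" using C(1) by (simp add: N_def add_nonneg_pos)
  ultimately show thesis using that by blast
qed

lemma herm_sum_bound:
  assumes w: "Im w > 0" and p: "p \<ge> 2"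
  obtains K where "\<forall>z F. Im z > 0 --> finite F --> F \<subseteq> M --> (\<Sum>A\<in>F. norm ((\<i> / herm A w z) ^ (2 * p))) \<le> 1 / (4 * Im z * Im w) ^ p * K"
proof -
  obtain K where K: "K > 0" "\<forall>z F. Im z > 0 --> finite F --> F \<subseteq> M --> (\<Sum>A\<in>F. 1 / (1 + hypu (moebius A z) w)\<^sup>2) \<le> K"
    by (rule orbit_sum_bound[OF w])
  have "(\<Sum>A\<in>F. norm ((\<i> / herm A w z) ^ (2 * p))) \<le> 1 / (4 * Im z * Im w) ^ p * K" if z: "Im z > 0" and F: "finite F" "F \<subseteq> M" for z F
  proof -
    have "(\<Sum>A\<in>F. norm ((\<i> / herm A w z) ^ (2 * p))) \<le> (\<Sum>A\<in>F. 1 / (4 * Im z * Im w) ^ p * (1 / (1 + hypu (moebius A z) w)\<^sup>2))"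
      using F det1 z w p by (intro sum_mono norm_herm_power_le) auto
    also have "... = 1 / (4 * Im z * Im w) ^ p * (\<Sum>A\<in>F. 1 / (1 + hypu (moebius A z) w)\<^sup>2)" by (simp only: sum_distrib_left)
    also have "... \<le> 1 / (4 * Im z * Im w) ^ p * K" using K(2) z w F by (intro mult_left_mono) auto
    finally show ?thesis .
  qed
  then show thesis using that by blast
qed

lemma pseries_summable:
  assumes w: "Im w > 0" and z: "Im z > 0" and p: "p \<ge> 2"
  shows "(\<lambda>A. norm ((\<i> / herm A w z) ^ (2 * p))) summable_on M"
proof -
  obtain K where K: "\<forall>z F. Im z > 0 --> finite F --> F \<subseteq> M --> (\<Sum>A\<in>F. norm ((\<i> / herm A w z) ^ (2 * p))) \<le> 1 / (4 * Im z * Im w) ^ p * K"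
    by (rule herm_sum_bound[OF w p])
  show ?thesis by (rule summable_bounded_partial(1)[OF K[rule_format, OF z]])
qed

lemma pseries_norm:
  assumes w: "Im w > 0" and p: "p \<ge> 2"
  shows "\<exists>K. \<forall>z\<in>uhp. cmod (pseries M p w z) * (2 * Im z) ^ p \<le> K"
proof -
  obtain K where K: "\<forall>z F. Im z > 0 --> finite F --> F \<subseteq> M --> (\<Sum>A\<in>F. norm ((\<i> / herm A w z) ^ (2 * p))) \<le> 1 / (4 * Im z * Im w) ^ p * K"
    by (rule herm_sum_bound[OF w p])
  have "cmod (pseries M p w z) * (2 * Im z) ^ p \<le> K / (2 * Im w) ^ p" if z: "Im z > 0" for z
  proof -
    have "cmod (infsum (\<lambda>A. (\<i> / herm A w z) ^ (2 * p)) M) \<le> 1 / (4 * Im z * Im w) ^ p * K"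
      by (rule summable_bounded_partial(3)[OF K[rule_format, OF z]])
    moreover have "cmod (pseries M p w z) \<le> cmod (infsum (\<lambda>A. (\<i> / herm A w z) ^ (2 * p)) M)"
      unfolding pseries_def norm_divide by simp
    ultimately have "cmod (pseries M p w z) * (2 * Im z) ^ p \<le> 1 / (4 * Im z * Im w) ^ p * K * (2 * Im z) ^ p"
      using z by (intro mult_right_mono) auto
    also have "4 * Im z * Im w = (2 * Im z) * (2 * Im w)" by simp
    also have "1 / ((2 * Im z) * (2 * Im w)) ^ p * K * (2 * Im z) ^ p = K / (2 * Im w) ^ p"
      unfolding power_mult_distrib[of "2 * Im z" "2 * Im w"] using z by simp
    finally show ?thesis .
  qed
  then show ?thesis by (intro exI[of _ "K / (2 * Im w) ^ p"]) (auto simp: uhp_iff)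
qed

text \<open>Weierstrass' test on Euclidean discs of radius Im z0 / 2: by
  \<open>hypu_triangle\<close> each term is bounded on the disc by a multiple of a summable quantity
  at its centre.\<close>

lemma pseries_holomorphic:
  assumes w: "Im w > 0" and p: "p \<ge> 2"
  shows "pseries M p w holomorphic_on uhp"
proof -
  obtain K where K: "K > 0" "\<forall>z F. Im z > 0 --> finite F --> F \<subseteq> M --> (\<Sum>A\<in>F. 1 / (1 + hypu (moebius A z) w)\<^sup>2) \<le> K"
    by (rule orbit_sum_bound[OF w])
  have hol: "(\<lambda>z. (\<i> / herm A w z) ^ (2 * p)) holomorphic_on uhp" if "A \<in> M" for A
  proof -
    have "(\<lambda>z. herm A w z) holomorphic_on uhp" unfolding herm_def aut_factor_def by (intro holomorphic_intros)
    then show ?thesis using herm_nz[OF det1[OF that] _ w] by (intro holomorphic_intros) (auto simp: uhp_iff)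
  qed
  have loc: "pseries M p w holomorphic_on ball z0 (Im z0 / 2)" if z0: "Im z0 > 0" for z0
  proof -
    let ?B = "cball z0 (Im z0 / 2)"
    have B: "Im z \<ge> Im z0 / 2" "Im z > 0" if "z \<in> ?B" for z
    proof -
      have "\<bar>Im (z0 - z)\<bar> \<le> Im z0 / 2" using that abs_Im_le_cmod[of "z0 - z"] by (simp add: dist_norm)
      then show "Im z \<ge> Im z0 / 2" unfolding minus_complex.sel abs_le_iff by linarith
      then show "Im z > 0" using z0 by linarith
    qed
    \<comment> \<open>On the disc \<open>hypu\<close> to the centre is at most 1/8, so 1 +
      \<open>hypu\<close> changes by a factor of at most 3/2 * 4 = 6, and 36 is its square. The
      height drops to no less than half, turning 4 Im z into 2 Im z0.\<close>
    let ?m = "\<lambda>A. 1 / (2 * Im z0 * Im w) ^ p * 36 * (1 / (1 + hypu (moebius A z0) w)\<^sup>2)"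
    have le: "norm ((\<i> / herm A w z) ^ (2 * p)) \<le> ?m A" if A: "A \<in> M" and z: "z \<in> ?B" for A z
    proof -
      have d: "det A = 1" by (rule det1[OF A])
      note zB = B[OF z]
      have "(cmod (z0 - z))\<^sup>2 \<le> (Im z0 / 2)\<^sup>2" using z by (intro power_mono) (auto simp: dist_norm)
      moreover have "4 * Im z0 * (Im z0 / 2) \<le> 4 * Im z0 * Im z" using zB z0 by (intro mult_left_mono) auto
      ultimately have "hypu z0 z \<le> (Im z0 / 2)\<^sup>2 / (4 * Im z0 * (Im z0 / 2))"
        unfolding hypu_def using z0 by (intro frac_le) auto
      also have "... = 1 / 8" using z0 by (simp add: power2_eq_square)
      finally have u1: "hypu (moebius A z0) (moebius A z) \<le> 1 / 8" using d z0 zB by (simp add: hypu_moebius)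
      have im: "Im (moebius A z0) > 0" "Im (moebius A z) > 0" using d z0 zB by (auto intro: Im_moebius_pos)
      have nn: "hypu (moebius A z) w \<ge> 0" "hypu (moebius A z0) w \<ge> 0" using im w by (auto intro: hypu_nonneg)
      have "1 + hypu (moebius A z0) w \<le> (1 + 4 * hypu (moebius A z0) (moebius A z)) * (1 + 4 * hypu (moebius A z) w)"
        using im w by (intro hypu_triangle)
      also have "... \<le> (3 / 2) * (4 * (1 + hypu (moebius A z) w))" using u1 nn by (intro mult_mono) auto
      finally have "1 + hypu (moebius A z0) w \<le> 6 * (1 + hypu (moebius A z) w)" by simp
      then have "(1 + hypu (moebius A z0) w)\<^sup>2 \<le> (6 * (1 + hypu (moebius A z) w))\<^sup>2" using nn by (intro power_mono) auto
      then have sq: "(1 + hypu (moebius A z0) w)\<^sup>2 \<le> 36 * (1 + hypu (moebius A z) w)\<^sup>2" by (simp only: power_mult_distrib) simp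
      have "1 / (1 + hypu (moebius A z) w)\<^sup>2 = 36 / (36 * (1 + hypu (moebius A z) w)\<^sup>2)" by simp
      also have "... \<le> 36 / (1 + hypu (moebius A z0) w)\<^sup>2" using sq nn by (intro divide_left_mono) auto
      finally have a: "1 / (1 + hypu (moebius A z) w)\<^sup>2 \<le> 36 * (1 / (1 + hypu (moebius A z0) w)\<^sup>2)" by simp
      have "2 * Im z0 * Im w \<le> 4 * Im z * Im w" using zB w by simp
      then have "(2 * Im z0 * Im w) ^ p \<le> (4 * Im z * Im w) ^ p" using z0 w by (intro power_mono) auto
      then have b: "1 / (4 * Im z * Im w) ^ p \<le> 1 / (2 * Im z0 * Im w) ^ p" using z0 w zB by (intro divide_left_mono) auto
      have "norm ((\<i> / herm A w z) ^ (2 * p)) \<le> 1 / (4 * Im z * Im w) ^ p * (1 / (1 + hypu (moebius A z) w)\<^sup>2)"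
        using d zB w p by (intro norm_herm_power_le)
      also have "... \<le> 1 / (2 * Im z0 * Im w) ^ p * (36 * (1 / (1 + hypu (moebius A z0) w)\<^sup>2))"
        using a b z0 w by (intro mult_mono) auto
      finally show ?thesis by (simp only: mult.assoc)
    qed
    have sm: "?m summable_on M"
    proof -
      have "(\<lambda>A. 1 / (1 + hypu (moebius A z0) w)\<^sup>2) summable_on M"
        by (rule nonneg_bdd_above_summable_on) (use K(2) z0 in \<open>auto intro!: bdd_aboveI2[of _ _ K]\<close>)
      then show ?thesis by (rule summable_on_cmult_right)
    qed
    let ?s = "\<lambda>F z. \<Sum>A\<in>F. (\<i> / herm A w z) ^ (2 * p)"
    have ul: "uniform_limit ?B ?s (\<lambda>z. \<Sum>\<^sub>\<infinity>A\<in>M. (\<i> / herm A w z) ^ (2 * p)) (finite_subsets_at_top M)"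
      by (rule Weierstrass_m_test_general[OF le sm])
    have sub: "?B \<subseteq> uhp" using B(2) by (auto simp: uhp_iff)
    have ev: "\<forall>\<^sub>F F in finite_subsets_at_top M. continuous_on ?B (?s F) \<and> (?s F) holomorphic_on ball z0 (Im z0 / 2)"
      unfolding eventually_finite_subsets_at_top
    proof (rule exI[of _ "{}"], safe)
      fix F assume F: "finite F" "F \<subseteq> M"
      have "?s F holomorphic_on uhp" using F hol by (intro holomorphic_on_sum) auto
      then show "continuous_on ?B (?s F)" "?s F holomorphic_on ball z0 (Im z0 / 2)"
        using holomorphic_on_subset[OF _ sub] holomorphic_on_imp_continuous_on holomorphic_on_subset[OF _ order_trans[OF ball_subset_cball sub]] by blast+
    qed
    have "(\<lambda>z. \<Sum>\<^sub>\<infinity>A\<in>M. (\<i> / herm A w z) ^ (2 * p)) holomorphic_on ball z0 (Im z0 / 2)"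
      by (rule holomorphic_uniform_limit[OF ev ul]) simp_all
    then show ?thesis unfolding pseries_def by (intro holomorphic_intros) auto
  qed
  show ?thesis
  proof (rule holomorphic_onI)
    fix z0 assume "z0 \<in> uhp"
    then have z0: "Im z0 > 0" by (simp add: uhp_iff)
    then have "pseries M p w field_differentiable at z0"
      using loc[OF z0] by (intro holomorphic_on_imp_differentiable_at[of _ "ball z0 (Im z0 / 2)"]) auto
    then show "pseries M p w field_differentiable at z0 within uhp" by (rule field_differentiable_at_within)
  qed
qed

lemma pseries_automorphic:
  assumes B: "B \<in> M" and z: "Im z > 0"
  shows "pseries M p w (moebius B z) = aut_factor B z ^ (2 * p) * pseries M p w z"
proof -
  have "bij_betw (\<lambda>A. A ** B) M M"
  proof (rule bij_betw_byWitness[where f' = "\<lambda>A. A ** adj2 B"])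
    have "A ** B ** adj2 B = A" "A ** adj2 B ** B = A" for A :: "real^2^2"
      using det1[OF B] by (simp_all flip: matrix_mul_assoc)
    then show "\<forall>A\<in>M. A ** B ** adj2 B = A" "\<forall>A\<in>M. A ** adj2 B ** B = A" by blast+
  qed (use B mult_mem adj2_mem in auto)
  then have r: "(\<Sum>\<^sub>\<infinity>A\<in>M. (\<i> / herm (A ** B) w z) ^ (2 * p)) = (\<Sum>\<^sub>\<infinity>A\<in>M. (\<i> / herm A w z) ^ (2 * p))"
    by (rule infsum_reindex_bij_betw)
  have "(\<Sum>\<^sub>\<infinity>A\<in>M. (\<i> / herm A w (moebius B z)) ^ (2 * p)) = (\<Sum>\<^sub>\<infinity>A\<in>M. aut_factor B z ^ (2 * p) * (\<i> / herm (A ** B) w z) ^ (2 * p))"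
  proof (rule infsum_cong)
    fix A assume "A \<in> M"
    then have "herm A w (moebius B z) = herm (A ** B) w z / aut_factor B z" using det1 B z by (intro herm_moebius)
    then have "\<i> / herm A w (moebius B z) = aut_factor B z * (\<i> / herm (A ** B) w z)" by simp
    then show "(\<i> / herm A w (moebius B z)) ^ (2 * p) = aut_factor B z ^ (2 * p) * (\<i> / herm (A ** B) w z) ^ (2 * p)"
      by (simp only: power_mult_distrib)
  qed
  also have "... = aut_factor B z ^ (2 * p) * (\<Sum>\<^sub>\<infinity>A\<in>M. (\<i> / herm (A ** B) w z) ^ (2 * p))"
    by (rule infsum_cmult_right')
  finally show ?thesis unfolding pseries_def r by simp
qed

lemma pseries_bounded_form:
  assumes "Im w > 0" "p \<ge> 2" shows "bounded_form M p (pseries M p w)"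
  unfolding bounded_form_def using pseries_holomorphic[OF assms] pseries_norm[OF assms] pseries_automorphic by (auto simp: uhp_iff)

lemma pseries_diag:
  assumes w: "Im w > 0"
  shows "pseries M p w w * of_real ((2 * Im w) ^ (2 * p)) = efun M p w"
proof -
  have "of_real ((2 * Im w) ^ (2 * p)) * (\<Sum>\<^sub>\<infinity>A\<in>M. (\<i> / herm A w w) ^ (2 * p)) = (\<Sum>\<^sub>\<infinity>A\<in>M. of_real ((2 * Im w) ^ (2 * p)) * (\<i> / herm A w w) ^ (2 * p))"
    by (rule infsum_cmult_right'[symmetric])
  also have "... = (\<Sum>\<^sub>\<infinity>A\<in>M. tfac w A ^ (2 * p))"
  proof (rule infsum_cong)
    fix A
    have "of_real (2 * Im w) * (\<i> / herm A w w) = tfac w A"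
      unfolding herm_diag[OF w] tfac_def using w by simp
    then have "(of_real (2 * Im w) * (\<i> / herm A w w)) ^ (2 * p) = tfac w A ^ (2 * p)" by simp
    then show "of_real ((2 * Im w) ^ (2 * p)) * (\<i> / herm A w w) ^ (2 * p) = tfac w A ^ (2 * p)"
      by (simp only: power_mult_distrib[of "complex_of_real (2 * Im w)"] of_real_power)
  qed
  finally show ?thesis unfolding pseries_def efun_def by (simp add: mult.commute)
qed

end

section \<open>The reproducing property\<close>

abbreviation qexp :: "complex \<Rightarrow> complex" where
  "qexp s \<equiv> exp (2 * of_real pi * \<i> * s)"

lemma circle_mean:
  assumes H: "H holomorphic_on ball 0 1" and r: "0 < r" "r < 1"
  shows "(\<integral>x. indicator {0<..<1} x *\<^sub>R H (of_real r * qexp (of_real x)) \<partial>lborel) = H 0"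
proof -
  let ?g = "\<lambda>x::real. H (of_real r * qexp (of_real x))"
  have Hc: "H holomorphic_on cball 0 r" by (rule holomorphic_on_subset[OF H]) (use r in auto)
  have "((\<lambda>u. H u / (u - 0)) has_contour_integral (2 * of_real pi * \<i> * H 0)) (circlepath 0 r)"
    using Hc r by (intro Cauchy_integral_circlepath_simple) auto
  then have "((\<lambda>x. H (circlepath 0 r x) / (circlepath 0 r x - 0) * vector_derivative (circlepath 0 r) (at x within {0..1})) has_integral
      (2 * of_real pi * \<i> * H 0)) {0..1}"
    by (simp add: has_contour_integral_def)
  moreover have "H (circlepath 0 r x) / (circlepath 0 r x - 0) * vector_derivative (circlepath 0 r) (at x within {0..1}) = ?g x * (2 * of_real pi * \<i>)"
    if "x \<in> {0..1}" for x
  proof -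
    have v: "vector_derivative (circlepath 0 r) (at x within {0..1}) = 2 * of_real pi * \<i> * of_real r * qexp (of_real x)"
      using that by (simp add: vector_derivative_circlepath01)
    have c: "circlepath 0 r x = of_real r * qexp (of_real x)"
      by (simp add: circlepath)
    show ?thesis unfolding v c using r by simp
  qed
  ultimately have "((\<lambda>x. ?g x * (2 * of_real pi * \<i>)) has_integral (2 * of_real pi * \<i> * H 0)) {0..1}"
    by (rule has_integral_eq[rotated]) 
  then have "((\<lambda>x. ?g x * (2 * of_real pi * \<i>) * (1 / (2 * of_real pi * \<i>))) has_integral (2 * of_real pi * \<i> * H 0 * (1 / (2 * of_real pi * \<i>)))) {0..1}"
    by (rule has_integral_mult_left)
  then have hk: "(?g has_integral H 0) {0..1}" by simp
  have cont: "continuous_on {0..1} ?g"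
  proof (rule continuous_on_compose2[OF holomorphic_on_imp_continuous_on[OF H]])
    show "continuous_on {0..1} (\<lambda>x::real. of_real r * qexp (of_real x))" by (intro continuous_intros)
    show "(\<lambda>x::real. of_real r * qexp (of_real x)) ` {0..1} \<subseteq> ball 0 1"
      using r by (auto simp: norm_mult)
  qed
  have int: "set_integrable lborel {0..1} ?g" by (rule borel_integrable_atLeastAtMost'[OF cont])
  have "(LINT x:{0..1}|lborel. ?g x) = integral {0..1} ?g" by (rule set_borel_integral_eq_integral(2)[OF int])
  also have "... = H 0" by (rule integral_unique[OF hk])
  finally have "(\<integral>x. indicator {0..1} x *\<^sub>R ?g x \<partial>lborel) = H 0" by (simp add: set_lebesgue_integral_def)
  moreover have "(\<integral>x. indicator {0<..<1} x *\<^sub>R ?g x \<partial>lborel) = (\<integral>x. indicator {0..1} x *\<^sub>R ?g x \<partial>lborel)"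
  proof (rule integral_cong_AE)
    have "AE x in lborel. x \<noteq> (0::real)" "AE x in lborel. x \<noteq> (1::real)" by (rule AE_lborel_singleton)+
    then show "AE x in lborel. indicator {0<..<1} x *\<^sub>R ?g x = indicator {0..1} x *\<^sub>R ?g x"
      by eventually_elim (auto simp: indicator_def)
    show "(\<lambda>x. indicator {0..1} x *\<^sub>R ?g x) \<in> borel_measurable lborel"
      using borel_measurable_continuous_on_indicator[OF _ cont] by simp
    have "continuous_on {0<..<1} ?g" by (rule continuous_on_subset[OF cont]) auto
    then show "(\<lambda>x. indicator {0<..<1} x *\<^sub>R ?g x) \<in> borel_measurable lborel"
      using borel_measurable_continuous_on_indicator[of "{0<..<1}" ?g] by simp
  qed
  ultimately show ?thesis by simp
qed

lemma nn_integral_exp_finite: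
  assumes "c > 0"
  shows "(\<integral>\<^sup>+y. ennreal (exp (- (c * y))) * indicator {0..} y \<partial>lborel) < \<infinity>"
proof -
  have "(\<integral>\<^sup>+y. ennreal (exp (- (c * y))) * indicator {0..} y \<partial>lborel) = ennreal (0 - (- exp (- (c * 0)) / c))"
  proof (rule nn_integral_FTC_atLeast[where F = "\<lambda>y. - exp (- (c * y)) / c"])
    fix y :: real
    show "((\<lambda>y. - exp (- (c * y)) / c) has_real_derivative exp (- (c * y))) (at y)"
      using assms by (auto intro!: derivative_eq_intros)
  next
    show "((\<lambda>y::real. - exp (- (c * y)) / c) \<longlongrightarrow> 0) at_top" using assms by real_asymp
  qed auto
  then show ?thesis by simp
qed

text \<open>With D = 1 - exp (- 4 pi y) the integrand becomes 2 pi D^(2p-2) dD over the interval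
  from 0 to 1.\<close>

lemma radial_integral:
  assumes p: "p \<ge> 1"
  shows "(\<integral>y. indicator {0<..} y *\<^sub>R (8 * pi\<^sup>2 * exp (- (4 * pi * y)) * (1 - exp (- (4 * pi * y))) ^ (2 * p - 2)) \<partial>lborel) = 2 * pi / (2 * real p - 1)"
proof -
  let ?f = "\<lambda>y::real. 8 * pi\<^sup>2 * exp (- (4 * pi * y)) * (1 - exp (- (4 * pi * y))) ^ (2 * p - 2)"
  let ?F = "\<lambda>y::real. 2 * pi / (2 * real p - 1) * (1 - exp (- (4 * pi * y))) ^ (2 * p - 1)"
  have q: "2 * real p - 1 = real (2 * p - 1)" "2 * p - 1 - 1 = 2 * p - 2" "2 * real p - 1 > 0" using p by auto
  have nn: "?f y \<ge> 0" if "y \<ge> 0" for y using that by (intro mult_nonneg_nonneg zero_le_power) auto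
  have z: "0 ^ (2 * p - 1) = (0::real)" using p by (simp add: zero_power)
  have "(\<integral>\<^sup>+y. ennreal (?f y) * indicator {0..} y \<partial>lborel) = ennreal (2 * pi / (2 * real p - 1) - ?F 0)"
  proof (rule nn_integral_FTC_atLeast)
    fix y :: real
    have "((\<lambda>y. (1 - exp (- (4 * pi * y))) ^ (2 * p - 1)) has_real_derivative
       real (2 * p - 1) * (1 - exp (- (4 * pi * y))) ^ (2 * p - 2) * (4 * pi * exp (- (4 * pi * y)))) (at y)"
      by (rule derivative_eq_intros refl | simp add: q(2) flip: numeral_2_eq_2)+
    then have "(?F has_real_derivative 2 * pi / (2 * real p - 1) *
       (real (2 * p - 1) * (1 - exp (- (4 * pi * y))) ^ (2 * p - 2) * (4 * pi * exp (- (4 * pi * y))))) (at y)"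
      by (rule DERIV_cmult)
    moreover have "2 * pi / (2 * real p - 1) *
       (real (2 * p - 1) * (1 - exp (- (4 * pi * y))) ^ (2 * p - 2) * (4 * pi * exp (- (4 * pi * y)))) = ?f y"
      using q(3) unfolding q(1)[symmetric] by (simp add: power2_eq_square)
    ultimately show "(?F has_real_derivative ?f y) (at y)" by (simp only:)
  next
    have "((\<lambda>y::real. 1 - exp (- (4 * pi * y))) \<longlongrightarrow> 1) at_top"
    proof -
      have "((\<lambda>y::real. 1 - exp (- (c * y))) \<longlongrightarrow> 1) at_top" if "c > 0" for c using that by real_asymp
      from this[of "4 * pi"] show ?thesis by simp
    qed
    then have "(?F \<longlongrightarrow> 2 * pi / (2 * real p - 1) * 1 ^ (2 * p - 1)) at_top" by (intro tendsto_intros)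
    then show "(?F \<longlongrightarrow> 2 * pi / (2 * real p - 1)) at_top" by simp
  qed (use nn in auto)
  then have e: "(\<integral>\<^sup>+y. ennreal (?f y) * indicator {0..} y \<partial>lborel) = ennreal (2 * pi / (2 * real p - 1))"
    by (simp only: mult_zero_right minus_zero exp_zero diff_self z diff_zero)
  have "(\<integral>y. indicator {0<..} y *\<^sub>R ?f y \<partial>lborel) = enn2real (\<integral>\<^sup>+y. ennreal (indicator {0<..} y *\<^sub>R ?f y) \<partial>lborel)"
    by (rule integral_eq_nn_integral) (use nn in \<open>auto simp: indicator_def\<close>)
  also have "(\<integral>\<^sup>+y. ennreal (indicator {0<..} y *\<^sub>R ?f y) \<partial>lborel) = (\<integral>\<^sup>+y. ennreal (?f y) * indicator {0..} y \<partial>lborel)"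
  proof (rule nn_integral_cong_AE)
    have "AE x in lborel. x \<noteq> (0::real)" by (rule AE_lborel_singleton)
    then show "AE y in lborel. ennreal (indicator {0<..} y *\<^sub>R ?f y) = ennreal (?f y) * indicator {0..} y"
      by eventually_elim (auto simp: indicator_def)
  qed
  finally show ?thesis unfolding e using q(3) by simp
qed

text \<open>A horizontal segment of the strip maps to a circle about 0, on which the mean of
  \<open>H\<close> is \<open>H 0\<close>; the radial integral remains. The growth bound on
  \<open>H\<close> with p >= 2 supplies the integrability for Fubini's theorem.\<close>

lemma strip_integral:
  assumes H: "H holomorphic_on ball 0 1" and p: "p \<ge> 2"
    and K: "\<forall>\<zeta>\<in>ball 0 1. cmod (H \<zeta>) * (1 - (cmod \<zeta>)\<^sup>2) ^ p \<le> K"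
  shows "(\<integral>s. indicator {s. 0 < Re s \<and> Re s < 1 \<and> 0 < Im s} s *\<^sub>R
     (of_real (8 * pi\<^sup>2 * exp (- (4 * pi * Im s)) * (1 - exp (- (4 * pi * Im s))) ^ (2 * p - 2)) * H (qexp s)) \<partial>lborel)
     = 2 * of_real pi / (2 * of_nat p - 1) * H 0"
proof -
  let ?S = "{s. 0 < Re s \<and> Re s < 1 \<and> 0 < Im s}"
  let ?a = "\<lambda>y::real. 8 * pi\<^sup>2 * exp (- (4 * pi * y)) * (1 - exp (- (4 * pi * y))) ^ (2 * p - 2)"
  let ?f = "\<lambda>s. of_real (?a (Im s)) * H (qexp s)"
  define T where "T = (\<lambda>s. indicator ?S s *\<^sub>R ?f s)"
  have So: "open ?S"
  proof -
    have "?S = {s. 0 < Re s} \<inter> {s. Re s < 1} \<inter> {s. 0 < Im s}" by auto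
    then show ?thesis by (simp add: open_Int open_halfspace_Re_gt open_halfspace_Re_lt open_halfspace_Im_gt)
  qed
  have qn: "cmod (qexp s) = exp (- (2 * pi * Im s))" for s by (simp add: norm_exp_eq_Re)
  have q2: "(cmod (qexp s))\<^sup>2 = exp (- (4 * pi * Im s))" for s
    unfolding qn by (simp add: power2_eq_square flip: exp_add)
  have q1: "qexp s \<in> ball 0 1" if "Im s > 0" for s using that by (simp add: qn)
  have cont: "continuous_on ?S ?f"
    by (intro continuous_intros continuous_on_compose2[OF holomorphic_on_imp_continuous_on[OF H]]) (use q1 in auto)
  have Tm: "T \<in> borel_measurable borel" unfolding T_def by (rule borel_measurable_continuous_on_indicator) (use So cont in auto)
  have K0: "K \<ge> 0" using K[rule_format, of 0] order_trans[OF norm_ge_zero[of "H 0"]] by simp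
  have bd: "norm (T s) \<le> 8 * pi\<^sup>2 * K * exp (- (4 * pi * Im s)) * indicator {0..} (Im s) * indicator {0..1} (Re s)" for s
  proof (cases "s \<in> ?S")
    case True
    let ?D = "1 - exp (- (4 * pi * Im s))"
    have D: "0 \<le> ?D" "?D \<le> 1" using True by auto
    have "cmod (H (qexp s)) * ?D ^ p \<le> K" using K q1 True q2 by fastforce
    then have "?D ^ (p - 2) * (cmod (H (qexp s)) * ?D ^ p) \<le> 1 * K"
      using D K0 by (intro mult_mono power_le_one) auto
    moreover have "?D ^ (2 * p - 2) = ?D ^ (p - 2) * ?D ^ p" 
    proof -
      have "2 * p - 2 = (p - 2) + p" using p by simp
      then show ?thesis by (simp only: power_add)
    qed
    ultimately have "?D ^ (2 * p - 2) * cmod (H (qexp s)) \<le> K" by (simp add: mult_ac)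
    then have "(8 * pi\<^sup>2 * exp (- (4 * pi * Im s))) * (?D ^ (2 * p - 2) * cmod (H (qexp s))) \<le> (8 * pi\<^sup>2 * exp (- (4 * pi * Im s))) * K"
      by (intro mult_left_mono) auto
    moreover have "norm (T s) = (8 * pi\<^sup>2 * exp (- (4 * pi * Im s))) * (?D ^ (2 * p - 2) * cmod (H (qexp s)))"
    proof -
      have "norm (T s) = \<bar>?a (Im s)\<bar> * cmod (H (qexp s))" using True unfolding T_def by (simp only: norm_mult norm_of_real norm_scaleR indicator_simps abs_one mult_1_left)
      also have "\<bar>?a (Im s)\<bar> = ?a (Im s)" using D(1) by (intro abs_of_nonneg mult_nonneg_nonneg zero_le_power) auto
      finally show ?thesis by (simp only: mult.assoc)
    qed
    ultimately show ?thesis using True by (simp add: mult_ac)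
  next
    case False
    then have "T s = 0" by (simp only: T_def indicator_simps scale_zero_left not_False_eq_True)
    then show ?thesis using K0 by simp
  qed
  let ?P = "\<lambda>(x, y). T (Complex x y)"
  have Pm: "?P \<in> borel_measurable (lborel \<Otimes>\<^sub>M lborel)"
    using measurable_compose[OF measurable_Complex Tm] by (simp add: case_prod_beta')
  have "integrable lborel T"
  proof (rule integrableI_bounded)
    show "T \<in> borel_measurable lborel" unfolding measurable_lborel2 by (rule Tm)
    have "(\<integral>\<^sup>+s. ennreal (norm (T s)) \<partial>lborel) \<le> (\<integral>\<^sup>+s. ennreal (8 * pi\<^sup>2 * K * exp (- (4 * pi * Im s)) * indicator {0..} (Im s) * indicator {0..1} (Re s)) \<partial>lborel)"
    proof (rule nn_integral_mono)
      fix s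
      show "ennreal (norm (T s)) \<le> ennreal (8 * pi\<^sup>2 * K * exp (- (4 * pi * Im s)) * indicator {0..} (Im s) * indicator {0..1} (Re s))"
        using bd[of s] by (rule ennreal_leI)
    qed
    also have "... = (\<integral>\<^sup>+y. (\<integral>\<^sup>+x. ennreal (8 * pi\<^sup>2 * K * exp (- (4 * pi * y)) * indicator {0..} y * indicator {0..1::real} x) \<partial>lborel) \<partial>lborel)"
    proof -
      have m1: "(\<lambda>s. indicator {0..} (Im s) :: real) \<in> borel_measurable borel"
        by (rule measurable_compose[of Im _ borel]) auto
      have m2: "(\<lambda>s. indicator {0..1} (Re s) :: real) \<in> borel_measurable borel"
        by (rule measurable_compose[of Re _ borel]) auto
      have m3: "(\<lambda>s. 8 * pi\<^sup>2 * K * exp (- (4 * pi * Im s))) \<in> borel_measurable borel"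
        by (intro borel_measurable_continuous_onI continuous_intros)
      have "(\<lambda>s. 8 * pi\<^sup>2 * K * exp (- (4 * pi * Im s)) * indicator {0..} (Im s) * indicator {0..1} (Re s)) \<in> borel_measurable borel"
        by (rule borel_measurable_times[OF borel_measurable_times[OF m3 m1] m2])
      then have "(\<lambda>s. ennreal (8 * pi\<^sup>2 * K * exp (- (4 * pi * Im s)) * indicator {0..} (Im s) * indicator {0..1} (Re s))) \<in> borel_measurable borel"
        by (rule measurable_compose[OF _ measurable_ennreal])
      from nn_integral_complex[OF this] show ?thesis by (simp only: complex.sel)
    qed
    also have "... = (\<integral>\<^sup>+y. (\<integral>\<^sup>+x. ennreal (8 * pi\<^sup>2 * K) * (ennreal (exp (- (4 * pi * y))) * indicator {0..} y) * indicator {0..1::real} x \<partial>lborel) \<partial>lborel)"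
    proof (rule nn_integral_cong, rule nn_integral_cong)
      fix x y :: real
      have "ennreal (8 * pi\<^sup>2 * K * exp (- (4 * pi * y))) = ennreal (8 * pi\<^sup>2 * K) * ennreal (exp (- (4 * pi * y)))"
        by (rule ennreal_mult) (use K0 in auto)
      then show "ennreal (8 * pi\<^sup>2 * K * exp (- (4 * pi * y)) * indicator {0..} y * indicator {0..1::real} x) =
          ennreal (8 * pi\<^sup>2 * K) * (ennreal (exp (- (4 * pi * y))) * indicator {0..} y) * indicator {0..1::real} x"
        by (simp split: split_indicator)
    qed
    also have "... = (\<integral>\<^sup>+y. ennreal (8 * pi\<^sup>2 * K) * (ennreal (exp (- (4 * pi * y))) * indicator {0..} y) \<partial>lborel)"
      by (rule nn_integral_cong, subst nn_integral_cmult_indicator) auto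
    also have "... = ennreal (8 * pi\<^sup>2 * K) * (\<integral>\<^sup>+y. ennreal (exp (- (4 * pi * y))) * indicator {0..} y \<partial>lborel)"
      by (rule nn_integral_cmult) measurable
    also have "... < \<infinity>" using nn_integral_exp_finite[of "4 * pi"] by (simp add: ennreal_mult_less_top mult.assoc)
    finally show "(\<integral>\<^sup>+s. ennreal (norm (T s)) \<partial>lborel) < \<infinity>" .
  qed
  then have "integrable (distr (lborel \<Otimes>\<^sub>M lborel) borel (\<lambda>(x, y). Complex x y)) T" by (simp only: distr_Complex)
  then have Pi: "integrable (lborel \<Otimes>\<^sub>M lborel) ?P"
    by (subst (asm) integrable_distr_eq[OF measurable_Complex Tm]) (simp add: case_prod_beta')
  have "(\<integral>s. indicator ?S s *\<^sub>R ?f s \<partial>lborel) = (\<integral>s. T s \<partial>lborel)" by (simp only: T_def)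
  also have "... = (\<integral>s. T s \<partial>distr (lborel \<Otimes>\<^sub>M lborel) borel (\<lambda>(x, y). Complex x y))" by (simp only: distr_Complex)
  also have "... = (\<integral>z. ?P z \<partial>(lborel \<Otimes>\<^sub>M lborel))"
    by (subst integral_distr[OF measurable_Complex Tm]) (simp add: case_prod_beta')
  also have "... = (\<integral>y. (\<integral>x. T (Complex x y) \<partial>lborel) \<partial>lborel)"
    by (rule lborel_pair.integral_snd[symmetric]) (rule Pi)
  also have "... = (\<integral>y. of_real (indicator {0<..} y *\<^sub>R ?a y) * H 0 \<partial>lborel)"
  proof (rule Bochner_Integration.integral_cong[OF refl])
    fix y :: real
    show "(\<integral>x. T (Complex x y) \<partial>lborel) = of_real (indicator {0<..} y *\<^sub>R ?a y) * H 0"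
    proof (cases "y > 0")
      case True
      define r where "r = exp (- (2 * pi * y))"
      have r: "0 < r" "r < 1" using True by (auto simp: r_def)
      have "qexp (Complex x y) = of_real r * qexp (of_real x)" for x
      proof -
        have "2 * of_real pi * \<i> * Complex x y = of_real (- (2 * pi * y)) + 2 * of_real pi * \<i> * of_real x"
          by (simp add: complex_eq_iff)
        then show ?thesis unfolding r_def by (simp only: exp_add exp_of_real)
      qed
      then have "(\<integral>x. T (Complex x y) \<partial>lborel) = (\<integral>x. of_real (?a y) * (indicator {0<..<1} x *\<^sub>R H (of_real r * qexp (of_real x))) \<partial>lborel)"
        using True unfolding T_def by (intro Bochner_Integration.integral_cong refl) (simp add: indicator_def)
      also have "... = of_real (?a y) * (\<integral>x. indicator {0<..<1} x *\<^sub>R H (of_real r * qexp (of_real x)) \<partial>lborel)"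
        by (rule integral_mult_right_zero)
      also have "... = of_real (?a y) * H 0" by (simp only: circle_mean[OF H r])
      finally show ?thesis using True by simp
    next
      case False
      then have "T (Complex x y) = 0" for x by (simp add: T_def)
      then show ?thesis using False by simp
    qed
  qed
  also have "... = (\<integral>y. of_real (indicator {0<..} y *\<^sub>R ?a y) \<partial>lborel) * H 0" by (rule integral_mult_left_zero)
  also have "... = of_real (\<integral>y. indicator {0<..} y *\<^sub>R ?a y \<partial>lborel) * H 0" by (simp only: integral_complex_of_real)
  also have "... = of_real (2 * pi / (2 * real p - 1)) * H 0" using p by (subst radial_integral) auto
  also have "complex_of_real (2 * pi / (2 * real p - 1)) = 2 * of_real pi / (2 * of_nat p - 1)" by simp
  finally show ?thesis .
qed

lemma cayley_disc:
  assumes "\<zeta> \<in> ball 0 1"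
  shows "1 - \<zeta> \<noteq> 0" "1 - (cmod \<zeta>)\<^sup>2 > 0" "Im (\<i> * (1 + \<zeta>) / (1 - \<zeta>)) = (1 - (cmod \<zeta>)\<^sup>2) / (cmod (1 - \<zeta>))\<^sup>2"
    "\<i> * (1 + \<zeta>) / (1 - \<zeta>) \<in> uhp"
proof -
  show 1: "1 - \<zeta> \<noteq> 0" "1 - (cmod \<zeta>)\<^sup>2 > 0" using assms by (auto simp: abs_square_less_1)
  have "\<i> * (1 + \<zeta>) / (1 - \<zeta>) = \<i> * (1 + \<zeta>) * cnj (1 - \<zeta>) / of_real ((cmod (1 - \<zeta>))\<^sup>2)"
    by (subst complex_div_cnj) (simp only: of_real_power)
  also have "Im ... = Im (\<i> * (1 + \<zeta>) * cnj (1 - \<zeta>)) / (cmod (1 - \<zeta>))\<^sup>2" by (simp only: Im_divide_of_real)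
  also have "Im (\<i> * (1 + \<zeta>) * cnj (1 - \<zeta>)) = 1 - (cmod \<zeta>)\<^sup>2"
    unfolding cmod_power2 by (simp add: power2_eq_square algebra_simps)
  finally show 2: "Im (\<i> * (1 + \<zeta>) / (1 - \<zeta>)) = (1 - (cmod \<zeta>)\<^sup>2) / (cmod (1 - \<zeta>))\<^sup>2" .
  show "\<i> * (1 + \<zeta>) / (1 - \<zeta>) \<in> uhp" unfolding uhp_iff 2 using 1 by (intro divide_pos_pos) auto
qed

lemma exp_disc:
  assumes "0 < Im s"
  shows "qexp s \<in> ball 0 1" "(cmod (qexp s))\<^sup>2 = exp (- (4 * pi * Im s))"
proof -
  have qn: "cmod (qexp s) = exp (- (2 * pi * Im s))" by (simp add: norm_exp_eq_Re)
  then show "qexp s \<in> ball 0 1" using assms by simp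
  show "(cmod (qexp s))\<^sup>2 = exp (- (4 * pi * Im s))" unfolding qn by (simp add: power2_eq_square flip: exp_add)
qed

text \<open>The upper half-plane minus a vertical slit is the image of a half-strip under the composition
  of the exponential with a Cayley transform.\<close>

lemma strip_map:
  defines "S \<equiv> {s. 0 < Re s \<and> Re s < 1 \<and> 0 < Im s}"
    and "\<Phi> \<equiv> \<lambda>s. \<i> * (1 + qexp s) / (1 - qexp s)"
  shows "open S" "\<Phi> holomorphic_on S" "inj_on \<Phi> S" "\<Phi> ` S \<subseteq> uhp" "uhp - \<Phi> ` S \<subseteq> {z. Re z = 0}"
    and "\<And>s. s \<in> S ==> deriv \<Phi> s = - 4 * of_real pi * qexp s / (1 - qexp s)\<^sup>2"
proof -
  let ?e = "\<lambda>s. qexp s"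
  have "S = {s. 0 < Re s} \<inter> {s. Re s < 1} \<inter> {s. 0 < Im s}" by (auto simp: S_def)
  then show "open S" by (simp add: open_Int open_halfspace_Re_gt open_halfspace_Re_lt open_halfspace_Im_gt)
  have nz: "1 - ?e s \<noteq> 0" if "s \<in> S" for s using cayley_disc(1)[OF exp_disc(1)[of s]] that by (simp add: S_def)
  show "\<Phi> holomorphic_on S" unfolding \<Phi>_def using nz by (intro holomorphic_intros) auto
  show "\<Phi> ` S \<subseteq> uhp"
  proof
    fix z assume "z \<in> \<Phi> ` S"
    then obtain s where s: "s \<in> S" "z = \<Phi> s" by blast
    then have i: "0 < Im s" by (simp add: S_def)
    show "z \<in> uhp" unfolding s(2) \<Phi>_def by (rule cayley_disc(4)[OF exp_disc(1)[OF i]])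
  qed
  have cay: "(\<i> * (1 + q) / (1 - q) - \<i>) / (\<i> * (1 + q) / (1 - q) + \<i>) = q" if "1 - q \<noteq> 0" for q :: complex
  proof -
    have "\<i> * (1 + q) / (1 - q) - \<i> = 2 * \<i> * q / (1 - q)" "\<i> * (1 + q) / (1 - q) + \<i> = 2 * \<i> / (1 - q)"
      using that by (simp_all add: divide_simps) (simp_all add: algebra_simps)
    then show ?thesis using that by simp
  qed
  have inv: "(\<Phi> s - \<i>) / (\<Phi> s + \<i>) = ?e s" if "s \<in> S" for s
    unfolding \<Phi>_def by (rule cay[OF nz[OF that]])
  show "inj_on \<Phi> S"
  \<comment> \<open>The inverse is a logarithm of the Cayley transform. The minus sign and the shift
    by 1/2 move the cut of the principal branch to the edges Re s = 0 and Re s = 1 of the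
    strip.\<close>
  proof (rule inj_on_inverseI[where g = "\<lambda>z. Ln (- ((z - \<i>) / (z + \<i>))) / (2 * of_real pi * \<i>) + 1 / 2"])
    fix s assume s: "s \<in> S"
    have "?e (s - 1 / 2) = ?e s * exp (- (of_real pi * \<i>))"
      by (simp add: algebra_simps flip: exp_add)
    also have "exp (- (of_real pi * \<i>)) = - 1" by (simp add: exp_minus)
    finally have e: "- ?e s = ?e (s - 1 / 2)" by simp
    have "Ln (?e (s - 1 / 2)) = 2 * of_real pi * \<i> * (s - 1 / 2)"
    proof (rule Ln_exp)
      have "Im (2 * of_real pi * \<i> * (s - 1 / 2)) = 2 * pi * (Re s - 1 / 2)" by simp
      moreover have "2 * pi * (Re s - 1 / 2) < 2 * pi * (1 / 2)" "2 * pi * (Re s - 1 / 2) > 2 * pi * (- 1 / 2)"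
        using s by (intro mult_strict_left_mono; simp add: S_def)+
      ultimately show "- pi < Im (2 * of_real pi * \<i> * (s - 1 / 2))" "Im (2 * of_real pi * \<i> * (s - 1 / 2)) \<le> pi" by simp_all
    qed
    then show "Ln (- ((\<Phi> s - \<i>) / (\<Phi> s + \<i>))) / (2 * of_real pi * \<i>) + 1 / 2 = s"
      unfolding inv[OF s] e by simp
  qed
  show "uhp - \<Phi> ` S \<subseteq> {z. Re z = 0}"
  proof
    fix z assume z: "z \<in> uhp - \<Phi> ` S"
    show "z \<in> {z. Re z = 0}"
    proof (rule ccontr)
      assume "z \<notin> {z. Re z = 0}"
      then have re: "Re z \<noteq> 0" by simp
      have im: "Im z > 0" using z by (simp add: uhp_iff)
      define \<zeta> where "\<zeta> = (z - \<i>) / (z + \<i>)"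
      have zi: "z + \<i> \<noteq> 0" using im by (auto simp: complex_eq_iff)
      have "\<zeta> = (z - \<i>) * cnj (z + \<i>) / of_real ((cmod (z + \<i>))\<^sup>2)"
        unfolding \<zeta>_def by (subst complex_div_cnj) (simp only: of_real_power)
      then have "Im \<zeta> = Im ((z - \<i>) * cnj (z + \<i>)) / (cmod (z + \<i>))\<^sup>2" by (simp only: Im_divide_of_real)
      moreover have "Im ((z - \<i>) * cnj (z + \<i>)) = - 2 * Re z" by (simp add: algebra_simps)
      ultimately have imz: "Im \<zeta> \<noteq> 0" using re zi by simp
      then have z0: "\<zeta> \<noteq> 0" by auto
      have "(cmod (z - \<i>))\<^sup>2 < (cmod (z + \<i>))\<^sup>2" unfolding cmod_power2 using im by (simp add: power2_eq_square algebra_simps)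
      then have "cmod (z - \<i>) < cmod (z + \<i>)" by (rule power_less_imp_less_base) simp
      then have n1: "cmod \<zeta> < 1" using zi by (simp add: \<zeta>_def norm_divide)
      define s where "s = Ln (- \<zeta>) / (2 * of_real pi * \<i>) + 1 / 2"
      have "2 * of_real pi * \<i> * s = Ln (- \<zeta>) + of_real pi * \<i>" by (simp add: s_def field_simps)
      then have "?e s = exp (Ln (- \<zeta>)) * exp (of_real pi * \<i>)" by (simp only: exp_add)
      then have es: "?e s = \<zeta>" using z0 by simp
      have re_s: "Re s = Im (Ln (- \<zeta>)) / (2 * pi) + 1 / 2" and im_s: "Im s = - Re (Ln (- \<zeta>)) / (2 * pi)"
        unfolding s_def by (simp_all add: Re_divide Im_divide power2_eq_square field_simps)
      have "Im (Ln (- \<zeta>)) \<noteq> pi" using Im_Ln_eq_pi[of "- \<zeta>"] z0 imz by simp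
      then have "- pi < Im (Ln (- \<zeta>))" "Im (Ln (- \<zeta>)) < pi" using mpi_less_Im_Ln[of "- \<zeta>"] Im_Ln_le_pi[of "- \<zeta>"] z0 by auto
      then have "0 < Re s" "Re s < 1" unfolding re_s by (simp_all add: field_simps)
      moreover have "Im s > 0"
      proof -
        have "Re (Ln (- \<zeta>)) = ln (cmod \<zeta>)" using z0 by simp
        also have "... < 0" using n1 z0 by simp
        finally show ?thesis unfolding im_s by (simp add: divide_neg_pos)
      qed
      ultimately have "s \<in> S" by (simp add: S_def)
      moreover have "\<Phi> s = z"
      proof -
        have "1 - \<zeta> = 2 * \<i> / (z + \<i>)" "1 + \<zeta> = 2 * z / (z + \<i>)" unfolding \<zeta>_def using zi by (simp_all add: field_simps)
        then show ?thesis unfolding \<Phi>_def es using zi by simp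
      qed
      ultimately show False using z by blast
    qed
  qed
  fix s assume s: "s \<in> S"
  have "(?e has_field_derivative ?e s * (2 * of_real pi * \<i>)) (at s)" by (auto intro!: derivative_eq_intros)
  moreover have "((\<lambda>\<zeta>. \<i> * (1 + \<zeta>) / (1 - \<zeta>)) has_field_derivative 2 * \<i> / (1 - ?e s)\<^sup>2) (at (?e s))"
    using nz[OF s] by (auto intro!: derivative_eq_intros simp: power2_eq_square field_simps)
  ultimately have "((\<lambda>\<zeta>. \<i> * (1 + \<zeta>) / (1 - \<zeta>)) \<circ> ?e has_field_derivative 2 * \<i> / (1 - ?e s)\<^sup>2 * (?e s * (2 * of_real pi * \<i>))) (at s)"
    by (intro DERIV_chain)
  then have "(\<Phi> has_field_derivative 2 * \<i> / (1 - ?e s)\<^sup>2 * (?e s * (2 * of_real pi * \<i>))) (at s)"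
    by (simp only: \<Phi>_def o_def)
  then have "deriv \<Phi> s = 2 * \<i> / (1 - ?e s)\<^sup>2 * (?e s * (2 * of_real pi * \<i>))" by (rule DERIV_imp_deriv)
  also have "... = - 4 * of_real pi * ?e s / (1 - ?e s)\<^sup>2" by (simp add: field_simps)
  finally show "deriv \<Phi> s = - 4 * of_real pi * ?e s / (1 - ?e s)\<^sup>2" .
qed

text \<open>With a = 1 - zeta and D = 1 - |zeta|^2, the Jacobian, area density, kernel and weight
  combine into a radial factor times a function holomorphic in zeta.\<close>

lemma reproducing_integrand:
  fixes a F :: complex
  assumes a: "a \<noteq> 0" and D: "D > 0" and p: "p \<ge> 1"
  defines "y \<equiv> D / (cmod a)\<^sup>2"
  shows "(cmod (- 4 * of_real pi * \<zeta> / a\<^sup>2))\<^sup>2 *\<^sub>R ((1 / (2 * y\<^sup>2)) *\<^sub>R (F * cnj ((a / 2) ^ (2 * p)) * of_real ((2 * y) ^ (2 * p))))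
     = of_real (8 * pi\<^sup>2 * (cmod \<zeta>)\<^sup>2 * D ^ (2 * p - 2)) * (F / a ^ (2 * p))"
proof -
  define N where "N = (cmod a)\<^sup>2"
  have N0: "N > 0" using a by (simp add: N_def)
  have y: "y = D / N" by (simp add: y_def N_def)
  have 1: "(cmod (- 4 * of_real pi * \<zeta> / a\<^sup>2))\<^sup>2 = 16 * pi\<^sup>2 * (cmod \<zeta>)\<^sup>2 / N\<^sup>2"
    by (simp add: norm_mult norm_divide norm_power power_divide power_mult_distrib N_def flip: power_mult)
  have 2: "cnj (a / 2) * of_real (2 * y) = of_real D / a"
  proof -
    have "a * cnj a = of_real N" by (simp add: N_def complex_mult_cnj cmod_def)
    then have "cnj a = of_real N / a" using a by (simp add: field_simps)
    then show ?thesis using N0 a by (simp add: y field_simps)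
  qed
  have "cnj ((a / 2) ^ (2 * p)) * of_real ((2 * y) ^ (2 * p)) = (cnj (a / 2) * of_real (2 * y)) ^ (2 * p)"
    by (simp only: complex_cnj_power of_real_power power_mult_distrib[of "cnj (a / 2)"])
  also have "... = of_real (D ^ (2 * p)) / a ^ (2 * p)" unfolding 2 by (simp add: power_divide)
  finally have 3: "F * cnj ((a / 2) ^ (2 * p)) * of_real ((2 * y) ^ (2 * p)) = of_real (D ^ (2 * p)) * (F / a ^ (2 * p))"
    by (simp add: mult.assoc)
  have "2 * p = (2 * p - 2) + 2" using p by simp
  then have "D ^ (2 * p) = D ^ (2 * p - 2) * D\<^sup>2" by (metis power_add)
  then have 4: "16 * pi\<^sup>2 * (cmod \<zeta>)\<^sup>2 / N\<^sup>2 * (1 / (2 * y\<^sup>2)) * D ^ (2 * p) = 8 * pi\<^sup>2 * (cmod \<zeta>)\<^sup>2 * D ^ (2 * p - 2)"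
    using N0 D by (simp add: y power_divide field_simps)
  show ?thesis unfolding 1 3 scaleR_conv_of_real 4[symmetric] by (simp only: of_real_mult mult.assoc)
qed

lemma null_vertical_line: "{z. Re z = 0} \<in> null_sets (lborel :: complex measure)"
proof -
  have "negligible {z::complex. z \<bullet> 1 = 0}" by (rule negligible_standard_hyperplane) (simp add: Basis_complex_def)
  then have "{z::complex. Re z = 0} \<in> null_sets (completion lborel)" by (simp add: negligible_iff_null_sets)
  moreover have "{z::complex. Re z = 0} \<in> sets lborel"
    using closed_hyperplane[of "1::complex" 0] by simp
  ultimately show ?thesis by (simp add: null_sets_completion_iff)
qed

text \<open>In the disc the form becomes H zeta = F / (1 - zeta)^(2p), and everything else in the
  integrand is radial by \<open>reproducing_integrand\<close>. The mean value property therefore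
  returns H 0 = F i.\<close>

lemma reproducing_i:
  assumes F: "F holomorphic_on uhp" and p: "p \<ge> 2" and K: "\<forall>z\<in>uhp. cmod (F z) * (2 * Im z) ^ p \<le> K"
  shows "(\<integral>z. F z * cnj ((\<i> / (z + \<i>)) ^ (2 * p)) * of_real ((2 * Im z) ^ (2 * p)) \<partial>hyp_area) = 2 * of_real pi / (2 * of_nat p - 1) * F \<i>"
proof -
  define S where "S = {s. 0 < Re s \<and> Re s < 1 \<and> 0 < Im s}"
  define \<Phi> where "\<Phi> = (\<lambda>s. \<i> * (1 + qexp s) / (1 - qexp s))"
  note sm = strip_map[folded S_def \<Phi>_def]
  let ?\<phi> = "\<lambda>z. F z * cnj ((\<i> / (z + \<i>)) ^ (2 * p)) * of_real ((2 * Im z) ^ (2 * p))"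
  define g where "g = (\<lambda>z. indicator uhp z *\<^sub>R ((1 / (2 * (Im z)\<^sup>2)) *\<^sub>R ?\<phi> z))"
  have zi: "z + \<i> \<noteq> 0" if "z \<in> uhp" for z using that by (auto simp: uhp_iff complex_eq_iff)
  have c1: "continuous_on uhp ?\<phi>"
    using zi by (intro continuous_intros holomorphic_on_imp_continuous_on[OF F]) auto
  have m1: "?\<phi> \<in> borel_measurable hyp_area"
    unfolding measurable_hyp_area by (rule borel_measurable_continuous_on_restrict[OF c1])
  have gm: "g \<in> borel_measurable borel"
    unfolding g_def by (rule borel_measurable_continuous_on_indicator, simp, intro continuous_intros c1) (auto simp: uhp_iff)
  define H where "H = (\<lambda>\<zeta>. F (\<i> * (1 + \<zeta>) / (1 - \<zeta>)) / (1 - \<zeta>) ^ (2 * p))"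
  note disc = cayley_disc(3,1,2) and up = cayley_disc(4)
  have Hh: "H holomorphic_on ball 0 1"
  proof -
    have "(F \<circ> (\<lambda>\<zeta>. \<i> * (1 + \<zeta>) / (1 - \<zeta>))) holomorphic_on ball 0 1"
      by (rule holomorphic_on_compose_gen[OF _ F]) (use disc(2) up in \<open>auto intro!: holomorphic_intros\<close>)
    then show ?thesis unfolding H_def o_def using disc(2) by (intro holomorphic_intros) auto
  qed
  have HK: "\<forall>\<zeta>\<in>ball 0 1. cmod (H \<zeta>) * (1 - (cmod \<zeta>)\<^sup>2) ^ p \<le> K"
  proof
    fix \<zeta> :: complex assume z: "\<zeta> \<in> ball 0 1"
    let ?z = "\<i> * (1 + \<zeta>) / (1 - \<zeta>)"
    have K0: "cmod (F ?z) * (Im ?z) ^ p \<le> cmod (F ?z) * (2 * Im ?z) ^ p"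
      using up[OF z] unfolding uhp_iff by (intro mult_left_mono power_mono) auto
    have "cmod (H \<zeta>) * (1 - (cmod \<zeta>)\<^sup>2) ^ p = cmod (F ?z) * (Im ?z) ^ p"
      unfolding disc(1)[OF z] H_def by (simp add: norm_divide norm_power power_divide power_mult)
    then show "cmod (H \<zeta>) * (1 - (cmod \<zeta>)\<^sup>2) ^ p \<le> K" using K0 K up[OF z] by force
  qed
  have "(\<integral>z. ?\<phi> z \<partial>hyp_area) = (\<integral>z. g z \<partial>lborel)" unfolding g_def by (rule integral_hyp_area[OF m1])
  also have "... = (\<integral>z. indicator (\<Phi> ` S) z *\<^sub>R g z \<partial>lborel)"
  proof (rule integral_cong_AE)
    show "g \<in> borel_measurable lborel" using gm by simp
    have "open (\<Phi> ` S)" by (rule distr_conformal(4)[OF sm(1,2,3)])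
    then show "(\<lambda>z. indicator (\<Phi> ` S) z *\<^sub>R g z) \<in> borel_measurable lborel"
      using gm by (intro borel_measurable_scaleR borel_measurable_indicator) auto
    show "AE z in lborel. g z = indicator (\<Phi> ` S) z *\<^sub>R g z"
      using null_vertical_line
    proof (rule AE_I')
      show "{z \<in> space lborel. g z \<noteq> indicator (\<Phi> ` S) z *\<^sub>R g z} \<subseteq> {z. Re z = 0}"
      proof
        fix z assume "z \<in> {z \<in> space lborel. g z \<noteq> indicator (\<Phi> ` S) z *\<^sub>R g z}"
        then have "z \<notin> \<Phi> ` S" "g z \<noteq> 0" by (auto simp: indicator_def split: if_splits)
        then have "z \<in> uhp - \<Phi> ` S" by (auto simp: g_def indicator_def split: if_splits)
        then show "z \<in> {z. Re z = 0}" using sm(5) by blast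
      qed
    qed
  qed
  also have "... = (\<integral>s. indicator S s *\<^sub>R ((cmod (deriv \<Phi> s))\<^sup>2 *\<^sub>R g (\<Phi> s)) \<partial>lborel)"
    by (rule integral_conformal[OF sm(1,2,3) gm])
  also have "... = (\<integral>s. indicator S s *\<^sub>R
     (of_real (8 * pi\<^sup>2 * exp (- (4 * pi * Im s)) * (1 - exp (- (4 * pi * Im s))) ^ (2 * p - 2)) * H (qexp s)) \<partial>lborel)"
  proof (rule Bochner_Integration.integral_cong[OF refl])
    fix s
    let ?q = "qexp s"
    show "indicator S s *\<^sub>R ((cmod (deriv \<Phi> s))\<^sup>2 *\<^sub>R g (\<Phi> s)) = indicator S s *\<^sub>R
     (of_real (8 * pi\<^sup>2 * exp (- (4 * pi * Im s)) * (1 - exp (- (4 * pi * Im s))) ^ (2 * p - 2)) * H ?q)"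
    proof (cases "s \<in> S")
      case True
      then have i: "Im s > 0" by (simp add: S_def)
      have q: "?q \<in> ball 0 1" by (rule exp_disc(1)[OF i])
      have U: "\<Phi> s \<in> uhp" using sm(4) True by blast
      have 1: "\<i> / (\<Phi> s + \<i>) = (1 - ?q) / 2" unfolding \<Phi>_def using disc(2)[OF q] by (simp add: field_simps)
      have 2: "Im (\<Phi> s) = (1 - (cmod ?q)\<^sup>2) / (cmod (1 - ?q))\<^sup>2" unfolding \<Phi>_def by (rule disc(1)[OF q])
      have "g (\<Phi> s) = (1 / (2 * (Im (\<Phi> s))\<^sup>2)) *\<^sub>R ?\<phi> (\<Phi> s)" using U by (simp add: g_def)
      then have "(cmod (deriv \<Phi> s))\<^sup>2 *\<^sub>R g (\<Phi> s) = of_real (8 * pi\<^sup>2 * (cmod ?q)\<^sup>2 * (1 - (cmod ?q)\<^sup>2) ^ (2 * p - 2)) * (F (\<Phi> s) / (1 - ?q) ^ (2 * p))"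
        unfolding sm(6)[OF True] 1 2 using reproducing_integrand[OF disc(2,3)[OF q], of p ?q "F (\<Phi> s)"] p by simp
      then show ?thesis unfolding exp_disc(2)[OF i] H_def \<Phi>_def by (simp only:)
    qed simp
  qed
  also have "... = 2 * of_real pi / (2 * of_nat p - 1) * H 0"
    unfolding S_def by (rule strip_integral[OF Hh p HK])
  also have "H 0 = F \<i>" by (simp add: H_def)
  finally show ?thesis .
qed

lemma slash_bounded:
  assumes S: "det S = 1" and f: "f holomorphic_on uhp" and K: "\<forall>z\<in>uhp. cmod (f z) * (2 * Im z) ^ p \<le> K"
  shows "(\<lambda>z. f (moebius S z) / aut_factor S z ^ (2 * p)) holomorphic_on uhp"
    and "\<forall>z\<in>uhp. cmod (f (moebius S z) / aut_factor S z ^ (2 * p)) * (2 * Im z) ^ p \<le> K"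
proof -
  have "(f \<circ> moebius S) holomorphic_on uhp"
    by (rule holomorphic_on_compose_gen[OF moebius_holomorphic(1)[OF S] f]) (simp add: moebius_image_uhp[OF S])
  then show "(\<lambda>z. f (moebius S z) / aut_factor S z ^ (2 * p)) holomorphic_on uhp"
    unfolding o_def using aut_factor_nz[OF S] by (intro holomorphic_intros moebius_holomorphic(2)[OF S]) (auto simp: uhp_iff)
  show "\<forall>z\<in>uhp. cmod (f (moebius S z) / aut_factor S z ^ (2 * p)) * (2 * Im z) ^ p \<le> K"
  proof
    fix z assume z: "z \<in> uhp"
    have "cmod (f (moebius S z) / aut_factor S z ^ (2 * p)) * (2 * Im z) ^ p = cmod (f (moebius S z)) * (2 * Im (moebius S z)) ^ p"
      unfolding Im_moebius[OF S] by (simp add: norm_divide norm_power power_divide power_mult power_mult_distrib)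
    also have "... \<le> K" using K z S by (blast intro: Im_moebius_pos uhp_iff[THEN iffD1] uhp_iff[THEN iffD2])
    finally show "cmod (f (moebius S z) / aut_factor S z ^ (2 * p)) * (2 * Im z) ^ p \<le> K" .
  qed
qed

text \<open>Transport to i by the weighted action of \<open>to_pt w\<close>, which preserves the
  bound K. Integrability holds since |f| y^p is bounded and the rest of the integrand decays like a
  power of 1 + \<open>hypu\<close> of exponent at least 2.\<close>

lemma reproducing:
  assumes f: "f holomorphic_on uhp" and p: "p \<ge> 2" and K: "\<forall>z\<in>uhp. cmod (f z) * (2 * Im z) ^ p \<le> K" and w: "Im w > 0"
  defines "\<phi> \<equiv> \<lambda>z. f z * cnj ((\<i> / (z - cnj w)) ^ (2 * p)) * of_real ((2 * Im z) ^ (2 * p))"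
  shows "integrable hyp_area \<phi>" "(\<integral>z. \<phi> z \<partial>hyp_area) = 2 * of_real pi / (2 * of_nat p - 1) * f w"
proof -
  have zw: "z - cnj w \<noteq> 0" if "z \<in> uhp" for z using that w by (auto simp: uhp_iff complex_eq_iff)
  have c1: "continuous_on uhp \<phi>"
    unfolding \<phi>_def using zw by (intro continuous_intros holomorphic_on_imp_continuous_on[OF f]) auto
  have m1: "\<phi> \<in> borel_measurable hyp_area"
    unfolding measurable_hyp_area by (rule borel_measurable_continuous_on_restrict[OF c1])
  define K' where "K' = K / (2 * Im w) ^ p"
  have bd: "norm (\<phi> z) \<le> K' * (1 / (1 + hypu w z)\<^sup>2)" if z: "z \<in> uhp" for z
  proof -
    have iz: "Im z > 0" using z by (simp add: uhp_iff)
    have u: "(cmod (z - cnj w))\<^sup>2 = (2 * Im z) * (2 * Im w) * (1 + hypu z w)"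
      using hypu_cnj[OF iz w] iz w by simp
    have nn: "hypu z w \<ge> 0" using iz w by (rule hypu_nonneg)
    have e: "cmod (cnj ((\<i> / (z - cnj w)) ^ (2 * p))) = 1 / ((cmod (z - cnj w))\<^sup>2) ^ p"
      unfolding complex_mod_cnj norm_power norm_divide power_mult by (simp add: power_divide)
    have "norm (\<phi> z) = cmod (f z) * cmod (cnj ((\<i> / (z - cnj w)) ^ (2 * p))) * (2 * Im z) ^ (2 * p)"
      using iz unfolding \<phi>_def norm_mult norm_of_real by (simp add: power_mult)
    also have "... = cmod (f z) * (1 / ((cmod (z - cnj w))\<^sup>2) ^ p) * ((2 * Im z) ^ p * (2 * Im z) ^ p)"
      unfolding e by (simp only: mult_2 power_add)
    also have "... = cmod (f z) * (2 * Im z) ^ p * (1 / (2 * Im w) ^ p) * (1 / (1 + hypu z w) ^ p)"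
      unfolding u power_mult_distrib[of "(2 * Im z) * (2 * Im w)"] power_mult_distrib[of "2 * Im z" "2 * Im w"] using iz by simp
    also have "... \<le> K * (1 / (2 * Im w) ^ p) * (1 / (1 + hypu z w)\<^sup>2)"
    proof (intro mult_mono)
      show "cmod (f z) * (2 * Im z) ^ p \<le> K" using K z by blast
      then show K1: "0 \<le> K" by (rule order_trans[rotated]) (use iz in auto)
      show "0 \<le> K * (1 / (2 * Im w) ^ p)" using K1 w by auto
      have "(1 + hypu z w)\<^sup>2 \<le> (1 + hypu z w) ^ p" using nn p by (intro power_increasing) auto
      then show "1 / (1 + hypu z w) ^ p \<le> 1 / (1 + hypu z w)\<^sup>2" using nn by (intro divide_left_mono) auto
    qed (use w iz nn in auto)
    finally show ?thesis by (simp add: K'_def hypu_sym[of z w])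
  qed
  have K0: "K' \<ge> 0"
  proof -
    have "0 \<le> norm (\<phi> w)" by simp
    also have "... \<le> K'" using bd[of w] w by (simp add: uhp_iff)
    finally show ?thesis .
  qed
  show "integrable hyp_area \<phi>"
  proof (rule integrableI_bounded[OF m1])
    have "(\<integral>\<^sup>+z. ennreal (norm (\<phi> z)) \<partial>hyp_area) \<le> (\<integral>\<^sup>+z. ennreal K' * ennreal (1 / (1 + hypu w z)\<^sup>2) \<partial>hyp_area)"
    proof (rule nn_integral_mono)
      fix z assume "z \<in> space hyp_area"
      then have "ennreal (norm (\<phi> z)) \<le> ennreal (K' * (1 / (1 + hypu w z)\<^sup>2))" using bd by (intro ennreal_leI) simp
      then show "ennreal (norm (\<phi> z)) \<le> ennreal K' * ennreal (1 / (1 + hypu w z)\<^sup>2)" using K0 by (simp only: ennreal_mult zero_le_divide_iff zero_le_one zero_le_power2 simp_thms)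
    qed
    also have "... = ennreal K' * (\<integral>\<^sup>+z. ennreal (1 / (1 + hypu w z)\<^sup>2) \<partial>hyp_area)"
      by (rule nn_integral_cmult[OF hypu_measurable])
    also have "... < \<infinity>" using kernel_integral_finite unfolding kernel_integral_invariant[OF w]
      by (simp only: ennreal_mult_less_top infinity_ennreal_def ennreal_less_top simp_thms)
    finally show "(\<integral>\<^sup>+z. ennreal (norm (\<phi> z)) \<partial>hyp_area) < \<infinity>" .
  qed
  define S where "S = to_pt w"
  have S: "det S = 1" "moebius S \<i> = w" using to_pt[OF w] by (simp_all add: S_def)
  define F where "F = (\<lambda>z. f (moebius S z) / aut_factor S z ^ (2 * p))"
  have jz: "aut_factor S z \<noteq> 0" if "z \<in> uhp" for z using aut_factor_nz[OF S(1)] that by (simp add: uhp_iff)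
  have FhK: "F holomorphic_on uhp" "\<forall>z\<in>uhp. cmod (F z) * (2 * Im z) ^ p \<le> K"
    unfolding F_def by (rule slash_bounded[OF S(1) f K])+
  have ji: "aut_factor S \<i> \<noteq> 0" "aut_factor S (- \<i>) = cnj (aut_factor S \<i>)"
    using jz[of \<i>] by (simp_all add: uhp_iff cnj_aut_factor)
  have "(\<integral>z. \<phi> z \<partial>hyp_area) = (\<integral>z. \<phi> (moebius S z) \<partial>hyp_area)" by (rule integral_moebius[OF S(1) m1, symmetric])
  also have "... = (\<integral>z. aut_factor S \<i> ^ (2 * p) * (F z * cnj ((\<i> / (z + \<i>)) ^ (2 * p)) * of_real ((2 * Im z) ^ (2 * p))) \<partial>hyp_area)"
  proof (rule Bochner_Integration.integral_cong[OF refl])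
    fix z assume "z \<in> space hyp_area"
    then have z: "z \<in> uhp" by simp
    let ?j = "aut_factor S z"
    have "moebius S z - cnj w = (z - (- \<i>)) / (?j * aut_factor S (- \<i>))"
    proof -
      have "cnj w = moebius S (- \<i>)" using cnj_moebius[of S \<i>] S(2) by simp
      then show ?thesis using moebius_diff[OF S(1) jz[OF z], of "- \<i>"] ji by simp
    qed
    then have 1: "\<i> / (moebius S z - cnj w) = ?j * cnj (aut_factor S \<i>) * (\<i> / (z + \<i>))" using ji by simp
    have 2: "of_real (2 * Im (moebius S z)) = of_real (2 * Im z) / (?j * cnj ?j)"
    proof -
      have "?j * cnj ?j = of_real ((cmod ?j)\<^sup>2)" by (simp add: complex_mult_cnj cmod_def)
      then show ?thesis unfolding Im_moebius[OF S(1)] by simp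
    qed
    have "\<phi> (moebius S z) = f (moebius S z) * (cnj (\<i> / (moebius S z - cnj w)) * of_real (2 * Im (moebius S z))) ^ (2 * p)"
      unfolding \<phi>_def by (simp only: complex_cnj_power of_real_power power_mult_distrib[of "cnj (\<i> / (moebius S z - cnj w))"] mult.assoc)
    also have "cnj (\<i> / (moebius S z - cnj w)) * of_real (2 * Im (moebius S z)) = aut_factor S \<i> * (cnj (\<i> / (z + \<i>)) * of_real (2 * Im z)) / ?j"
      unfolding 1 2 using jz[OF z] by (simp add: complex_cnj_mult)
    also have "f (moebius S z) * (aut_factor S \<i> * (cnj (\<i> / (z + \<i>)) * of_real (2 * Im z)) / ?j) ^ (2 * p)
       = aut_factor S \<i> ^ (2 * p) * (F z * cnj ((\<i> / (z + \<i>)) ^ (2 * p)) * of_real ((2 * Im z) ^ (2 * p)))"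
    proof -
      have g: "c * (a * (x * y) / j) ^ n = a ^ n * (c / j ^ n * x ^ n * y ^ n)" for a c j x y :: complex and n
        by (simp add: power_divide power_mult_distrib)
      show ?thesis unfolding F_def complex_cnj_power of_real_power by (rule g)
    qed
    finally show "\<phi> (moebius S z) = aut_factor S \<i> ^ (2 * p) * (F z * cnj ((\<i> / (z + \<i>)) ^ (2 * p)) * of_real ((2 * Im z) ^ (2 * p)))" .
  qed
  also have "... = aut_factor S \<i> ^ (2 * p) * (\<integral>z. F z * cnj ((\<i> / (z + \<i>)) ^ (2 * p)) * of_real ((2 * Im z) ^ (2 * p)) \<partial>hyp_area)"
    by (rule integral_mult_right_zero)
  also have "... = aut_factor S \<i> ^ (2 * p) * (2 * of_real pi / (2 * of_nat p - 1) * F \<i>)" by (simp only: reproducing_i[OF FhK(1) p FhK(2)])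
  also have "... = 2 * of_real pi / (2 * of_nat p - 1) * f w" unfolding F_def S(2) using ji(1) by simp
  finally show "(\<integral>z. \<phi> z \<partial>hyp_area) = 2 * of_real pi / (2 * of_nat p - 1) * f w" .
qed

section \<open>Cusp forms are the bounded automorphic forms\<close>

text \<open>By periodicity F is a function g of q. The bound on |F| y^p, with y proportional to - ln
  |q|, makes g tend to 0 at q = 0, so the singularity is removable and boundedness already implies
  vanishing at the cusp.\<close>

lemma q_expansion:
  fixes F :: "complex \<Rightarrow> complex" and h K :: real
  assumes F: "F holomorphic_on uhp" and h: "h > 0" and per: "\<forall>z\<in>uhp. F (z + of_real h) = F z"
    and K: "\<forall>z\<in>uhp. cmod (F z) * (2 * Im z) ^ p \<le> K" and p: "p \<ge> 1"
  shows "\<exists>g. g holomorphic_on ball 0 1 \<and> g 0 = 0 \<and> (\<forall>z\<in>uhp. F z = g (exp (2 * of_real pi * \<i> * z / of_real h)))"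
proof -
  have pn: "F (z + of_nat n * of_real h) = F z" if "z \<in> uhp" for z n
  proof (induction n)
    case (Suc n)
    have "z + of_nat n * of_real h \<in> uhp" using that by (simp add: uhp_iff)
    then have "F (z + of_nat n * of_real h + of_real h) = F (z + of_nat n * of_real h)" using per by blast
    then show ?case using Suc by (simp add: algebra_simps)
  qed simp
  have pz: "F (z + of_int n * of_real h) = F z" if z: "z \<in> uhp" for z n
  proof (cases "n \<ge> 0")
    case True
    then show ?thesis using pn[OF z, of "nat n"] by simp
  next
    case False
    have "z + of_int n * of_real h \<in> uhp" using z by (simp add: uhp_iff)
    from pn[OF this, of "nat (- n)"] show ?thesis using False by simp
  qed
  have ph: "F z = F z'" if z: "z \<in> uhp" "z' \<in> uhp" and e: "exp (2 * of_real pi * \<i> * z / of_real h) = exp (2 * of_real pi * \<i> * z' / of_real h)" for z z'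
  proof -
    obtain n :: int where "2 * of_real pi * \<i> * z / of_real h = 2 * of_real pi * \<i> * z' / of_real h + of_real (of_int (2 * n) * pi) * \<i>"
      using e unfolding exp_eq by blast
    then have "2 * of_real pi * \<i> * (z / of_real h) = 2 * of_real pi * \<i> * (z' / of_real h + of_int n)"
      by (simp add: algebra_simps)
    moreover have "2 * of_real pi * \<i> \<noteq> 0" by simp
    ultimately have "z / of_real h = z' / of_real h + of_int n" by (rule mult_left_cancel[THEN iffD1, rotated])
    then have "z = z' + of_int n * of_real h" using h by (simp add: field_simps)
    then show ?thesis using pz[OF z(2)] by simp
  qed
  define \<zeta> where "\<zeta> = (\<lambda>L. of_real h * L / (2 * of_real pi * \<i>))"
  have \<zeta>e: "2 * of_real pi * \<i> * \<zeta> L / of_real h = L" for L using h by (simp add: \<zeta>_def)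
  have \<zeta>i: "Im (\<zeta> L) = - (h * Re L / (2 * pi))" for L
    unfolding \<zeta>_def by (simp add: Im_divide power2_eq_square)
  have \<zeta>u: "\<zeta> L \<in> uhp" if "cmod (exp L) < 1" for L
  proof -
    have "Re L < 0" using that by (simp add: norm_exp_eq_Re)
    then have "h * Re L / (2 * pi) < 0" using h by (intro divide_neg_pos mult_pos_neg) auto
    then show ?thesis by (simp add: uhp_iff \<zeta>i)
  qed
  define g where "g = (\<lambda>q. if q = 0 then 0 else F (\<zeta> (Ln q)))"
  have gL: "g (exp L) = F (\<zeta> L)" if "cmod (exp L) < 1" for L
  proof -
    have "cmod (exp (Ln (exp L))) < 1" using that by simp
    then have "F (\<zeta> (Ln (exp L))) = F (\<zeta> L)" using that by (intro ph \<zeta>u) (simp_all only: \<zeta>e exp_Ln exp_not_eq_zero not_False_eq_True)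
    then show ?thesis by (simp add: g_def)
  qed
  have gz: "F z = g (exp (2 * of_real pi * \<i> * z / of_real h))" if z: "z \<in> uhp" for z
  proof -
    let ?L = "2 * of_real pi * \<i> * z / of_real h"
    have "Im z / h > 0" using z h by (simp add: uhp_iff)
    moreover have "Re ?L = - (2 * pi * (Im z / h))" by simp
    ultimately have "Re ?L < 0" using pi_gt_zero by (smt (verit) mult_pos_pos)
    then have c: "cmod (exp ?L) < 1" by (simp only: norm_exp_eq_Re exp_less_one_iff)
    have "\<zeta> ?L = z" using h by (simp add: \<zeta>_def)
    then show ?thesis using gL[OF c] by simp
  qed
  have hol: "g holomorphic_on ball 0 1 - {0}"
  proof (rule holomorphic_onI)
    fix q0 :: complex assume "q0 \<in> ball 0 1 - {0}"
    then have q0: "q0 \<noteq> 0" "cmod q0 < 1" by auto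
    define N where "N = ball q0 (cmod q0) \<inter> ball 0 1"
    have N: "open N" "q0 \<in> N" using q0 by (auto simp: N_def)
    \<comment> \<open>A branch of the logarithm that is holomorphic near q0 even if q0 lies on the
      cut of \<open>Ln\<close>; by \<open>gL\<close> any logarithm of q gives the same value of
      g.\<close>
    let ?L = "\<lambda>q. Ln (q / q0) + Ln q0"
    have re: "Re (q / q0) > 0" if "q \<in> N" for q
    proof -
      have "cmod (1 - q / q0) = cmod (q0 - q) / cmod q0" using q0 by (simp add: diff_divide_distrib flip: norm_divide)
      also have "... < 1" using that q0 by (simp add: N_def dist_norm)
      finally have "\<bar>Re (1 - q / q0)\<bar> < 1" using abs_Re_le_cmod[of "1 - q / q0"] by linarith
      then show ?thesis by simp
    qed
    then have nr: "q / q0 \<notin> \<real>\<^sub>\<le>\<^sub>0" if "q \<in> N" for q using that complex_nonpos_Reals_iff by force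
    have e: "exp (?L q) = q" if "q \<in> N" for q
    proof -
      have "q / q0 \<noteq> 0" using re[OF that] by force
      then have "exp (Ln (q / q0)) = q / q0" by (rule exp_Ln)
      then show ?thesis using q0 by (simp add: exp_add)
    qed
    have "(F \<circ> (\<lambda>q. \<zeta> (?L q))) holomorphic_on N"
    proof (rule holomorphic_on_compose_gen[OF _ F])
      show "(\<lambda>q. \<zeta> (?L q)) holomorphic_on N" unfolding \<zeta>_def using nr by (intro holomorphic_intros) auto
      show "(\<lambda>q. \<zeta> (?L q)) ` N \<subseteq> uhp"
      proof
        fix z assume "z \<in> (\<lambda>q. \<zeta> (?L q)) ` N"
        then obtain q where q: "q \<in> N" "z = \<zeta> (?L q)" by blast
        have "cmod (exp (?L q)) < 1" unfolding e[OF q(1)] using q(1) by (simp add: N_def)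
        then show "z \<in> uhp" unfolding q(2) by (rule \<zeta>u)
      qed
    qed
    moreover have "(F \<circ> (\<lambda>q. \<zeta> (?L q))) q = g q" if "q \<in> N" for q
    proof -
      have "cmod (exp (?L q)) < 1" unfolding e[OF that] using that by (simp add: N_def)
      from gL[OF this] show ?thesis unfolding e[OF that] by simp
    qed
    ultimately have "g holomorphic_on N" by (rule holomorphic_transform)
    then have "g field_differentiable at q0" using N by (intro holomorphic_on_imp_differentiable_at)
    then show "g field_differentiable at q0 within ball 0 1 - {0}" by (rule field_differentiable_at_within)
  qed
  have lim: "(g \<longlongrightarrow> 0) (at 0)"
  proof (rule Lim_null_comparison)
    let ?X = "\<lambda>q. h / pi * (- ln (cmod q))"
    show "\<forall>\<^sub>F q in at 0. norm (g q) \<le> K / (?X q) ^ p"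
      unfolding eventually_at
    proof (rule exI[of _ 1], intro conjI ballI impI)
      fix q :: complex assume "q \<noteq> 0 \<and> dist q 0 < 1"
      then have q: "q \<noteq> 0" "cmod q < 1" by auto
      have u: "\<zeta> (Ln q) \<in> uhp" using q by (intro \<zeta>u) simp
      have X: "2 * Im (\<zeta> (Ln q)) = ?X q" using q by (simp add: \<zeta>i)
      have Xp: "?X q > 0" using u unfolding X[symmetric] by (simp add: uhp_iff)
      have "cmod (F (\<zeta> (Ln q))) * (2 * Im (\<zeta> (Ln q))) ^ p \<le> K" using K u by blast
      then have "cmod (F (\<zeta> (Ln q))) * (?X q) ^ p \<le> K" unfolding X .
      then have "cmod (F (\<zeta> (Ln q))) \<le> K / (?X q) ^ p" using Xp by (simp only: pos_le_divide_eq zero_less_power)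
      then show "norm (g q) \<le> K / (?X q) ^ p" using q by (simp add: g_def)
    qed simp
    have "filterlim cmod (at_right 0) (at (0 :: complex))"
      unfolding filterlim_at by (auto simp: eventually_at_filter intro!: tendsto_norm_zero tendsto_ident_at)
    then have "filterlim (\<lambda>q::complex. ln (cmod q)) at_bot (at 0)" by (rule filterlim_compose[OF ln_at_0])
    then have "filterlim (\<lambda>q::complex. - ln (cmod q)) at_top (at 0)" by (simp only: filterlim_uminus_at_bot)
    then have "filterlim ?X at_top (at 0)" using h by (intro filterlim_tendsto_pos_mult_at_top[OF tendsto_const]) auto
    then have "filterlim (\<lambda>q. (?X q) ^ p) at_top (at 0)" using p by (intro filterlim_pow_at_top) auto
    then show "((\<lambda>q. K / (?X q) ^ p) \<longlongrightarrow> 0) (at 0)"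
      by (intro tendsto_divide_0[OF tendsto_const] filterlim_at_top_imp_at_infinity)
  qed
  have "continuous_on (ball 0 1) g"
  proof (rule continuous_at_imp_continuous_on, rule ballI)
    fix q :: complex assume q: "q \<in> ball 0 1"
    show "isCont g q"
    proof (cases "q = 0")
      case True
      then show ?thesis using lim by (simp add: isCont_def g_def)
    next
      case False
      have "open (ball 0 1 - {0 :: complex})" by auto
      then show ?thesis using holomorphic_on_imp_continuous_on[OF hol] q False by (simp add: continuous_on_eq_continuous_at)
    qed
  qed
  then have "g holomorphic_on ball 0 1" by (rule no_isolated_singularity[OF _ hol]) auto
  moreover have "g 0 = 0" by (simp add: g_def)
  ultimately show ?thesis using gz by blast
qed

lemma translation_mat_eq: "translation_mat h = mat2 1 h 0 1"
  by (simp add: translation_mat_def mat2_def)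

lemma bounded_form_imp_cusp_form:
  assumes G: "subgroup \<Gamma> PSL2R" and f: "bounded_form (\<Union>\<Gamma>) p f" and p: "p \<ge> 1"
  shows "cusp_form \<Gamma> p f"
proof -
  note m = subgroup_matrices(1)[OF G]
  have fh: "f holomorphic_on uhp" and fa: "\<forall>A\<in>\<Union>\<Gamma>. \<forall>z\<in>uhp. f (moebius A z) = aut_factor A z ^ (2 * p) * f z"
    using f by (auto simp: bounded_form_def)
  obtain K where K: "\<forall>z\<in>uhp. cmod (f z) * (2 * Im z) ^ p \<le> K" using f by (auto simp: bounded_form_def)
  have ext: "\<exists>g. cusp_extension p f \<sigma> h g \<and> g 0 = 0" if c: "cusp_chart \<Gamma> x \<sigma> h" for x \<sigma> h
  proof -
    have s: "det \<sigma> = 1" "h > 0" "PSL_proj (\<sigma> ** mat2 1 h 0 1 ** adj2 \<sigma>) \<in> \<Gamma>"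
      using c by (auto simp: cusp_chart_def SL2R_def translation_mat_eq matrix_inv_eq_adj2)
    let ?T = "mat2 1 h 0 1" and ?A = "\<sigma> ** mat2 1 h 0 1 ** adj2 \<sigma>"
    have dT: "det ?T = 1" by (simp add: det_2)
    have dA: "det ?A = 1" using s(1) dT by (simp add: det_mul)
    then have AM: "?A \<in> \<Union>\<Gamma>" using m s(3) by blast
    have As: "?A ** \<sigma> = \<sigma> ** ?T" using s(1) by (simp add: matrix_mul_assoc[symmetric])
    define F where "F = (\<lambda>z. f (moebius \<sigma> z) / aut_factor \<sigma> z ^ (2 * p))"
    have FhK: "F holomorphic_on uhp" "\<forall>z\<in>uhp. cmod (F z) * (2 * Im z) ^ p \<le> K"
      unfolding F_def by (rule slash_bounded[OF s(1) fh K])+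
    have per: "\<forall>z\<in>uhp. F (z + of_real h) = F z"
    proof
      fix z assume "z \<in> uhp"
      then have z: "Im z > 0" by (simp add: uhp_iff)
      have Tz: "moebius ?T z = z + of_real h" "aut_factor ?T z = 1" by (simp_all add: moebius_def aut_factor_def)
      have sz: "Im (moebius \<sigma> z) > 0" using s(1) z by (rule Im_moebius_pos)
      have 1: "moebius \<sigma> (z + of_real h) = moebius ?A (moebius \<sigma> z)"
        using moebius_mult[OF s(1) dT z] moebius_mult[OF dA s(1) z] unfolding As Tz by simp
      have 2: "aut_factor \<sigma> (z + of_real h) = aut_factor ?A (moebius \<sigma> z) * aut_factor \<sigma> z"
        using aut_factor_mult[OF dT z, of \<sigma>] aut_factor_mult[OF s(1) z, of ?A] unfolding As Tz by simp
      have 3: "f (moebius ?A (moebius \<sigma> z)) = aut_factor ?A (moebius \<sigma> z) ^ (2 * p) * f (moebius \<sigma> z)"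
        using fa AM sz by (simp only: uhp_iff)
      have "aut_factor ?A (moebius \<sigma> z) \<noteq> 0" using dA sz by (rule aut_factor_nz)
      then show "F (z + of_real h) = F z" unfolding F_def 1 2 3 power_mult_distrib by simp
    qed
    obtain g where "g holomorphic_on ball 0 1" "g 0 = 0" "\<forall>z\<in>uhp. F z = g (exp (2 * of_real pi * \<i> * z / of_real h))"
      using q_expansion[OF FhK(1) s(2) per FhK(2) p] by blast
    then show ?thesis unfolding cusp_extension_def F_def by blast
  qed
  have "modular_form \<Gamma> p f" unfolding modular_form_def using fh fa ext by blast
  then show ?thesis unfolding cusp_form_def using ext by blast
qed

lemma compact_hyp_cball:
  assumes z0: "Im z0 > 0"
  shows "compact {z. Im z > 0 \<and> hypu z0 z \<le> R}"
proof (cases "R \<ge> 0")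
  case False
  then have "{z. Im z > 0 \<and> hypu z0 z \<le> R} = {}" using hypu_nonneg[OF z0] by force
  then show ?thesis by (simp only: compact_empty)
next
  case True
  let ?c = "Im z0 / (2 + 4 * R)"
  have c0: "?c > 0" using True z0 by simp
  have eq: "{z. Im z > 0 \<and> hypu z0 z \<le> R} = {z. ?c \<le> Im z} \<inter> {z. (cmod (z0 - z))\<^sup>2 \<le> R * (4 * Im z0 * Im z)}"
  proof (rule Set.set_eqI)
    fix z
    have iff: "hypu z0 z \<le> R \<longleftrightarrow> (cmod (z0 - z))\<^sup>2 \<le> R * (4 * Im z0 * Im z)" if "Im z > 0"
      unfolding hypu_def using that z0 by (intro pos_divide_le_eq) simp
    have lo: "?c \<le> Im z" if z: "Im z > 0" "hypu z0 z \<le> R"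
    proof -
      have "Im z0 / Im z \<le> 2 + 4 * R" using hypu_Im_ratio[OF z0 z(1)] z(2) by linarith
      then show ?thesis using z(1) True by (simp add: field_simps)
    qed
    show "z \<in> {z. Im z > 0 \<and> hypu z0 z \<le> R} \<longleftrightarrow> z \<in> {z. ?c \<le> Im z} \<inter> {z. (cmod (z0 - z))\<^sup>2 \<le> R * (4 * Im z0 * Im z)}"
      using iff lo c0 by (auto simp del: hypu_self)
  qed
  have "closed {z. Im z > 0 \<and> hypu z0 z \<le> R}"
    unfolding eq by (intro closed_Int closed_Collect_le continuous_intros)
  moreover have "bounded {z. Im z > 0 \<and> hypu z0 z \<le> R}"
  proof -
    have "dist z0 z \<le> sqrt (R * (4 * Im z0 * (Im z0 * (2 + 4 * R))))" if z: "Im z > 0" "hypu z0 z \<le> R" for z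
    proof -
      have "Im z / Im z0 \<le> 2 + 4 * R" using hypu_Im_ratio[OF z(1) z0] z(2) hypu_sym[of z z0] by simp
      then have "Im z \<le> Im z0 * (2 + 4 * R)" using z0 by (simp add: field_simps)
      then have "R * (4 * Im z0 * Im z) \<le> R * (4 * Im z0 * (Im z0 * (2 + 4 * R)))"
        using True z0 by (intro mult_left_mono) auto
      moreover have "(cmod (z0 - z))\<^sup>2 \<le> R * (4 * Im z0 * Im z)"
        using z z0 unfolding hypu_def by (simp add: pos_divide_le_eq)
      ultimately show ?thesis unfolding dist_norm by (intro real_le_rsqrt) linarith
    qed
    then have "{z. Im z > 0 \<and> hypu z0 z \<le> R} \<subseteq> cball z0 (sqrt (R * (4 * Im z0 * (Im z0 * (2 + 4 * R)))))" by auto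
    then show ?thesis using bounded_subset[OF bounded_cball] by blast
  qed
  ultimately show ?thesis by (simp add: compact_eq_bounded_closed)
qed

text \<open>The conjugate of the unit translation back to the original group is a parabolic element
  fixing the image of infinity, so the analytic conditions on cusp forms apply in this
  chart.\<close>

lemma cusp_group_chart:
  assumes G: "subgroup \<Gamma> PSL2R" and S: "det S = 1" and c: "cusp_group (conj_group S (\<Union>\<Gamma>))"
  shows "moebius_sphere S None \<in> cusps \<Gamma>" "cusp_chart \<Gamma> (moebius_sphere S None) S 1"
proof -
  let ?T = "mat2 1 1 0 1" and ?A = "S ** mat2 1 1 0 1 ** adj2 S"
  have "?T \<in> conj_group S (\<Union>\<Gamma>)" using c by (rule cusp_group.unit_translation)
  then obtain A where A: "A \<in> \<Union>\<Gamma>" "?T = adj2 S ** A ** S" by blast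
  have "?A = A" unfolding A(2) by (rule conj2_inverse[OF S])
  then have AM: "det ?A = 1" "PSL_proj ?A \<in> \<Gamma>" using A(1) subgroup_matrices(1)[OF G] by auto
  show "cusp_chart \<Gamma> (moebius_sphere S None) S 1"
    using AM S by (simp add: cusp_chart_def SL2R_def translation_mat_eq matrix_inv_eq_adj2)
  have ent: "?A$1$1 = 1 - S$1$1 * S$2$1" "?A$1$2 = (S$1$1)\<^sup>2" "?A$2$1 = - (S$2$1)\<^sup>2" "?A$2$2 = 1 + S$1$1 * S$2$1"
    using S unfolding det_2 by (simp_all add: power2_eq_square algebra_simps)
  have nz: "S$1$1 \<noteq> 0 \<or> S$2$1 \<noteq> 0" using S by (auto simp: det_2)
  have "?A \<noteq> mat 1"
  proof
    assume "?A = mat 1"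
    then have "?A$1$2 = 0" "?A$2$1 = 0" by simp_all
    then show False using nz unfolding ent by simp
  qed
  moreover have "?A \<noteq> - mat 1"
  proof
    assume "?A = - mat 1"
    then have "?A$1$2 = 0" "?A$2$1 = 0" by simp_all
    then show False using nz unfolding ent by simp
  qed
  moreover have "\<bar>trace ?A\<bar> = 2" unfolding trace2 ent by simp
  moreover have "?A \<in> PSL_proj ?A" by (simp add: PSL_proj_eq)
  ultimately have par: "parabolic (PSL_proj ?A)" unfolding parabolic_def PSL_proj_one by blast
  have fixA: "moebius_sphere ?A (moebius_sphere S None) = moebius_sphere S None"
  proof (cases "S$2$1 = 0")
    case True
    have "?A$2$1 = 0" unfolding ent True by simp
    then show ?thesis unfolding moebius_sphere_def True by simp
  next
    case False
    let ?x = "of_real (S$1$1 / S$2$1) :: complex"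
    have 1: "aut_factor ?A ?x = 1" unfolding aut_factor_def ent using False by (simp add: power2_eq_square)
    have "moebius ?A ?x = ?x" unfolding moebius_def 1 unfolding ent using False by (simp add: power2_eq_square field_simps)
    then show ?thesis unfolding moebius_sphere_def using False 1 by simp
  qed
  have "\<forall>B\<in>PSL_proj ?A. moebius_sphere B (moebius_sphere S None) = moebius_sphere S None"
  proof
    fix B assume "B \<in> PSL_proj ?A"
    then have "B = ?A \<or> B = - ?A" by (simp add: PSL_proj_eq)
    moreover have "moebius_sphere (- C) x = moebius_sphere C x" for C x
      unfolding moebius_sphere_def moebius_neg aut_factor_neg by (simp split: option.split)
    ultimately show "moebius_sphere B (moebius_sphere S None) = moebius_sphere S None" using fixA by metis
  qed
  moreover have "moebius_sphere S None \<in> boundary_uhp" by (auto simp: moebius_sphere_def boundary_uhp_def simp del: of_real_divide)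
  ultimately show "moebius_sphere S None \<in> cusps \<Gamma>" unfolding cusps_def using par AM(2) by blast
qed

lemma power_mult_exp_le: "(x::real) ^ p * exp (- x) \<le> fact p" if "x \<ge> 0"
proof -
  have "(\<Sum>n\<in>{p}. x ^ n /\<^sub>R fact n) \<le> exp x"
    unfolding exp_def by (rule sum_le_suminf[OF summable_exp_generic]) (use that in auto)
  then have "x ^ p \<le> fact p * exp x" by (simp add: field_simps)
  then have "x ^ p * exp (- x) \<le> fact p * exp x * exp (- x)" by (rule mult_right_mono) simp
  then show ?thesis by (simp add: mult.assoc flip: exp_add)
qed

text \<open>In a cusp the bound comes from the maximum principle for \<open>g q / q\<close> on the disc bounded by a
  horocycle that still lies in the thick part.\<close>

lemma cusp_form_imp_bounded_form:
  assumes G: "subgroup \<Gamma> PSL2R" and L: "lattice (\<Union>\<Gamma>) U" and f: "cusp_form \<Gamma> p f"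
  shows "bounded_form (\<Union>\<Gamma>) p f"
proof -
  let ?M = "\<Union>\<Gamma>"
  interpret lattice ?M U by (rule L)
  have fh: "f holomorphic_on uhp" and fa: "\<forall>A\<in>?M. \<forall>z\<in>uhp. f (moebius A z) = aut_factor A z ^ (2 * p) * f z"
    using f by (auto simp: cusp_form_def modular_form_def)
  define N where "N = (\<lambda>z. cmod (f z) * (2 * Im z) ^ p)"
  have inv: "N (moebius A z) = N z" if A: "A \<in> ?M" and z: "Im z > 0" for A z
  proof -
    have "f (moebius A z) = aut_factor A z ^ (2 * p) * f z" using fa A z unfolding uhp_iff[symmetric] by blast
    moreover have "aut_factor A z \<noteq> 0" using aut_factor_nz[OF det1[OF A] z] .
    ultimately show ?thesis unfolding N_def Im_moebius[OF det1[OF A]]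
      by (simp add: norm_mult norm_power power_divide power_mult power_mult_distrib)
  qed
  have L0: "64 * cusp_height + 1 > 0" using cusp_height_pos by simp
  obtain t where t: "t > 0" "t \<le> margulis_const" "t \<le> 1 / (4 * (64 * cusp_height + 1)\<^sup>2)"
    "\<forall>w. Im w > 0 --> \<not> thick ?M t w --> (\<exists>S v. det S = 1 \<and> cusp_group (conj_group S ?M) \<and> Im v > 0 \<and> moebius S v = w \<and> 1 / (4 * (Im v)\<^sup>2) < t)"
    using thick_or_cusp[OF L0] by blast
  obtain Z where Z: "finite Z" "\<And>z. z \<in> Z ==> Im z > 0"
    "\<And>w. Im w > 0 ==> thick ?M t w ==> \<exists>A\<in>?M. \<exists>z\<in>Z. hypu z (moebius A w) \<le> t"
    using thick_cover[OF t(1)] by blast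
  define Kc where "Kc = (\<Union>z\<in>Z. {\<zeta>. Im \<zeta> > 0 \<and> hypu z \<zeta> \<le> t})"
  have "compact Kc" unfolding Kc_def using Z(1,2) compact_hyp_cball by (intro compact_UN) auto
  moreover have "continuous_on Kc N"
    unfolding N_def by (intro continuous_intros continuous_on_subset[OF holomorphic_on_imp_continuous_on[OF fh]]) (auto simp: Kc_def uhp_iff)
  ultimately have "bounded (N ` Kc)" by (intro compact_imp_bounded compact_continuous_image)
  then obtain B0 where B0: "\<forall>x\<in>N ` Kc. norm x \<le> B0" by (auto simp: bounded_iff)
  define B where "B = max B0 0"
  have B: "N w \<le> B" if w: "Im w > 0" "thick ?M t w" for w
  proof -
    obtain A z where A: "A \<in> ?M" "z \<in> Z" "hypu z (moebius A w) \<le> t" using Z(3)[OF w] by blast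
    then have "moebius A w \<in> Kc" using moebius_mem[OF A(1) w(1)] by (auto simp: Kc_def)
    then have "norm (N (moebius A w)) \<le> B0" using B0 by blast
    then show ?thesis unfolding inv[OF A(1) w(1)] B_def by simp
  qed
  \<comment> \<open>The height at which the unit translation has displacement exactly t: thin points
    of the cusp lie above it, and t is small enough for y0 to exceed the height required by
    \<open>cusp_disp_ge\<close>.\<close>
  define y0 where "y0 = 1 / (2 * sqrt t)"
  have y0: "y0 > 0" "1 / (4 * y0\<^sup>2) = t" "y0 \<ge> 64 * cusp_height"
  proof -
    show 1: "y0 > 0" using t(1) by (simp add: y0_def)
    show 2: "1 / (4 * y0\<^sup>2) = t" using t(1) by (simp add: y0_def power_divide power_mult_distrib)
    let ?L = "64 * cusp_height + 1"
    have L0: "?L > 0" using cusp_height_pos by simp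
    have "1 / (4 * y0\<^sup>2) \<le> 1 / (4 * ?L\<^sup>2)" using t(3) 2 by simp
    then have "inverse (4 * y0\<^sup>2) \<le> inverse (4 * ?L\<^sup>2)" by (simp only: inverse_eq_divide)
    moreover have "0 < 4 * y0\<^sup>2" using 1 by simp
    ultimately have "4 * ?L\<^sup>2 \<le> 4 * y0\<^sup>2" by (rule inverse_le_imp_le)
    then have "?L\<^sup>2 \<le> y0\<^sup>2" by simp
    then have "?L \<le> y0" by (rule power2_le_imp_le) (use 1 in simp)
    then show "y0 \<ge> 64 * cusp_height" by simp
  qed
  define \<rho> where "\<rho> = exp (- (2 * pi * y0))"
  have \<rho>: "0 < \<rho>" "\<rho> < 1" using y0(1) by (auto simp: \<rho>_def)
  define B' where "B' = B / ((2 * y0) ^ p * \<rho>)"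
  have B'0: "B' \<ge> 0" using y0 \<rho> by (simp add: B'_def B_def)
  have main: "N w \<le> B + B' * fact p" if w: "Im w > 0" for w
  proof (cases "thick ?M t w")
    case True
    then show ?thesis using B[OF w True] B'0 by (simp add: add_increasing2)
  next
    case False
    then obtain S v where S: "det S = 1" "cusp_group (conj_group S ?M)" "Im v > 0" "moebius S v = w" "1 / (4 * (Im v)\<^sup>2) < t"
      using t(4)[rule_format, OF w False] by (elim exE conjE)
    interpret c: cusp_group "conj_group S ?M" by (rule S(2))
    have vy: "Im v \<ge> y0"
    proof -
      have "1 / (4 * (Im v)\<^sup>2) < 1 / (4 * y0\<^sup>2)" using S(5) y0(2) by simp
      then have "inverse (4 * (Im v)\<^sup>2) < inverse (4 * y0\<^sup>2)" by (simp only: inverse_eq_divide)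
      moreover have "0 < 4 * (Im v)\<^sup>2" using S(3) by simp
      ultimately have "4 * y0\<^sup>2 < 4 * (Im v)\<^sup>2" by (rule inverse_less_imp_less)
      then have "y0\<^sup>2 < (Im v)\<^sup>2" by simp
      then have "y0 < Im v" by (rule power_less_imp_less_base) (use S(3) in simp)
      then show ?thesis by simp
    qed
    \<comment> \<open>At height y0 a nonzero integer translation has displacement at least t, and
      every other noncentral element has displacement at least 4.\<close>
    have horo: "thick ?M t (moebius S z)" if z: "Im z = y0" for z
      unfolding thick_def
    proof (intro ballI impI)
      fix A assume A: "A \<in> ?M" "A \<noteq> mat 1" "A \<noteq> - mat 1"
      have z0: "Im z > 0" using z y0 by simp
      let ?C = "adj2 S ** A ** S"
      have CM: "?C \<in> conj_group S ?M" using A(1) by blast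
      have ds: "disp ?C z = disp A (moebius S z)" by (rule disp_conj[OF S(1) det1[OF A(1)] z0])
      have AC: "A = S ** ?C ** adj2 S" using conj2_inverse[OF S(1)] by simp
      show "t \<le> disp A (moebius S z)"
      proof (cases "?C$2$1 = 0")
        case True
        obtain n :: int where n: "?C = mat2 1 (of_int n) 0 1 \<or> ?C = - mat2 1 (of_int n) 0 1"
          by (rule c.fixes_infinity[OF CM True])
        have "n \<noteq> 0"
        proof
          assume n0: "n = 0"
          have "mat2 1 (of_int n) 0 1 = mat 1" unfolding n0 by (rule mat2_eqI) simp_all
          then have "?C = mat 1 \<or> ?C = - mat 1" using n by metis
          moreover have "S ** mat 1 ** adj2 S = mat 1" "S ** (- mat 1) ** adj2 S = - mat 1" using S(1) by simp_all
          ultimately show False using AC A(2,3) by metis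
        qed
        then have "1 \<le> \<bar>real_of_int n\<bar>" by linarith
        then have n1: "1 \<le> (real_of_int n)\<^sup>2" using abs_le_square_iff[of 1 "real_of_int n"] by simp
        have "disp (- mat2 1 (of_int n) 0 1) z = disp (mat2 1 (of_int n) 0 1) z" by (simp add: disp_def)
        then have "disp ?C z = (of_int n)\<^sup>2 / (4 * y0\<^sup>2)" using n disp_translation[OF z0, of "of_int n"] z by metis
        moreover have "1 / (4 * y0\<^sup>2) \<le> (of_int n)\<^sup>2 / (4 * y0\<^sup>2)" using n1 by (intro divide_right_mono) auto
        ultimately show ?thesis using y0(2) ds by simp
      next
        case False
        have "Im z / (16 * cusp_height) \<le> disp ?C z" using z y0(3) by (intro c.cusp_disp_ge CM False) simp
        moreover have "4 \<le> Im z / (16 * cusp_height)" using z y0(3) cusp_height_pos by (simp add: field_simps)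
        moreover have "t \<le> 1" using t(2) by (simp add: margulis_const_def)
        ultimately show ?thesis using ds by linarith
      qed
    qed
    obtain g where g: "cusp_extension p f S 1 g" "g 0 = 0"
      using f cusp_group_chart[OF G S(1,2)] unfolding cusp_form_def by blast
    have gh: "g holomorphic_on ball 0 1" and ge: "\<forall>z\<in>uhp. f (moebius S z) / aut_factor S z ^ (2 * p) = g (qexp z)"
      using g(1) by (simp_all add: cusp_extension_def)
    have Ng: "N (moebius S z) = cmod (g (qexp z)) * (2 * Im z) ^ p" if z: "Im z > 0" for z
    proof -
      have "g (qexp z) = f (moebius S z) / aut_factor S z ^ (2 * p)" using ge z by (simp add: uhp_iff)
      then show ?thesis unfolding N_def Im_moebius[OF S(1)]
        by (simp add: norm_divide norm_power power_divide power_mult power_mult_distrib)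
    qed
    define g1 where "g1 = (\<lambda>q. if q = 0 then deriv g 0 else (g q - g 0) / (q - 0))"
    have g1h: "g1 holomorphic_on ball 0 1" unfolding g1_def by (rule pole_lemma[OF gh]) simp
    have gg: "g q = q * g1 q" for q using g(2) by (simp add: g1_def)
    have fr: "cmod (g1 q) \<le> B'" if q: "cmod q = \<rho>" for q
    proof -
      have q0: "q \<noteq> 0" using q \<rho> by auto
      define z where "z = Ln q / (2 * of_real pi * \<i>)"
      have ez: "qexp z = q" using q0 by (simp add: z_def)
      have "Im z = - (ln (cmod q)) / (2 * pi)" unfolding z_def using q0 by (simp add: Im_divide power2_eq_square)
      then have iz: "Im z = y0" unfolding q by (simp add: \<rho>_def)
      then have "cmod (g q) * (2 * y0) ^ p \<le> B" using Ng[of z] B[of "moebius S z"] horo[OF iz] y0(1) S(1) ez by (simp add: Im_moebius_pos)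
      then have "\<rho> * cmod (g1 q) * (2 * y0) ^ p \<le> B" unfolding gg norm_mult q .
      then show ?thesis unfolding B'_def using y0(1) \<rho>(1) by (simp add: pos_le_divide_eq mult_ac)
    qed
    let ?q = "qexp v"
    have nq: "cmod ?q = exp (- (2 * pi * Im v))" by (simp add: norm_exp_eq_Re)
    have "cmod (g1 ?q) \<le> B'"
    proof (rule maximum_modulus_frontier[of g1 "cball 0 \<rho>"])
      show "g1 holomorphic_on interior (cball 0 \<rho>)" by (rule holomorphic_on_subset[OF g1h]) (use \<rho> in auto)
      show "continuous_on (closure (cball 0 \<rho>)) g1"
        by (rule continuous_on_subset[OF holomorphic_on_imp_continuous_on[OF g1h]]) (use \<rho> in auto)
      show "?q \<in> cball 0 \<rho>" using vy by (simp add: nq \<rho>_def)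
    qed (use fr in \<open>auto simp: frontier_cball\<close>)
    then have "cmod (g ?q) \<le> exp (- (2 * pi * Im v)) * B'" unfolding gg[of ?q] norm_mult nq by (intro mult_left_mono) auto
    then have "cmod (g ?q) * (2 * Im v) ^ p \<le> exp (- (2 * pi * Im v)) * B' * (2 * Im v) ^ p" using S(3) by (intro mult_right_mono) auto
    moreover have "exp (- (2 * pi * Im v)) * B' * (2 * Im v) ^ p \<le> B' * fact p"
    proof -
      have "1 * (2 * Im v) \<le> pi * (2 * Im v)" using S(3) pi_gt3 by (intro mult_right_mono) auto
      then have "exp (- (2 * pi * Im v)) \<le> exp (- (2 * Im v))" by (simp add: mult_ac)
      then have "(2 * Im v) ^ p * exp (- (2 * pi * Im v)) \<le> (2 * Im v) ^ p * exp (- (2 * Im v))" using S(3) by (intro mult_left_mono) auto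
      also have "... \<le> fact p" using S(3) by (intro power_mult_exp_le) auto
      finally have "B' * ((2 * Im v) ^ p * exp (- (2 * pi * Im v))) \<le> B' * fact p" using B'0 by (rule mult_left_mono)
      then show ?thesis by (simp only: mult_ac)
    qed
    moreover have "B \<ge> 0" by (simp add: B_def)
    ultimately have "cmod (g ?q) * (2 * Im v) ^ p \<le> B + B' * fact p" by linarith
    then show ?thesis unfolding Ng[OF S(3), symmetric] S(4) .
  qed
  have "\<exists>K. \<forall>z\<in>uhp. cmod (f z) * (2 * Im z) ^ p \<le> K"
  proof (intro exI ballI)
    fix z assume "z \<in> uhp"
    then show "cmod (f z) * (2 * Im z) ^ p \<le> B + B' * fact p" using main[of z] unfolding N_def uhp_iff by blast
  qed
  then show ?thesis unfolding bounded_form_def using fh fa by blast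
qed

section \<open>The Petersson product\<close>

text \<open>The constant of the reproducing formula; its inverse p / pi - 1 / (2 pi) produces the
  leading term of the theorem.\<close>

definition petersson_const :: "nat \<Rightarrow> real" where
  "petersson_const p = 2 * pi / (2 * real p - 1)"

context lattice
begin

lemma petersson_integrable:
  assumes f: "bounded_form M p f" and g: "bounded_form M p g"
  shows "integrable hyp_area (\<lambda>z. indicator U z *\<^sub>R (f z * cnj (g z) * of_real ((2 * Im z) ^ (2 * p))))"
proof -
  obtain K where K: "\<forall>z\<in>uhp. cmod (f z) * (2 * Im z) ^ p \<le> K" using f by (auto simp: bounded_form_def)
  obtain L where L: "\<forall>z\<in>uhp. cmod (g z) * (2 * Im z) ^ p \<le> L" using g by (auto simp: bounded_form_def)
  have fh: "continuous_on uhp f" "continuous_on uhp g" using f g by (auto simp: bounded_form_def holomorphic_on_imp_continuous_on)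
  have m: "(\<lambda>z. f z * cnj (g z) * of_real ((2 * Im z) ^ (2 * p))) \<in> borel_measurable hyp_area"
    unfolding measurable_hyp_area by (rule borel_measurable_continuous_on_restrict) (intro continuous_intros fh)
  have b: "norm (f z * cnj (g z) * of_real ((2 * Im z) ^ (2 * p))) \<le> K * L" if z: "z \<in> U" for z
  proof -
    have u: "z \<in> uhp" "Im z > 0" using z U_uhp by (auto simp: uhp_iff)
    have "norm (f z * cnj (g z) * of_real ((2 * Im z) ^ (2 * p))) = (cmod (f z) * (2 * Im z) ^ p) * (cmod (g z) * (2 * Im z) ^ p)"
      using u(2) unfolding norm_mult norm_of_real complex_mod_cnj mult_2 power_add by simp
    also have "... \<le> K * L"
    proof (rule mult_mono)
      show a: "cmod (f z) * (2 * Im z) ^ p \<le> K" "cmod (g z) * (2 * Im z) ^ p \<le> L" using K L u(1) by blast+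
      show "0 \<le> K" by (rule order_trans[OF _ a(1)]) (use u in auto)
    qed (use u in auto)
    finally show ?thesis .
  qed
  show ?thesis
    by (rule integrableI_bounded_set_indicator[OF U_sets m finite_area, of "K * L"]) (use b in auto)
qed

lemma petersson_eq: "petersson U p f g = (\<integral>z. indicator U z *\<^sub>R (f z * cnj (g z) * of_real ((2 * Im z) ^ (2 * p))) \<partial>hyp_area)"
  by (simp add: petersson_def set_lebesgue_integral_def)

lemma petersson_cnj:
  assumes "bounded_form M p f" "bounded_form M p g"
  shows "petersson U p g f = cnj (petersson U p f g)"
proof -
  have "cnj (petersson U p f g) = (\<integral>z. cnj (indicator U z *\<^sub>R (f z * cnj (g z) * of_real ((2 * Im z) ^ (2 * p)))) \<partial>hyp_area)"
    unfolding petersson_eq by (rule Bochner_Integration.integral_cnj[symmetric])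
  also have "... = petersson U p g f"
    unfolding petersson_eq by (intro Bochner_Integration.integral_cong refl) (simp add: scaleR_conv_of_real mult_ac)
  finally show ?thesis by simp
qed

lemma petersson_lincomb:
  assumes h: "bounded_form M p h" and f: "\<forall>j<n. bounded_form M p (f j)" and g: "bounded_form M p g"
  shows "petersson U p (\<lambda>z. h z - (\<Sum>j<n. c j * f j z)) g = petersson U p h g - (\<Sum>j<n. c j * petersson U p (f j) g)"
proof -
  let ?i = "\<lambda>f z. indicator U z *\<^sub>R (f z * cnj (g z) * of_real ((2 * Im z) ^ (2 * p)))"
  have ih: "integrable hyp_area (?i h)" using petersson_integrable[OF h g] .
  have ij: "integrable hyp_area (\<lambda>z. c j * ?i (f j) z)" if "j \<in> {..<n}" for j
    using petersson_integrable[OF _ g] f that by (intro integrable_mult_right) auto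
  have "petersson U p (\<lambda>z. h z - (\<Sum>j<n. c j * f j z)) g = (\<integral>z. ?i h z - (\<Sum>j<n. c j * ?i (f j) z) \<partial>hyp_area)"
    unfolding petersson_eq
    by (intro Bochner_Integration.integral_cong refl) (simp add: scaleR_conv_of_real algebra_simps sum_distrib_left sum_distrib_right)
  also have "... = (\<integral>z. ?i h z \<partial>hyp_area) - (\<integral>z. (\<Sum>j<n. c j * ?i (f j) z) \<partial>hyp_area)"
    by (rule Bochner_Integration.integral_diff[OF ih Bochner_Integration.integrable_sum[OF ij]])
  also have "(\<integral>z. (\<Sum>j<n. c j * ?i (f j) z) \<partial>hyp_area) = (\<Sum>j<n. (\<integral>z. c j * ?i (f j) z \<partial>hyp_area))"
    by (rule Bochner_Integration.integral_sum[OF ij])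
  also have "... = (\<Sum>j<n. c j * petersson U p (f j) g)"
    unfolding petersson_eq by (intro sum.cong refl integral_mult_right_zero)
  finally show ?thesis unfolding petersson_eq[of p h g] .
qed

lemma bounded_form_lincomb:
  assumes h: "bounded_form M p h" and f: "\<forall>j<n. bounded_form M p (f j)"
  shows "bounded_form M p (\<lambda>z. h z - (\<Sum>j<n. c j * f j z))"
proof -
  have "(\<lambda>z. h z - (\<Sum>j<n. c j * f j z)) holomorphic_on uhp"
    using h f by (intro holomorphic_intros) (auto simp: bounded_form_def)
  moreover have "h (moebius A z) - (\<Sum>j<n. c j * f j (moebius A z)) = aut_factor A z ^ (2 * p) * (h z - (\<Sum>j<n. c j * f j z))"
    if "A \<in> M" "z \<in> uhp" for A z
  proof -
    have "(\<Sum>j<n. c j * f j (moebius A z)) = (\<Sum>j<n. aut_factor A z ^ (2 * p) * (c j * f j z))"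
      using f that by (intro sum.cong refl) (simp add: bounded_form_def)
    moreover have "h (moebius A z) = aut_factor A z ^ (2 * p) * h z" using h that by (simp add: bounded_form_def)
    ultimately show ?thesis by (simp add: right_diff_distrib sum_distrib_left)
  qed
  moreover have "\<exists>K. \<forall>z\<in>uhp. cmod (h z - (\<Sum>j<n. c j * f j z)) * (2 * Im z) ^ p \<le> K"
  proof -
    obtain K where K: "\<forall>z\<in>uhp. cmod (h z) * (2 * Im z) ^ p \<le> K" using h by (auto simp: bounded_form_def)
    have "\<forall>j. \<exists>L. j < n --> (\<forall>z\<in>uhp. cmod (f j z) * (2 * Im z) ^ p \<le> L)" using f by (auto simp: bounded_form_def)
    then obtain L where L: "\<forall>j. j < n --> (\<forall>z\<in>uhp. cmod (f j z) * (2 * Im z) ^ p \<le> L j)" by metis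
    have "cmod (h z - (\<Sum>j<n. c j * f j z)) * (2 * Im z) ^ p \<le> K + (\<Sum>j<n. cmod (c j) * L j)" if z: "z \<in> uhp" for z
    proof -
      have y: "(2 * Im z) ^ p \<ge> 0" using z by (simp add: uhp_iff)
      have "cmod (h z - (\<Sum>j<n. c j * f j z)) \<le> cmod (h z) + (\<Sum>j<n. cmod (c j) * cmod (f j z))"
        by (rule order_trans[OF norm_triangle_ineq4 add_left_mono]) (simp add: sum_norm_le norm_mult)
      then have "cmod (h z - (\<Sum>j<n. c j * f j z)) * (2 * Im z) ^ p \<le> (cmod (h z) + (\<Sum>j<n. cmod (c j) * cmod (f j z))) * (2 * Im z) ^ p"
        using y by (rule mult_right_mono)
      also have "... = cmod (h z) * (2 * Im z) ^ p + (\<Sum>j<n. cmod (c j) * (cmod (f j z) * (2 * Im z) ^ p))"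
        by (simp only: distrib_right sum_distrib_right mult.assoc)
      also have "... \<le> K + (\<Sum>j<n. cmod (c j) * L j)"
        using K L z by (intro add_mono sum_mono mult_left_mono) auto
      finally show ?thesis .
    qed
    then show ?thesis by blast
  qed
  ultimately show ?thesis unfolding bounded_form_def by blast
qed

lemma bounded_form_scale:
  assumes h: "bounded_form M p h" shows "bounded_form M p (\<lambda>z. c * h z)"
proof -
  have "bounded_form M p (\<lambda>z. h z - (\<Sum>j<1::nat. (1 - c) * h z))"
    by (rule bounded_form_lincomb) (use h in auto)
  moreover have "(\<lambda>z. h z - (\<Sum>j<1::nat. (1 - c) * h z)) = (\<lambda>z. c * h z)" by (rule ext) (simp add: algebra_simps)
  ultimately show ?thesis by simp
qed

lemma petersson_scale: "petersson U p (\<lambda>z. a * f z) (\<lambda>z. b * g z) = a * cnj b * petersson U p f g"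
proof -
  have "petersson U p (\<lambda>z. a * f z) (\<lambda>z. b * g z) = (\<integral>z. (a * cnj b) * (indicator U z *\<^sub>R (f z * cnj (g z) * of_real ((2 * Im z) ^ (2 * p)))) \<partial>hyp_area)"
    unfolding petersson_eq by (intro Bochner_Integration.integral_cong refl) (simp add: scaleR_conv_of_real mult_ac)
  then show ?thesis unfolding petersson_eq by (simp only: integral_mult_right_zero)
qed

lemma petersson_self:
  assumes f: "bounded_form M p f"
  defines "I \<equiv> (\<integral>z. indicator U z * ((cmod (f z))\<^sup>2 * (2 * Im z) ^ (2 * p)) \<partial>hyp_area)"
  shows "petersson U p f f = of_real I" "I \<ge> 0"
    and "integrable hyp_area (\<lambda>z. indicator U z * ((cmod (f z))\<^sup>2 * (2 * Im z) ^ (2 * p)))"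
proof -
  have e: "indicator U z *\<^sub>R (f z * cnj (f z) * of_real ((2 * Im z) ^ (2 * p))) = of_real (indicator U z * ((cmod (f z))\<^sup>2 * (2 * Im z) ^ (2 * p)))" for z
    by (simp only: complex_norm_square[symmetric] scaleR_conv_of_real of_real_mult)
  have "petersson U p f f = (\<integral>z. complex_of_real (indicator U z * ((cmod (f z))\<^sup>2 * (2 * Im z) ^ (2 * p))) \<partial>hyp_area)"
    unfolding petersson_eq by (simp only: e)
  then show "petersson U p f f = of_real I" unfolding I_def by (simp only: integral_complex_of_real)
  show "I \<ge> 0" unfolding I_def by (rule Bochner_Integration.integral_nonneg) (auto simp: power_mult)
  show "integrable hyp_area (\<lambda>z. indicator U z * ((cmod (f z))\<^sup>2 * (2 * Im z) ^ (2 * p)))"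
    using petersson_integrable[OF f f] unfolding e by (simp only: complex_of_real_integrable_eq)
qed

text \<open>The product of a form with one term of the series is the reproducing integrand evaluated
  at A z. Unfolding turns the integral over \<open>U\<close> into one over the half-plane, and its
  factor 2 cancels the 1/2 in \<open>pseries\<close>.\<close>

lemma petersson_pseries:
  assumes f: "bounded_form M p f" and p: "p \<ge> 2" and w: "Im w > 0"
  shows "petersson U p f (pseries M p w) = of_real (petersson_const p) * f w"
proof -
  have fh: "f holomorphic_on uhp" and fa: "\<forall>A\<in>M. \<forall>z\<in>uhp. f (moebius A z) = aut_factor A z ^ (2 * p) * f z"
    using f by (auto simp: bounded_form_def)
  obtain K where K: "\<forall>z\<in>uhp. cmod (f z) * (2 * Im z) ^ p \<le> K" using f by (auto simp: bounded_form_def)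
  define \<phi> where "\<phi> = (\<lambda>z. f z * cnj ((\<i> / (z - cnj w)) ^ (2 * p)) * of_real ((2 * Im z) ^ (2 * p)))"
  note R = reproducing[OF fh p K w, folded \<phi>_def]
  have \<phi>A: "\<phi> (moebius A z) = f z * of_real ((2 * Im z) ^ (2 * p)) * cnj ((\<i> / herm A w z) ^ (2 * p))"
    if A: "A \<in> M" and z: "Im z > 0" for A z
  proof -
    let ?j = "aut_factor A z"
    have jz: "?j \<noteq> 0" by (rule aut_factor_nz[OF det1[OF A] z])
    have h: "herm A w z = ?j * (moebius A z - cnj w)" by (rule herm_eq[OF det1[OF A] z])
    have n: "?j * cnj ?j = of_real ((cmod ?j)\<^sup>2)" by (simp add: complex_mult_cnj cmod_def)
    have 2: "of_real (2 * Im (moebius A z)) = of_real (2 * Im z) / (?j * cnj ?j)"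
      unfolding n Im_moebius[OF det1[OF A]] by simp
    have "\<phi> (moebius A z) = (?j * cnj (\<i> / (moebius A z - cnj w)) * of_real (2 * Im (moebius A z))) ^ (2 * p) * f z"
      using fa A z unfolding \<phi>_def power_mult_distrib[of "?j * cnj (\<i> / (moebius A z - cnj w))"] power_mult_distrib[of ?j] complex_cnj_power of_real_power uhp_iff[symmetric]
      by (simp only: mult_ac)
    also have "?j * cnj (\<i> / (moebius A z - cnj w)) * of_real (2 * Im (moebius A z)) = of_real (2 * Im z) * cnj (\<i> / herm A w z)"
      unfolding 2 h using jz by (simp add: mult_ac)
    also have "(of_real (2 * Im z) * cnj (\<i> / herm A w z)) ^ (2 * p) * f z = f z * of_real ((2 * Im z) ^ (2 * p)) * cnj ((\<i> / herm A w z) ^ (2 * p))"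
      unfolding power_mult_distrib[of "of_real (2 * Im z)"] complex_cnj_power of_real_power by (simp only: mult_ac)
    finally show ?thesis .
  qed
  have cs: "(\<integral>A. \<phi> (moebius A z) \<partial>count_space M) = f z * of_real ((2 * Im z) ^ (2 * p)) * cnj (2 * pseries M p w z)" if z: "Im z > 0" for z
  proof -
    let ?c = "f z * of_real ((2 * Im z) ^ (2 * p))"
    have "(\<lambda>A. norm ?c * norm ((\<i> / herm A w z) ^ (2 * p))) summable_on M"
      by (intro summable_on_cmult_right pseries_summable w z p)
    then have "(\<lambda>A. norm (\<phi> (moebius A z))) summable_on M"
      by (rule summable_on_cong[THEN iffD1, rotated]) (simp only: \<phi>A[OF _ z] norm_mult complex_mod_cnj)
    then have as: "Infinite_Set_Sum.abs_summable_on (\<lambda>A. \<phi> (moebius A z)) M" by (simp only: abs_summable_equivalent)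
    have "(\<integral>A. \<phi> (moebius A z) \<partial>count_space M) = infsetsum (\<lambda>A. \<phi> (moebius A z)) M" by (simp only: infsetsum_def)
    also have "... = infsum (\<lambda>A. \<phi> (moebius A z)) M" by (rule infsetsum_infsum[OF as])
    also have "... = infsum (\<lambda>A. ?c * cnj ((\<i> / herm A w z) ^ (2 * p))) M" by (rule infsum_cong) (rule \<phi>A[OF _ z])
    also have "... = ?c * infsum (\<lambda>A. cnj ((\<i> / herm A w z) ^ (2 * p))) M" by (rule infsum_cmult_right')
    also have "infsum (\<lambda>A. cnj ((\<i> / herm A w z) ^ (2 * p))) M = cnj (infsum (\<lambda>A. (\<i> / herm A w z) ^ (2 * p)) M)" by (rule infsum_cnj)
    also have "infsum (\<lambda>A. (\<i> / herm A w z) ^ (2 * p)) M = 2 * pseries M p w z" by (simp add: pseries_def)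
    finally show ?thesis .
  qed
  have "2 * petersson U p f (pseries M p w) = (\<integral>z. 2 * (indicator U z *\<^sub>R (f z * cnj (pseries M p w z) * of_real ((2 * Im z) ^ (2 * p)))) \<partial>hyp_area)"
    unfolding petersson_eq by (rule integral_mult_right_zero[symmetric])
  also have "... = (\<integral>z. indicator U z *\<^sub>R (\<integral>A. \<phi> (moebius A z) \<partial>count_space M) \<partial>hyp_area)"
  proof (rule Bochner_Integration.integral_cong[OF refl])
    fix z assume "z \<in> space hyp_area"
    then have "Im z > 0" by (simp add: uhp_iff)
    then show "2 * (indicator U z *\<^sub>R (f z * cnj (pseries M p w z) * of_real ((2 * Im z) ^ (2 * p)))) = indicator U z *\<^sub>R (\<integral>A. \<phi> (moebius A z) \<partial>count_space M)"
      by (simp add: cs scaleR_conv_of_real mult_ac)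
  qed
  also have "... = 2 * (\<integral>z. \<phi> z \<partial>hyp_area)" by (rule unfolding_integral(1)[OF R(1)])
  also have "... = 2 * (2 * of_real pi / (2 * of_nat p - 1) * f w)" unfolding R(2) ..
  finally have "2 * petersson U p f (pseries M p w) = 2 * (2 * of_real pi / (2 * of_nat p - 1) * f w)" .
  from mult_left_cancel[THEN iffD1, OF _ this] have "petersson U p f (pseries M p w) = 2 * of_real pi / (2 * of_nat p - 1) * f w" by simp
  then show ?thesis by (simp add: petersson_const_def)
qed

text \<open>A form of norm 0 vanishes almost everywhere on \<open>U\<close>, so its product with
  every \<open>pseries\<close> is 0. By the reproducing formula that product is a nonzero multiple
  of its value at w.\<close>

lemma petersson_zero:
  assumes f: "bounded_form M p f" and p: "p \<ge> 2" and z: "petersson U p f f = 0" and w: "Im w > 0"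
  shows "f w = 0"
proof -
  note s = petersson_self[OF f]
  have "(\<integral>z. indicator U z * ((cmod (f z))\<^sup>2 * (2 * Im z) ^ (2 * p)) \<partial>hyp_area) = 0" using s(1) z by simp
  then have ae: "AE z in hyp_area. indicator U z * ((cmod (f z))\<^sup>2 * (2 * Im z) ^ (2 * p)) = 0"
    by (subst (asm) integral_nonneg_eq_0_iff_AE[OF s(3)]) (auto simp: power_mult)
  have "petersson U p f (pseries M p w) = (\<integral>z. 0 \<partial>hyp_area)"
    unfolding petersson_eq
  proof (rule integral_cong_AE)
    show "(\<lambda>z. indicator U z *\<^sub>R (f z * cnj (pseries M p w z) * of_real ((2 * Im z) ^ (2 * p)))) \<in> borel_measurable hyp_area"
      by (rule borel_measurable_integrable[OF petersson_integrable[OF f pseries_bounded_form[OF w p]]])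
    show "AE z in hyp_area. indicator U z *\<^sub>R (f z * cnj (pseries M p w z) * of_real ((2 * Im z) ^ (2 * p))) = 0"
      using ae by eventually_elim auto
  qed auto
  then have "of_real (petersson_const p) * f w = 0" using petersson_pseries[OF f p w] by simp
  moreover have "petersson_const p \<noteq> 0" using p by (simp add: petersson_const_def)
  ultimately show ?thesis by simp
qed

section \<open>Orthonormal systems and finite dimension\<close>

definition orthonormal :: "nat \<Rightarrow> nat \<Rightarrow> (nat \<Rightarrow> complex \<Rightarrow> complex) \<Rightarrow> bool" where
  "orthonormal p n f \<longleftrightarrow> (\<forall>j<n. bounded_form M p (f j)) \<and> (\<forall>i<n. \<forall>j<n. petersson U p (f i) (f j) = (if i = j then 1 else 0))"

lemma residual:
  assumes o: "orthonormal p n f" and h: "bounded_form M p h"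
  defines "g \<equiv> \<lambda>z. h z - (\<Sum>j<n. petersson U p h (f j) * f j z)"
  shows "bounded_form M p g" "\<forall>j<n. petersson U p g (f j) = 0"
    "petersson U p g g = petersson U p h h - (\<Sum>j<n. petersson U p h (f j) * petersson U p (f j) h)"
proof -
  have f: "\<forall>j<n. bounded_form M p (f j)" and on: "\<forall>i<n. \<forall>j<n. petersson U p (f i) (f j) = (if i = j then 1 else 0)"
    using o by (auto simp: orthonormal_def)
  show gb: "bounded_form M p g" unfolding g_def by (rule bounded_form_lincomb[OF h f])
  note lin = petersson_lincomb[OF h f, where c = "\<lambda>j. petersson U p h (f j)", folded g_def]
  show 0: "\<forall>j<n. petersson U p g (f j) = 0"
  proof (intro allI impI)
    fix j assume j: "j < n"
    have "(\<Sum>i<n. petersson U p h (f i) * petersson U p (f i) (f j)) = (\<Sum>i<n. if i = j then petersson U p h (f i) else 0)"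
      using on j by (intro sum.cong refl) auto
    also have "... = petersson U p h (f j)" using j by simp
    finally show "petersson U p g (f j) = 0" using lin[of "f j"] f j by simp
  qed
  have fg: "petersson U p (f j) g = 0" if "j < n" for j using petersson_cnj[OF gb, of "f j"] f 0 that by simp
  have "petersson U p g g = petersson U p h g" using lin[OF gb] fg by simp
  also have "... = cnj (petersson U p g h)" by (rule petersson_cnj[OF gb h])
  also have "petersson U p g h = petersson U p h h - (\<Sum>j<n. petersson U p h (f j) * petersson U p (f j) h)" by (rule lin[OF h])
  also have "cnj ... = petersson U p h h - (\<Sum>j<n. petersson U p h (f j) * petersson U p (f j) h)"
    using petersson_cnj[OF h h] petersson_cnj[OF h] f by (simp add: mult.commute)
  finally show "petersson U p g g = petersson U p h h - (\<Sum>j<n. petersson U p h (f j) * petersson U p (f j) h)" .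
qed

text \<open>The squared norm of the part of the averaged kernel orthogonal to the system. Its
  nonnegativity is Bessel's inequality, and its vanishing for a basis expresses the kernel function
  through \<open>efun\<close>.\<close>

lemma pseries_residual:
  assumes o: "orthonormal p n f" and p: "p \<ge> 2" and w: "Im w > 0"
  defines "G \<equiv> pseries M p w"
  defines "g \<equiv> \<lambda>z. G z - (\<Sum>j<n. petersson U p G (f j) * f j z)"
  shows "petersson U p g g * of_real ((2 * Im w) ^ (2 * p)) = of_real (petersson_const p) *
     (efun M p w - of_real (petersson_const p * (\<Sum>j<n. (cmod (f j w))\<^sup>2 * (2 * Im w) ^ (2 * p))))"
proof -
  have Gb: "bounded_form M p G" unfolding G_def by (rule pseries_bounded_form[OF w p])
  have f: "\<forall>j<n. bounded_form M p (f j)" using o by (simp add: orthonormal_def)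
  let ?c = "complex_of_real (petersson_const p)"
  have fG: "petersson U p (f j) G = ?c * f j w" if "j < n" for j unfolding G_def using f that by (intro petersson_pseries p w) auto
  have Gf: "petersson U p G (f j) = ?c * cnj (f j w)" if "j < n" for j
    using petersson_cnj[OF _ Gb, of "f j"] f that by (simp add: fG)
  have "petersson U p g g = petersson U p G G - (\<Sum>j<n. petersson U p G (f j) * petersson U p (f j) G)"
    unfolding g_def by (rule residual(3)[OF o Gb])
  also have "petersson U p G G = ?c * G w" using petersson_pseries[OF Gb p w] by (simp only: G_def)
  also have "(\<Sum>j<n. petersson U p G (f j) * petersson U p (f j) G) = (\<Sum>j<n. ?c * ?c * of_real ((cmod (f j w))\<^sup>2))"
    by (intro sum.cong refl) (simp only: lessThan_iff Gf fG complex_norm_square mult_ac)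
  finally have "petersson U p g g = ?c * G w - ?c * ?c * of_real (\<Sum>j<n. (cmod (f j w))\<^sup>2)"
    by (simp only: sum_distrib_left of_real_sum)
  moreover have "(c * g - c * c * s) * y = c * (g * y - c * (s * y))" for c g s y :: complex by (simp add: algebra_simps)
  ultimately have "petersson U p g g * of_real ((2 * Im w) ^ (2 * p)) = ?c * (G w * of_real ((2 * Im w) ^ (2 * p)) - ?c * (of_real (\<Sum>j<n. (cmod (f j w))\<^sup>2) * of_real ((2 * Im w) ^ (2 * p))))"
    by (simp only:)
  also have "G w * of_real ((2 * Im w) ^ (2 * p)) = efun M p w" unfolding G_def by (rule pseries_diag[OF w])
  also have "complex_of_real (\<Sum>j<n. (cmod (f j w))\<^sup>2) * of_real ((2 * Im w) ^ (2 * p)) = of_real (\<Sum>j<n. (cmod (f j w))\<^sup>2 * (2 * Im w) ^ (2 * p))"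
    by (simp only: of_real_mult[symmetric] sum_distrib_right)
  finally show ?thesis by (simp only: of_real_mult)
qed

lemma petersson_const_pos: "p \<ge> 2 ==> petersson_const p > 0"
  by (simp add: petersson_const_def)

lemma bessel:
  assumes o: "orthonormal p n f" and p: "p \<ge> 2" and w: "Im w > 0"
  shows "petersson_const p * (\<Sum>j<n. (cmod (f j w))\<^sup>2 * (2 * Im w) ^ (2 * p)) \<le> Re (efun M p w)"
proof -
  let ?G = "pseries M p w"
  let ?g = "\<lambda>z. ?G z - (\<Sum>j<n. petersson U p ?G (f j) * f j z)"
  let ?s = "petersson_const p * (\<Sum>j<n. (cmod (f j w))\<^sup>2 * (2 * Im w) ^ (2 * p))"
  have gb: "bounded_form M p ?g" by (rule residual(1)[OF o pseries_bounded_form[OF w p]])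
  obtain I where I: "petersson U p ?g ?g = of_real I" "I \<ge> 0" using petersson_self(1,2)[OF gb] by blast
  have "of_real I * of_real ((2 * Im w) ^ (2 * p)) = of_real (petersson_const p) * (efun M p w - of_real ?s)"
    using pseries_residual[OF o p w] unfolding I(1) .
  then have "Re (of_real I * of_real ((2 * Im w) ^ (2 * p))) = Re (of_real (petersson_const p) * (efun M p w - of_real ?s))" by (simp only:)
  moreover have re: "Re (of_real a * of_real b) = a * b" "Re (of_real a * (E - of_real b)) = a * (Re E - b)" for a b E by simp_all
  ultimately have e: "I * (2 * Im w) ^ (2 * p) = petersson_const p * (Re (efun M p w) - ?s)"
    by (simp only: re)
  have "0 \<le> I * (2 * Im w) ^ (2 * p)" using I(2) w by simp
  then have "0 \<le> Re (efun M p w) - ?s" unfolding e using petersson_const_pos[OF p] by (simp only: zero_le_mult_iff) linarith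
  then show ?thesis by simp
qed

text \<open>Bessel's inequality integrated over \<open>U\<close>: each member of the system
  contributes 1 on the left, while the right-hand side is at most a constant times the finite
  area.\<close>

lemma orthonormal_length:
  assumes o: "orthonormal p n f" and p: "p \<ge> 2" and B: "\<forall>w. Im w > 0 --> Re (efun M p w) \<le> B"
  shows "real n \<le> B / petersson_const p * measure hyp_area U"
proof -
  let ?F = "\<lambda>j z. indicator U z * ((cmod (f j z))\<^sup>2 * (2 * Im z) ^ (2 * p))"
  have f: "bounded_form M p (f j)" "petersson U p (f j) (f j) = 1" if "j < n" for j using o that by (auto simp: orthonormal_def)
  have one: "(\<integral>z. ?F j z \<partial>hyp_area) = 1" if "j \<in> {..<n}" for j
    using petersson_self(1)[OF f(1), of j] f(2)[of j] that by (simp del: of_real_mult)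
  have int: "integrable hyp_area (?F j)" if "j \<in> {..<n}" for j using petersson_self(3)[OF f(1)] that by simp
  have "real n = (\<Sum>j<n. (\<integral>z. ?F j z \<partial>hyp_area))" by (simp only: one sum.cong[OF refl one] sum_constant card_lessThan mult_1_right)
  also have "... = (\<integral>z. (\<Sum>j<n. ?F j z) \<partial>hyp_area)" by (rule Bochner_Integration.integral_sum[OF int, symmetric])
  also have "... \<le> (\<integral>z. indicator U z * (B / petersson_const p) \<partial>hyp_area)"
  proof (rule integral_mono)
    show "integrable hyp_area (\<lambda>z. \<Sum>j<n. ?F j z)" by (rule Bochner_Integration.integrable_sum[OF int])
    show "integrable hyp_area (\<lambda>z. indicator U z * (B / petersson_const p))"
      by (intro integrable_mult_left integrable_real_indicator U_sets finite_area)
    fix z assume "z \<in> space hyp_area"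
    then have z: "Im z > 0" by (simp add: uhp_iff)
    have "petersson_const p * (\<Sum>j<n. (cmod (f j z))\<^sup>2 * (2 * Im z) ^ (2 * p)) \<le> B"
      using bessel[OF o p z] B z by (blast intro: order_trans)
    then have "(\<Sum>j<n. (cmod (f j z))\<^sup>2 * (2 * Im z) ^ (2 * p)) \<le> B / petersson_const p"
      using petersson_const_pos[OF p] by (simp add: pos_le_divide_eq mult.commute)
    then show "(\<Sum>j<n. ?F j z) \<le> indicator U z * (B / petersson_const p)"
      unfolding sum_distrib_left[symmetric] by (intro mult_left_mono) auto
  qed
  also have "... = B / petersson_const p * measure hyp_area U" using U_sets U_uhp by (simp add: Int_absorb2)
  finally show ?thesis .
qed

text \<open>A system of greatest length spans, because a nonzero residual could be normalised and
  appended.\<close>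

lemma orthonormal_basis_exists:
  assumes p: "p \<ge> 2" and B: "\<forall>w. Im w > 0 --> Re (efun M p w) \<le> B"
  shows "\<exists>n f. orthonormal p n f \<and> (\<forall>h. bounded_form M p h --> (\<exists>c. \<forall>z\<in>uhp. h z = (\<Sum>j<n. c j * f j z)))"
proof -
  define P where "P = (\<lambda>n. \<exists>f. orthonormal p n f)"
  define N where "N = nat \<lceil>B / petersson_const p * measure hyp_area U\<rceil>"
  have bd: "n \<le> N" if Pn: "P n" for n
  proof -
    obtain f where "orthonormal p n f" using Pn unfolding P_def by blast
    then have "real n \<le> B / petersson_const p * measure hyp_area U" using p B by (rule orthonormal_length)
    then show ?thesis unfolding N_def by linarith
  qed
  have "P 0" by (auto simp: P_def orthonormal_def)
  define n where "n = Greatest P"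
  have Pn: "P n" unfolding n_def using \<open>P 0\<close> bd by (intro GreatestI_nat[of P 0 N]) auto
  have nP: "\<not> P (Suc n)"
  proof
    assume "P (Suc n)"
    then have "Suc n \<le> n" unfolding n_def using bd by (intro Greatest_le_nat[of P _ N]) auto
    then show False by simp
  qed
  obtain f where o: "orthonormal p n f" using Pn by (auto simp: P_def)
  have "\<exists>c. \<forall>z\<in>uhp. h z = (\<Sum>j<n. c j * f j z)" if h: "bounded_form M p h" for h
  proof -
    define g where "g = (\<lambda>z. h z - (\<Sum>j<n. petersson U p h (f j) * f j z))"
    note r = residual(1,2)[OF o h, folded g_def]
    have "petersson U p g g = 0"
    proof (rule ccontr)
      assume ne: "petersson U p g g \<noteq> 0"
      obtain I where I: "petersson U p g g = of_real I" "I \<ge> 0" using petersson_self(1,2)[OF r(1)] by blast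
      have I0: "I > 0" using I ne by (cases "I = 0") auto
      define a where "a = complex_of_real (1 / sqrt I)"
      define f' where "f' = (\<lambda>j. if j < n then f j else (\<lambda>z. a * g z))"
      have fj: "bounded_form M p (f j)" "\<forall>i<n. petersson U p (f j) (f i) = (if j = i then 1 else 0)" if "j < n" for j
        using o that by (auto simp: orthonormal_def)
      have ab: "bounded_form M p (\<lambda>z. a * g z)" by (rule bounded_form_scale[OF r(1)])
      have 1: "petersson U p (\<lambda>z. a * g z) (\<lambda>z. a * g z) = 1"
      proof -
        have "sqrt I * sqrt I = I" using I0 by simp
        then have "1 / sqrt I * (1 / sqrt I) * I = 1" using I0 by (simp add: field_simps)
        then have "complex_of_real (1 / sqrt I * (1 / sqrt I) * I) = 1" by (simp only: of_real_1)
        then show ?thesis unfolding petersson_scale I(1) a_def by (simp only: complex_cnj_complex_of_real of_real_mult)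
      qed
      have 2: "petersson U p (\<lambda>z. a * g z) (f j) = 0" if "j < n" for j
        using petersson_scale[of p a g 1 "f j"] r(2) that by simp
      have 3: "petersson U p (f j) (\<lambda>z. a * g z) = 0" if "j < n" for j
        using petersson_cnj[OF ab fj(1)[OF that]] 2[OF that] by simp
      have "orthonormal p (Suc n) f'"
        unfolding orthonormal_def f'_def less_Suc_eq using fj ab 1 2 3 by auto
      then show False using nP by (auto simp: P_def)
    qed
    then have "g z = 0" if "z \<in> uhp" for z using petersson_zero[OF r(1) p] that by (simp add: uhp_iff)
    then have "\<forall>z\<in>uhp. h z = (\<Sum>j<n. petersson U p h (f j) * f j z)" by (simp add: g_def)
    then show ?thesis by (rule exI[of _ "\<lambda>j. petersson U p h (f j)"])
  qed
  then show ?thesis using o by blast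
qed

text \<open>The residual of the averaged kernel lies in the span of the system and is orthogonal to
  it, so its norm is 0.\<close>

lemma parseval:
  assumes o: "orthonormal p n f" and p: "p \<ge> 2" and w: "Im w > 0"
    and c: "\<forall>h. bounded_form M p h --> (\<exists>c. \<forall>z\<in>uhp. h z = (\<Sum>j<n. c j * f j z))"
  shows "(\<Sum>j<n. (cmod (f j w))\<^sup>2 * (2 * Im w) ^ (2 * p)) = Re (efun M p w) / petersson_const p"
proof -
  let ?G = "pseries M p w"
  let ?g = "\<lambda>z. ?G z - (\<Sum>j<n. petersson U p ?G (f j) * f j z)"
  let ?s = "petersson_const p * (\<Sum>j<n. (cmod (f j w))\<^sup>2 * (2 * Im w) ^ (2 * p))"
  have Gb: "bounded_form M p ?G" by (rule pseries_bounded_form[OF w p])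
  note r = residual(1,2)[OF o Gb]
  obtain d where d: "\<forall>z\<in>uhp. ?g z = (\<Sum>j<n. d j * f j z)" using c r(1) by blast
  have f: "\<forall>j<n. bounded_form M p (f j)" using o by (simp add: orthonormal_def)
  have "petersson U p (\<lambda>z. ?g z - (\<Sum>j<n. d j * f j z)) ?g = petersson U p ?g ?g - (\<Sum>j<n. d j * petersson U p (f j) ?g)"
    by (rule petersson_lincomb[OF r(1) f r(1)])
  moreover have "petersson U p (f j) ?g = 0" if "j < n" for j using petersson_cnj[OF r(1), of "f j"] f r(2) that by simp
  moreover have "petersson U p (\<lambda>z. ?g z - (\<Sum>j<n. d j * f j z)) ?g = 0"
  proof -
    have "petersson U p (\<lambda>z. ?g z - (\<Sum>j<n. d j * f j z)) ?g = (\<integral>z. 0 \<partial>hyp_area)"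
      unfolding petersson_eq[of p "\<lambda>z. ?g z - (\<Sum>j<n. d j * f j z)"]
    proof (rule Bochner_Integration.integral_cong[OF refl])
      fix z assume "z \<in> space hyp_area"
      then have "?g z - (\<Sum>j<n. d j * f j z) = 0" by (intro right_minus_eq[THEN iffD2] bspec[OF d]) simp
      then show "indicator U z *\<^sub>R ((?g z - (\<Sum>j<n. d j * f j z)) * cnj (?g z) * of_real ((2 * Im z) ^ (2 * p))) = 0"
        by (simp only: mult_zero_left scale_zero_right)
    qed
    then show ?thesis by simp
  qed
  ultimately have "petersson U p ?g ?g = 0" by simp
  then have "0 = of_real (petersson_const p) * (efun M p w - of_real ?s)" using pseries_residual[OF o p w] by simp
  then have "efun M p w = of_real ?s" using petersson_const_pos[OF p] by simp
  then have "Re (efun M p w) = ?s" by (simp only: Re_complex_of_real)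
  then show ?thesis using petersson_const_pos[OF p] by simp
qed

lemma efun_invariant:
  assumes S: "S \<in> M" and w: "Im w > 0"
  shows "efun M p (moebius S w) = efun M p w"
proof -
  have "conj_group S M = M"
  proof (intro equalityI subsetI)
    fix A assume "A \<in> conj_group S M"
    then show "A \<in> M" using S mult_mem adj2_mem by auto
  next
    fix A assume A: "A \<in> M"
    have "adj2 S ** (S ** A ** adj2 S) ** S = A" using det1[OF S] by (simp add: matrix_mul_assoc[symmetric])
    moreover have "S ** A ** adj2 S \<in> M" using A S mult_mem adj2_mem by blast
    ultimately show "A \<in> conj_group S M" by (metis imageI)
  qed
  then show ?thesis using efun_conj[OF det1[OF S] det1 w, where M = M] by simp
qed

end

text \<open>The description needs a basis to exist, which is where the bound B enters. Independence
  of the basis and of the point of the orbit follows because \<open>parseval\<close> gives the sum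
  in terms of \<open>efun\<close>, which is invariant under the group.\<close>

lemma bergman_kernel_eq:
  assumes G: "subgroup \<Gamma> PSL2R" and L: "lattice (\<Union>\<Gamma>) U" and p: "p \<ge> 2"
    and B: "\<forall>w. Im w > 0 --> Re (efun (\<Union>\<Gamma>) p w) \<le> B" and w: "Im w > 0"
  shows "bergman_kernel \<Gamma> U p (orbit_of \<Gamma> w) = Re (efun (\<Union>\<Gamma>) p w) / petersson_const p"
proof -
  let ?M = "\<Union>\<Gamma>"
  interpret lattice ?M U by (rule L)
  have cb: "cusp_form \<Gamma> p f \<longleftrightarrow> bounded_form ?M p f" for f
    using cusp_form_imp_bounded_form[OF G L] bounded_form_imp_cusp_form[OF G] p by auto
  have onb: "cusp_form_onb \<Gamma> U p n f \<longleftrightarrow> orthonormal p n f \<and> (\<forall>h. bounded_form ?M p h --> (\<exists>c. \<forall>z\<in>uhp. h z = (\<Sum>j<n. c j * f j z)))" for n f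
    unfolding cusp_form_onb_def orthonormal_def cb by blast
  obtain n f where nf: "cusp_form_onb \<Gamma> U p n f" using orthonormal_basis_exists[OF p B] unfolding onb by blast
  have val: "(\<Sum>j<n. (cmod (f j z))\<^sup>2 * (2 * Im z) ^ (2 * p)) = Re (efun ?M p z) / petersson_const p"
    if "cusp_form_onb \<Gamma> U p n f" "z \<in> uhp" for n f z
    using that p unfolding onb by (intro parseval) (auto simp: uhp_iff)
  have inv: "efun ?M p z = efun ?M p w" if z: "z \<in> uhp" "orbit_of \<Gamma> z = orbit_of \<Gamma> w" for z
  proof -
    have "moebius (mat 1) w \<in> orbit_of \<Gamma> w" unfolding orbit_of_def using one_mem by blast
    then have "w \<in> orbit_of \<Gamma> z" using z(2) by simp
    then obtain A where "A \<in> ?M" "w = moebius A z" by (auto simp: orbit_of_def)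
    then show ?thesis using efun_invariant[of A z p] z(1) by (simp add: uhp_iff)
  qed
  show ?thesis unfolding bergman_kernel_def
  proof (rule the_equality)
    show "\<exists>n f z. cusp_form_onb \<Gamma> U p n f \<and> z \<in> uhp \<and> orbit_of \<Gamma> z = orbit_of \<Gamma> w \<and>
        Re (efun ?M p w) / petersson_const p = (\<Sum>j<n. (cmod (f j z))\<^sup>2 * (2 * Im z) ^ (2 * p))"
      using nf val[OF nf, of w] w by (intro exI[of _ n] exI[of _ f] exI[of _ w]) (simp add: uhp_iff)
  next
    fix b assume "\<exists>n f z. cusp_form_onb \<Gamma> U p n f \<and> z \<in> uhp \<and> orbit_of \<Gamma> z = orbit_of \<Gamma> w \<and>
        b = (\<Sum>j<n. (cmod (f j z))\<^sup>2 * (2 * Im z) ^ (2 * p))"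
    then show "b = Re (efun ?M p w) / petersson_const p" using val inv by metis
  qed
qed

section \<open>Compactness of the quotient\<close>

text \<open>Geometric finiteness provides some polygon, which has finite area; the given domain
  \<open>U\<close> embeds in the quotient and so has no larger area.\<close>

lemma lattice_domain:
  assumes F: "fuchsian \<Gamma>" and gf: "geometrically_finite \<Gamma>" and fk: "first_kind \<Gamma>"
    and ell: "\<forall>\<gamma>\<in>\<Gamma>. \<not> elliptic \<gamma>" and U: "fundamental_domain \<Gamma> U"
  shows "lattice (\<Union>\<Gamma>) U"
proof -
  obtain P where P: "fundamental_domain \<Gamma> P" "finite_sided_convex_polygon P"
    using gf by (auto simp: geometrically_finite_def)
  have tU: "fundamental_tiling (\<Union>\<Gamma>) U" by (rule fundamental_tiling_domain[OF F ell U])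
  have tP: "fundamental_tiling (\<Union>\<Gamma>) P" by (rule fundamental_tiling_domain[OF F ell P(1)])
  have "emeasure hyp_area U \<le> emeasure hyp_area P"
    by (rule fundamental_tiling.injected_area_le[OF tP fundamental_tiling.U_sets[OF tU] fundamental_tiling.U_disjoint[OF tU]])
  also have "... < \<infinity>" by (rule finite_area_polygon[OF F fk P])
  finally show ?thesis using tU by (simp add: lattice_def lattice_axioms_def)
qed

lemma orbit_of_moebius:
  assumes M: "fuchsian_matrices (\<Union>\<Gamma>)" and A: "A \<in> \<Union>\<Gamma>" and z: "Im z > 0"
  shows "orbit_of \<Gamma> (moebius A z) = orbit_of \<Gamma> z"
proof -
  interpret fuchsian_matrices "\<Union>\<Gamma>" by (rule M)
  have 1: "moebius B (moebius A z) = moebius (B ** A) z" if "B \<in> \<Union>\<Gamma>" for B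
    using moebius_mult[OF det1[OF that] det1[OF A] z] by simp
  have 2: "moebius B z = moebius (B ** adj2 A) (moebius A z)" if B: "B \<in> \<Union>\<Gamma>" for B
  proof -
    have "moebius (B ** adj2 A ** A) z = moebius (B ** adj2 A) (moebius A z)"
      using det1[OF B] det1[OF A] z by (intro moebius_mult) (simp_all add: det_mul)
    moreover have "B ** adj2 A ** A = B" using det1[OF A] by (simp flip: matrix_mul_assoc)
    ultimately show ?thesis by simp
  qed
  show ?thesis
  proof (intro equalityI subsetI)
    fix x assume "x \<in> orbit_of \<Gamma> (moebius A z)"
    then obtain B where B: "B \<in> \<Union>\<Gamma>" "x = moebius B (moebius A z)" unfolding orbit_of_def by blast
    then have "x = moebius (B ** A) z" "B ** A \<in> \<Union>\<Gamma>" using 1 mult_mem[OF B(1) A] by simp_all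
    then show "x \<in> orbit_of \<Gamma> z" unfolding orbit_of_def by blast
  next
    fix x assume "x \<in> orbit_of \<Gamma> z"
    then obtain B where B: "B \<in> \<Union>\<Gamma>" "x = moebius B z" unfolding orbit_of_def by blast
    then have "x = moebius (B ** adj2 A) (moebius A z)" "B ** adj2 A \<in> \<Union>\<Gamma>" using 2 mult_mem[OF B(1) adj2_mem[OF A]] by simp_all
    then show "x \<in> orbit_of \<Gamma> (moebius A z)" unfolding orbit_of_def by blast
  qed
qed

text \<open>If every point is thick, the finitely many closed hyperbolic balls from
  \<open>thick_cover\<close> form a compact set meeting every orbit.\<close>

lemma thick_imp_cocompact:
  assumes L: "lattice (\<Union>\<Gamma>) U" and t: "t > 0" and th: "\<forall>w. Im w > 0 --> thick (\<Union>\<Gamma>) t w"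
  shows "cocompact \<Gamma>"
proof -
  interpret lattice "\<Union>\<Gamma>" U by (rule L)
  obtain Z where Z: "finite Z" "\<And>z. z \<in> Z ==> Im z > 0"
    "\<And>w. Im w > 0 ==> thick (\<Union>\<Gamma>) t w ==> \<exists>A\<in>\<Union>\<Gamma>. \<exists>z\<in>Z. hypu z (moebius A w) \<le> t"
    using thick_cover[OF t] by blast
  define K where "K = (\<Union>z\<in>Z. {\<zeta>. Im \<zeta> > 0 \<and> hypu z \<zeta> \<le> t})"
  have Ku: "K \<subseteq> uhp" by (auto simp: K_def uhp_iff)
  have "compact K" unfolding K_def using Z(1,2) compact_hyp_cball by (intro compact_UN) auto
  then have c: "compactin (top_of_set uhp) K" using Ku by (simp add: compactin_subtopology)
  let ?Q = "quotient_topology (top_of_set uhp) (orbit_of \<Gamma>)"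
  have "continuous_map (top_of_set uhp) ?Q (orbit_of \<Gamma>)"
    by (rule quotient_imp_continuous_map[OF quotient_map_quotient_topology])
  then have "compactin ?Q (orbit_of \<Gamma> ` K)" by (rule image_compactin[OF c])
  moreover have "orbit_of \<Gamma> ` K = topspace ?Q"
  proof -
    have "orbit_of \<Gamma> w \<in> orbit_of \<Gamma> ` K" if "w \<in> uhp" for w
    proof -
      have w: "Im w > 0" using that by (simp add: uhp_iff)
      obtain A z where A: "A \<in> \<Union>\<Gamma>" "z \<in> Z" "hypu z (moebius A w) \<le> t" using Z(3)[OF w] th w by blast
      then have "moebius A w \<in> K" using moebius_mem[OF A(1) w] by (auto simp: K_def)
      then show ?thesis using orbit_of_moebius[OF fuchsian_matrices_axioms A(1) w] by (metis imageI)
    qed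
    then show ?thesis using Ku by (auto simp: topspace_quotient_topology)
  qed
  ultimately show ?thesis by (simp add: cocompact_def compact_space_def)
qed

text \<open>The orbits passing within a \<open>hypu\<close> of less than n from i form open sets
  exhausting the quotient, so finitely many of them suffice.\<close>

lemma cocompact_bounded:
  assumes M: "fuchsian_matrices (\<Union>\<Gamma>)" and cc: "cocompact \<Gamma>"
  shows "\<exists>R\<ge>0. \<forall>w. Im w > 0 --> (\<exists>A\<in>\<Union>\<Gamma>. hypu \<i> (moebius A w) \<le> R)"
proof -
  interpret fuchsian_matrices "\<Union>\<Gamma>" by (rule M)
  let ?Q = "quotient_topology (top_of_set uhp) (orbit_of \<Gamma>)"
  let ?H = "\<lambda>n. {z \<in> uhp. \<exists>A\<in>\<Union>\<Gamma>. hypu \<i> (moebius A z) < real n}"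
  define V where "V = (\<lambda>n. orbit_of \<Gamma> ` ?H n)"
  have self: "z \<in> orbit_of \<Gamma> z" for z
  proof -
    have "moebius (mat 1) z \<in> orbit_of \<Gamma> z" unfolding orbit_of_def using one_mem by blast
    then show ?thesis by simp
  qed
  have pre: "{x \<in> uhp. orbit_of \<Gamma> x \<in> V n} = ?H n" for n
  proof (intro equalityI subsetI)
    fix x assume "x \<in> {x \<in> uhp. orbit_of \<Gamma> x \<in> V n}"
    then obtain z A where x: "x \<in> uhp" "orbit_of \<Gamma> x = orbit_of \<Gamma> z" "z \<in> uhp" "A \<in> \<Union>\<Gamma>" "hypu \<i> (moebius A z) < real n"
      by (auto simp: V_def)
    have "z \<in> orbit_of \<Gamma> x" using self[of z] x(2) by simp
    then obtain B where B: "B \<in> \<Union>\<Gamma>" "z = moebius B x" by (auto simp: orbit_of_def)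
    have "moebius (A ** B) x = moebius A z" unfolding B(2) using x(1) det1[OF x(4)] det1[OF B(1)] by (intro moebius_mult) (auto simp: uhp_iff)
    then have "hypu \<i> (moebius (A ** B) x) < real n" using x(5) by simp
    then show "x \<in> ?H n" using x(1) mult_mem[OF x(4) B(1)] by blast
  qed (auto simp: V_def)
  have op: "openin ?Q (V n)" for n
    unfolding openin_quotient_topology topspace_euclidean_subtopology pre
  proof
    show "V n \<subseteq> orbit_of \<Gamma> ` uhp" by (auto simp: V_def)
    have eqn: "?H n = (\<Union>A\<in>\<Union>\<Gamma>. uhp \<inter> (\<lambda>z. hypu \<i> (moebius A z)) -` {..<real n})" by auto
    have opn: "openin (top_of_set uhp) (uhp \<inter> (\<lambda>z. hypu \<i> (moebius A z)) -` {..<real n})" if A: "A \<in> \<Union>\<Gamma>" for A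
    proof (rule continuous_openin_preimage_gen)
      have "continuous_on uhp (moebius A)" by (rule holomorphic_on_imp_continuous_on[OF moebius_holomorphic(1)[OF det1[OF A]]])
      moreover have "Im (moebius A z) \<noteq> 0" if "z \<in> uhp" for z using moebius_mem[OF A, of z] that by (simp add: uhp_iff)
      ultimately show "continuous_on uhp (\<lambda>z. hypu \<i> (moebius A z))" unfolding hypu_def by (intro continuous_intros) auto
    qed simp
    show "openin (top_of_set uhp) (?H n)"
      unfolding eqn by (rule openin_Union) (elim imageE; simp only: opn)
  qed
  have "\<Union>(range V) = topspace ?Q"
  proof
    show "\<Union>(range V) \<subseteq> topspace ?Q" by (auto simp: V_def topspace_quotient_topology)
    show "topspace ?Q \<subseteq> \<Union>(range V)"
    proof
      fix x assume "x \<in> topspace ?Q"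
      then obtain z where z: "z \<in> uhp" "x = orbit_of \<Gamma> z" by (auto simp: topspace_quotient_topology)
      obtain n where "hypu \<i> (moebius (mat 1) z) < real n" using reals_Archimedean2 by blast
      then have "z \<in> ?H n" using z(1) one_mem by blast
      then show "x \<in> \<Union>(range V)" using z(2) by (auto simp: V_def)
    qed
  qed
  then obtain \<F> where \<F>: "finite \<F>" "\<F> \<subseteq> range V" "\<Union>\<F> = topspace ?Q"
    using cc op unfolding cocompact_def compact_space by (metis (no_types, lifting) rangeE)
  obtain I where I: "finite I" "\<F> = V ` I" using finite_subset_image[OF \<F>(1,2)] by blast
  define R where "R = (\<Sum>n\<in>I. real n)"
  have "\<exists>A\<in>\<Union>\<Gamma>. hypu \<i> (moebius A w) \<le> R" if w: "Im w > 0" for w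
  proof -
    have "orbit_of \<Gamma> w \<in> \<Union>\<F>" unfolding \<F>(3) topspace_quotient_topology using w by (auto simp: uhp_iff)
    then obtain n where n: "n \<in> I" "orbit_of \<Gamma> w \<in> V n" using I(2) by auto
    then have "w \<in> ?H n" using pre[of n] w by (auto simp: uhp_iff)
    then obtain A where A: "A \<in> \<Union>\<Gamma>" "hypu \<i> (moebius A w) < real n" by blast
    have "real n \<le> R" unfolding R_def using n(1) I(1) by (intro member_le_sum) auto
    then show ?thesis using A by (intro bexI[of _ A]) auto
  qed
  moreover have "R \<ge> 0" by (simp add: R_def sum_nonneg)
  ultimately show ?thesis by blast
qed

text \<open>Every orbit meets a fixed compact set, on which the finitely many elements that can move
  a point by at most 1 have displacements bounded below. Conjugates of the unit translation of a
  cusp would have displacement 1 / (4 y^2) there for arbitrarily large y.\<close>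

lemma cocompact_no_cusp:
  assumes M: "fuchsian_matrices (\<Union>\<Gamma>)" and cc: "cocompact \<Gamma>" and S: "det S = 1"
    and c: "cusp_group (conj_group S (\<Union>\<Gamma>))"
  shows False
proof -
  let ?M = "\<Union>\<Gamma>"
  interpret fuchsian_matrices ?M by (rule M)
  obtain R where R: "R \<ge> 0" "\<forall>w. Im w > 0 --> (\<exists>A\<in>?M. hypu \<i> (moebius A w) \<le> R)"
    using cocompact_bounded[OF M cc] by blast
  define K where "K = {z. Im z > 0 \<and> hypu \<i> z \<le> R}"
  have K: "compact K" unfolding K_def by (rule compact_hyp_cball) simp
  have iK: "\<i> \<in> K" using R(1) by (simp add: K_def)
  \<comment> \<open>By \<open>disp_transport\<close>, an element of displacement at most 1 at a
    point of \<open>K\<close> has displacement at most R1 at i.\<close>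
  define R1 where "R1 = (1 + 4 * R) * (1 + 4 * ((1 + 4 * 1) * (1 + 4 * R)))"
  define Fs where "Fs = {A \<in> ?M. disp A \<i> \<le> R1} - {mat 1, - mat 1}"
  have finF: "finite Fs" unfolding Fs_def using finite_disp[of \<i> R1] by simp
  have "\<forall>A\<in>Fs. \<exists>m>0. \<forall>z\<in>K. m \<le> disp A z"
  proof
    fix A assume "A \<in> Fs"
    then have A: "A \<in> ?M" "A \<noteq> mat 1" "A \<noteq> - mat 1" by (auto simp: Fs_def)
    have Kp: "Im z > 0" if "z \<in> K" for z using that by (simp add: K_def)
    have "continuous_on K (disp A)"
    proof -
      have "continuous_on K (moebius A)"
        by (rule continuous_on_subset[OF holomorphic_on_imp_continuous_on[OF moebius_holomorphic(1)[OF det1[OF A(1)]]]]) (auto simp: K_def uhp_iff)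
      moreover have "4 * Im z * Im (moebius A z) \<noteq> 0" if "z \<in> K" for z using moebius_mem[OF A(1) Kp[OF that]] Kp[OF that] by simp
      ultimately show ?thesis unfolding disp_def[abs_def] hypu_def by (intro continuous_intros) auto
    qed
    then obtain x where x: "x \<in> K" "\<forall>z\<in>K. disp A x \<le> disp A z" using continuous_attains_inf[OF K] iK by blast
    have "disp A x > 0" by (rule disp_pos[OF A(1) Kp[OF x(1)] A(2,3)])
    then show "\<exists>m>0. \<forall>z\<in>K. m \<le> disp A z" using x(2) by blast
  qed
  then obtain m where m: "\<forall>A\<in>Fs. m A > 0 \<and> (\<forall>z\<in>K. m A \<le> disp A z)" by metis
  define e where "e = Min (insert 1 (m ` Fs))"
  have e0: "e > 0" unfolding e_def using finF m by (subst Min_gr_iff) auto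
  have em: "e \<le> m A" if "A \<in> Fs" for A unfolding e_def using finF that by (intro Min_le) auto
  let ?T = "mat2 1 1 0 1"
  have "?T \<in> conj_group S ?M" using c by (rule cusp_group.unit_translation)
  then obtain X where X: "X \<in> ?M" "?T = adj2 S ** X ** S" by blast
  have X1: "X \<noteq> mat 1" "X \<noteq> - mat 1"
  proof -
    have "?T$1$2 \<noteq> (mat 1 :: real^2^2)$1$2" "?T$1$2 \<noteq> (- mat 1 :: real^2^2)$1$2" by simp_all
    moreover have "adj2 S ** mat 1 ** S = mat 1" "adj2 S ** (- mat 1) ** S = - mat 1" using S by simp_all
    ultimately show "X \<noteq> mat 1" "X \<noteq> - mat 1" using X(2) by metis+
  qed
  have low: "e \<le> 1 / (4 * y\<^sup>2)" if y: "y \<ge> 1" for y :: real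
  proof -
    let ?z = "Complex 0 y"
    let ?w = "moebius S ?z"
    have z: "Im ?z > 0" using y by simp
    have w: "Im ?w > 0" using S z by (rule Im_moebius_pos)
    have dX: "disp X ?w = 1 / (4 * y\<^sup>2)"
      using disp_conj[OF S det1[OF X(1)] z] disp_translation[OF z, of 1] unfolding X(2)[symmetric] by simp
    obtain B where B: "B \<in> ?M" "hypu \<i> (moebius B ?w) \<le> R" using R(2) w by blast
    have Bw: "Im (moebius B ?w) > 0" using moebius_mem[OF B(1) w] .
    let ?Y = "B ** X ** adj2 B"
    have YM: "?Y \<in> ?M" using B(1) X(1) mult_mem adj2_mem by blast
    have YX: "adj2 B ** ?Y ** B = X" using det1[OF B(1)] by (simp add: matrix_mul_assoc[symmetric])
    have dY: "disp ?Y (moebius B ?w) = disp X ?w" using disp_conj[OF det1[OF B(1)] det1[OF YM] w] unfolding YX by simp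
    have Y1: "?Y \<noteq> mat 1" "?Y \<noteq> - mat 1"
    proof -
      have "adj2 B ** mat 1 ** B = mat 1" "adj2 B ** (- mat 1) ** B = - mat 1" using det1[OF B(1)] by simp_all
      then show "?Y \<noteq> mat 1" "?Y \<noteq> - mat 1" using YX X1 by metis+
    qed
    have "1 * 1 \<le> y\<^sup>2" using y unfolding power2_eq_square by (intro mult_mono) auto
    then have y2: "1 \<le> y\<^sup>2" by simp
    have d1: "disp ?Y (moebius B ?w) \<le> 1" unfolding dY dX using y2 by (simp add: divide_le_eq)
    have "disp ?Y \<i> \<le> (1 + 4 * R) * (1 + 4 * ((1 + 4 * disp ?Y (moebius B ?w)) * (1 + 4 * R)))"
      by (rule disp_transport[OF YM _ Bw B(2)]) simp
    also have "... \<le> R1" unfolding R1_def using d1 R(1) by (intro mult_left_mono add_left_mono mult_right_mono) auto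
    finally have "?Y \<in> Fs" using YM Y1 by (simp add: Fs_def)
    moreover have "moebius B ?w \<in> K" using B(2) Bw by (simp add: K_def)
    ultimately have "e \<le> disp ?Y (moebius B ?w)" using m em order_trans by blast
    then show ?thesis unfolding dY dX .
  qed
  define y where "y = max 1 (1 / e)"
  have y: "y \<ge> 1" "y \<ge> 1 / e" by (simp_all add: y_def)
  have "1 / e * 1 \<le> y * y" using y e0 by (intro mult_mono) auto
  then have "1 \<le> e * y\<^sup>2" using e0 by (simp add: field_simps power2_eq_square)
  moreover have "e * (4 * y\<^sup>2) \<le> 1" using low[OF y(1)] y(1) by (simp add: pos_le_divide_eq)
  ultimately show False by linarith
qed

section \<open>Asymptotics\<close>

text \<open>The mode m = 1 of \<open>Qsum p u\<close> at u = p / pi, where it is largest.\<close>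

definition peak :: "nat \<Rightarrow> real" where
  "peak p = real (2 * p) ^ (2 * p) * exp (- real (2 * p)) / fact (2 * p - 1)"

lemma peak_nonneg: "peak p \<ge> 0"
  by (simp add: peak_def)

lemma peak_const:
  assumes p: "p \<ge> 2"
  shows "peak p / petersson_const p \<le> (real p / pi) powr (3/2)"
    and "peak p / petersson_const p \<ge> (real p / pi) powr (3/2) - real p"
proof -
  have F: "fact (2 * p) = (2 * real p) * fact (2 * p - 1)" using p by (subst fact_reduce) auto
  have gen: "W / F / (2 * pi / q) = W * (P * q) / (2 * pi * (P * F))" if "P \<noteq> 0" for W F q P :: real using that by simp
  have "peak p / petersson_const p = real (2*p) ^ (2*p) * exp (- real (2*p)) * (2 * real p * (2 * real p - 1)) / (2 * pi * fact (2*p))"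
    unfolding peak_def petersson_const_def F by (rule gen) (use p in simp)
  then show "peak p / petersson_const p \<le> (real p / pi) powr (3/2)" "peak p / petersson_const p \<ge> (real p / pi) powr (3/2) - real p"
    using peak_bounds[of p] p by simp_all
qed

lemma inverse_const_le: "p \<ge> 2 ==> 1 / petersson_const p \<le> real p"
proof -
  assume p: "p \<ge> 2"
  have "1 / petersson_const p = (2 * real p - 1) / (2 * pi)" by (simp add: petersson_const_def)
  also have "... \<le> (2 * real p * pi) / (2 * pi)"
  proof (rule divide_right_mono)
    have "2 * real p * 1 \<le> 2 * real p * pi" using pi_gt3 by (intro mult_left_mono) auto
    then show "2 * real p - 1 \<le> 2 * real p * pi" by linarith
  qed simp
  also have "... = real p" by simp
  finally show ?thesis .
qed

context lattice
begin

text \<open>The order of choices matters: L comes from the estimate in the cusps, then t is chosen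
  so that points that are not thick lie above L, and only then is the constant for the thick part at
  level t available.\<close>

lemma efun_estimates:
  obtains t C L where "t > 0" "C > 0" "L > 0"
    "\<forall>w p. Im w > 0 --> thick M t w --> p \<ge> 3 --> norm (efun M p w - 1) \<le> C / (1 + t) ^ (p - 2)"
    "\<forall>S v p. det S = 1 --> cusp_group (conj_group S M) --> Im v \<ge> L --> p \<ge> 3 -->
       norm (efun M p (moebius S v) - of_real (Qsum p (2 * Im v))) \<le> C"
    "\<forall>w. Im w > 0 --> \<not> thick M t w --> (\<exists>S v. det S = 1 \<and> cusp_group (conj_group S M) \<and> Im v \<ge> L \<and> moebius S v = w)"
    "\<forall>w p. Im w > 0 --> p \<ge> 3 --> Re (efun M p w) \<le> peak p + 1 + C"
proof -
  obtain C1 L where C1: "C1 > 0" and L: "L \<ge> 64 * cusp_height" "L \<ge> 1"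
    and ec: "\<And>M w p. cusp_group M ==> Im w \<ge> L ==> p \<ge> 3 ==> norm (efun M p w - of_real (Qsum p (2 * Im w))) \<le> C1 / 4 ^ (p - 3)"
    using efun_cusp by blast
  have L0: "L > 0" using L(2) by simp
  obtain t where t: "t > 0" "t \<le> 1 / (4 * L\<^sup>2)"
    "\<forall>w. Im w > 0 --> \<not> thick M t w --> (\<exists>S v. det S = 1 \<and> cusp_group (conj_group S M) \<and> Im v > 0 \<and> moebius S v = w \<and> 1 / (4 * (Im v)\<^sup>2) < t)"
    using thick_or_cusp[OF L0] by blast
  obtain C2 where C2: "C2 > 0"
    and et: "\<And>M w p. fuchsian_matrices M ==> Im w > 0 ==> thick M t w ==> p \<ge> 2 ==> norm (efun M p w - 1) \<le> C2 / (1 + t) ^ (p - 2)"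
    using efun_thick[OF t(1)] by blast
  define C where "C = max C1 C2"
  have C: "C > 0" "C1 \<le> C" "C2 \<le> C" using C1 by (auto simp: C_def)
  have 1: "norm (efun M p w - 1) \<le> C / (1 + t) ^ (p - 2)" if "Im w > 0" "thick M t w" "p \<ge> 3" for w p
  proof -
    have "norm (efun M p w - 1) \<le> C2 / (1 + t) ^ (p - 2)" by (rule et) (use that fuchsian_matrices_axioms in auto)
    also have "... \<le> C / (1 + t) ^ (p - 2)" using C t(1) by (intro divide_right_mono) auto
    finally show ?thesis .
  qed
  have 2: "norm (efun M p (moebius S v) - of_real (Qsum p (2 * Im v))) \<le> C"
    if S: "det S = 1" "cusp_group (conj_group S M)" "Im v \<ge> L" "p \<ge> 3" for S v p
  proof -
    have v: "Im v > 0" using S(3) L0 by simp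
    have "norm (efun M p (moebius S v) - of_real (Qsum p (2 * Im v))) \<le> C1 / 4 ^ (p - 3)"
    proof -
      have "efun (conj_group S M) p v = efun M p (moebius S v)" by (rule efun_conj[OF S(1) det1 v])
      then show ?thesis using ec[OF S(2-4)] by simp
    qed
    also have "... \<le> C1 / 1" using C1 by (intro divide_left_mono) auto
    finally show ?thesis using C by simp
  qed
  have 3: "\<exists>S v. det S = 1 \<and> cusp_group (conj_group S M) \<and> Im v \<ge> L \<and> moebius S v = w"
    if w: "Im w > 0" "\<not> thick M t w" for w
  proof -
    obtain S v where S: "det S = 1" "cusp_group (conj_group S M)" "Im v > 0" "moebius S v = w" "1 / (4 * (Im v)\<^sup>2) < t"
      using t(3)[rule_format, OF w] by (elim exE conjE)
    have "inverse (4 * (Im v)\<^sup>2) < inverse (4 * L\<^sup>2)" using S(5) t(2) by (simp only: inverse_eq_divide)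
    moreover have "0 < 4 * (Im v)\<^sup>2" using S(3) by simp
    ultimately have "4 * L\<^sup>2 < 4 * (Im v)\<^sup>2" by (rule inverse_less_imp_less)
    then have "L\<^sup>2 < (Im v)\<^sup>2" by simp
    then have "L < Im v" using S(3) by (intro power_less_imp_less_base[of L 2]) auto
    then show ?thesis using S by (intro exI[of _ S] exI[of _ v]) simp
  qed
  have 4: "Re (efun M p w) \<le> peak p + 1 + C" if w: "Im w > 0" and p: "p \<ge> 3" for w p
  proof (cases "thick M t w")
    case True
    have "Re (efun M p w - 1) \<le> norm (efun M p w - 1)" by (rule complex_Re_le_cmod)
    also have "... \<le> C / (1 + t) ^ (p - 2)" by (rule 1[OF w True p])
    also have "... \<le> C / 1" using C(1) t(1) by (intro divide_left_mono) auto
    finally show ?thesis using peak_nonneg[of p] by simp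
  next
    case False
    then obtain S v where S: "det S = 1" "cusp_group (conj_group S M)" "Im v \<ge> L" "moebius S v = w"
      using 3[OF w] by blast
    have "Re (efun M p w - of_real (Qsum p (2 * Im v))) \<le> norm (efun M p w - of_real (Qsum p (2 * Im v)))" by (rule complex_Re_le_cmod)
    also have "... \<le> C" using 2[OF S(1-3) p] unfolding S(4) .
    finally have "Re (efun M p w) \<le> Qsum p (2 * Im v) + C" by simp
    also have "Qsum p (2 * Im v) \<le> peak p + 1" unfolding peak_def using S(3) L0 p by (intro Qsum_le) auto
    finally show ?thesis by simp
  qed
  show thesis using that[OF t(1) C(1) L0] 1 2 3 4 by blast
qed

end

theorem corollary1p5:
  fixes \<Gamma> :: "(real^2^2) set set" and U :: "complex set"
  assumes "fuchsian \<Gamma>" and "geometrically_finite \<Gamma>" and "first_kind \<Gamma>"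
    and "\<forall>\<gamma>\<in>\<Gamma>. \<not> elliptic \<gamma>"
    and "fundamental_domain \<Gamma> U"
  shows "(cocompact \<Gamma> \<longrightarrow>
           (\<exists>C. \<forall>\<^sub>F p in sequentially. \<forall>x\<in>quotient_surface \<Gamma>.
              \<bar>bergman_kernel \<Gamma> U p x - real p / pi\<bar> \<le> C)) \<and>
         (\<not> cocompact \<Gamma> \<longrightarrow>
           (\<forall>\<^sub>F p in sequentially. bdd_above (bergman_kernel \<Gamma> U p ` quotient_surface \<Gamma>)) \<and>
           (\<lambda>p. (SUP x\<in>quotient_surface \<Gamma>. bergman_kernel \<Gamma> U p x) - (real p / pi) powr (3/2))
             \<in> O(\<lambda>p. real p))"
proof -
  let ?M = "\<Union>\<Gamma>"
  have L: "lattice ?M U" by (rule lattice_domain[OF assms])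
  interpret lattice ?M U by (rule L)
  have G: "subgroup \<Gamma> PSL2R" using assms(1) by (simp add: fuchsian_def)
  obtain t C L where t: "t > 0" and C: "C > 0" and L: "L > 0"
    and th: "\<forall>w p. Im w > 0 --> thick ?M t w --> p \<ge> 3 --> norm (efun ?M p w - 1) \<le> C / (1 + t) ^ (p - 2)"
    and cu: "\<forall>S v p. det S = 1 --> cusp_group (conj_group S ?M) --> Im v \<ge> L --> p \<ge> 3 -->
       norm (efun ?M p (moebius S v) - of_real (Qsum p (2 * Im v))) \<le> C"
    and al: "\<forall>w. Im w > 0 --> \<not> thick ?M t w --> (\<exists>S v. det S = 1 \<and> cusp_group (conj_group S ?M) \<and> Im v \<ge> L \<and> moebius S v = w)"
    and up: "\<forall>w p. Im w > 0 --> p \<ge> 3 --> Re (efun ?M p w) \<le> peak p + 1 + C"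
    by (rule efun_estimates)
  have bk: "bergman_kernel \<Gamma> U p (orbit_of \<Gamma> w) = Re (efun ?M p w) / petersson_const p" if p: "p \<ge> 3" and w: "Im w > 0" for p w
  proof (rule bergman_kernel_eq[OF G \<open>lattice ?M U\<close> _ _ w])
    show "\<forall>w. Im w > 0 --> Re (efun ?M p w) \<le> peak p + 1 + C" using up p by blast
  qed (use p in simp)
  have surf: "\<exists>w. Im w > 0 \<and> x = orbit_of \<Gamma> w" if "x \<in> quotient_surface \<Gamma>" for x
    using that by (auto simp: quotient_surface_def uhp_iff)
  have ev3: "\<forall>\<^sub>F p in sequentially. p \<ge> (3::nat)" by (rule eventually_ge_at_top)
  have pc: "petersson_const p > 0" "1 / petersson_const p \<le> real p" if "p \<ge> 3" for p
    using that petersson_const_pos[of p] inverse_const_le[of p] by simp_all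
  show ?thesis
  proof (intro conjI impI)
    assume cc: "cocompact \<Gamma>"
    have thick: "thick ?M t w" if "Im w > 0" for w
      using al that cocompact_no_cusp[OF fuchsian_matrices_axioms cc] by blast
    \<comment> \<open>The exponential decay in the thick part beats the factor of order p that comes
      from dividing by \<open>petersson_const p\<close>.\<close>
    have "((\<lambda>p. real p / (1 + t) ^ (p - 2)) \<longlongrightarrow> 0) sequentially"
      using t by real_asymp
    then have "\<forall>\<^sub>F p in sequentially. real p / (1 + t) ^ (p - 2) < 1"
      by (rule order_tendstoD) simp
    with ev3 have "\<forall>\<^sub>F p in sequentially. \<forall>x\<in>quotient_surface \<Gamma>. \<bar>bergman_kernel \<Gamma> U p x - real p / pi\<bar> \<le> C + 1"
    proof eventually_elim
      case (elim p)
      show ?case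
      proof
        fix x assume "x \<in> quotient_surface \<Gamma>"
        then obtain w where w: "Im w > 0" "x = orbit_of \<Gamma> w" using surf by blast
        let ?E = "Re (efun ?M p w)"
        have "\<bar>Re (efun ?M p w - 1)\<bar> \<le> norm (efun ?M p w - 1)" by (rule abs_Re_le_cmod)
        also have "... \<le> C / (1 + t) ^ (p - 2)" using th w(1) thick[OF w(1)] elim(1) by blast
        finally have E: "\<bar>?E - 1\<bar> \<le> C / (1 + t) ^ (p - 2)" by simp
        have pcp: "1 / petersson_const p = real p / pi - 1 / (2 * pi)"
          using elim(1) by (simp add: petersson_const_def diff_divide_distrib)
        have "bergman_kernel \<Gamma> U p x - real p / pi = 1 / petersson_const p * (?E - 1) - 1 / (2 * pi)"
          unfolding w(2) bk[OF elim(1) w(1)] using pcp by (simp add: algebra_simps diff_divide_distrib)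
        then have "\<bar>bergman_kernel \<Gamma> U p x - real p / pi\<bar> \<le> \<bar>1 / petersson_const p * (?E - 1)\<bar> + 1 / (2 * pi)"
          using abs_triangle_ineq4[of "1 / petersson_const p * (?E - 1)" "1 / (2 * pi)"] by simp
        also have "\<bar>1 / petersson_const p * (?E - 1)\<bar> = 1 / petersson_const p * \<bar>?E - 1\<bar>"
          using pc(1)[OF elim(1)] by (simp add: abs_mult)
        also have "... \<le> real p * (C / (1 + t) ^ (p - 2))"
          using pc[OF elim(1)] E by (intro mult_mono) auto
        also have "... = C * (real p / (1 + t) ^ (p - 2))" by simp
        also have "... \<le> C * 1" using C elim(2) by (intro mult_left_mono) auto
        also have "C * 1 + 1 / (2 * pi) \<le> C + 1" using pi_gt3 by simp
        finally show "\<bar>bergman_kernel \<Gamma> U p x - real p / pi\<bar> \<le> C + 1" by simp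
      qed
    qed
    then show "\<exists>C. \<forall>\<^sub>F p in sequentially. \<forall>x\<in>quotient_surface \<Gamma>. \<bar>bergman_kernel \<Gamma> U p x - real p / pi\<bar> \<le> C" by blast
  next
    have ub: "bergman_kernel \<Gamma> U p x \<le> (real p / pi) powr (3/2) + (1 + C) * real p"
      if p: "p \<ge> 3" and x: "x \<in> quotient_surface \<Gamma>" for p x
    proof -
      obtain w where w: "Im w > 0" "x = orbit_of \<Gamma> w" using surf x by blast
      have "bergman_kernel \<Gamma> U p x = Re (efun ?M p w) / petersson_const p" unfolding w(2) by (rule bk[OF p w(1)])
      also have "... \<le> (peak p + (1 + C)) / petersson_const p"
        using up[rule_format, OF w(1) p] pc(1)[OF p] by (intro divide_right_mono) auto
      also have "... = peak p / petersson_const p + (1 + C) * (1 / petersson_const p)" by (simp add: add_divide_distrib)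
      also have "... \<le> (real p / pi) powr (3/2) + (1 + C) * real p"
        using peak_const(1)[of p] pc[OF p] p C by (intro add_mono mult_left_mono) auto
      finally show ?thesis .
    qed
    assume nc: "\<not> cocompact \<Gamma>"
    have bdd: "bdd_above (bergman_kernel \<Gamma> U p ` quotient_surface \<Gamma>)" if "p \<ge> 3" for p
      using ub[OF that] by (intro bdd_aboveI2)
    show "\<forall>\<^sub>F p in sequentially. bdd_above (bergman_kernel \<Gamma> U p ` quotient_surface \<Gamma>)"
      using ev3 bdd by (rule eventually_mono)
    \<comment> \<open>A group that is not cocompact has a point that is not thick, and such a point
      yields a cusp.\<close>
    obtain w0 where w0: "Im w0 > 0" "\<not> thick ?M t w0" using thick_imp_cocompact[OF \<open>lattice ?M U\<close> t] nc by blast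
    obtain S where S: "det S = 1" "cusp_group (conj_group S ?M)" using al w0 by blast
    obtain p0 :: nat where p0: "2 * pi * L \<le> real p0" using real_arch_simple by blast
    show "(\<lambda>p. (SUP x\<in>quotient_surface \<Gamma>. bergman_kernel \<Gamma> U p x) - (real p / pi) powr (3/2)) \<in> O(\<lambda>p. real p)"
    proof (rule bigoI)
      have "\<forall>\<^sub>F p in sequentially. p \<ge> max 3 p0" by (rule eventually_ge_at_top)
      then show "\<forall>\<^sub>F p in sequentially. norm ((SUP x\<in>quotient_surface \<Gamma>. bergman_kernel \<Gamma> U p x) - (real p / pi) powr (3/2)) \<le> (1 + C) * norm (real p)"
      proof eventually_elim
        case (elim p)
        then have p: "p \<ge> 3" "2 * pi * L \<le> real p" using p0 by auto
        define s where "s = (SUP x\<in>quotient_surface \<Gamma>. bergman_kernel \<Gamma> U p x)"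
        \<comment> \<open>The height where the first Fourier mode peaks: 2 Im v = p / pi. For p >=
          p0 it lies in the range of the cusp estimate.\<close>
        define v where "v = Complex 0 (real p / (2 * pi))"
        have vL: "Im v \<ge> L" unfolding v_def using p(2) by (simp add: field_simps)
        have v: "2 * Im v = real p / pi" "Im v > 0" unfolding v_def using p(1) by simp_all
        let ?w = "moebius S v"
        have w: "Im ?w > 0" using S(1) v(2) by (rule Im_moebius_pos)
        have xs: "orbit_of \<Gamma> ?w \<in> quotient_surface \<Gamma>" using w by (simp add: quotient_surface_def uhp_iff)
        have "norm (efun ?M p ?w - of_real (Qsum p (real p / pi))) \<le> C" using cu S vL p(1) unfolding v(1)[symmetric] by blast
        then have "\<bar>Re (efun ?M p ?w - of_real (Qsum p (real p / pi)))\<bar> \<le> C" using abs_Re_le_cmod order_trans by blast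
        then have "Qsum p (real p / pi) - C \<le> Re (efun ?M p ?w)" by simp
        moreover have "peak p \<le> Qsum p (real p / pi)" unfolding peak_def using p(1) by (intro Qsum_ge) auto
        ultimately have "peak p - C \<le> Re (efun ?M p ?w)" by linarith
        then have "(peak p - C) / petersson_const p \<le> bergman_kernel \<Gamma> U p (orbit_of \<Gamma> ?w)"
          unfolding bk[OF p(1) w] using pc(1)[OF p(1)] by (intro divide_right_mono) auto
        also have "... \<le> s" unfolding s_def by (rule cSUP_upper[OF xs bdd[OF p(1)]])
        finally have "peak p / petersson_const p - C * (1 / petersson_const p) \<le> s" by (simp add: diff_divide_distrib)
        moreover have "(real p / pi) powr (3/2) - real p \<le> peak p / petersson_const p" using p(1) by (intro peak_const(2)) auto
        moreover have "C * (1 / petersson_const p) \<le> C * real p" using C pc(2)[OF p(1)] by (intro mult_left_mono) auto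
        ultimately have lo: "(real p / pi) powr (3/2) - real p - C * real p \<le> s" by linarith
        have "quotient_surface \<Gamma> \<noteq> {}" using xs by blast
        then have hi: "s \<le> (real p / pi) powr (3/2) + (1 + C) * real p"
          unfolding s_def by (rule cSUP_least) (rule ub[OF p(1)])
        have "\<bar>s - (real p / pi) powr (3/2)\<bar> \<le> (1 + C) * real p" using lo hi by (simp add: abs_le_iff algebra_simps)
        then show ?case by (simp add: s_def)
      qed
    qed
  qed
qed

end
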